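(* Let $0<\alpha<n$ and let $b$ be a locally integrable function on $\mathbb{Q}_p^n$. The following assertions are equivalent: (T.1) $b\in \mathrm{BMO}(\mathbb{Q}_p^n)$ and $b^-\in L^\infty(\mathbb{Q}_p^n)$. (T.2) $[b,\mathcal{M}^p_\alpha]$ is bounded from $L^{r(\cdot)}(\mathbb{Q}_p^n)$ to $L^{q(\cdot)}(\mathbb{Q}_p^n)$ for all $r(\cdot),q(\cdot)\in\mathscr{C}^{\log}(\mathbb{Q}_p^n)$ with $r(\cdot)\in\mathscr{P}(\mathbb{Q}_p^n)$, $r_+<n/\alpha$ and $1/q(\cdot)=1/r(\cdot)-\alpha/n$. (T.3) $[b,\mathcal{M}^p_\alpha]$ is bounded from $L^{r(\cdot)}(\mathbb{Q}_p^n)$ to $L^{q(\cdot)}(\mathbb{Q}_p^n)$ for some $r(\cdot),q(\cdot)\in\mathscr{C}^{\log}(\mathbb{Q}_p^n)$ with $r(\cdot)\in\mathscr{P}(\mathbb{Q}_p^n)$, $r_+<n/\alpha$ and $1/q(\cdot)=1/r(\cdot)-\alpha/n$. (T.4) For some $r(\cdot),q(\cdot)\in\mathscr{C}^{\log}(\mathbb{Q}_p^n)$ with $r(\cdot)\in\mathscr{P}(\mathbb{Q}_p^n)$, $r_+<n/\alpha$ and $1/q(\cdot)=1/r(\cdot)-\alpha/n$, one has $$\sup_{\gamma\in\mathbb{Z},\,x\in\mathbb{Q}_p^n}\frac{\big\|\big(b-|B_\gamma(x)|_h^{-\alpha/n}\mathcal{M}^p_{\alpha,B_\gamma(x)}(b)\big)\chi_{B_\gamma(x)}\big\|_{L^{q(\cdot)}(\mathbb{Q}_p^n)}}{\|\chi_{B_\gamma(x)}\|_{L^{q(\cdot)}(\mathbb{Q}_p^n)}}<\infty.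 \quad ( * )$$ (T.5) $( * )$ holds for all $r(\cdot),q(\cdot)\in\mathscr{C}^{\log}(\mathbb{Q}_p^n)$ with $r(\cdot)\in\mathscr{P}(\mathbb{Q}_p^n)$, $r_+<n/\alpha$ and $1/q(\cdot)=1/r(\cdot)-\alpha/n$.
   Context: Fix a prime $p$. $\mathbb{Q}_p$ is the field of $p$-adic numbers with absolute value $|\cdot|_p$; on $\mathbb{Q}_p^n$ put $|x|_p=\max_{1\le j\le n}|x_j|_p$. For $\gamma\in\mathbb{Z}$, $x\in\mathbb{Q}_p^n$, the ($p$-adic) ball is $B_\gamma(x)=\{y\in\mathbb{Q}_p^n:|y-x|_p\le p^\gamma\}$. $dx$ is the Haar measure on $\mathbb{Q}_p^n$ normalized by $|B_0(0)|_h=1$, where $|E|_h$ denotes the Haar measure of $E$; thus $|B_\gamma(x)|_h=p^{n\gamma}$. $\chi_E$ is the characteristic function of $E$, and $f_B=|B|_h^{-1}\int_B f$. For $0\le\alpha<n$ and $f$ locally integrable: $\mathcal{M}^p_\alpha(f)(x)=\sup_{\gamma\in\mathbb{Z}}|B_\gamma(x)|_h^{\alpha/n-1}\int_{B_\gamma(x)}|f(y)|\,dy$; $\mathcal{M}^p=\mathcal{M}^p_0$. For a fixed ball $B_*$ and $x\in B_*$: $\mathcal{M}^p_{\alpha,B_*}(f)(x)=\sup\{|B_\gamma(x)|_h^{\alpha/n-1}\int_{B_\gamma(x)}|f(y)|dy:\ \gamma\in\mathbb{Z},\ B_\gamma(x)\subset B_*\}$. The nonlinear commutator is $[b,\mathcal{M}^p_\alpha](f)(x)=b(x)\mathcal{M}^p_\alpha(f)(x)-\mathcal{M}^p_\alpha(bf)(x)$.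 $\mathrm{BMO}(\mathbb{Q}_p^n)$ is the set of locally integrable $b$ with $\|b\|_{*}=\sup_{\gamma,x}|B_\gamma(x)|_h^{-1}\int_{B_\gamma(x)}|b(y)-b_{B_\gamma(x)}|dy<\infty$. $b^-=-\min\{b,0\}$. Variable exponents: for measurable $q(\cdot)$, $q_-=\operatorname{ess\,inf} q$, $q_+=\operatorname{ess\,sup}q$, and for a ball $B$, $q_\pm(B)$ are the ess inf/sup over $B$. $\mathscr{P}(\mathbb{Q}_p^n)$ is the set of measurable $q:\mathbb{Q}_p^n\to(1,\infty)$ with $1<q_-\le q_+<\infty$. $L^{q(\cdot)}(\mathbb{Q}_p^n)$ is the space of measurable $f$ with $\int(|f|/\eta)^{q(x)}dx<\infty$ for some $\eta>0$, normed by $\|f\|_{L^{q(\cdot)}}=\inf\{\eta>0:\int(|f(x)|/\eta)^{q(x)}dx\le1\}$. $\mathscr{C}^{\log}_0$: there is $C$ with $\gamma\big(q_-(B_\gamma(x))-q_+(B_\gamma(x))\big)\le C$ for all $\gamma\in\mathbb{Z}$, $x$. $\mathscr{C}^{\log}_\infty$: there is $C$ with $|q(x)-q(y)|\le C/\log_p(p+\min\{|x|_p,|y|_p\})$ for all $x,y$. $\mathscr{C}^{\log}=\mathscr{C}^{\log}_0\cap\mathscr{C}^{\log}_\infty$. *)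

theory Defs
  imports "HOL-Analysis.Analysis"
begin

text \<open>The prime p is encoded as the cardinality of a finite type 'p (the theorem
assumes prime CARD('p)).  Q_p is constructed as the inverse limit
Q_p = lim_k Q_p / p^k Z_p = lim_k Z[1/p] / p^k Z  (k = 0,1,2,...):
an element x is represented by the family t with t k the unique representative of
x mod p^k Z_p lying in Z[1/p] and in the interval [0, p^k).\<close>

definition rmod :: "rat \<Rightarrow> rat \<Rightarrow> rat" where
  "rmod r m = r - m * of_int \<lfloor>r / m\<rfloor>"

definition qp_rep :: "nat \<Rightarrow> (nat \<Rightarrow> rat) \<Rightarrow> bool" where
  "qp_rep p t \<longleftrightarrow> (\<forall>k. (\<exists>z::int. \<exists>j::nat. t k = of_int z / of_nat p ^ j)
      \<and> 0 \<le> t k \<and> t k < of_nat p ^ k \<and> t k = rmod (t (Suc k)) (of_nat p ^ k))"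

typedef ('p::finite) qp = "{t. qp_rep CARD('p) t}"
  morphisms Rep_qp Abs_qp
proof
  show "(\<lambda>_. 0) \<in> {t. qp_rep CARD('p) t}"
    by (auto simp: qp_rep_def rmod_def intro!: exI[of _ 0] exI[of _ "0::nat"])
qed

definition qp_zero :: "'p::finite qp" where
  "qp_zero = Abs_qp (\<lambda>_. 0)"

definition qp_add :: "'p::finite qp \<Rightarrow> 'p qp \<Rightarrow> 'p qp" where
  "qp_add x y = Abs_qp (\<lambda>k. rmod (Rep_qp x k + Rep_qp y k) (of_nat CARD('p) ^ k))"

definition qp_sub :: "'p::finite qp \<Rightarrow> 'p qp \<Rightarrow> 'p qp" where
  "qp_sub x y = Abs_qp (\<lambda>k. rmod (Rep_qp x k - Rep_qp y k) (of_nat CARD('p) ^ k))"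

text \<open>x \<in> p^m Z_p\<close>
definition qp_in :: "'p::finite qp \<Rightarrow> int \<Rightarrow> bool" where
  "qp_in x m \<longleftrightarrow> (\<forall>k. \<exists>z::int. Rep_qp x k = of_int z * (of_nat CARD('p)) powi m)"

definition qp_val :: "'p::finite qp \<Rightarrow> int" where
  "qp_val x = (GREATEST m. qp_in x m)"

definition qp_abs :: "'p::finite qp \<Rightarrow> real" where
  "qp_abs x = (if x = qp_zero then 0 else real CARD('p) powi (- qp_val x))"

definition qpn_zero :: "('p::finite qp) ^ 'n" where
  "qpn_zero = (\<chi> i. qp_zero)"

definition qpn_add :: "('p::finite qp) ^ 'n \<Rightarrow> 'p qp ^ 'n \<Rightarrow> 'p qp ^ 'n" where
  "qpn_add x y = (\<chi> i. qp_add (x $ i) (y $ i))"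

definition qpn_sub :: "('p::finite qp) ^ 'n \<Rightarrow> 'p qp ^ 'n \<Rightarrow> 'p qp ^ 'n" where
  "qpn_sub x y = (\<chi> i. qp_sub (x $ i) (y $ i))"

definition qpn_abs :: "('p::finite qp) ^ ('n::finite) \<Rightarrow> real" where
  "qpn_abs x = Max (range (\<lambda>i. qp_abs (x $ i)))"

definition qball :: "('p::finite qp) ^ ('n::finite) \<Rightarrow> int \<Rightarrow> ('p qp ^ 'n) set" where
  "qball x \<gamma> = {y. qpn_abs (qpn_sub y x) \<le> real CARD('p) powi \<gamma>}"

definition haar :: "('p::finite qp ^ ('n::finite)) measure" where
  "haar = (SOME M. space M = UNIV
     \<and> sets M = sigma_sets UNIV (range (\<lambda>(x, \<gamma>). qball x \<gamma>))
     \<and> (\<forall>a. \<forall>A\<in>sets M. emeasure M (qpn_add a ` A) = emeasure M A)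
     \<and> emeasure M (qball qpn_zero 0) = 1)"

definition loc_int :: "('p::finite qp ^ ('n::finite) \<Rightarrow> real) \<Rightarrow> bool" where
  "loc_int f \<longleftrightarrow> (\<forall>x \<gamma>. set_integrable haar (qball x \<gamma>) f)"

definition ball_avg :: "('p::finite qp ^ ('n::finite) \<Rightarrow> real) \<Rightarrow> ('p qp ^ 'n) set \<Rightarrow> real" where
  "ball_avg f B = (LINT y:B|haar. f y) / measure haar B"

definition BMO :: "('p::finite qp ^ ('n::finite) \<Rightarrow> real) set" where
  "BMO = {b. loc_int b \<and> (\<exists>C. \<forall>x \<gamma>.
      ball_avg (\<lambda>y. \<bar>b y - ball_avg b (qball x \<gamma>)\<bar>) (qball x \<gamma>) \<le> C)}"

definition Linfty :: "('p::finite qp ^ ('n::finite) \<Rightarrow> real) set" where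
  "Linfty = {f. f \<in> borel_measurable haar \<and> (\<exists>C. AE x in haar. \<bar>f x\<bar> \<le> C)}"

definition frac_max :: "real \<Rightarrow> ('p::finite qp ^ ('n::finite) \<Rightarrow> real) \<Rightarrow> 'p qp ^ 'n \<Rightarrow> ennreal" where
  "frac_max \<alpha> f x = (SUP \<gamma>::int.
     ennreal (measure haar (qball x \<gamma>) powr (\<alpha> / real CARD('n) - 1))
       * (\<integral>\<^sup>+ y. indicator (qball x \<gamma>) y * ennreal \<bar>f y\<bar> \<partial>haar))"

definition frac_max_loc :: "real \<Rightarrow> ('p::finite qp ^ ('n::finite)) set \<Rightarrow> ('p qp ^ 'n \<Rightarrow> real)
    \<Rightarrow> 'p qp ^ 'n \<Rightarrow> ennreal" where
  "frac_max_loc \<alpha> Bs f x = (SUP \<gamma>\<in>{\<gamma>::int. qball x \<gamma> \<subseteq> Bs}.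
     ennreal (measure haar (qball x \<gamma>) powr (\<alpha> / real CARD('n) - 1))
       * (\<integral>\<^sup>+ y. indicator (qball x \<gamma>) y * ennreal \<bar>f y\<bar> \<partial>haar))"

text \<open>nonlinear commutator [b, M_alpha](f) (meaningful where both maximal functions are finite)\<close>
definition frac_comm :: "real \<Rightarrow> ('p::finite qp ^ ('n::finite) \<Rightarrow> real) \<Rightarrow> ('p qp ^ 'n \<Rightarrow> real)
    \<Rightarrow> 'p qp ^ 'n \<Rightarrow> real" where
  "frac_comm \<alpha> b f x = b x * enn2real (frac_max \<alpha> f x) - enn2real (frac_max \<alpha> (\<lambda>y. b y * f y) x)"

definition ess_sup_on :: "('p::finite qp ^ ('n::finite)) set \<Rightarrow> ('p qp ^ 'n \<Rightarrow> real) \<Rightarrow> ereal" where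
  "ess_sup_on B q = Inf {z::ereal. AE x in haar. x \<in> B \<longrightarrow> ereal (q x) \<le> z}"

definition ess_inf_on :: "('p::finite qp ^ ('n::finite)) set \<Rightarrow> ('p qp ^ 'n \<Rightarrow> real) \<Rightarrow> ereal" where
  "ess_inf_on B q = Sup {z::ereal. AE x in haar. x \<in> B \<longrightarrow> z \<le> ereal (q x)}"

definition var_exp_P :: "('p::finite qp ^ ('n::finite) \<Rightarrow> real) set" where
  "var_exp_P = {q. q \<in> borel_measurable haar \<and> (\<forall>x. 1 < q x)
      \<and> 1 < ess_inf_on UNIV q \<and> ess_sup_on UNIV q < \<infinity>}"

definition Clog0 :: "('p::finite qp ^ ('n::finite) \<Rightarrow> real) set" where
  "Clog0 = {q. \<exists>C. \<forall>\<gamma> x. ereal (real_of_int \<gamma>)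
      * (ess_inf_on (qball x \<gamma>) q - ess_sup_on (qball x \<gamma>) q) \<le> ereal C}"

definition ClogInf :: "('p::finite qp ^ ('n::finite) \<Rightarrow> real) set" where
  "ClogInf = {q. \<exists>C. \<forall>x y. \<bar>q x - q y\<bar>
      \<le> C / log (real CARD('p)) (real CARD('p) + min (qpn_abs x) (qpn_abs y))}"

definition Clog :: "('p::finite qp ^ ('n::finite) \<Rightarrow> real) set" where
  "Clog = Clog0 \<inter> ClogInf"

text \<open>Luxemburg norm (value \<infinity> if f is not in L^q(.))\<close>
definition var_norm :: "('p::finite qp ^ ('n::finite) \<Rightarrow> real) \<Rightarrow> ('p qp ^ 'n \<Rightarrow> real) \<Rightarrow> ennreal" where
  "var_norm q f = (INF \<eta>\<in>{\<eta>::real. 0 < \<eta> \<and>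
      (\<integral>\<^sup>+ x. ennreal ((\<bar>f x\<bar> / \<eta>) powr q x) \<partial>haar) \<le> 1}. ennreal \<eta>)"

definition Lvar :: "('p::finite qp ^ ('n::finite) \<Rightarrow> real) \<Rightarrow> ('p qp ^ 'n \<Rightarrow> real) set" where
  "Lvar q = {f. f \<in> borel_measurable haar \<and>
      (\<exists>\<eta>>0. (\<integral>\<^sup>+ x. ennreal ((\<bar>f x\<bar> / \<eta>) powr q x) \<partial>haar) < \<infinity>)}"

definition admissible :: "real \<Rightarrow> ('p::finite qp ^ ('n::finite) \<Rightarrow> real) \<Rightarrow> ('p qp ^ 'n \<Rightarrow> real) \<Rightarrow> bool" where
  "admissible \<alpha> r q \<longleftrightarrow> r \<in> Clog \<and> q \<in> Clog \<and> r \<in> var_exp_P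
     \<and> ess_sup_on UNIV r < ereal (real CARD('n) / \<alpha>)
     \<and> (\<forall>x. 1 / q x = 1 / r x - \<alpha> / real CARD('n))"

definition comm_bounded :: "real \<Rightarrow> ('p::finite qp ^ ('n::finite) \<Rightarrow> real)
    \<Rightarrow> ('p qp ^ 'n \<Rightarrow> real) \<Rightarrow> ('p qp ^ 'n \<Rightarrow> real) \<Rightarrow> bool" where
  "comm_bounded \<alpha> b r q \<longleftrightarrow> (\<exists>C::real. \<forall>f\<in>Lvar r.
      (AE x in haar. frac_max \<alpha> f x < \<infinity> \<and> frac_max \<alpha> (\<lambda>y. b y * f y) x < \<infinity>)
      \<and> frac_comm \<alpha> b f \<in> Lvar q
      \<and> var_norm q (frac_comm \<alpha> b f) \<le> ennreal C * var_norm r f)"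

definition star_cond :: "real \<Rightarrow> ('p::finite qp ^ ('n::finite) \<Rightarrow> real) \<Rightarrow> ('p qp ^ 'n \<Rightarrow> real) \<Rightarrow> bool" where
  "star_cond \<alpha> b q \<longleftrightarrow>
     (SUP (x, \<gamma>)\<in>UNIV.
        var_norm q (\<lambda>y. (b y - measure haar (qball x \<gamma>) powr (- \<alpha> / real CARD('n))
                             * enn2real (frac_max_loc \<alpha> (qball x \<gamma>) b y))
                        * indicator (qball x \<gamma>) y)
        / var_norm q (indicator (qball x \<gamma>))) < \<infinity>"

end

theory Submission
  imports Defs
begin

text \<open>Write \<open>\<beta> = \<alpha>/n\<close>. On a ball \<open>B\<close> the commutator applied to \<open>\<chi>\<^sub>B\<close> equals
  \<open>|B|\<^bsup>\<beta>\<^esup> b - M\<^bsub>\<alpha>,B\<^esub>(b)\<close>, because balls larger than \<open>B\<close> contribute no more than \<open>B\<close> itself; so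
  boundedness gives the local condition. That condition bounds the mean of \<open>|b - |B|\<^bsup>-\<beta>\<^esup> M\<^bsub>\<alpha>,B\<^esub>(b)|\<close> over \<open>B\<close>, and since
  \<open>|B|\<^bsup>-\<beta>\<^esup> M\<^bsub>\<alpha>,B\<^esub>(b)\<close> dominates the mean of \<open>|b|\<close> over \<open>B\<close>, both the oscillation of \<open>b\<close> and, by
  differentiation, its negative part are controlled.

  Conversely, up to the bounded function \<open>b\<^sup>-\<close> the commutator is dominated by the maximal commutator
  with kernel \<open>|b(x) - b(y)|\<close>, hence by weighted fractional maximal functions with weights \<open>e\<^bsup>\<plusminus>\<tau>b\<^esup>\<close>.
  By the John--Nirenberg inequality these are Muckenhoupt weights for small \<open>\<tau>\<close>, so the constant
  exponent weighted bound applies, and extrapolation with \<open>A\<^sub>1\<close> majorants transfers it to variable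
  exponents.\<close>

section \<open>Integrals of powers\<close>

text \<open>All maximal functions are first truncated to finitely many levels, \<open>mx N\<close>:
  such a function is locally constant, hence measurable, and real valued. Every estimate is uniform
  in \<open>N\<close>, and monotone convergence of modulars removes the truncation at the end;
  finiteness almost everywhere comes out of the same argument. Nestedness of ultrametric balls
  replaces covering lemmas: the maximal balls with a given property are disjoint. Hence the maximal
  theorem holds with a constant depending on the exponent alone for every measure that is finite on
  balls, doubling or not, and this allows the change to the weighted measures \<open>Mu\<close> and
  \<open>Ms\<close> in the proof of the weighted bound. Two obstacles shape the rest. Weighted
  bounds are available for constant exponents only, so the modular is tested against an explicitly
  chosen dual function, and that function is majorized by a weight to which a constant exponent
  bound applies. Further, \<open>haar\<close> is given by a choice operator, so an invariant measure
  has to be constructed before anything is known about it.\<close>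

lemma nn_integral_powr_Ioo:
  fixes p m :: real
  assumes "0 < p" "0 \<le> m"
  shows "(\<integral>\<^sup>+ l. ennreal (p * l powr (p - 1)) * indicator {0<..<m} l \<partial>lborel) = ennreal (m powr p)"
proof -
  have h: "((\<lambda>l. p * l powr (p - 1)) has_integral (p * (m powr (p - 1 + 1) / (p - 1 + 1)))) {0..m}"
    by (intro has_integral_mult_right has_integral_powr_from_0) (use assms in auto)
  have "(\<integral>\<^sup>+ l. ennreal (p * l powr (p - 1)) * indicator {0<..<m} l \<partial>lborel)
      = (\<integral>\<^sup>+ l. indicator {0..m} l * ennreal (p * l powr (p - 1)) \<partial>lborel)"
  proof (rule nn_integral_cong_AE)
    have "AE l in lborel. l \<noteq> (m::real)" by (rule AE_lborel_singleton)
    then show "AE l in lborel. ennreal (p * l powr (p - 1)) * indicator {0<..<m} l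
        = indicator {0..m} l * ennreal (p * l powr (p - 1))"
      by eventually_elim (auto simp: indicator_def)
  qed
  also have "\<dots> = (\<integral>\<^sup>+ l. ennreal (indicator {0..m} l * (p * l powr (p - 1))) \<partial>lborel)"
    by (intro nn_integral_cong) (auto simp: indicator_def)
  also have "\<dots> = ennreal (p * (m powr (p - 1 + 1) / (p - 1 + 1)))"
  proof (rule nn_integral_has_integral_lborel)
    have "(\<lambda>l. indicator {0..m} l * (p * l powr (p - 1))) = (\<lambda>l. if l \<in> {0..m} then p * l powr (p - 1) else 0)"
      by (auto simp: indicator_def)
    then show "((\<lambda>l. indicator {0..m} l * (p * l powr (p - 1))) has_integral
        p * (m powr (p - 1 + 1) / (p - 1 + 1))) UNIV"
      using h by (simp only: has_integral_restrict_UNIV)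
  qed (use assms in auto)
  finally show ?thesis using assms by simp
qed

text \<open>Tonelli for the region under the graph of \<open>m\<close>. The weight \<open>g\<close>
  is carried along because it becomes \<open>f\<close> itself in the interpolation argument and the
  indicator of a ball in the Coifman-Rochberg estimate.\<close>

lemma (in sigma_finite_measure) layer_cake:
  fixes m :: "'a \<Rightarrow> real"
  assumes [measurable]: "m \<in> borel_measurable M" "g \<in> borel_measurable M"
    and "\<And>x. 0 \<le> m x" "0 < p"
  shows "(\<integral>\<^sup>+ x. g x * ennreal (m x powr p) \<partial>M)
    = (\<integral>\<^sup>+ l. ennreal (p * l powr (p - 1)) * indicator {0<..} l *
        (\<integral>\<^sup>+ x. g x * indicator {x. l < m x} x \<partial>M) \<partial>lborel)"
proof -
  interpret pair_sigma_finite M lborel ..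
  have [measurable]: "Measurable.pred (M \<Otimes>\<^sub>M lborel) (\<lambda>z. snd z < m (fst z))" by measurable
  have "(\<integral>\<^sup>+ x. g x * ennreal (m x powr p) \<partial>M)
      = (\<integral>\<^sup>+ x. (\<integral>\<^sup>+ l. g x * (ennreal (p * l powr (p - 1)) * (indicator {0<..} l * indicator {z. snd z < m (fst z)} (x, l))) \<partial>lborel) \<partial>M)"
  proof (rule nn_integral_cong)
    fix x
    have "g x * ennreal (m x powr p) = g x * (\<integral>\<^sup>+ l. ennreal (p * l powr (p - 1)) * indicator {0<..<m x} l \<partial>lborel)"
      using nn_integral_powr_Ioo[of p "m x"] assms by simp
    also have "\<dots> = (\<integral>\<^sup>+ l. g x * (ennreal (p * l powr (p - 1)) * indicator {0<..<m x} l) \<partial>lborel)"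
      by (rule nn_integral_cmult[symmetric]) auto
    also have "\<dots> = (\<integral>\<^sup>+ l. g x * (ennreal (p * l powr (p - 1)) * (indicator {0<..} l * indicator {z. snd z < m (fst z)} (x, l))) \<partial>lborel)"
      by (intro nn_integral_cong) (auto simp: indicator_def)
    finally show "g x * ennreal (m x powr p) = (\<integral>\<^sup>+ l. g x * (ennreal (p * l powr (p - 1)) * (indicator {0<..} l * indicator {z. snd z < m (fst z)} (x, l))) \<partial>lborel)" .
  qed
  also have "\<dots> = (\<integral>\<^sup>+ l. (\<integral>\<^sup>+ x. g x * (ennreal (p * l powr (p - 1)) * (indicator {0<..} l * indicator {z. snd z < m (fst z)} (x, l))) \<partial>M) \<partial>lborel)"
    by (rule Fubini'[symmetric]) measurable
  also have "\<dots> = (\<integral>\<^sup>+ l. ennreal (p * l powr (p - 1)) * indicator {0<..} l *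
        (\<integral>\<^sup>+ x. g x * indicator {x. l < m x} x \<partial>M) \<partial>lborel)"
  proof (rule nn_integral_cong)
    fix l :: real
    have "(\<integral>\<^sup>+ x. g x * (ennreal (p * l powr (p - 1)) * (indicator {0<..} l * indicator {z. snd z < m (fst z)} (x, l))) \<partial>M)
      = (\<integral>\<^sup>+ x. ennreal (p * l powr (p - 1)) * indicator {0<..} l * (g x * indicator {x. l < m x} x) \<partial>M)"
      by (intro nn_integral_cong) (auto simp: indicator_def mult_ac)
    also have "\<dots> = ennreal (p * l powr (p - 1)) * indicator {0<..} l *
        (\<integral>\<^sup>+ x. g x * indicator {x. l < m x} x \<partial>M)"
      by (rule nn_integral_cmult) measurable
    finally show "(\<integral>\<^sup>+ x. g x * (ennreal (p * l powr (p - 1)) * (indicator {0<..} l * indicator {z. snd z < m (fst z)} (x, l))) \<partial>M)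
      = ennreal (p * l powr (p - 1)) * indicator {0<..} l *
        (\<integral>\<^sup>+ x. g x * indicator {x. l < m x} x \<partial>M)" .
  qed
  finally show ?thesis .
qed

text \<open>Marcinkiewicz interpolation with the endpoint at infinity already absorbed: the weak
  bound only sees the part of \<open>f\<close> above \<open>l/2\<close>. The layer cake formula is
  used for exponent \<open>p\<close>, then backwards for exponent \<open>p - 1\<close> with weight
  \<open>f\<close>. The constant depends on \<open>p\<close> alone, which matters since the measure
  will vary.\<close>

lemma (in sigma_finite_measure) strong_type_from_weak_type:
  fixes m f :: "'a \<Rightarrow> real"
  assumes [measurable]: "m \<in> borel_measurable M" "f \<in> borel_measurable M"
    and nn: "\<And>x. 0 \<le> m x" "\<And>x. 0 \<le> f x" and p: "1 < p"
    and weak: "\<And>l. 0 < l \<Longrightarrow> ennreal l * (\<integral>\<^sup>+ x. indicator {x. l < m x} x \<partial>M)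
        \<le> 2 * (\<integral>\<^sup>+ x. ennreal (f x) * indicator {x. l < 2 * f x} x \<partial>M)"
  shows "(\<integral>\<^sup>+ x. ennreal (m x powr p) \<partial>M) \<le> ennreal (p * 2 powr p / (p - 1)) * (\<integral>\<^sup>+ x. ennreal (f x powr p) \<partial>M)"
proof -
  have "(\<integral>\<^sup>+ x. ennreal (m x powr p) \<partial>M) = (\<integral>\<^sup>+ x. 1 * ennreal (m x powr p) \<partial>M)" by simp
  also have "\<dots> = (\<integral>\<^sup>+ l. ennreal (p * l powr (p - 1)) * indicator {0<..} l *
        (\<integral>\<^sup>+ x. 1 * indicator {x. l < m x} x \<partial>M) \<partial>lborel)"
    by (rule layer_cake) (use nn p in auto)
  also have "\<dots> \<le> (\<integral>\<^sup>+ l. ennreal (2 * p / (p - 1)) * (ennreal ((p - 1) * l powr (p - 1 - 1)) * indicator {0<..} l *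
        (\<integral>\<^sup>+ x. ennreal (f x) * indicator {x. l < 2 * f x} x \<partial>M)) \<partial>lborel)"
  proof (rule nn_integral_mono)
    fix l :: real
    show "ennreal (p * l powr (p - 1)) * indicator {0<..} l * (\<integral>\<^sup>+ x. 1 * indicator {x. l < m x} x \<partial>M)
      \<le> ennreal (2 * p / (p - 1)) * (ennreal ((p - 1) * l powr (p - 1 - 1)) * indicator {0<..} l *
        (\<integral>\<^sup>+ x. ennreal (f x) * indicator {x. l < 2 * f x} x \<partial>M))" (is "?L \<le> ?R")
    proof (cases "0 < l")
      case True
      \<comment> \<open>One factor \<open>l\<close> is spent on the weak bound; what is left is the
        layer cake kernel of exponent \<open>p - 1\<close>, up to a constant.\<close>
      have e1: "p * l powr (p - 1) = (p * l powr (p - 2)) * l"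
        using True by (simp add: powr_diff power2_eq_square)
      have e2: "2 * p / (p - 1) * ((p - 1) * l powr (p - 1 - 1)) = (p * l powr (p - 2)) * 2"
        using p by (simp add: field_simps)
      have "?L = ennreal (p * l powr (p - 2)) * (ennreal l * (\<integral>\<^sup>+ x. indicator {x. l < m x} x \<partial>M))"
        using True p by (simp add: e1 ennreal_mult mult.assoc)
      also have "\<dots> \<le> ennreal (p * l powr (p - 2)) * (2 * (\<integral>\<^sup>+ x. ennreal (f x) * indicator {x. l < 2 * f x} x \<partial>M))"
        by (intro mult_left_mono weak True) auto
      also have "\<dots> = ennreal (p * l powr (p - 2) * 2) * (\<integral>\<^sup>+ x. ennreal (f x) * indicator {x. l < 2 * f x} x \<partial>M)"
        using p by (simp add: ennreal_mult mult.assoc)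
      also have "\<dots> = ennreal (2 * p / (p - 1)) * ennreal ((p - 1) * l powr (p - 1 - 1)) * (\<integral>\<^sup>+ x. ennreal (f x) * indicator {x. l < 2 * f x} x \<partial>M)"
        unfolding e2[symmetric] using p by (subst ennreal_mult) auto
      also have "\<dots> = ?R" using True by (simp add: mult.assoc)
      finally show ?thesis .
    qed simp
  qed
  also have "\<dots> = ennreal (2 * p / (p - 1)) * (\<integral>\<^sup>+ l. ennreal ((p - 1) * l powr (p - 1 - 1)) * indicator {0<..} l *
        (\<integral>\<^sup>+ x. ennreal (f x) * indicator {x. l < 2 * f x} x \<partial>M) \<partial>lborel)"
    by (rule nn_integral_cmult) measurable
  also have "(\<integral>\<^sup>+ l. ennreal ((p - 1) * l powr (p - 1 - 1)) * indicator {0<..} l *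
        (\<integral>\<^sup>+ x. ennreal (f x) * indicator {x. l < 2 * f x} x \<partial>M) \<partial>lborel)
     = (\<integral>\<^sup>+ x. ennreal (f x) * ennreal ((2 * f x) powr (p - 1)) \<partial>M)"
    by (rule layer_cake[symmetric]) (use nn p in auto)
  also have "\<dots> = (\<integral>\<^sup>+ x. ennreal (2 powr (p - 1)) * ennreal (f x powr p) \<partial>M)"
  proof (rule nn_integral_cong)
    fix x
    have "f x * (2 * f x) powr (p - 1) = 2 powr (p - 1) * f x powr p"
    proof (cases "f x = 0")
      case False
      then have "f x > 0" using nn(2)[of x] by auto
      then show ?thesis by (simp add: powr_mult powr_diff field_simps)
    qed (use p in auto)
    then show "ennreal (f x) * ennreal ((2 * f x) powr (p - 1)) = ennreal (2 powr (p - 1)) * ennreal (f x powr p)"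
      by (simp add: ennreal_mult[symmetric] nn)
  qed
  also have "\<dots> = ennreal (2 powr (p - 1)) * (\<integral>\<^sup>+ x. ennreal (f x powr p) \<partial>M)"
    by (rule nn_integral_cmult) measurable
  also have "ennreal (2 * p / (p - 1)) * \<dots> = ennreal (p * 2 powr p / (p - 1)) * (\<integral>\<^sup>+ x. ennreal (f x powr p) \<partial>M)"
  proof -
    have t: "(2::real) powr p = 2 * 2 powr (p - 1)" by (simp add: powr_diff)
    have e: "p * 2 powr p / (p - 1) = 2 * p / (p - 1) * 2 powr (p - 1)" unfolding t by simp
    show ?thesis unfolding e using p by (subst ennreal_mult) (auto simp: mult.assoc)
  qed
  finally show ?thesis .
qed

section \<open>Ultrametric balls\<close>

text \<open>Only the combinatorics of an ultrametric is kept, with integer levels in place of radii.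
  Countability of the family of balls stands in for separability, and \<open>ball_cover\<close> says
  that any two points lie in a common ball.\<close>

locale ball_tree =
  fixes ball :: "'a \<Rightarrow> int \<Rightarrow> 'a set"
  assumes ball_self: "x \<in> ball x \<gamma>"
    and ball_eq: "y \<in> ball x \<gamma> \<Longrightarrow> ball y \<gamma> = ball x \<gamma>"
    and ball_mono: "\<gamma> \<le> \<delta> \<Longrightarrow> ball x \<gamma> \<subseteq> ball x \<delta>"
    and countable_balls: "countable (range (\<lambda>(x, \<gamma>). ball x \<gamma>))"
    and ball_cover: "\<exists>\<gamma>. y \<in> ball x \<gamma>"
begin

lemma ball_sym: "y \<in> ball x \<gamma> \<longleftrightarrow> x \<in> ball y \<gamma>"
  using ball_eq[of y x \<gamma>] ball_eq[of x y \<gamma>] ball_self[of x \<gamma>] ball_self[of y \<gamma>] by auto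

lemma ball_up: "y \<in> ball x \<gamma> \<Longrightarrow> \<gamma> \<le> \<delta> \<Longrightarrow> ball y \<delta> = ball x \<delta>"
  by (rule ball_eq) (rule subsetD[OF ball_mono])

lemma ball_meet: "\<gamma> \<le> \<delta> \<Longrightarrow> z \<in> ball x \<gamma> \<Longrightarrow> z \<in> ball y \<delta> \<Longrightarrow> ball x \<gamma> \<subseteq> ball y \<delta>"
  using ball_eq[of z x \<gamma>] ball_eq[of z y \<delta>] ball_mono[of \<gamma> \<delta> z] by simp

text \<open>The open sets of the ultrametric as a plain predicate: no topology is put on the type,
  and measurability is always referred to the balls.\<close>

definition ball_open :: "'a set \<Rightarrow> bool" where
  "ball_open U \<longleftrightarrow> (\<forall>x\<in>U. \<exists>\<gamma>. ball x \<gamma> \<subseteq> U)"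

lemma ball_open_ball: "ball_open (ball x \<gamma>)"
  unfolding ball_open_def using ball_eq by blast

lemma ball_open_Compl_ball: "ball_open (- ball x \<gamma>)"
  unfolding ball_open_def using ball_eq ball_self by blast

lemma ball_open_UN: "(\<And>i. i \<in> I \<Longrightarrow> ball_open (U i)) \<Longrightarrow> ball_open (\<Union>i\<in>I. U i)"
  unfolding ball_open_def by (meson UN_E UN_upper order_trans)

lemma ball_open_Int:
  assumes "ball_open U" "ball_open V" shows "ball_open (U \<inter> V)"
  unfolding ball_open_def
proof
  fix x assume "x \<in> U \<inter> V"
  then obtain \<gamma> \<delta> where "ball x \<gamma> \<subseteq> U" "ball x \<delta> \<subseteq> V" using assms unfolding ball_open_def by blast
  then have "ball x (min \<gamma> \<delta>) \<subseteq> U \<inter> V" using ball_mono[of "min \<gamma> \<delta>" \<gamma> x] ball_mono[of "min \<gamma> \<delta>" \<delta> x] by auto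
  then show "\<exists>\<gamma>. ball x \<gamma> \<subseteq> U \<inter> V" by blast
qed

lemma ball_open_INT: "finite I \<Longrightarrow> (\<And>i. i \<in> I \<Longrightarrow> ball_open (U i)) \<Longrightarrow> ball_open (\<Inter>i\<in>I. U i)"
proof (induction I rule: finite_induct)
  case empty
  show ?case by (simp add: ball_open_def)
next
  case (insert i I)
  then show ?case by (simp add: ball_open_Int)
qed

text \<open>Calderon-Zygmund selection. As the levels satisfying \<open>Q\<close> are bounded by
  \<open>G\<close>, each point of the set has a largest such level; by nestedness two of these
  largest balls are equal or disjoint. The invariance of \<open>Q\<close> makes the choice depend on
  the ball and not on its centre.\<close>

lemma stopping_balls:
  assumes inv: "\<And>x y \<gamma>. y \<in> ball x \<gamma> \<Longrightarrow> Q y \<gamma> = Q x \<gamma>"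
    and bdd: "\<And>x \<gamma>. Q x \<gamma> \<Longrightarrow> \<gamma> \<le> G"
  obtains F where "F \<subseteq> range (\<lambda>(x, \<gamma>). ball x \<gamma>)" "disjoint F" "\<Union>F = {x. \<exists>\<gamma>. Q x \<gamma>}"
    "\<And>B. B \<in> F \<Longrightarrow> \<exists>x \<gamma>. B = ball x \<gamma> \<and> Q x \<gamma> \<and> (\<forall>\<delta>>\<gamma>. \<not> Q x \<delta>)"
proof
  let ?F = "{ball x \<gamma> |x \<gamma>. Q x \<gamma> \<and> (\<forall>\<delta>>\<gamma>. \<not> Q x \<delta>)}"
  show "?F \<subseteq> range (\<lambda>(x, \<gamma>). ball x \<gamma>)" by auto
  have mx: "(\<forall>\<delta>>\<gamma>. \<not> Q z \<delta>) \<and> Q z \<gamma>" if "z \<in> ball x \<gamma>" "Q x \<gamma>" "\<forall>\<delta>>\<gamma>. \<not> Q x \<delta>" for x z \<gamma>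
  proof (intro conjI allI impI)
    fix \<delta> assume "\<gamma> < \<delta>"
    then have "z \<in> ball x \<delta>" using that(1) ball_mono[of \<gamma> \<delta> x] by auto
    then show "\<not> Q z \<delta>" using inv that \<open>\<gamma> < \<delta>\<close> by blast
  qed (use inv that in blast)
  show "disjoint ?F"
  proof (rule disjointI)
    fix A B assume "A \<in> ?F" "B \<in> ?F" "A \<noteq> B"
    then obtain x \<gamma> y \<delta> where a: "A = ball x \<gamma>" "Q x \<gamma>" "\<forall>\<delta>>\<gamma>. \<not> Q x \<delta>"
      and b: "B = ball y \<delta>" "Q y \<delta>" "\<forall>\<epsilon>>\<delta>. \<not> Q y \<epsilon>" by blast
    show "A \<inter> B = {}"
    proof (rule ccontr)
      assume "A \<inter> B \<noteq> {}"
      then obtain z where z: "z \<in> ball x \<gamma>" "z \<in> ball y \<delta>" using a b by blast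
      have "\<gamma> = \<delta>" using mx[OF z(1) a(2,3)] mx[OF z(2) b(2,3)] by (metis linorder_neqE)
      then show False using z a(1) b(1) \<open>A \<noteq> B\<close> ball_eq by blast
    qed
  qed
  show "\<Union>?F = {x. \<exists>\<gamma>. Q x \<gamma>}"
  proof (intro set_eqI iffI)
    fix z assume "z \<in> \<Union>?F" then show "z \<in> {x. \<exists>\<gamma>. Q x \<gamma>}" using mx by blast
  next
    fix z assume "z \<in> {x. \<exists>\<gamma>. Q x \<gamma>}"
    then obtain \<gamma> where g: "Q z \<gamma>" by blast
    define S where "S = {\<delta>. \<gamma> \<le> \<delta> \<and> Q z \<delta>}"
    have fin: "finite S" by (rule finite_subset[of _ "{\<gamma>..G}"]) (use bdd in \<open>auto simp: S_def\<close>)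
    have gS: "\<gamma> \<in> S" using g by (simp add: S_def)
    then have MS: "Max S \<in> S" using fin Max_in by blast
    have "\<not> Q z \<delta>" if "Max S < \<delta>" for \<delta>
    proof
      assume "Q z \<delta>"
      moreover have "\<gamma> \<le> \<delta>" using that Max_ge[OF fin gS] by simp
      ultimately have "\<delta> \<in> S" by (simp add: S_def)
      then show False using Max_ge[OF fin] that by fastforce
    qed
    then show "z \<in> \<Union>?F" using MS ball_self[of z "Max S"] unfolding S_def by blast
  qed
  show "\<And>B. B \<in> ?F \<Longrightarrow> \<exists>x \<gamma>. B = ball x \<gamma> \<and> Q x \<gamma> \<and> (\<forall>\<delta>>\<gamma>. \<not> Q x \<delta>)" by blast
qed

text \<open>The maximal function of an arbitrary set function \<open>c\<close>, cut to levels
  between \<open>- N\<close> and \<open>N\<close>. It is constant on balls of level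
  \<open>- N\<close>, hence measurable whatever \<open>c\<close> is, and as a finite maximum it is
  real valued and attained.\<close>

definition mx :: "nat \<Rightarrow> ('a set \<Rightarrow> real) \<Rightarrow> 'a \<Rightarrow> real" where
  "mx N c x = Max ((\<lambda>\<gamma>. c (ball x \<gamma>)) ` {- int N .. int N})"

lemma mx_ge: "\<gamma> \<in> {- int N .. int N} \<Longrightarrow> c (ball x \<gamma>) \<le> mx N c x"
  unfolding mx_def by (intro Max_ge) auto

lemma mx_le_iff: "mx N c x \<le> l \<longleftrightarrow> (\<forall>\<gamma>\<in>{- int N .. int N}. c (ball x \<gamma>) \<le> l)"
  unfolding mx_def by (subst Max_le_iff) auto

lemma mx_gr_iff: "l < mx N c x \<longleftrightarrow> (\<exists>\<gamma>\<in>{- int N .. int N}. l < c (ball x \<gamma>))"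
  unfolding mx_def by (subst Max_gr_iff) auto

lemma mx_attained: obtains \<gamma> where "\<gamma> \<in> {- int N .. int N}" "mx N c x = c (ball x \<gamma>)"
proof -
  have "mx N c x \<in> (\<lambda>\<gamma>. c (ball x \<gamma>)) ` {- int N .. int N}" unfolding mx_def by (rule Max_in) auto
  then show ?thesis using that by blast
qed

lemma mx_nonneg: "(\<And>B. 0 \<le> c B) \<Longrightarrow> 0 \<le> mx N c x"
  by (rule mx_attained[of N c x]) auto

lemma mx_incseq: "N \<le> K \<Longrightarrow> mx N c x \<le> mx K c x"
  by (auto simp: mx_le_iff intro!: mx_ge)

lemma mx_local: "y \<in> ball x (- int N) \<Longrightarrow> mx N c y = mx N c x"
  unfolding mx_def by (intro arg_cong[where f = Max] image_cong refl arg_cong[where f = c] ball_up[of _ _ "- int N"]) auto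

end

section \<open>Measures on a ball tree and the maximal theorem\<close>

definition avg :: "'a measure \<Rightarrow> ('a \<Rightarrow> real) \<Rightarrow> 'a set \<Rightarrow> real" where
  "avg M f B = (LINT y:B|M. f y) / measure M B"

text \<open>Kept general enough that weighted densities of a given measure are again instances:
  balls only have to be of finite measure.\<close>

locale ball_measure = ball_tree ball for ball :: "'a \<Rightarrow> int \<Rightarrow> 'a set" +
  fixes M :: "'a measure"
  assumes sets_M: "sets M = sigma_sets UNIV (range (\<lambda>(x, \<gamma>). ball x \<gamma>))"
    and finite_ball: "emeasure M (ball x \<gamma>) < \<infinity>"
begin

lemma ball_in_sets [measurable, simp]: "ball x \<gamma> \<in> sets M"
  unfolding sets_M by (rule sigma_sets.Basic) auto

lemma space_M [simp]: "space M = UNIV"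
proof -
  have "UNIV \<in> sets M" unfolding sets_M by (rule sigma_sets_top)
  then show ?thesis using sets.sets_into_space by blast
qed

text \<open>An open set is the union of the balls inside it, and there are only countably many balls
  at all.\<close>

lemma ball_open_sets: assumes "ball_open U" shows "U \<in> sets M"
proof -
  let ?F = "{B \<in> range (\<lambda>(x, \<gamma>). ball x \<gamma>). B \<subseteq> U}"
  have "countable ?F" by (rule countable_subset[OF _ countable_balls]) blast
  moreover have "U = \<Union>?F"
  proof (intro set_eqI iffI)
    fix x assume "x \<in> U"
    then obtain \<gamma> where "ball x \<gamma> \<subseteq> U" using assms unfolding ball_open_def by blast
    then have "ball x \<gamma> \<in> ?F" by (auto intro!: image_eqI[of _ _ "(x, \<gamma>)"])
    then show "x \<in> \<Union>?F" by (rule UnionI) (rule ball_self)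
  qed auto
  moreover have "?F \<subseteq> sets M" by auto
  ultimately show ?thesis using sets.countable_Union[of ?F M] by simp
qed

lemma measurable_locally_constant:
  fixes f :: "'a \<Rightarrow> 'b::topological_space"
  assumes "\<And>x y. y \<in> ball x \<gamma> \<Longrightarrow> f y = f x"
  shows "f \<in> borel_measurable M"
proof (rule measurableI)
  fix A :: "'b set" 
  have "ball_open (f -` A)" unfolding ball_open_def using assms by blast
  then show "f -` A \<inter> space M \<in> sets M" using ball_open_sets by simp
qed simp

lemma measurable_ball_fun [measurable]: "(\<lambda>x. c (ball x \<gamma>)) \<in> borel_measurable M"
  by (rule measurable_locally_constant[of \<gamma>]) (simp add: ball_eq)

lemma measurable_mx [measurable]: "mx N c \<in> borel_measurable M"
  by (rule measurable_locally_constant[of "- int N"]) (rule mx_local)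

lemma sigma_finite: "sigma_finite_measure M"
proof
  show "\<exists>A. countable A \<and> A \<subseteq> sets M \<and> \<Union>A = space M \<and> (\<forall>a\<in>A. emeasure M a \<noteq> \<infinity>)"
  proof (intro exI conjI)
    show "countable (range (\<lambda>(x, \<gamma>). ball x \<gamma>))" by (rule countable_balls)
    show "\<Union>(range (\<lambda>(x, \<gamma>). ball x \<gamma>)) = space M" using ball_self by auto
    show "\<forall>a\<in>range (\<lambda>(x, \<gamma>). ball x \<gamma>). emeasure M a \<noteq> \<infinity>"
      using finite_ball by (auto simp: less_top)
  qed auto
qed

end

sublocale ball_measure \<subseteq> sigma_finite_measure M by (rule sigma_finite)

context ball_measure
begin

lemma AE_from_balls:
  assumes "\<And>x \<gamma>. AE y in M. y \<in> ball x \<gamma> \<longrightarrow> P y"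
  shows "AE y in M. P y"
proof -
  have "AE y in M. \<forall>B\<in>range (\<lambda>(x, \<gamma>). ball x \<gamma>). y \<in> B \<longrightarrow> P y"
    by (subst AE_ball_countable[OF countable_balls]) (use assms in auto)
  then show ?thesis by eventually_elim (use ball_self in fastforce)
qed

lemma emeasure_ball: "emeasure M (ball x \<gamma>) = ennreal (measure M (ball x \<gamma>))"
  using finite_ball[of x \<gamma>] by (intro emeasure_eq_ennreal_measure) (simp add: less_top)

text \<open>The integral over the union is a sum over a countable disjoint family, written as an
  integral for the counting measure.\<close>

lemma nn_integral_Union_mono:
  assumes F: "F \<subseteq> range (\<lambda>(x, \<gamma>). ball x \<gamma>)" "disjoint F"
    and [measurable]: "g \<in> borel_measurable M" "h \<in> borel_measurable M"
    and le: "\<And>B. B \<in> F \<Longrightarrow> (\<integral>\<^sup>+ x. g x * indicator B x \<partial>M) \<le> (\<integral>\<^sup>+ x. h x * indicator B x \<partial>M)"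
  shows "(\<integral>\<^sup>+ x. g x * indicator (\<Union>F) x \<partial>M) \<le> (\<integral>\<^sup>+ x. h x * indicator (\<Union>F) x \<partial>M)"
proof -
  have cF: "countable F" by (rule countable_subset[OF F(1) countable_balls])
  have sF: "F \<subseteq> sets M" using F(1) by auto
  have UF: "\<Union>F \<in> sets M" using cF sF sets.countable_Union by blast
  have dj: "disjoint_family_on (\<lambda>B. B) F" using F(2) by (auto simp: disjoint_family_on_def disjoint_def)
  have e: "(\<integral>\<^sup>+ x. k x * indicator (\<Union>F) x \<partial>M) = (\<integral>\<^sup>+ B. (\<integral>\<^sup>+ x. k x * indicator B x \<partial>M) \<partial>count_space F)"
    if [measurable]: "k \<in> borel_measurable M" for k
  proof -
    have "(\<integral>\<^sup>+ x. k x * indicator (\<Union>F) x \<partial>M) = emeasure (density M k) (\<Union>B\<in>F. B)"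
      using UF by (simp add: emeasure_density)
    also have "\<dots> = (\<integral>\<^sup>+ B. emeasure (density M k) B \<partial>count_space F)"
      by (rule emeasure_UN_countable) (use sF cF dj in auto)
    also have "\<dots> = (\<integral>\<^sup>+ B. (\<integral>\<^sup>+ x. k x * indicator B x \<partial>M) \<partial>count_space F)"
      using sF by (intro nn_integral_cong) (auto simp: emeasure_density)
    finally show ?thesis .
  qed
  show ?thesis by (subst (1 2) e) (auto intro!: nn_integral_mono le)
qed

text \<open>Turns an inequality on single stopping balls into one on their union, and so does the
  work of a covering lemma. Only balls that are maximal for \<open>Q\<close> have to be
  tested.\<close>

lemma stopping_compare:
  assumes inv: "\<And>x y \<gamma>. y \<in> ball x \<gamma> \<Longrightarrow> Q y \<gamma> = Q x \<gamma>"
    and bdd: "\<And>x \<gamma>. Q x \<gamma> \<Longrightarrow> \<gamma> \<le> G"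
    and meas: "g \<in> borel_measurable M" "h \<in> borel_measurable M"
    and le: "\<And>x \<gamma>. Q x \<gamma> \<Longrightarrow> \<forall>\<delta>>\<gamma>. \<not> Q x \<delta> \<Longrightarrow>
      (\<integral>\<^sup>+ y. g y * indicator (ball x \<gamma>) y \<partial>M) \<le> (\<integral>\<^sup>+ y. h y * indicator (ball x \<gamma>) y \<partial>M)"
  shows "(\<integral>\<^sup>+ x. g x * indicator {x. \<exists>\<gamma>. Q x \<gamma>} x \<partial>M) \<le> (\<integral>\<^sup>+ x. h x * indicator {x. \<exists>\<gamma>. Q x \<gamma>} x \<partial>M)"
proof (rule stopping_balls[of Q G])
  fix F assume F: "F \<subseteq> range (\<lambda>(x, \<gamma>). ball x \<gamma>)" "disjoint F" "\<Union>F = {x. \<exists>\<gamma>. Q x \<gamma>}"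
    "\<And>B. B \<in> F \<Longrightarrow> \<exists>x \<gamma>. B = ball x \<gamma> \<and> Q x \<gamma> \<and> (\<forall>\<delta>>\<gamma>. \<not> Q x \<delta>)"
  show ?thesis unfolding F(3)[symmetric]
  proof (rule nn_integral_Union_mono[OF F(1,2) meas])
    fix B assume "B \<in> F"
    then show "(\<integral>\<^sup>+ x. g x * indicator B x \<partial>M) \<le> (\<integral>\<^sup>+ x. h x * indicator B x \<partial>M)"
      using F(4) le by blast
  qed
qed (use inv bdd in blast)+

lemma nn_integral_ball_eq:
  assumes "set_integrable M B f" "\<And>x. 0 \<le> f x" 
  shows "(\<integral>\<^sup>+ x. ennreal (f x) * indicator B x \<partial>M) = ennreal (LINT x:B|M. f x)"
proof -
  have "(\<integral>\<^sup>+ x. ennreal (f x) * indicator B x \<partial>M) = (\<integral>\<^sup>+ x. ennreal (indicator B x *\<^sub>R f x) \<partial>M)"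
    by (intro nn_integral_cong) (auto simp: indicator_def)
  also have "\<dots> = ennreal (LINT x:B|M. f x)"
    unfolding set_lebesgue_integral_def
    by (rule nn_integral_eq_integral) (use assms in \<open>auto simp: set_integrable_def\<close>)
  finally show ?thesis .
qed

text \<open>A non-integrable function has Bochner integral 0 by convention, and division by measure
  0 gives 0; so a nonzero average certifies both integrability and positive measure. Case
  distinctions on a zero average rest on this.\<close>

lemma avg_integrable:
  assumes "avg M f B \<noteq> 0" shows "set_integrable M B f"
proof (rule ccontr)
  assume "\<not> set_integrable M B f"
  then have "(LINT x:B|M. f x) = 0"
    unfolding set_lebesgue_integral_def set_integrable_def by (rule not_integrable_integral_eq)
  then show False using assms by (simp add: avg_def)
qed

lemma avg_nonneg: "(\<And>x. 0 \<le> f x) \<Longrightarrow> 0 \<le> avg M f B"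
  unfolding avg_def set_lebesgue_integral_def by (intro divide_nonneg_nonneg integral_nonneg) auto

lemma nn_integral_ball_avg:
  assumes "set_integrable M (ball x \<gamma>) f" "\<And>x. 0 \<le> f x" "0 < measure M (ball x \<gamma>)"
  shows "(\<integral>\<^sup>+ y. ennreal (f y) * indicator (ball x \<gamma>) y \<partial>M) = ennreal (avg M f (ball x \<gamma>) * measure M (ball x \<gamma>))"
  using assms by (subst nn_integral_ball_eq) (auto simp: avg_def)

text \<open>On a maximal ball with average above \<open>l\<close> the inequality is immediate, and
  these balls partition the level set. This gives the constant 1, with \<open>f\<close> integrated
  over the level set only. The bound \<open>G\<close> guarantees that maximal balls exist.\<close>

lemma weak_type:
  assumes [measurable]: "f \<in> borel_measurable M" and nn: "\<And>x. 0 \<le> f x"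
    and \<Gamma>: "\<And>\<gamma>. \<gamma> \<in> \<Gamma> \<Longrightarrow> \<gamma> \<le> G" and l: "0 < l"
  shows "ennreal l * (\<integral>\<^sup>+ x. indicator {x. \<exists>\<gamma>\<in>\<Gamma>. l < avg M f (ball x \<gamma>)} x \<partial>M)
    \<le> (\<integral>\<^sup>+ x. ennreal (f x) * indicator {x. \<exists>\<gamma>\<in>\<Gamma>. l < avg M f (ball x \<gamma>)} x \<partial>M)"
proof -
  let ?Q = "\<lambda>x \<gamma>. \<gamma> \<in> \<Gamma> \<and> l < avg M f (ball x \<gamma>)"
  let ?E = "{x. \<exists>\<gamma>. ?Q x \<gamma>}"
  have eq: "{x. \<exists>\<gamma>\<in>\<Gamma>. l < avg M f (ball x \<gamma>)} = ?E" by blast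
  have "ball_open ?E" unfolding ball_open_def
  proof
    fix x assume "x \<in> ?E"
    then obtain \<gamma> where "?Q x \<gamma>" by blast
    then have "ball x \<gamma> \<subseteq> ?E" using ball_eq[of _ x \<gamma>] by auto
    then show "\<exists>\<gamma>. ball x \<gamma> \<subseteq> ?E" by blast
  qed
  then have [measurable]: "?E \<in> sets M" by (rule ball_open_sets)
  have "ennreal l * (\<integral>\<^sup>+ x. indicator ?E x \<partial>M) = (\<integral>\<^sup>+ x. ennreal l * indicator ?E x \<partial>M)"
    by (rule nn_integral_cmult[symmetric]) measurable
  also have "\<dots> \<le> (\<integral>\<^sup>+ x. ennreal (f x) * indicator ?E x \<partial>M)"
  proof (rule stopping_compare[of ?Q G])
    fix x \<gamma> assume "?Q x \<gamma>"
    then have a: "l < avg M f (ball x \<gamma>)" by simp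
    then have int: "set_integrable M (ball x \<gamma>) f" using l avg_integrable[of f "ball x \<gamma>"] by auto
    have m: "measure M (ball x \<gamma>) > 0" using a l by (auto simp: avg_def zero_less_measure_iff intro!: ccontr[of "0 < measure M (ball x \<gamma>)"])
    have "(\<integral>\<^sup>+ y. ennreal l * indicator (ball x \<gamma>) y \<partial>M) = ennreal (l * measure M (ball x \<gamma>))"
      using l by (simp add: nn_integral_cmult_indicator emeasure_ball ennreal_mult)
    also have "\<dots> \<le> ennreal (avg M f (ball x \<gamma>) * measure M (ball x \<gamma>))"
      using a m by (intro ennreal_leI mult_right_mono) auto
    finally show "(\<integral>\<^sup>+ y. ennreal l * indicator (ball x \<gamma>) y \<partial>M) \<le> (\<integral>\<^sup>+ y. ennreal (f y) * indicator (ball x \<gamma>) y \<partial>M)"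
      using nn_integral_ball_avg[OF int nn m] by simp
  qed (use ball_eq \<Gamma> in auto)
  finally show ?thesis unfolding eq .
qed

theorem maximal_strong_type:
  assumes [measurable]: "f \<in> borel_measurable M" and nn: "\<And>x. 0 \<le> f x" and p: "1 < p"
  shows "(\<integral>\<^sup>+ x. ennreal (mx N (avg M f) x powr p) \<partial>M)
    \<le> ennreal (p * 2 powr p / (p - 1)) * (\<integral>\<^sup>+ x. ennreal (f x powr p) \<partial>M)"
proof (rule strong_type_from_weak_type)
  fix l :: real assume l: "0 < l"
  \<comment> \<open>The part of \<open>f\<close> below \<open>l/2\<close> adds at most
    \<open>l/2\<close> to any average, so the level set at height \<open>l\<close> lies in that of
    \<open>f1\<close> at height \<open>l/2\<close>.\<close>
  define f1 where "f1 = (\<lambda>x. f x * indicator {x. l < 2 * f x} x)"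
  have [measurable]: "f1 \<in> borel_measurable M" unfolding f1_def by measurable
  have f1nn: "0 \<le> f1 x" for x using nn by (simp add: f1_def)
  let ?E = "{x. \<exists>\<gamma>\<in>{- int N..int N}. l / 2 < avg M f1 (ball x \<gamma>)}"
  have sub: "{x. l < mx N (avg M f) x} \<subseteq> ?E"
  proof
    fix x assume "x \<in> {x. l < mx N (avg M f) x}"
    then obtain \<gamma> where g: "\<gamma> \<in> {- int N..int N}" "l < avg M f (ball x \<gamma>)" by (auto simp: mx_gr_iff)
    let ?B = "ball x \<gamma>"
    have int: "set_integrable M ?B f" using l g(2) avg_integrable[of f ?B] by auto
    have m: "measure M ?B > 0" using g l by (auto simp: avg_def zero_less_measure_iff intro!: ccontr[of "0 < measure M ?B"])
    have int1: "set_integrable M ?B f1"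
      by (rule set_integrable_bound[OF int]) (auto simp: f1_def set_borel_measurable_def indicator_def nn)
    have c: "set_integrable M ?B (\<lambda>_. l / 2)"
      using finite_ball[of x \<gamma>] by (simp add: set_integrable_def integrable_mult_left_iff)
    have "(LINT y:?B|M. f y) \<le> (LINT y:?B|M. f1 y + l / 2)"
      by (rule set_integral_mono[OF int set_integral_add(1)[OF int1 c]]) (use l in \<open>auto simp: f1_def indicator_def\<close>)
    also have "\<dots> = (LINT y:?B|M. f1 y) + l / 2 * measure M ?B"
      by (subst set_integral_add(2)[OF int1 c]) (simp add: set_lebesgue_integral_def)
    finally have "avg M f ?B \<le> avg M f1 ?B + l / 2" using m by (simp add: avg_def field_simps)
    then have "l / 2 < avg M f1 ?B" using g(2) by simp
    then show "x \<in> ?E" using g(1) by blast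
  qed
  have "ennreal l * (\<integral>\<^sup>+ x. indicator {x. l < mx N (avg M f) x} x \<partial>M) \<le> ennreal l * (\<integral>\<^sup>+ x. indicator ?E x \<partial>M)"
    using sub by (intro mult_left_mono nn_integral_mono) (auto simp: indicator_def)
  also have "\<dots> = 2 * (ennreal (l / 2) * (\<integral>\<^sup>+ x. indicator ?E x \<partial>M))"
    using ennreal_mult[of 2 "l / 2"] l by (simp add: mult.assoc[symmetric])
  also have "\<dots> \<le> 2 * (\<integral>\<^sup>+ x. ennreal (f1 x) * indicator ?E x \<partial>M)"
    by (intro mult_left_mono weak_type[where G = "int N"]) (use l f1nn in auto)
  also have "\<dots> \<le> 2 * (\<integral>\<^sup>+ x. ennreal (f x) * indicator {x. l < 2 * f x} x \<partial>M)"
    by (intro mult_left_mono nn_integral_mono) (auto simp: indicator_def f1_def)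
  finally show "ennreal l * (\<integral>\<^sup>+ x. indicator {x. l < mx N (avg M f) x} x \<partial>M)
    \<le> 2 * (\<integral>\<^sup>+ x. ennreal (f x) * indicator {x. l < 2 * f x} x \<partial>M)" .
qed (use nn p mx_nonneg avg_nonneg in auto)

end

section \<open>Hoelder's inequality and limits of modulars\<close>

text \<open>Young's inequality after normalizing by the bounds \<open>a\<close> and
  \<open>b\<close>, which may exceed the integrals. A zero bound cannot be normalized and is treated
  apart.\<close>

lemma Holder_nn_integral:
  fixes f g :: "'a \<Rightarrow> real"
  assumes [measurable]: "f \<in> borel_measurable M" "g \<in> borel_measurable M"
    and nn: "\<And>x. 0 \<le> f x" "\<And>x. 0 \<le> g x"
    and pq: "1 < p" "1 < q" "1 / p + 1 / q = 1" and ab: "0 \<le> a" "0 \<le> b"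
    and fa: "(\<integral>\<^sup>+ x. ennreal (f x powr p) \<partial>M) \<le> ennreal a"
    and gb: "(\<integral>\<^sup>+ x. ennreal (g x powr q) \<partial>M) \<le> ennreal b"
  shows "(\<integral>\<^sup>+ x. ennreal (f x * g x) \<partial>M) \<le> ennreal (a powr (1 / p) * b powr (1 / q))"
proof (cases "a = 0 \<or> b = 0")
  case True
  have "AE x in M. f x * g x = 0"
    using True
  proof
    assume "a = 0"
    then have "(\<integral>\<^sup>+ x. ennreal (f x powr p) \<partial>M) = 0" using fa by simp
    then have "AE x in M. ennreal (f x powr p) = 0" by (subst (asm) nn_integral_0_iff_AE) auto
    then show ?thesis by eventually_elim (auto simp: ennreal_eq_0_iff powr_def split: if_splits)
  next
    assume "b = 0"
    then have "(\<integral>\<^sup>+ x. ennreal (g x powr q) \<partial>M) = 0" using gb by simp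
    then have "AE x in M. ennreal (g x powr q) = 0" by (subst (asm) nn_integral_0_iff_AE) auto
    then show ?thesis by eventually_elim (auto simp: ennreal_eq_0_iff powr_def split: if_splits)
  qed
  then have "(\<integral>\<^sup>+ x. ennreal (f x * g x) \<partial>M) = (\<integral>\<^sup>+ x. 0 \<partial>M)"
    by (intro nn_integral_cong_AE) auto
  then show ?thesis by simp
next
  case False
  then have pos: "0 < a" "0 < b" using ab by auto
  define A where "A = a powr (1 / p)"
  define B where "B = b powr (1 / q)"
  have AB: "0 < A" "0 < B" "A powr p = a" "B powr q = b"
    using pos pq by (auto simp: A_def B_def powr_powr)
  have pw: "f x * g x \<le> A * B * (f x powr p / (p * a) + g x powr q / (q * b))" for x
  proof -
    have "(f x / A) * (g x / B) \<le> (f x / A) powr p / p + (g x / B) powr q / q"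
      by (rule Youngs_inequality) (use pq nn AB in auto)
    also have "\<dots> = f x powr p / (p * a) + g x powr q / (q * b)"
      using AB nn by (simp add: powr_divide mult_ac)
    finally have "A * B * ((f x / A) * (g x / B)) \<le> A * B * (f x powr p / (p * a) + g x powr q / (q * b))"
      using AB by (intro mult_left_mono) auto
    then show ?thesis using AB by simp
  qed
  have "(\<integral>\<^sup>+ x. ennreal (f x * g x) \<partial>M)
      \<le> (\<integral>\<^sup>+ x. ennreal (A * B / (p * a)) * ennreal (f x powr p) + ennreal (A * B / (q * b)) * ennreal (g x powr q) \<partial>M)"
  proof (rule nn_integral_mono)
    fix x
    have "f x * g x \<le> A * B / (p * a) * f x powr p + A * B / (q * b) * g x powr q"
      using pw[of x] by (simp add: algebra_simps)
    then show "ennreal (f x * g x) \<le> ennreal (A * B / (p * a)) * ennreal (f x powr p) + ennreal (A * B / (q * b)) * ennreal (g x powr q)"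
      using AB pos pq by (subst (1 2) ennreal_mult[symmetric]) (auto simp: ennreal_plus[symmetric] simp del: ennreal_plus intro!: ennreal_leI)
  qed
  also have "\<dots> = ennreal (A * B / (p * a)) * (\<integral>\<^sup>+ x. ennreal (f x powr p) \<partial>M)
      + ennreal (A * B / (q * b)) * (\<integral>\<^sup>+ x. ennreal (g x powr q) \<partial>M)"
    by (subst nn_integral_add) (auto simp: nn_integral_cmult)
  also have "\<dots> \<le> ennreal (A * B / (p * a)) * ennreal a + ennreal (A * B / (q * b)) * ennreal b"
    by (intro add_mono mult_left_mono fa gb) auto
  also have "\<dots> = ennreal (A * B / p + A * B / q)"
    using AB pos pq by (simp add: ennreal_mult[symmetric] ennreal_plus[symmetric] del: ennreal_plus)
  also have "A * B / p + A * B / q = A * B * (1 / p + 1 / q)" by (simp add: field_simps)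
  finally show ?thesis using pq(3) by (simp add: A_def B_def)
qed

text \<open>Monotone convergence for modulars. \<open>G\<close> is described by its upper bounds
  instead of as a limit, so that it may be the commutator, whose truncations are not monotone; where
  the \<open>F N x\<close> are unbounded the condition says nothing and the supremum is infinite
  anyway.\<close>

lemma modular_limit:
  fixes F :: "nat \<Rightarrow> 'a \<Rightarrow> real"
  assumes [measurable]: "\<And>N. F N \<in> borel_measurable M" "P \<in> borel_measurable M"
    and P: "AE x in M. 0 < P x"
    and nn: "\<And>N x. 0 \<le> F N x" and inc: "\<And>N x. F N x \<le> F (Suc N) x"
    and C: "\<And>N. (\<integral>\<^sup>+ x. ennreal (F N x powr P x) \<partial>M) \<le> C"
    and G: "AE x in M. 0 \<le> G x \<and> (\<forall>K\<ge>0. (\<forall>N. F N x \<le> K) \<longrightarrow> G x \<le> K)"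
  shows "(\<integral>\<^sup>+ x. ennreal (G x powr P x) \<partial>M) \<le> C"
proof -
  have inc': "AE x in M. \<forall>N. ennreal (F N x powr P x) \<le> ennreal (F (Suc N) x powr P x)"
    using P by eventually_elim (auto intro!: ennreal_leI powr_mono2 inc nn)
  have "(\<integral>\<^sup>+ x. ennreal (G x powr P x) \<partial>M) \<le> (\<integral>\<^sup>+ x. (SUP N. ennreal (F N x powr P x)) \<partial>M)"
  proof (rule nn_integral_mono_AE)
    show "AE x in M. ennreal (G x powr P x) \<le> (SUP N. ennreal (F N x powr P x))"
      using P G
    proof eventually_elim
      case (elim x)
      show ?case
      proof (cases "(SUP N. ennreal (F N x powr P x))")
        case (real s)
        have "F N x \<le> s powr (1 / P x)" for N
        proof -
          have "ennreal (F N x powr P x) \<le> ennreal s" unfolding real(2)[symmetric] by (rule SUP_upper) simp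
          then have "F N x powr P x \<le> s" using real(1) by simp
          then have "(F N x powr P x) powr (1 / P x) \<le> s powr (1 / P x)" using elim by (intro powr_mono2) auto
          then show ?thesis using elim nn[of N x] by (simp add: powr_powr)
        qed
        then have "G x \<le> s powr (1 / P x)" using elim by auto
        then have "G x powr P x \<le> (s powr (1 / P x)) powr P x" using elim by (intro powr_mono2) auto
        also have "\<dots> = s" using elim real by (simp add: powr_powr)
        finally show ?thesis unfolding real(2) by (rule ennreal_leI)
      next
        case top
        show ?thesis unfolding top by simp
      qed
    qed
  qed
  also have "\<dots> = (SUP N. (\<integral>\<^sup>+ x. ennreal (F N x powr P x) \<partial>M))"
    by (rule nn_integral_monotone_convergence_SUP_AE) (use inc' in auto)
  also have "\<dots> \<le> C" by (intro SUP_least C)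
  finally show ?thesis .
qed

text \<open>A finite integral of the supremum forces the supremum to be finite almost everywhere.
  This is where finiteness of the global maximal functions comes from.\<close>

lemma modular_limit_bounded:
  fixes F :: "nat \<Rightarrow> 'a \<Rightarrow> real"
  assumes [measurable]: "\<And>N. F N \<in> borel_measurable M" "P \<in> borel_measurable M"
    and P: "AE x in M. 0 < P x"
    and nn: "\<And>N x. 0 \<le> F N x" and inc: "\<And>N x. F N x \<le> F (Suc N) x"
    and C: "\<And>N. (\<integral>\<^sup>+ x. ennreal (F N x powr P x) \<partial>M) \<le> C" "C < \<infinity>"
  shows "AE x in M. \<exists>K\<ge>0. \<forall>N. F N x \<le> K"
proof -
  have inc': "AE x in M. \<forall>N. ennreal (F N x powr P x) \<le> ennreal (F (Suc N) x powr P x)"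
    using P by eventually_elim (auto intro!: ennreal_leI powr_mono2 inc nn)
  have "(\<integral>\<^sup>+ x. (SUP N. ennreal (F N x powr P x)) \<partial>M) = (SUP N. (\<integral>\<^sup>+ x. ennreal (F N x powr P x) \<partial>M))"
    by (rule nn_integral_monotone_convergence_SUP_AE) (use inc' in auto)
  also have "\<dots> \<le> C" by (intro SUP_least C)
  finally have "(\<integral>\<^sup>+ x. (SUP N. ennreal (F N x powr P x)) \<partial>M) \<noteq> \<infinity>" using C(2) by (auto simp: less_top[symmetric] top_unique)
  then have "AE x in M. (SUP N. ennreal (F N x powr P x)) \<noteq> \<infinity>" by (intro nn_integral_noteq_infinite) auto
  then show ?thesis using P
  proof eventually_elim
    case (elim x)
    then obtain s where s: "0 \<le> s" "(SUP N. ennreal (F N x powr P x)) = ennreal s"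
      by (cases "(SUP N. ennreal (F N x powr P x))") auto
    have "F N x \<le> s powr (1 / P x)" for N
    proof -
      have "ennreal (F N x powr P x) \<le> ennreal s" unfolding s(2)[symmetric] by (rule SUP_upper) simp
      then have "F N x powr P x \<le> s" using s(1) by simp
      then have "(F N x powr P x) powr (1 / P x) \<le> s powr (1 / P x)" using elim by (intro powr_mono2) auto
      then show ?thesis using elim nn[of N x] by (simp add: powr_powr)
    qed
    then show ?case by (intro exI[of _ "s powr (1 / P x)"]) auto
  qed
qed

section \<open>Regularity and differentiation\<close>

context ball_measure
begin

text \<open>Outer regularity, stated for \<open>A\<close> and its complement together: the symmetric
  form is closed under complements, so induction over the generated sigma algebra goes
  through.\<close>

lemma regular_cover:
  assumes "finite_measure \<rho>" and s\<rho>: "sets \<rho> = sets M" and A: "A \<in> sets M" and "0 < \<epsilon>"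
  shows "\<exists>U V. ball_open U \<and> ball_open V \<and> A \<subseteq> U \<and> - A \<subseteq> V \<and> measure \<rho> (U \<inter> V) < \<epsilon>"
proof -
  interpret r: finite_measure \<rho> by fact
  have mo: "ball_open U \<Longrightarrow> U \<in> sets \<rho>" for U using ball_open_sets s\<rho> by simp
  have "A \<in> sigma_sets UNIV (range (\<lambda>(x, \<gamma>). ball x \<gamma>))" using A sets_M by simp
  then show ?thesis using \<open>0 < \<epsilon>\<close>
  proof (induction arbitrary: \<epsilon> rule: sigma_sets.induct)
    case (Basic a)
    then obtain x \<gamma> where a: "a = ball x \<gamma>" by auto
    have "a \<inter> - a = {}" by auto
    then show ?case unfolding a using Basic(2) ball_open_ball ball_open_Compl_ball
      by (intro exI[of _ "ball x \<gamma>"] exI[of _ "- ball x \<gamma>"]) auto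
  next
    case Empty
    then show ?case by (intro exI[of _ "{}"] exI[of _ UNIV]) (auto simp: ball_open_def)
  next
    case (Compl a)
    from Compl(2)[OF Compl(3)] obtain U V where
      "ball_open U \<and> ball_open V \<and> a \<subseteq> U \<and> - a \<subseteq> V \<and> measure \<rho> (U \<inter> V) < \<epsilon>" by blast
    then show ?case by (intro exI[of _ V] exI[of _ U]) (auto simp: Int_commute)
  next
    case (Union a)
    \<comment> \<open>The tolerances sum to at most \<open>\<epsilon> / 2\<close>. The other half
      pays for cutting the union of the \<open>U i\<close> at a finite \<open>n\<close>, since only
      finitely many of the \<open>V i\<close> can be intersected without losing openness.\<close>
    have "\<forall>i. \<exists>U V. ball_open U \<and> ball_open V \<and> a i \<subseteq> U \<and> - a i \<subseteq> V \<and> measure \<rho> (U \<inter> V) < \<epsilon> / 2 ^ (i + 2)"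
      using Union(2,3) by simp
    then obtain U V where UV: "\<And>i::nat. ball_open (U i)" "\<And>i. ball_open (V i)" "\<And>i. a i \<subseteq> U i"
      "\<And>i. - a i \<subseteq> V i" "\<And>i. measure \<rho> (U i \<inter> V i) < \<epsilon> / 2 ^ (i + 2)" by metis
    define W where "W n = (\<Union>i\<le>n. U i)" for n
    have oW: "ball_open (W n)" for n unfolding W_def by (intro ball_open_UN UV)
    have oU: "ball_open (\<Union>i. U i)" by (intro ball_open_UN UV)
    have "(\<lambda>n. measure \<rho> (W n)) \<longlonglongrightarrow> measure \<rho> (\<Union>n. W n)"
      proof (rule r.finite_Lim_measure_incseq)
      show "incseq W" unfolding incseq_def W_def by (intro allI impI UN_mono) auto
    qed (use mo oW in auto)
    moreover have "(\<Union>n. W n) = (\<Union>i. U i)" by (auto simp: W_def)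
    ultimately have "\<forall>\<^sub>F n in sequentially. measure \<rho> (\<Union>i. U i) - \<epsilon> / 2 < measure \<rho> (W n)"
      using Union(3) by (auto intro!: order_tendstoD)
    then obtain n where n: "measure \<rho> (\<Union>i. U i) - \<epsilon> / 2 < measure \<rho> (W n)"
      by (auto simp: eventually_sequentially)
    define V' where "V' = (\<Inter>i\<le>n. V i)"
    have oV: "ball_open V'" unfolding V'_def by (intro ball_open_INT UV) auto
    have sub: "(\<Union>i. U i) \<inter> V' \<subseteq> ((\<Union>i. U i) - W n) \<union> (\<Union>i\<le>n. U i \<inter> V i)"
      unfolding W_def V'_def by auto
    have m1: "measure \<rho> ((\<Union>i. U i) - W n) < \<epsilon> / 2"
    proof -
      have "measure \<rho> ((\<Union>i. U i) - W n) = measure \<rho> (\<Union>i. U i) - measure \<rho> (W n)"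
        by (rule r.finite_measure_Diff) (use mo[OF oU] mo[OF oW] in \<open>auto simp: W_def\<close>)
      then show ?thesis using n by simp
    qed
    have geo: "(\<Sum>i\<le>n. \<epsilon> / 2 ^ (i + 2)) \<le> \<epsilon> / 2" for n :: nat
    proof -
      have "(\<Sum>i\<le>n. \<epsilon> / 2 ^ (i + 2)) = \<epsilon> / 2 - \<epsilon> / 2 ^ (n + 2)"
        by (induction n) (auto simp: field_simps)
      then show ?thesis using Union(3) by simp
    qed
    have m2: "measure \<rho> (\<Union>i\<le>n. U i \<inter> V i) \<le> \<epsilon> / 2"
    proof -
      have "measure \<rho> (\<Union>i\<le>n. U i \<inter> V i) \<le> (\<Sum>i\<le>n. measure \<rho> (U i \<inter> V i))"
        by (rule r.finite_measure_subadditive_finite) (use mo UV in auto)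
      also have "\<dots> \<le> (\<Sum>i\<le>n. \<epsilon> / 2 ^ (i + 2))" by (intro sum_mono less_imp_le UV)
      finally show ?thesis using geo[of n] by simp
    qed
    have "measure \<rho> ((\<Union>i. U i) \<inter> V') \<le> measure \<rho> (((\<Union>i. U i) - W n) \<union> (\<Union>i\<le>n. U i \<inter> V i))"
      by (rule r.finite_measure_mono[OF sub]) (use mo UV oU oW in \<open>auto intro!: sets.Un sets.Diff sets.finite_UN\<close>)
    also have "\<dots> \<le> measure \<rho> ((\<Union>i. U i) - W n) + measure \<rho> (\<Union>i\<le>n. U i \<inter> V i)"
      by (rule measure_Un_le) (use mo UV oU oW in \<open>auto intro!: sets.Un sets.Diff sets.finite_UN\<close>)
    also have "\<dots> < \<epsilon>" using m1 m2 by simp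
    finally have fin: "measure \<rho> ((\<Union>i. U i) \<inter> V') < \<epsilon>" .
    show ?case
    proof (intro exI conjI)
      show "\<Union> (range a) \<subseteq> (\<Union>i. U i)" using UV(3) by blast
      show "- \<Union> (range a) \<subseteq> V'" using UV(4) unfolding V'_def by blast
    qed (use oU oV fin in auto)
  qed
qed

text \<open>Takes the place of Lebesgue differentiation. The set \<open>A\<close> where
  \<open>g\<close> exceeds \<open>c\<close> inside a ball is approximated from outside by an open
  \<open>W\<close>, which splits into maximal balls. So the integral of \<open>g\<close> over
  \<open>A\<close> is at most \<open>c\<close> times the measure of \<open>A\<close>, which is only
  possible if \<open>A\<close> is null.\<close>

lemma AE_le_of_ball_integrals:
  fixes g :: "'a \<Rightarrow> real"
  assumes [measurable]: "g \<in> borel_measurable M" and c: "0 \<le> c" and nn: "\<And>x. 0 \<le> g x"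
    and le: "\<And>x \<gamma>. (\<integral>\<^sup>+ y. ennreal (g y) * indicator (ball x \<gamma>) y \<partial>M) \<le> ennreal c * emeasure M (ball x \<gamma>)"
  shows "AE x in M. g x \<le> c"
proof (rule AE_from_balls)
  fix x0 \<gamma>0
  define B where "B = ball x0 \<gamma>0"
  define A where "A = {x. c < g x} \<inter> B"
  have [measurable]: "B \<in> sets M" by (simp add: B_def)
  have "{x \<in> space M. c < g x} \<in> sets M" by measurable
  then have [measurable]: "A \<in> sets M" unfolding A_def by simp
  define \<rho> where "\<rho> = density M (indicator B)"
  have \<rho>: "emeasure \<rho> X = emeasure M (B \<inter> X)" if "X \<in> sets M" for X
    using that unfolding \<rho>_def by (subst emeasure_density) (auto simp: indicator_inter_arith[symmetric])
  have fin\<rho>: "finite_measure \<rho>"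
    by (rule finite_measureI) (use \<rho>[of UNIV] finite_ball[of x0 \<gamma>0] sets.top[of M] in \<open>auto simp: \<rho>_def B_def\<close>)
  have finA: "emeasure M A < \<infinity>"
  proof -
    have "emeasure M A \<le> emeasure M B" by (rule emeasure_mono) (auto simp: A_def)
    then show ?thesis using finite_ball[of x0 \<gamma>0] by (auto simp: B_def)
  qed
  have key: "(\<integral>\<^sup>+ x. ennreal (g x) * indicator A x \<partial>M) \<le> ennreal c * emeasure M A + ennreal (c * e)" if e: "0 < e" for e
  proof -
    obtain U V where UV: "ball_open U" "ball_open V" "A \<subseteq> U" "- A \<subseteq> V" "measure \<rho> (U \<inter> V) < e"
      using regular_cover[OF fin\<rho> _ \<open>A \<in> sets M\<close> e] by (auto simp: \<rho>_def)
    define W where "W = U \<inter> B"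
    have oW: "ball_open W" unfolding W_def B_def by (intro ball_open_Int UV ball_open_ball)
    have [measurable]: "W \<in> sets M" by (rule ball_open_sets[OF oW])
    have [measurable]: "U \<in> sets M" "V \<in> sets M" using UV ball_open_sets by auto
    \<comment> \<open>The cap at level 0 makes maximal balls exist; shrinking a ball about its
      centre always achieves it.\<close>
    let ?Q = "\<lambda>x \<gamma>. \<gamma> \<le> 0 \<and> ball x \<gamma> \<subseteq> W"
    have WQ: "{x. \<exists>\<gamma>. ?Q x \<gamma>} = W"
    proof (intro set_eqI iffI)
      fix x assume "x \<in> {x. \<exists>\<gamma>. ?Q x \<gamma>}" then show "x \<in> W" using ball_self by blast
    next
      fix x assume "x \<in> W"
      then obtain \<gamma> where "ball x \<gamma> \<subseteq> W" using oW unfolding ball_open_def by blast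
      then have "?Q x (min \<gamma> 0)" using ball_mono[of "min \<gamma> 0" \<gamma> x] by auto
      then show "x \<in> {x. \<exists>\<gamma>. ?Q x \<gamma>}" by blast
    qed
    have "(\<integral>\<^sup>+ x. ennreal (g x) * indicator {x. \<exists>\<gamma>. ?Q x \<gamma>} x \<partial>M) \<le> (\<integral>\<^sup>+ x. ennreal c * indicator {x. \<exists>\<gamma>. ?Q x \<gamma>} x \<partial>M)"
    proof (rule stopping_compare[of ?Q 0])
      show "(\<integral>\<^sup>+ y. ennreal (g y) * indicator (ball x \<gamma>) y \<partial>M) \<le> (\<integral>\<^sup>+ y. ennreal c * indicator (ball x \<gamma>) y \<partial>M)" for x \<gamma>
        using le[of x \<gamma>] by (simp add: nn_integral_cmult_indicator)
    qed (use ball_eq in auto)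
    then have gW: "(\<integral>\<^sup>+ x. ennreal (g x) * indicator W x \<partial>M) \<le> ennreal c * emeasure M W"
      unfolding WQ by (simp add: nn_integral_cmult_indicator)
    have "(\<integral>\<^sup>+ x. ennreal (g x) * indicator A x \<partial>M) \<le> (\<integral>\<^sup>+ x. ennreal (g x) * indicator W x \<partial>M)"
      using UV(3) by (intro nn_integral_mono) (auto simp: indicator_def W_def A_def)
    also note gW
    also have "emeasure M W \<le> emeasure M A + ennreal e"
    proof -
      have "emeasure M W \<le> emeasure M (A \<union> (B \<inter> (U \<inter> V)))"
        using UV by (intro emeasure_mono) (auto simp: W_def)
      also have "\<dots> \<le> emeasure M A + emeasure M (B \<inter> (U \<inter> V))" by (rule emeasure_subadditive) auto
      also have "emeasure M (B \<inter> (U \<inter> V)) = emeasure \<rho> (U \<inter> V)" by (rule \<rho>[symmetric]) auto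
      also have "\<dots> = ennreal (measure \<rho> (U \<inter> V))" by (rule finite_measure.emeasure_eq_measure[OF fin\<rho>])
      also have "\<dots> \<le> ennreal e" using UV(5) by (intro ennreal_leI) auto
      finally show ?thesis by (simp add: add_left_mono)
    qed
    finally show ?thesis using c e by (simp add: distrib_left ennreal_mult mult_left_mono)
  qed
  have "(\<integral>\<^sup>+ x. ennreal (g x) * indicator A x \<partial>M) \<le> ennreal c * emeasure M A"
  proof (rule ennreal_le_epsilon)
    \<comment> \<open>The tolerance is divided by \<open>c + 1\<close> rather than by
      \<open>c\<close> so that \<open>c = 0\<close> is covered.\<close>
    fix e :: real assume e: "0 < e"
    show "(\<integral>\<^sup>+ x. ennreal (g x) * indicator A x \<partial>M) \<le> ennreal c * emeasure M A + ennreal e"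
      using key[of "e / (c + 1)"] e c by (rule_tac order_trans[OF key[of "e / (c + 1)"]]) (auto intro!: add_left_mono ennreal_leI simp: field_simps)
  qed
  also have "\<dots> = (\<integral>\<^sup>+ x. ennreal c * indicator A x \<partial>M)" by (simp add: nn_integral_cmult_indicator)
  finally have gA: "(\<integral>\<^sup>+ x. ennreal (g x) * indicator A x \<partial>M) \<le> (\<integral>\<^sup>+ x. ennreal c * indicator A x \<partial>M)" .
  have finc: "(\<integral>\<^sup>+ x. ennreal c * indicator A x \<partial>M) < \<infinity>"
    using finA by (simp add: nn_integral_cmult_indicator ennreal_mult_less_top)
  from gA finc have fing: "(\<integral>\<^sup>+ x. ennreal (g x) * indicator A x \<partial>M) < top" by simp
  have 1: "(\<integral>\<^sup>+ x. ennreal (g x) * indicator A x \<partial>M) - (\<integral>\<^sup>+ x. ennreal c * indicator A x \<partial>M) = 0"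
    using gA fing by (simp add: diff_eq_0_iff_ennreal)
  have "(\<integral>\<^sup>+ x. ennreal (g x) * indicator A x - ennreal c * indicator A x \<partial>M)
      = (\<integral>\<^sup>+ x. ennreal (g x) * indicator A x \<partial>M) - (\<integral>\<^sup>+ x. ennreal c * indicator A x \<partial>M)"
  proof (rule nn_integral_diff)
    show "(\<integral>\<^sup>+ x. ennreal c * indicator A x \<partial>M) \<noteq> \<infinity>" using finc by simp
    show "AE x in M. ennreal c * indicator A x \<le> ennreal (g x) * indicator A x"
      by (intro AE_I2) (auto simp: indicator_def A_def intro!: ennreal_leI)
  qed measurable
  then have "(\<integral>\<^sup>+ x. ennreal (g x) * indicator A x - ennreal c * indicator A x \<partial>M) = 0" using 1 by simp
  then have "AE x in M. ennreal (g x) * indicator A x - ennreal c * indicator A x = 0"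
    by (subst (asm) nn_integral_0_iff_AE) auto
  then show "AE x in M. x \<in> ball x0 \<gamma>0 \<longrightarrow> g x \<le> c"
  proof eventually_elim
    case (elim x)
    show ?case
    proof (rule impI, rule ccontr)
      assume "x \<in> ball x0 \<gamma>0" "\<not> g x \<le> c"
      then have "x \<in> A" by (simp add: A_def B_def)
      then have "ennreal (g x) \<le> ennreal c" using elim by (simp add: diff_eq_0_iff_ennreal)
      then show False using \<open>\<not> g x \<le> c\<close> c nn[of x] by simp
    qed
  qed
qed

text \<open>Hoelder against the indicator of the ball. A zero average makes the inequality trivial,
  and a nonzero one brings local integrability with it.\<close>

lemma avg_powr_le:
  fixes f :: "'a \<Rightarrow> real"
  assumes [measurable]: "f \<in> borel_measurable M" and nn: "\<And>x. 0 \<le> f x" and p: "1 < p"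
  shows "ennreal (avg M f (ball x \<gamma>) powr p * measure M (ball x \<gamma>))
    \<le> (\<integral>\<^sup>+ y. ennreal (f y powr p) * indicator (ball x \<gamma>) y \<partial>M)"
proof (cases "avg M f (ball x \<gamma>) = 0")
  case False
  let ?B = "ball x \<gamma>" let ?m = "measure M ?B" and ?I = "\<integral>\<^sup>+ y. ennreal (f y powr p) * indicator ?B y \<partial>M"
  have int: "set_integrable M ?B f" by (rule avg_integrable[OF False])
  have m: "0 < ?m" using False by (auto simp: avg_def zero_less_measure_iff)
  show ?thesis
  proof (cases ?I)
    case (real a)
    have pq: "1 < p / (p - 1)" "1 / p + 1 / (p / (p - 1)) = 1" using p by (auto simp: field_simps)
    have "(\<integral>\<^sup>+ y. ennreal ((f y * indicator ?B y) * indicator ?B y) \<partial>M) \<le> ennreal (a powr (1 / p) * ?m powr (1 / (p / (p - 1))))"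
    proof (rule Holder_nn_integral)
      have "(\<integral>\<^sup>+ y. ennreal ((f y * indicator ?B y) powr p) \<partial>M) = ?I"
        by (intro nn_integral_cong) (auto simp: indicator_def)
      then show "(\<integral>\<^sup>+ y. ennreal ((f y * indicator ?B y) powr p) \<partial>M) \<le> ennreal a" using real by simp
      have "(\<integral>\<^sup>+ y. ennreal (indicator ?B y powr (p / (p - 1))) \<partial>M) = (\<integral>\<^sup>+ y. indicator ?B y \<partial>M)"
        by (intro nn_integral_cong) (auto simp: indicator_def)
      then show "(\<integral>\<^sup>+ y. ennreal (indicator ?B y powr (p / (p - 1))) \<partial>M) \<le> ennreal ?m"
        by (simp add: emeasure_ball)
    qed (use p pq nn real in auto)
    moreover have "(\<integral>\<^sup>+ y. ennreal ((f y * indicator ?B y) * indicator ?B y) \<partial>M) = ennreal (avg M f ?B * ?m)"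
      unfolding nn_integral_ball_avg[OF int nn m, symmetric] by (intro nn_integral_cong) (auto simp: indicator_def)
    ultimately have "avg M f ?B * ?m \<le> a powr (1 / p) * ?m powr (1 - 1 / p)"
      using pq p by (simp add: ennreal_le_iff diff_divide_distrib)
    then have "(avg M f ?B * ?m) powr p \<le> (a powr (1 / p) * ?m powr (1 - 1 / p)) powr p"
      using p avg_nonneg[of f ?B] nn by (intro powr_mono2) auto
    also have "\<dots> = a * ?m powr (p - 1)"
      using p real m by (simp add: powr_mult powr_powr algebra_simps)
    finally have "avg M f ?B powr p * ?m * ?m powr (p - 1) \<le> a * ?m powr (p - 1)"
      using m avg_nonneg[of f ?B] nn by (simp add: powr_mult powr_diff)
    then have "avg M f ?B powr p * ?m \<le> a" using m by simp
    then show ?thesis unfolding real(2) by (rule ennreal_leI)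
  qed simp
qed simp

end

section \<open>Weighted inequalities\<close>

text \<open>Kolmogorov's inequality in integrated form: a distribution function of size
  \<open>min 1 (s / l)\<close> has finite moments of order \<open>\<delta> < 1\<close>. The range
  below \<open>s\<close> gives \<open>s powr \<delta>\<close>, the range above gives
  \<open>\<delta> / (1 - \<delta>)\<close> times that.\<close>

lemma nn_integral_powr_min:
  fixes s \<delta> :: real
  assumes "0 \<le> s" "0 < \<delta>" "\<delta> < 1"
  shows "(\<integral>\<^sup>+ l. ennreal (\<delta> * l powr (\<delta> - 1)) * indicator {0<..} l * ennreal (min 1 (s / l)) \<partial>lborel)
    \<le> ennreal (s powr \<delta> / (1 - \<delta>))"
proof (cases "s = 0")
  case True
  then show ?thesis by simp
next
  case False
  then have s: "0 < s" using assms by auto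
  have "(\<integral>\<^sup>+ l. ennreal (\<delta> * l powr (\<delta> - 1)) * indicator {0<..} l * ennreal (min 1 (s / l)) \<partial>lborel)
    \<le> (\<integral>\<^sup>+ l. ennreal (\<delta> * l powr (\<delta> - 1)) * indicator {0<..<s} l
        + ennreal (\<delta> * s * (indicator {s..} l * l powr (\<delta> - 2))) \<partial>lborel)"
  proof (rule nn_integral_mono)
    fix l :: real
    consider "l \<le> 0" | "0 < l" "l < s" | "s \<le> l" by linarith
    then show "ennreal (\<delta> * l powr (\<delta> - 1)) * indicator {0<..} l * ennreal (min 1 (s / l))
      \<le> ennreal (\<delta> * l powr (\<delta> - 1)) * indicator {0<..<s} l
        + ennreal (\<delta> * s * (indicator {s..} l * l powr (\<delta> - 2)))"
    proof cases
      case 3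
      then have l: "0 < l" using s by simp
      have "l powr (\<delta> - 2) = l powr (\<delta> - 1 - 1)" by simp
      also have "\<dots> = l powr (\<delta> - 1) / l" using l by (subst powr_diff) simp
      finally have "\<delta> * l powr (\<delta> - 1) * min 1 (s / l) = \<delta> * s * l powr (\<delta> - 2)"
      proof -
        assume e: "l powr (\<delta> - 2) = l powr (\<delta> - 1) / l"
        have "min 1 (s / l) = s / l" using 3 l by (auto simp: min_def divide_le_eq)
        then show ?thesis unfolding e by simp
      qed
      then show ?thesis using 3 l s assms by (simp add: ennreal_mult[symmetric] del: ennreal_mult')
    qed (auto simp: min_def intro!: mult_left_le)
  qed
  also have "\<dots> = (\<integral>\<^sup>+ l. ennreal (\<delta> * l powr (\<delta> - 1)) * indicator {0<..<s} l \<partial>lborel)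
      + (\<integral>\<^sup>+ l. ennreal (\<delta> * s * (indicator {s..} l * l powr (\<delta> - 2))) \<partial>lborel)"
    by (rule nn_integral_add) measurable
  also have "(\<integral>\<^sup>+ l. ennreal (\<delta> * l powr (\<delta> - 1)) * indicator {0<..<s} l \<partial>lborel) = ennreal (s powr \<delta>)"
    by (rule nn_integral_powr_Ioo) (use assms in auto)
  also have "(\<integral>\<^sup>+ l. ennreal (\<delta> * s * (indicator {s..} l * l powr (\<delta> - 2))) \<partial>lborel)
      = ennreal (\<delta> * s * (- (s powr (\<delta> - 2 + 1)) / (\<delta> - 2 + 1)))"
  proof (rule nn_integral_has_integral_lborel)
    have "((\<lambda>l. l powr (\<delta> - 2)) has_integral - (s powr (\<delta> - 2 + 1)) / (\<delta> - 2 + 1)) {s..}"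
      by (rule has_integral_powr_to_inf) (use assms s in auto)
    moreover have "(\<lambda>l. indicator {s..} l * l powr (\<delta> - 2)) = (\<lambda>l. if l \<in> {s..} then l powr (\<delta> - 2) else 0)"
      by (auto simp: indicator_def)
    ultimately have "((\<lambda>l. indicator {s..} l * l powr (\<delta> - 2)) has_integral - (s powr (\<delta> - 2 + 1)) / (\<delta> - 2 + 1)) UNIV"
      by (simp only: has_integral_restrict_UNIV)
    then show "((\<lambda>l. \<delta> * s * (indicator {s..} l * l powr (\<delta> - 2))) has_integral
        \<delta> * s * (- (s powr (\<delta> - 2 + 1)) / (\<delta> - 2 + 1))) UNIV"
      by (rule has_integral_mult_right)
  qed (use assms in auto)
  also have "ennreal (s powr \<delta>) + ennreal (\<delta> * s * (- (s powr (\<delta> - 2 + 1)) / (\<delta> - 2 + 1)))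
      = ennreal (s powr \<delta> + \<delta> * s * (- (s powr (\<delta> - 2 + 1)) / (\<delta> - 2 + 1)))"
    using assms by (intro ennreal_plus[symmetric] mult_nonneg_nonneg divide_nonpos_nonpos) auto
  also have "s powr \<delta> + \<delta> * s * (- (s powr (\<delta> - 2 + 1)) / (\<delta> - 2 + 1)) = s powr \<delta> / (1 - \<delta>)"
  proof -
    have "\<delta> - 2 + 1 = \<delta> - 1" by simp
    moreover have "s * s powr (\<delta> - 1) = s powr \<delta>" using s by (simp add: powr_diff)
    moreover have "- (s powr (\<delta> - 1)) / (\<delta> - 1) = s powr (\<delta> - 1) / (1 - \<delta>)"
      using assms by (simp add: divide_simps algebra_simps)
    ultimately have "s powr \<delta> + \<delta> * s * (- (s powr (\<delta> - 2 + 1)) / (\<delta> - 2 + 1)) = s powr \<delta> + \<delta> * (s powr \<delta>) / (1 - \<delta>)"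
      by (metis (no_types, lifting) mult.assoc times_divide_eq_right)
    then show ?thesis using assms by (simp add: field_simps)
  qed
  finally show ?thesis .
qed

section \<open>Spaces in which a ball of level \<gamma> has measure D to the power \<gamma>\<close>

locale ball_space = ball_measure ball M for ball :: "'a \<Rightarrow> int \<Rightarrow> 'a set" and M +
  fixes D :: real
  assumes D_gt_1: "1 < D"
    and measure_ball: "measure M (ball x \<gamma>) = D powr real_of_int \<gamma>"
begin

lemma measure_ball_pos: "0 < measure M (ball x \<gamma>)"
  using D_gt_1 by (simp add: measure_ball)

lemma emeasure_ball_powr: "emeasure M (ball x \<gamma>) = ennreal (D powr real_of_int \<gamma>)"
  by (simp add: emeasure_ball measure_ball)

lemma nn_integral_ball_pos:
  assumes [measurable]: "v \<in> borel_measurable M" and pos: "\<And>x. 0 < v x"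
  shows "0 < (\<integral>\<^sup>+ y. ennreal (v y) * indicator (ball x \<gamma>) y \<partial>M)"
proof (rule ccontr)
  assume "\<not> ?thesis"
  then have "(\<integral>\<^sup>+ y. ennreal (v y) * indicator (ball x \<gamma>) y \<partial>M) = 0" by simp
  then have "AE y in M. ennreal (v y) * indicator (ball x \<gamma>) y = 0" by (subst (asm) nn_integral_0_iff_AE) auto
  then have "AE y in M. y \<notin> ball x \<gamma>"
    by eventually_elim (use pos in \<open>auto simp: indicator_def not_le[symmetric] ennreal_eq_0_iff split: if_splits\<close>)
  then have "emeasure M (ball x \<gamma>) = 0" by (subst (asm) AE_iff_measurable[of "ball x \<gamma>"]) auto
  then show False using measure_ball_pos[of x \<gamma>] by (simp add: emeasure_ball)
qed

lemma avg_cong_ball: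
  assumes "\<And>y. y \<in> B \<Longrightarrow> f y = g y" shows "avg M f B = avg M g B"
proof -
  have "(\<lambda>x. indicator B x *\<^sub>R f x) = (\<lambda>x. indicator B x *\<^sub>R g x)" using assms by (auto simp: indicator_def)
  then show ?thesis by (simp add: avg_def set_lebesgue_integral_def)
qed

text \<open>Averages of \<open>g\<close> over balls larger than \<open>ball y \<gamma>0\<close> are
  the same for all points of that ball, hence at most \<open>m y\<close>. Above this height only the
  restriction of \<open>g\<close> to the ball counts, and the weak type bound gives the distribution
  function \<open>s / l\<close>. \<open>m\<close> is given through its relation to averages because
  the function used later is the maximal function modified on a null set.\<close>

lemma Coifman_Rochberg:
  fixes g m :: "'a \<Rightarrow> real"
  assumes [measurable]: "g \<in> borel_measurable M" "m \<in> borel_measurable M"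
    and nn: "\<And>x. 0 \<le> g x" and int: "\<And>x \<gamma>. set_integrable M (ball x \<gamma>) g"
    and \<delta>: "0 < \<delta>" "\<delta> < 1"
    and m_nn: "\<And>x. 0 \<le> m x"
    and m_le: "AE x in M. \<forall>K\<ge>0. (\<forall>\<gamma>. avg M g (ball x \<gamma>) \<le> K) \<longrightarrow> m x \<le> K"
    and y: "\<And>\<gamma>. avg M g (ball y \<gamma>) \<le> m y"
  shows "(\<integral>\<^sup>+ x. ennreal (m x powr \<delta>) * indicator (ball y \<gamma>0) x \<partial>M)
    \<le> ennreal (m y powr \<delta> / (1 - \<delta>)) * emeasure M (ball y \<gamma>0)"
proof -
  define B where "B = ball y \<gamma>0"
  define s where "s = m y"
  have s0: "0 \<le> s" by (simp add: s_def m_nn)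
  have [measurable]: "B \<in> sets M" by (simp add: B_def)
  define g1 where "g1 = (\<lambda>x. g x * indicator B x)"
  have [measurable]: "g1 \<in> borel_measurable M" unfolding g1_def by measurable
  have g1nn: "0 \<le> g1 x" for x by (simp add: g1_def nn)
  have level: "(\<integral>\<^sup>+ x. indicator B x * indicator {x. l < m x} x \<partial>M) \<le> ennreal (min 1 (s / l)) * emeasure M B"
    if l: "0 < l" for l
  proof (cases "l \<le> s")
    case True
    have "(\<integral>\<^sup>+ x. indicator B x * indicator {x. l < m x} x \<partial>M) \<le> (\<integral>\<^sup>+ x. indicator B x \<partial>M)"
      by (intro nn_integral_mono) (auto simp: indicator_def)
    then show ?thesis using True l by (simp add: min_def)
  next
    case False
    let ?E = "{x. \<exists>\<gamma>\<in>{..\<gamma>0}. l < avg M g1 (ball x \<gamma>)}"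
    have "AE x in M. x \<in> B \<longrightarrow> l < m x \<longrightarrow> x \<in> ?E"
      using m_le
    proof eventually_elim
      case (elim x)
      show ?case
      proof (intro impI, rule ccontr)
        assume x: "x \<in> B" "l < m x" "x \<notin> ?E"
        have "avg M g (ball x \<gamma>) \<le> l" for \<gamma>
        proof (cases "\<gamma> \<le> \<gamma>0")
          case True
          have "ball x \<gamma> \<subseteq> B" unfolding B_def using x(1) True ball_self[of x \<gamma>] by (intro ball_meet[of _ _ x]) (auto simp: B_def)
          then have "avg M g (ball x \<gamma>) = avg M g1 (ball x \<gamma>)" by (intro avg_cong_ball) (auto simp: g1_def)
          then show ?thesis using x(3) True by (auto simp: not_less)
        next
          case g: False
          then have "ball x \<gamma> = ball y \<gamma>" using x(1) unfolding B_def by (intro ball_up) auto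
          then show ?thesis using y[of \<gamma>] False by (simp add: s_def)
        qed
        then have "m x \<le> l" using elim l by simp
        then show False using x by simp
      qed
    qed
    then have "(\<integral>\<^sup>+ x. indicator B x * indicator {x. l < m x} x \<partial>M) \<le> (\<integral>\<^sup>+ x. indicator ?E x \<partial>M)"
      by (intro nn_integral_mono_AE) (auto simp: indicator_def)
    then have "ennreal l * (\<integral>\<^sup>+ x. indicator B x * indicator {x. l < m x} x \<partial>M) \<le> ennreal l * (\<integral>\<^sup>+ x. indicator ?E x \<partial>M)"
      by (rule mult_left_mono) simp
    also have "\<dots> \<le> (\<integral>\<^sup>+ x. ennreal (g1 x) * indicator ?E x \<partial>M)"
      by (rule weak_type[of _ _ \<gamma>0]) (use l g1nn in auto)
    also have "\<dots> \<le> (\<integral>\<^sup>+ x. ennreal (g x) * indicator (ball y \<gamma>0) x \<partial>M)"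
      by (intro nn_integral_mono) (auto simp: indicator_def g1_def B_def)
    also have "\<dots> = ennreal (avg M g (ball y \<gamma>0) * measure M (ball y \<gamma>0))"
      by (rule nn_integral_ball_avg[OF int nn measure_ball_pos])
    also have "\<dots> \<le> ennreal (s * measure M (ball y \<gamma>0))"
      using y[of \<gamma>0] by (intro ennreal_leI mult_right_mono) (auto simp: s_def)
    finally have 1: "ennreal l * (\<integral>\<^sup>+ x. indicator B x * indicator {x. l < m x} x \<partial>M) \<le> ennreal (s * measure M (ball y \<gamma>0))" .
    have "(\<integral>\<^sup>+ x. indicator B x * indicator {x. l < m x} x \<partial>M)
        = ennreal (1 / l) * (ennreal l * (\<integral>\<^sup>+ x. indicator B x * indicator {x. l < m x} x \<partial>M))"
      using l by (simp add: mult.assoc[symmetric] ennreal_mult[symmetric])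
    also have "\<dots> \<le> ennreal (1 / l) * ennreal (s * measure M (ball y \<gamma>0))"
      by (intro mult_left_mono 1) simp
    also have "\<dots> = ennreal (s / l) * emeasure M B"
      using l s0 by (simp add: B_def emeasure_ball ennreal_mult[symmetric])
    finally show ?thesis using False l by (simp add: min_def)
  qed
  have "(\<integral>\<^sup>+ x. ennreal (m x powr \<delta>) * indicator B x \<partial>M) = (\<integral>\<^sup>+ x. indicator B x * ennreal (m x powr \<delta>) \<partial>M)"
    by (simp add: mult.commute)
  also have "\<dots> = (\<integral>\<^sup>+ l. ennreal (\<delta> * l powr (\<delta> - 1)) * indicator {0<..} l *
      (\<integral>\<^sup>+ x. indicator B x * indicator {x. l < m x} x \<partial>M) \<partial>lborel)"
    by (rule layer_cake) (use m_nn \<delta> in auto)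
  also have "\<dots> \<le> (\<integral>\<^sup>+ l. ennreal (\<delta> * l powr (\<delta> - 1)) * indicator {0<..} l * ennreal (min 1 (s / l)) * emeasure M B \<partial>lborel)"
  proof (rule nn_integral_mono)
    fix l :: real
    show "ennreal (\<delta> * l powr (\<delta> - 1)) * indicator {0<..} l * (\<integral>\<^sup>+ x. indicator B x * indicator {x. l < m x} x \<partial>M)
      \<le> ennreal (\<delta> * l powr (\<delta> - 1)) * indicator {0<..} l * ennreal (min 1 (s / l)) * emeasure M B"
    proof (cases "0 < l")
      case True
      then show ?thesis using mult_left_mono[OF level[OF True], of "ennreal (\<delta> * l powr (\<delta> - 1)) * indicator {0<..} l"]
        by (simp add: mult.assoc)
    qed simp
  qed
  also have "\<dots> = (\<integral>\<^sup>+ l. ennreal (\<delta> * l powr (\<delta> - 1)) * indicator {0<..} l * ennreal (min 1 (s / l)) \<partial>lborel) * emeasure M B"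
    by (rule nn_integral_multc) measurable
  also have "\<dots> \<le> ennreal (s powr \<delta> / (1 - \<delta>)) * emeasure M B"
    by (intro mult_right_mono nn_integral_powr_min s0 \<delta>) simp
  finally show ?thesis by (simp add: B_def s_def)
qed

text \<open>Cutting \<open>f\<close> to the set where all averages are at most \<open>c\<close>
  yields a function whose ball integrals are at most \<open>c\<close> times the measure, since a
  ball meeting that set has average at most \<open>c\<close>. The differentiation argument then
  applies for each \<open>c\<close>, and rational \<open>c\<close> suffice.\<close>

lemma AE_le_maximal:
  fixes f :: "'a \<Rightarrow> real"
  assumes [measurable]: "f \<in> borel_measurable M" and nn: "\<And>x. 0 \<le> f x"
    and int: "\<And>x \<gamma>. set_integrable M (ball x \<gamma>) f"
  shows "AE x in M. \<forall>K. (\<forall>\<gamma>. avg M f (ball x \<gamma>) \<le> K) \<longrightarrow> f x \<le> K"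
proof -
  have 1: "AE x in M. (\<forall>\<gamma>. avg M f (ball x \<gamma>) \<le> c) \<longrightarrow> f x \<le> c" if c: "0 \<le> c" for c
  proof -
    let ?G = "{x. \<forall>\<gamma>. avg M f (ball x \<gamma>) \<le> c}"
    have "{x \<in> space M. \<forall>\<gamma>. avg M f (ball x \<gamma>) \<le> c} \<in> sets M" by measurable
    then have [measurable]: "?G \<in> sets M" by simp
    have "AE x in M. f x * indicator ?G x \<le> c"
    proof (rule AE_le_of_ball_integrals)
      fix x \<gamma>
      show "(\<integral>\<^sup>+ y. ennreal (f y * indicator ?G y) * indicator (ball x \<gamma>) y \<partial>M) \<le> ennreal c * emeasure M (ball x \<gamma>)"
      proof (cases "\<exists>z\<in>ball x \<gamma>. z \<in> ?G")
        case True
        then obtain z where z: "z \<in> ball x \<gamma>" "z \<in> ?G" by blast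
        from z(2) have "avg M f (ball z \<gamma>) \<le> c" by blast
        then have "avg M f (ball x \<gamma>) \<le> c" using ball_eq[OF z(1)] by simp
        have "(\<integral>\<^sup>+ y. ennreal (f y * indicator ?G y) * indicator (ball x \<gamma>) y \<partial>M)
            \<le> (\<integral>\<^sup>+ y. ennreal (f y) * indicator (ball x \<gamma>) y \<partial>M)"
          by (intro nn_integral_mono) (auto simp: indicator_def)
        also have "\<dots> = ennreal (avg M f (ball x \<gamma>) * measure M (ball x \<gamma>))"
          by (rule nn_integral_ball_avg[OF int nn measure_ball_pos])
        also have "\<dots> \<le> ennreal (c * measure M (ball x \<gamma>))"
          using \<open>avg M f (ball x \<gamma>) \<le> c\<close> by (intro ennreal_leI mult_right_mono) auto
        finally show ?thesis using c by (simp add: emeasure_ball ennreal_mult)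
      next
        case False
        then have "(\<integral>\<^sup>+ y. ennreal (f y * indicator ?G y) * indicator (ball x \<gamma>) y \<partial>M) = (\<integral>\<^sup>+ y. 0 \<partial>M)"
          by (intro nn_integral_cong) (auto simp: indicator_def)
        then show ?thesis by simp
      qed
    qed (use c nn in auto)
    then show ?thesis by eventually_elim (auto simp: indicator_def)
  qed
  have "AE x in M. \<forall>c\<in>{c \<in> \<rat>. 0 \<le> c}. (\<forall>\<gamma>. avg M f (ball x \<gamma>) \<le> c) \<longrightarrow> f x \<le> c"
    by (subst AE_ball_countable) (use 1 in \<open>auto intro: countable_subset[OF _ countable_rat]\<close>)
  then show ?thesis
  proof eventually_elim
    case (elim x)
    show ?case
    proof (intro allI impI)
      fix K assume K: "\<forall>\<gamma>. avg M f (ball x \<gamma>) \<le> K"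
      have "0 \<le> K" using K avg_nonneg[of f "ball x 0"] nn order_trans by blast
      show "f x \<le> K"
      proof (rule ccontr)
        assume "\<not> f x \<le> K"
        then obtain c where c: "c \<in> \<rat>" "K < c" "c < f x" using Rats_dense_in_real[of K "f x"] by auto
        have "\<forall>\<gamma>. avg M f (ball x \<gamma>) \<le> c" using K c(2) by (meson less_imp_le order_trans)
        then have "f x \<le> c" using elim c \<open>0 \<le> K\<close> by auto
        then show False using c by simp
      qed
    qed
  qed
qed

text \<open>Lerner's argument: under the \<open>A\<^bsub>p,q\<^esub>\<close> condition the fractional maximal function is
  dominated pointwise by a composition of two maximal functions, one with respect to \<open>v\<^sup>q\<close> and one
  with respect to \<open>v\<close> to the power \<open>-p'\<close>, and these are bounded with universal constants.\<close>

theorem fractional_maximal_weighted: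
  fixes v :: "'a \<Rightarrow> real" and p q \<beta> K :: real
  defines "pp \<equiv> p / (p - 1)"
  assumes vm [measurable]: "v \<in> borel_measurable M" and vpos: "\<And>x. 0 < v x"
    and p: "1 < p" and q: "0 < q" and \<beta>: "0 < \<beta>" "\<beta> = 1 / p - 1 / q" and K: "0 \<le> K"
    and W: "\<And>x \<gamma>. \<exists>U S. 0 \<le> U \<and> 0 \<le> S
      \<and> (\<integral>\<^sup>+ y. ennreal (v y powr q) * indicator (ball x \<gamma>) y \<partial>M) \<le> ennreal U
      \<and> (\<integral>\<^sup>+ y. ennreal (v y powr (- pp)) * indicator (ball x \<gamma>) y \<partial>M) \<le> ennreal S
      \<and> U powr (1 / q) * S powr (1 / pp) \<le> K * measure M (ball x \<gamma>) powr (1 - \<beta>)"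
    and fm [measurable]: "f \<in> borel_measurable M" and fnn: "\<And>x. 0 \<le> f x"
    and I: "0 < I" "(\<integral>\<^sup>+ x. ennreal ((f x * v x) powr p) \<partial>M) \<le> ennreal I"
  shows "(\<integral>\<^sup>+ x. ennreal (mx N (\<lambda>B. measure M B powr (\<beta> - 1) * (LINT y:B|M. f y)) x powr q * v x powr q) \<partial>M)
    \<le> ennreal (K powr (q + pp) * ((1 + pp / q) * 2 powr (1 + pp / q) / (pp / q)) * (p * 2 powr p / (p - 1)) * I powr (q / p))"
proof -
  \<comment> \<open>Chosen so that \<open>u\<close> to the power \<open>1 - r\<close> equals
    \<open>\<sigma>\<close>; it is the Muckenhoupt exponent of \<open>\<sigma>\<close> under the
    condition \<open>W\<close>.\<close>
  define r where "r = 1 + pp / q"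
  define a where "a = q / r"
  have pp: "1 < pp" "1 / p + 1 / pp = 1" using p by (auto simp: pp_def field_simps)
  have r: "1 < r" using q pp by (simp add: r_def)
  then have r: "1 < r" "a * r = q" "0 < a" using q by (auto simp: a_def)
  have b1: "1 - \<beta> = 1 / pp + 1 / q" using \<beta> pp by simp
  have qr: "q * r = q + pp" using q by (simp add: r_def field_simps)
  \<comment> \<open>The identities \<open>e1\<close> and \<open>e2\<close> make the powers of the
    measure of the ball cancel when \<open>a\<close>-th powers are averaged in
    \<open>c1_le\<close>.\<close>
  have e1: "(1 - \<beta>) * a = q / pp"
  proof -
    have "(1 - \<beta>) * (q * pp) = q + pp" unfolding b1 using q pp by (simp add: field_simps)
    then have h: "(1 - \<beta>) * q * pp = q * r" using qr by (simp add: mult.assoc)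
    have "(1 - \<beta>) * a = ((1 - \<beta>) * q * pp) / (r * pp)" unfolding a_def using pp r by simp
    also have "\<dots> = q / pp" unfolding h using r by simp
    finally show ?thesis .
  qed
  have e2: "(1 - \<beta>) * (q - a) = 1"
  proof -
    have "(1 - \<beta>) * q = 1 + q / pp" unfolding b1 using q by (simp add: field_simps)
    then show ?thesis using e1 by (simp add: algebra_simps)
  qed
  define u where "u = (\<lambda>x. v x powr q)"
  define \<sigma> where "\<sigma> = (\<lambda>x. v x powr (- pp))"
  have [measurable]: "u \<in> borel_measurable M" "\<sigma> \<in> borel_measurable M" unfolding u_def \<sigma>_def by measurable
  have pos: "0 < u x" "0 < \<sigma> x" for x using vpos[of x] by (auto simp: u_def \<sigma>_def)
  define Mu where "Mu = density M (\<lambda>x. ennreal (u x))"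
  define Ms where "Ms = density M (\<lambda>x. ennreal (\<sigma> x))"
  have eu: "emeasure Mu (ball x \<gamma>) = (\<integral>\<^sup>+ y. ennreal (u y) * indicator (ball x \<gamma>) y \<partial>M)"
    and es: "emeasure Ms (ball x \<gamma>) = (\<integral>\<^sup>+ y. ennreal (\<sigma> y) * indicator (ball x \<gamma>) y \<partial>M)" for x \<gamma>
    unfolding Mu_def Ms_def by (subst emeasure_density; simp)+
  have fu: "emeasure Mu (ball x \<gamma>) < \<infinity>" and fs: "emeasure Ms (ball x \<gamma>) < \<infinity>" for x \<gamma>
    using W[of x \<gamma>] unfolding eu es u_def \<sigma>_def by (auto intro: le_less_trans)
  interpret U: ball_measure ball Mu
    by unfold_locales (use sets_M fu in \<open>auto simp: Mu_def\<close>)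
  interpret S: ball_measure ball Ms
    by unfold_locales (use sets_M fs in \<open>auto simp: Ms_def\<close>)
  have mu0: "0 < measure Mu (ball x \<gamma>)" and ms0: "0 < measure Ms (ball x \<gamma>)" for x \<gamma>
    using nn_integral_ball_pos[of u x \<gamma>] nn_integral_ball_pos[of \<sigma> x \<gamma>] pos
    unfolding eu[symmetric] es[symmetric] U.emeasure_ball S.emeasure_ball by auto
  have AW: "measure Mu (ball x \<gamma>) * measure Ms (ball x \<gamma>) powr (q / pp) \<le> K powr q * measure M (ball x \<gamma>) powr ((1 - \<beta>) * q)" for x \<gamma>
  proof -
    obtain Ub Sb where us: "0 \<le> Ub" "0 \<le> Sb" "emeasure Mu (ball x \<gamma>) \<le> ennreal Ub" "emeasure Ms (ball x \<gamma>) \<le> ennreal Sb"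
      "Ub powr (1 / q) * Sb powr (1 / pp) \<le> K * measure M (ball x \<gamma>) powr (1 - \<beta>)"
      using W[of x \<gamma>] unfolding eu es u_def \<sigma>_def by blast
    have le: "measure Mu (ball x \<gamma>) \<le> Ub" "measure Ms (ball x \<gamma>) \<le> Sb"
      using us by (auto simp: U.emeasure_ball S.emeasure_ball)
    have "measure Mu (ball x \<gamma>) powr (1 / q) * measure Ms (ball x \<gamma>) powr (1 / pp) \<le> Ub powr (1 / q) * Sb powr (1 / pp)"
      using le q pp by (intro mult_mono powr_mono2) auto
    then have "(measure Mu (ball x \<gamma>) powr (1 / q) * measure Ms (ball x \<gamma>) powr (1 / pp)) powr q \<le> (K * measure M (ball x \<gamma>) powr (1 - \<beta>)) powr q"
      using us(5) q by (intro powr_mono2) auto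
    then show ?thesis using q K mu0[of x \<gamma>] by (simp add: powr_mult powr_powr)
  qed
  \<comment> \<open>Dividing by \<open>\<sigma>\<close> turns the weighted norm of \<open>f\<close>
    into the norm of \<open>\<phi>\<close> for \<open>Ms\<close>, while integrals over balls stay
    the same.\<close>
  define \<phi> where "\<phi> = (\<lambda>x. f x / \<sigma> x)"
  have [measurable]: "\<phi> \<in> borel_measurable M" unfolding \<phi>_def by measurable
  have [measurable]: "\<phi> \<in> borel_measurable Ms" unfolding Ms_def by measurable
  have \<phi>nn: "0 \<le> \<phi> x" for x using fnn pos by (simp add: \<phi>_def less_imp_le)
  have \<phi>int: "(\<integral>\<^sup>+ x. ennreal (\<phi> x powr p) \<partial>Ms) \<le> ennreal I"
  proof -
    have "(\<integral>\<^sup>+ x. ennreal (\<phi> x powr p) \<partial>Ms) = (\<integral>\<^sup>+ x. ennreal (\<sigma> x) * ennreal (\<phi> x powr p) \<partial>M)"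
      unfolding Ms_def by (rule nn_integral_density) measurable
    also have "\<dots> = (\<integral>\<^sup>+ x. ennreal ((f x * v x) powr p) \<partial>M)"
    proof (rule nn_integral_cong)
      fix x
      have "pp * (p - 1) = p" using p by (simp add: pp_def)
      then have e: "- pp + pp * p = p" by (simp add: algebra_simps)
      have "\<sigma> x * \<phi> x powr p = v x powr (- pp) * (f x * v x powr pp) powr p"
        using vpos[of x] by (simp add: \<phi>_def \<sigma>_def powr_minus divide_inverse)
      also have "\<dots> = f x powr p * (v x powr (- pp) * v x powr (pp * p))"
        using fnn[of x] vpos[of x] by (simp add: powr_mult powr_powr mult_ac)
      also have "\<dots> = f x powr p * v x powr p" using e by (simp add: powr_add[symmetric])
      also have "\<dots> = (f x * v x) powr p" using fnn[of x] vpos[of x] by (simp add: powr_mult)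
      finally show "ennreal (\<sigma> x) * ennreal (\<phi> x powr p) = ennreal ((f x * v x) powr p)"
        using pos(2)[of x] by (simp add: ennreal_mult[symmetric])
    qed
    finally show ?thesis using I by simp
  qed
  define c1 where "c1 = (\<lambda>B. measure M B powr (\<beta> - 1) * (LINT y:B|M. f y))"
  define c2 where "c2 = (\<lambda>B. measure Ms B powr \<beta> * avg Ms \<phi> B)"
  have c1nn: "0 \<le> c1 B" for B
    unfolding c1_def set_lebesgue_integral_def by (intro mult_nonneg_nonneg integral_nonneg) (auto simp: fnn)
  have c2nn: "0 \<le> c2 B" for B unfolding c2_def by (intro mult_nonneg_nonneg S.avg_nonneg \<phi>nn) auto
  define \<Phi> where "\<Phi> = mx N c2"
  have \<Phi>nn: "0 \<le> \<Phi> x" for x unfolding \<Phi>_def by (rule mx_nonneg[OF c2nn])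
  have [measurable]: "\<Phi> \<in> borel_measurable M" unfolding \<Phi>_def by measurable
  define C1 where "C1 = p * 2 powr p / (p - 1)"
  define C2 where "C2 = r * 2 powr r / (r - 1)"
  have C0: "0 \<le> C1" "0 \<le> C2" using p r by (auto simp: C1_def C2_def)
  \<comment> \<open>Since \<open>p * \<beta> + p / q = 1\<close>, the average splits into two
    powers, one of which is absorbed by the bound \<open>I\<close>. The fractional maximal function
    for \<open>Ms\<close> is thus reduced to the ordinary one.\<close>
  have c2_le: "c2 (ball x \<gamma>) \<le> I powr \<beta> * avg Ms \<phi> (ball x \<gamma>) powr (p / q)" for x \<gamma>
  proof (cases "avg Ms \<phi> (ball x \<gamma>) = 0")
    case False
    let ?A = "avg Ms \<phi> (ball x \<gamma>)" and ?m = "measure Ms (ball x \<gamma>)"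
    have A: "0 < ?A" using False S.avg_nonneg[of \<phi> "ball x \<gamma>"] \<phi>nn by auto
    have "ennreal (?A powr p * ?m) \<le> (\<integral>\<^sup>+ y. ennreal (\<phi> y powr p) * indicator (ball x \<gamma>) y \<partial>Ms)"
      by (rule S.avg_powr_le) (use \<phi>nn p in auto)
    also have "\<dots> \<le> (\<integral>\<^sup>+ y. ennreal (\<phi> y powr p) \<partial>Ms)" by (intro nn_integral_mono) (auto simp: indicator_def)
    also note \<phi>int
    finally have "?A powr p * ?m \<le> I" using I by simp
    then have "(?A powr p * ?m) powr \<beta> \<le> I powr \<beta>" using \<beta> by (intro powr_mono2) auto
    then have "(?A powr p * ?m) powr \<beta> * ?A powr (p / q) \<le> I powr \<beta> * ?A powr (p / q)" by (rule mult_right_mono) simp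
    moreover have "(?A powr p * ?m) powr \<beta> * ?A powr (p / q) = ?m powr \<beta> * ?A powr (p * \<beta> + p / q)"
      using A by (simp add: powr_mult powr_powr powr_add)
    moreover have "p * \<beta> + p / q = 1" using \<beta> p q by (simp add: field_simps)
    ultimately show ?thesis using A by (simp add: c2_def)
  qed (simp add: c2_def)
  have \<Phi>le: "\<Phi> x powr q \<le> I powr (\<beta> * q) * mx N (avg Ms \<phi>) x powr p" for x
  proof -
    obtain \<gamma> where g: "\<gamma> \<in> {- int N..int N}" "\<Phi> x = c2 (ball x \<gamma>)" unfolding \<Phi>_def by (rule mx_attained)
    have "\<Phi> x \<le> I powr \<beta> * mx N (avg Ms \<phi>) x powr (p / q)"
      unfolding g(2) by (rule order_trans[OF c2_le]) (use p q g(1) \<phi>nn in \<open>auto intro!: mult_left_mono powr_mono2 mx_ge S.avg_nonneg\<close>)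
    then have "\<Phi> x powr q \<le> (I powr \<beta> * mx N (avg Ms \<phi>) x powr (p / q)) powr q"
      using q \<Phi>nn by (intro powr_mono2) auto
    then show ?thesis using q by (simp add: powr_mult powr_powr)
  qed
  have \<Phi>int: "(\<integral>\<^sup>+ x. ennreal (\<Phi> x powr q * \<sigma> x) \<partial>M) \<le> ennreal (C1 * I powr (q / p))"
  proof -
    have "(\<integral>\<^sup>+ x. ennreal (\<Phi> x powr q * \<sigma> x) \<partial>M) = (\<integral>\<^sup>+ x. ennreal (\<sigma> x) * ennreal (\<Phi> x powr q) \<partial>M)"
      using pos by (intro nn_integral_cong) (auto simp: ennreal_mult[symmetric] less_imp_le mult.commute)
    also have "\<dots> = (\<integral>\<^sup>+ x. ennreal (\<Phi> x powr q) \<partial>Ms)"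
      unfolding Ms_def by (rule nn_integral_density[symmetric]) measurable
    also have "\<dots> \<le> (\<integral>\<^sup>+ x. ennreal (I powr (\<beta> * q)) * ennreal (mx N (avg Ms \<phi>) x powr p) \<partial>Ms)"
      by (intro nn_integral_mono) (auto simp: ennreal_mult[symmetric] intro!: ennreal_leI \<Phi>le)
    also have "\<dots> = ennreal (I powr (\<beta> * q)) * (\<integral>\<^sup>+ x. ennreal (mx N (avg Ms \<phi>) x powr p) \<partial>Ms)"
      by (rule nn_integral_cmult) measurable
    also have "\<dots> \<le> ennreal (I powr (\<beta> * q)) * (ennreal C1 * (\<integral>\<^sup>+ x. ennreal (\<phi> x powr p) \<partial>Ms))"
      unfolding C1_def by (intro mult_left_mono S.maximal_strong_type) (use \<phi>nn p in auto)
    also have "\<dots> \<le> ennreal (I powr (\<beta> * q)) * (ennreal C1 * ennreal I)"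
      by (intro mult_left_mono \<phi>int) auto
    also have "\<dots> = ennreal (C1 * (I powr (\<beta> * q) * I powr 1))"
      using C0 I by (simp add: ennreal_mult[symmetric] mult_ac)
    also have "I powr (\<beta> * q) * I powr 1 = I powr (q / p)"
      unfolding powr_add[symmetric] \<beta>(2) using q by (simp add: field_simps)
    finally show ?thesis .
  qed
  \<comment> \<open>The second maximal function is taken for \<open>Mu\<close>. By the choice of
    \<open>r\<close> the integral of \<open>\<Psi> powr r\<close> for \<open>Mu\<close> is that of
    \<open>\<Phi> powr q * \<sigma>\<close>, which \<open>\<Phi>int\<close> controls.\<close>
  define \<Psi> where "\<Psi> = (\<lambda>x. \<Phi> x powr a / u x)"
  have \<Psi>nn: "0 \<le> \<Psi> x" for x using pos(1)[of x] by (simp add: \<Psi>_def)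
  have [measurable]: "\<Psi> \<in> borel_measurable M" unfolding \<Psi>_def by measurable
  have [measurable]: "\<Psi> \<in> borel_measurable Mu" unfolding Mu_def by measurable
  have ballP: "(\<integral>\<^sup>+ y. ennreal (\<Psi> y) * indicator (ball x \<gamma>) y \<partial>Mu) = (\<integral>\<^sup>+ y. ennreal (\<Phi> y powr a) * indicator (ball x \<gamma>) y \<partial>M)" for x \<gamma>
  proof -
    have "(\<integral>\<^sup>+ y. ennreal (\<Psi> y) * indicator (ball x \<gamma>) y \<partial>Mu) = (\<integral>\<^sup>+ y. ennreal (u y) * (ennreal (\<Psi> y) * indicator (ball x \<gamma>) y) \<partial>M)"
      unfolding Mu_def by (rule nn_integral_density) measurable
    also have "\<dots> = (\<integral>\<^sup>+ y. ennreal (\<Phi> y powr a) * indicator (ball x \<gamma>) y \<partial>M)"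
    proof (rule nn_integral_cong)
      fix y
      have "u y * \<Psi> y = \<Phi> y powr a" using pos(1)[of y] by (simp add: \<Psi>_def)
      then show "ennreal (u y) * (ennreal (\<Psi> y) * indicator (ball x \<gamma>) y) = ennreal (\<Phi> y powr a) * indicator (ball x \<gamma>) y"
        using pos(1)[of y] \<Psi>nn[of y] by (simp add: mult.assoc[symmetric] ennreal_mult[symmetric])
    qed
    finally show ?thesis .
  qed
  \<comment> \<open>Averages of non-integrable functions default to 0, so integrability must be
    secured before averaging; it follows from Young's inequality with exponent
    \<open>r\<close>.\<close>
  have \<Psi>int: "set_integrable Mu (ball x \<gamma>) \<Psi>" for x \<gamma>
  proof -
    have yg: "\<Phi> y powr a \<le> \<Phi> y powr q * \<sigma> y + u y" for y
    proof -
      have div_le: "t / k \<le> t" if "0 \<le> t" "1 < k" for t k :: real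
        using that by (simp add: divide_le_eq mult_le_cancel_left1)
      have rr: "1 < r / (r - 1)" "1 / r + 1 / (r / (r - 1)) = 1" using r by (auto simp: field_simps)
      have "(\<Phi> y powr a * \<sigma> y powr (1 / r)) * \<sigma> y powr (- (1 / r))
         \<le> (\<Phi> y powr a * \<sigma> y powr (1 / r)) powr r / r + (\<sigma> y powr (- (1 / r))) powr (r / (r - 1)) / (r / (r - 1))"
        by (rule Youngs_inequality) (use r rr \<Phi>nn in auto)
      also have "(\<Phi> y powr a * \<sigma> y powr (1 / r)) powr r = \<Phi> y powr q * \<sigma> y"
        using r pos(2)[of y] \<Phi>nn[of y] by (simp add: powr_mult powr_powr)
      also have "(\<sigma> y powr (- (1 / r))) powr (r / (r - 1)) = u y"
      proof -
        have "pp * (1 / r) * (r / (r - 1)) = pp / (r - 1)" using r by simp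
        also have "\<dots> = q" using q pp by (simp add: r_def)
        finally have "pp * (1 / r) * (r / (r - 1)) = q" .
        then show ?thesis using vpos[of y] by (simp add: \<sigma>_def u_def powr_powr)
      qed
      also have "\<Phi> y powr q * \<sigma> y / r + u y / (r / (r - 1)) \<le> \<Phi> y powr q * \<sigma> y + u y"
        using rr r pos[of y] by (intro add_mono div_le) auto
      finally show ?thesis using pos(2)[of y] by (simp add: powr_minus mult.assoc)
    qed
    have "(\<integral>\<^sup>+ y. ennreal (\<Phi> y powr a) * indicator (ball x \<gamma>) y \<partial>M)
      \<le> (\<integral>\<^sup>+ y. ennreal (\<Phi> y powr q * \<sigma> y) + ennreal (u y) * indicator (ball x \<gamma>) y \<partial>M)"
      using yg pos by (intro nn_integral_mono) (auto simp: indicator_def ennreal_plus[symmetric] less_imp_le simp del: ennreal_plus intro!: ennreal_leI)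
    also have "\<dots> = (\<integral>\<^sup>+ y. ennreal (\<Phi> y powr q * \<sigma> y) \<partial>M) + emeasure Mu (ball x \<gamma>)"
      unfolding eu by (rule nn_integral_add) measurable
    also have "\<dots> < \<infinity>" using \<Phi>int fu[of x \<gamma>] by (auto intro: le_less_trans)
    finally have fin: "(\<integral>\<^sup>+ y. ennreal (\<Psi> y) * indicator (ball x \<gamma>) y \<partial>Mu) < \<infinity>" unfolding ballP .
    have eq: "(\<integral>\<^sup>+ y. ennreal (\<Psi> y) * indicator (ball x \<gamma>) y \<partial>Mu)
        = (\<integral>\<^sup>+ y. ennreal (norm (indicator (ball x \<gamma>) y *\<^sub>R \<Psi> y)) \<partial>Mu)"
      by (intro nn_integral_cong) (auto simp: indicator_def \<Psi>nn)
    show ?thesis unfolding set_integrable_def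
      by (rule integrableI_bounded) (use fin[unfolded eq] in auto)
  qed
  have c1_le: "c1 (ball x \<gamma>) powr a \<le> K powr q * avg Mu \<Psi> (ball x \<gamma>)" if g: "\<gamma> \<in> {- int N..int N}" for x \<gamma>
  proof -
    let ?B = "ball x \<gamma>"
    let ?m = "measure M ?B" and ?s = "measure Ms ?B" and ?u = "measure Mu ?B"
    have m0: "0 < ?m" "0 < ?s" "0 < ?u" using measure_ball_pos ms0 mu0 by auto
    define T where "T = ?m powr (\<beta> - 1) * ?s powr (1 - \<beta>)"
    have T0: "0 \<le> T" by (simp add: T_def)
    have "(LINT y:?B|M. f y) = (LINT y:?B|Ms. \<phi> y)"
    proof -
      have "(LINT y:?B|Ms. \<phi> y) = (LINT y|M. \<sigma> y *\<^sub>R (indicator ?B y *\<^sub>R \<phi> y))"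
        unfolding set_lebesgue_integral_def Ms_def by (rule integral_density) (use pos in \<open>auto simp: less_imp_le\<close>)
      also have "\<dots> = (LINT y:?B|M. f y)"
        unfolding set_lebesgue_integral_def using pos(2) by (intro Bochner_Integration.integral_cong) (auto simp: \<phi>_def less_imp_neq[symmetric])
      finally show ?thesis by simp
    qed
    then have c1eq: "c1 ?B = T * c2 ?B"
    proof -
      assume h: "(LINT y:?B|M. f y) = (LINT y:?B|Ms. \<phi> y)"
      have "(LINT y:?B|M. f y) = ?s * avg Ms \<phi> ?B" using m0 by (simp add: h avg_def)
      moreover have "?s = ?s powr (1 - \<beta>) * ?s powr \<beta>" using m0 by (simp add: powr_add[symmetric])
      ultimately show ?thesis by (metis (no_types, lifting) T_def c1_def c2_def mult.assoc)
    qed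
    \<comment> \<open>\<open>c2\<close> of this ball is among the values maximized in
      \<open>\<Phi>\<close> at every point of the ball, so the inequality can be averaged over
      it.\<close>
    have le: "c1 ?B \<le> T * \<Phi> y" if "y \<in> ?B" for y
      unfolding c1eq \<Phi>_def using g ball_eq[OF that] T0 mx_ge[OF g, of c2 y] by (intro mult_left_mono) auto
    have "ennreal (c1 ?B powr a * ?m) = (\<integral>\<^sup>+ y. ennreal (c1 ?B powr a) * indicator ?B y \<partial>M)"
      by (simp add: nn_integral_cmult_indicator emeasure_ball ennreal_mult)
    also have "\<dots> \<le> (\<integral>\<^sup>+ y. ennreal (T powr a) * (ennreal (\<Phi> y powr a) * indicator ?B y) \<partial>M)"
    proof (rule nn_integral_mono)
      fix y
      show "ennreal (c1 ?B powr a) * indicator ?B y \<le> ennreal (T powr a) * (ennreal (\<Phi> y powr a) * indicator ?B y)"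
      proof (cases "y \<in> ?B")
        case True
        have "c1 ?B powr a \<le> (T * \<Phi> y) powr a" using le[OF True] r c1nn by (intro powr_mono2) auto
        also have "\<dots> = T powr a * \<Phi> y powr a" using T0 \<Phi>nn by (simp add: powr_mult)
        finally show ?thesis using True by (simp add: ennreal_mult[symmetric] ennreal_leI)
      qed simp
    qed
    also have "\<dots> = ennreal (T powr a) * (\<integral>\<^sup>+ y. ennreal (\<Phi> y powr a) * indicator ?B y \<partial>M)"
      by (rule nn_integral_cmult) measurable
    also have "(\<integral>\<^sup>+ y. ennreal (\<Phi> y powr a) * indicator ?B y \<partial>M) = ennreal (avg Mu \<Psi> ?B * ?u)"
      unfolding ballP[symmetric] by (rule U.nn_integral_ball_avg[OF \<Psi>int \<Psi>nn m0(3)])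
    finally have 1: "c1 ?B powr a * ?m \<le> T powr a * (avg Mu \<Psi> ?B * ?u)"
      using U.avg_nonneg[of \<Psi> ?B] \<Psi>nn by (simp add: ennreal_mult[symmetric] ennreal_le_iff)
    have 2: "T powr a * ?u \<le> K powr q * ?m"
    proof -
      have "T powr a * ?u = ?m powr ((\<beta> - 1) * a) * (?u * ?s powr (q / pp))"
        using e1 by (simp add: T_def powr_mult powr_powr mult_ac)
      also have "\<dots> \<le> ?m powr ((\<beta> - 1) * a) * (K powr q * ?m powr ((1 - \<beta>) * q))"
        by (intro mult_left_mono AW) simp
      also have "\<dots> = K powr q * ?m powr ((\<beta> - 1) * a + (1 - \<beta>) * q)" by (simp add: powr_add mult_ac)
      also have "(\<beta> - 1) * a + (1 - \<beta>) * q = 1" using e2 by (simp add: algebra_simps)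
      finally show ?thesis using m0 by simp
    qed
    have "c1 ?B powr a * ?m \<le> (T powr a * ?u) * avg Mu \<Psi> ?B" using 1 by (simp add: mult_ac)
    also have "\<dots> \<le> (K powr q * ?m) * avg Mu \<Psi> ?B"
      by (intro mult_right_mono 2 U.avg_nonneg \<Psi>nn)
    finally have "c1 ?B powr a * ?m \<le> (K powr q * avg Mu \<Psi> ?B) * ?m" by (simp add: mult_ac)
    then show ?thesis using m0 by simp
  qed
  have mx_le: "mx N c1 x powr q \<le> K powr (q + pp) * mx N (avg Mu \<Psi>) x powr r" for x
  proof -
    obtain \<gamma> where g: "\<gamma> \<in> {- int N..int N}" "mx N c1 x = c1 (ball x \<gamma>)" by (rule mx_attained)
    have "mx N c1 x powr a \<le> K powr q * avg Mu \<Psi> (ball x \<gamma>)" unfolding g(2) by (rule c1_le[OF g(1)])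
    also have "\<dots> \<le> K powr q * mx N (avg Mu \<Psi>) x" by (intro mult_left_mono mx_ge g) simp
    finally have "(mx N c1 x powr a) powr r \<le> (K powr q * mx N (avg Mu \<Psi>) x) powr r"
      using r by (intro powr_mono2) auto
    then show ?thesis using r mx_nonneg[of c1 N x] c1nn mx_nonneg[of "avg Mu \<Psi>" N x] U.avg_nonneg[of \<Psi>] \<Psi>nn
      by (simp add: powr_powr powr_mult qr)
  qed
  have "(\<integral>\<^sup>+ x. ennreal (mx N c1 x powr q * v x powr q) \<partial>M) = (\<integral>\<^sup>+ x. ennreal (u x) * ennreal (mx N c1 x powr q) \<partial>M)"
    by (intro nn_integral_cong) (auto simp: u_def ennreal_mult[symmetric] mult.commute)
  also have "\<dots> = (\<integral>\<^sup>+ x. ennreal (mx N c1 x powr q) \<partial>Mu)"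
    unfolding Mu_def by (rule nn_integral_density[symmetric]) measurable
  also have "\<dots> \<le> (\<integral>\<^sup>+ x. ennreal (K powr (q + pp)) * ennreal (mx N (avg Mu \<Psi>) x powr r) \<partial>Mu)"
    by (intro nn_integral_mono) (auto simp: ennreal_mult[symmetric] intro!: ennreal_leI mx_le)
  also have "\<dots> = ennreal (K powr (q + pp)) * (\<integral>\<^sup>+ x. ennreal (mx N (avg Mu \<Psi>) x powr r) \<partial>Mu)"
    by (rule nn_integral_cmult) measurable
  also have "\<dots> \<le> ennreal (K powr (q + pp)) * (ennreal C2 * (\<integral>\<^sup>+ x. ennreal (\<Psi> x powr r) \<partial>Mu))"
    unfolding C2_def by (intro mult_left_mono U.maximal_strong_type) (use \<Psi>nn r in auto)
  also have "(\<integral>\<^sup>+ x. ennreal (\<Psi> x powr r) \<partial>Mu) = (\<integral>\<^sup>+ x. ennreal (\<Phi> x powr q * \<sigma> x) \<partial>M)"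
  proof -
    have "(\<integral>\<^sup>+ x. ennreal (\<Psi> x powr r) \<partial>Mu) = (\<integral>\<^sup>+ x. ennreal (u x) * ennreal (\<Psi> x powr r) \<partial>M)"
      unfolding Mu_def by (rule nn_integral_density) measurable
    also have "\<dots> = (\<integral>\<^sup>+ x. ennreal (\<Phi> x powr q * \<sigma> x) \<partial>M)"
    proof (rule nn_integral_cong)
      fix x
      have "\<Psi> x powr r = \<Phi> x powr q / u x powr r"
        using r pos(1)[of x] \<Phi>nn[of x] by (simp add: \<Psi>_def powr_divide powr_powr)
      then have "u x * \<Psi> x powr r = \<Phi> x powr q * (u x * u x powr (- r))"
        by (simp add: powr_minus_divide)
      also have "u x * u x powr (- r) = u x powr (1 + - r)" using pos(1)[of x] by (simp add: powr_add powr_minus powr_diff divide_inverse)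
      also have "\<dots> = \<sigma> x" using q by (simp add: u_def \<sigma>_def powr_powr r_def)
      finally show "ennreal (u x) * ennreal (\<Psi> x powr r) = ennreal (\<Phi> x powr q * \<sigma> x)"
        using pos(1)[of x] by (simp add: ennreal_mult[symmetric])
    qed
    finally show ?thesis .
  qed
  also have "ennreal (K powr (q + pp)) * (ennreal C2 * (\<integral>\<^sup>+ x. ennreal (\<Phi> x powr q * \<sigma> x) \<partial>M))
     \<le> ennreal (K powr (q + pp)) * (ennreal C2 * ennreal (C1 * I powr (q / p)))"
    by (intro mult_left_mono \<Phi>int) auto
  also have "\<dots> = ennreal (K powr (q + pp) * C2 * C1 * I powr (q / p))"
    using C0 by (simp add: ennreal_mult[symmetric] mult_ac)
  finally show ?thesis unfolding c1_def C1_def C2_def r_def by simp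
qed

end

section \<open>The John--Nirenberg inequality\<close>

context ball_space
begin

lemma avg_abs_diff_le:
  assumes b: "set_integrable M (ball x \<gamma>) b"
  shows "\<bar>avg M b (ball x \<gamma>) - c\<bar> \<le> avg M (\<lambda>y. \<bar>b y - c\<bar>) (ball x \<gamma>)"
proof -
  let ?B = "ball x \<gamma>"
  have m: "0 < measure M ?B" by (rule measure_ball_pos)
  have c: "set_integrable M ?B (\<lambda>_. c)"
    using finite_ball[of x \<gamma>] by (simp add: set_integrable_def integrable_mult_left_iff)
  have d: "set_integrable M ?B (\<lambda>y. b y - c)" by (rule set_integral_diff(1)[OF b c])
  have "avg M b ?B - c = (LINT y:?B|M. b y - c) / measure M ?B"
    using m by (subst set_integral_diff(2)[OF b c]) (simp add: avg_def set_lebesgue_integral_def[of _ _ "\<lambda>_. c"] field_simps)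
  moreover have "\<bar>LINT y:?B|M. b y - c\<bar> \<le> (LINT y:?B|M. \<bar>b y - c\<bar>)"
    using set_integral_norm_bound[OF d] by simp
  ultimately show ?thesis using m by (simp add: avg_def divide_right_mono)
qed

lemma set_integrable_abs_diff:
  fixes b :: "'a \<Rightarrow> real"
  assumes b: "set_integrable M (ball x \<gamma>) b"
  shows "set_integrable M (ball x \<gamma>) (\<lambda>y. \<bar>b y - c\<bar>)"
proof -
  have "set_integrable M (ball x \<gamma>) (\<lambda>_. c)"
    using finite_ball[of x \<gamma>] by (simp add: set_integrable_def integrable_mult_left_iff)
  then show ?thesis by (intro set_integrable_abs set_integral_diff(1)[OF b])
qed

text \<open>Calderon-Zygmund decomposition at height \<open>2 * A\<close>. The stopping balls cover
  at most half of the ball. On each of them the mean of \<open>b\<close> has moved by at most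
  \<open>2 * D * A\<close>, which costs the factor \<open>3 / 2\<close> by the choice of
  \<open>t\<close>, and \<open>IH\<close> applies around the new mean. Almost everywhere else the
  deviation from the old mean is at most \<open>2 * A\<close>. So the bound \<open>v\<close> is
  transformed by an affine contraction with factor \<open>3 / 4\<close>, half of
  \<open>3 / 2\<close>.\<close>

lemma John_Nirenberg_step:
  fixes b :: "'a \<Rightarrow> real"
  assumes [measurable]: "b \<in> borel_measurable M"
    and int: "\<And>x \<gamma>. set_integrable M (ball x \<gamma>) b" and A: "0 < A" and v: "0 \<le> v"
    and osc: "\<And>x \<gamma>. avg M (\<lambda>y. \<bar>b y - avg M b (ball x \<gamma>)\<bar>) (ball x \<gamma>) \<le> A"
    and t: "t = ln (3 / 2) / (2 * D * A)"
    and IH: "\<And>x \<gamma>. (\<integral>\<^sup>+ y. ennreal (exp (t * \<bar>b y - avg M b (ball x \<gamma>)\<bar>)) * indicator (ball x \<gamma>) y \<partial>M)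
      \<le> ennreal v * emeasure M (ball x \<gamma>)"
  shows "(\<integral>\<^sup>+ y. ennreal (exp (t * \<bar>b y - avg M b (ball x0 \<gamma>0)\<bar>)) * indicator (ball x0 \<gamma>0) y \<partial>M)
      \<le> ennreal (3 / 2 + 3 / 4 * v) * emeasure M (ball x0 \<gamma>0)"
proof -
  define B where "B = ball x0 \<gamma>0"
  define bB where "bB = avg M b B"
  define h where "h = (\<lambda>y. \<bar>b y - bB\<bar>)"
  have D: "1 < D" by (rule D_gt_1)
  have t0: "0 < t" using A D by (simp add: t)
  have t1: "exp (t * (2 * D * A)) = 3 / 2" using A D by (simp add: t)
  have t2: "exp (t * (2 * A)) \<le> 3 / 2"
    unfolding t1[symmetric] using t0 A D by (simp add: mult_left_mono)
  have [measurable]: "B \<in> sets M" "h \<in> borel_measurable M" by (auto simp: B_def h_def)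
  have hnn: "0 \<le> h x" for x by (simp add: h_def)
  have hint: "set_integrable M (ball x \<gamma>) h" for x \<gamma> unfolding h_def by (rule set_integrable_abs_diff[OF int])
  have hint_eq: "(\<integral>\<^sup>+ y. ennreal (h y) * indicator (ball x \<gamma>) y \<partial>M) = ennreal (avg M h (ball x \<gamma>) * measure M (ball x \<gamma>))" for x \<gamma>
    by (rule nn_integral_ball_avg[OF hint hnn measure_ball_pos])
  have hB: "avg M h B \<le> A" using osc[of x0 \<gamma>0] by (simp add: h_def bB_def B_def)
  let ?Q = "\<lambda>x \<gamma>. \<gamma> \<le> \<gamma>0 \<and> x \<in> B \<and> 2 * A < avg M h (ball x \<gamma>)"
  define E where "E = {x. \<exists>\<gamma>. ?Q x \<gamma>}"
  have inv: "?Q y \<gamma> = ?Q x \<gamma>" if "y \<in> ball x \<gamma>" for x y \<gamma>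
  proof (cases "\<gamma> \<le> \<gamma>0")
    case True
    have "ball y \<gamma> = ball x \<gamma>" by (rule ball_eq[OF that])
    moreover have "x \<in> B \<longleftrightarrow> y \<in> B"
      unfolding B_def using ball_up[OF that True] ball_sym[of x x0 \<gamma>0] ball_sym[of y x0 \<gamma>0] by simp
    ultimately show ?thesis by simp
  qed simp
  have "ball_open E" unfolding ball_open_def E_def
  proof
    fix x assume "x \<in> {x. \<exists>\<gamma>. ?Q x \<gamma>}"
    then obtain \<gamma> where "?Q x \<gamma>" by blast
    then have "ball x \<gamma> \<subseteq> {x. \<exists>\<gamma>. ?Q x \<gamma>}" using inv[of _ x \<gamma>] by blast
    then show "\<exists>\<gamma>. ball x \<gamma> \<subseteq> {x. \<exists>\<gamma>. ?Q x \<gamma>}" by blast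
  qed
  then have [measurable]: "E \<in> sets M" by (rule ball_open_sets)
  have EB: "E \<subseteq> B" by (auto simp: E_def)
  have sE: "(\<integral>\<^sup>+ y. ennreal (exp (t * h y)) * indicator E y \<partial>M) \<le> (\<integral>\<^sup>+ y. ennreal (3 / 2 * v) * indicator E y \<partial>M)"
    unfolding E_def
  proof (rule stopping_compare[of ?Q \<gamma>0])
    fix x \<gamma> assume Q: "?Q x \<gamma>" and mxl: "\<forall>\<delta>>\<gamma>. \<not> ?Q x \<delta>"
    have xB: "x \<in> B" using Q by simp
    have "ball x \<gamma>0 = B" unfolding B_def using xB by (intro ball_eq) (simp add: B_def)
    \<comment> \<open>The average over the whole ball is at most \<open>A\<close>, so a stopping
      ball is a proper subball and its parent of level \<open>\<gamma> + 1\<close> still lies in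
      \<open>B\<close>. Maximality bounds the average over the parent, and passing down one level
      costs the factor \<open>D\<close>.\<close>
    then have "\<gamma> \<noteq> \<gamma>0" using Q hB A by auto
    then have "\<gamma> + 1 \<le> \<gamma>0" using Q by simp
    then have par: "avg M h (ball x (\<gamma> + 1)) \<le> 2 * A" using mxl[rule_format, of "\<gamma> + 1"] xB by simp
    have "ennreal (avg M h (ball x \<gamma>) * measure M (ball x \<gamma>)) \<le> ennreal (avg M h (ball x (\<gamma> + 1)) * measure M (ball x (\<gamma> + 1)))"
      unfolding hint_eq[symmetric] using ball_mono[of \<gamma> "\<gamma> + 1" x]
      by (intro nn_integral_mono) (auto simp: indicator_def)
    then have "avg M h (ball x \<gamma>) * measure M (ball x \<gamma>) \<le> avg M h (ball x (\<gamma> + 1)) * measure M (ball x (\<gamma> + 1))"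
      using avg_nonneg[of h "ball x (\<gamma> + 1)"] hnn by (simp add: ennreal_le_iff)
    also have "\<dots> \<le> 2 * A * measure M (ball x (\<gamma> + 1))" by (intro mult_right_mono par) simp
    also have "\<dots> = (2 * D * A) * measure M (ball x \<gamma>)" using D by (simp add: measure_ball powr_add)
    finally have "avg M h (ball x \<gamma>) \<le> 2 * D * A" using measure_ball_pos[of x \<gamma>] by simp
    then have ab: "\<bar>avg M b (ball x \<gamma>) - bB\<bar> \<le> 2 * D * A"
      using avg_abs_diff_le[OF int[of x \<gamma>], of bB] by (simp add: h_def)
    have "(\<integral>\<^sup>+ y. ennreal (exp (t * h y)) * indicator (ball x \<gamma>) y \<partial>M)
      \<le> (\<integral>\<^sup>+ y. ennreal (3 / 2) * (ennreal (exp (t * \<bar>b y - avg M b (ball x \<gamma>)\<bar>)) * indicator (ball x \<gamma>) y) \<partial>M)"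
    proof (rule nn_integral_mono)
      fix y
      have "h y \<le> 2 * D * A + \<bar>b y - avg M b (ball x \<gamma>)\<bar>" using ab by (simp add: h_def)
      then have "t * h y \<le> t * (2 * D * A) + t * \<bar>b y - avg M b (ball x \<gamma>)\<bar>"
        using t0 by (metis distrib_left mult_le_cancel_left_pos)
      then have "exp (t * h y) \<le> 3 / 2 * exp (t * \<bar>b y - avg M b (ball x \<gamma>)\<bar>)"
        unfolding t1[symmetric] by (simp add: exp_add[symmetric])
      then show "ennreal (exp (t * h y)) * indicator (ball x \<gamma>) y
          \<le> ennreal (3 / 2) * (ennreal (exp (t * \<bar>b y - avg M b (ball x \<gamma>)\<bar>)) * indicator (ball x \<gamma>) y)"
        by (simp add: mult.assoc[symmetric] ennreal_mult[symmetric] mult_right_mono ennreal_leI)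
    qed
    also have "\<dots> = ennreal (3 / 2) * (\<integral>\<^sup>+ y. ennreal (exp (t * \<bar>b y - avg M b (ball x \<gamma>)\<bar>)) * indicator (ball x \<gamma>) y \<partial>M)"
      by (rule nn_integral_cmult) measurable
    also have "\<dots> \<le> ennreal (3 / 2) * (ennreal v * emeasure M (ball x \<gamma>))" by (intro mult_left_mono IH) simp
    also have "\<dots> = (\<integral>\<^sup>+ y. ennreal (3 / 2 * v) * indicator (ball x \<gamma>) y \<partial>M)"
    proof -
      have e: "ennreal (3 / 2 * v) = ennreal (3 / 2) * ennreal v" using v by (intro ennreal_mult) auto
      show ?thesis unfolding e by (subst nn_integral_cmult_indicator) (simp_all only: ball_in_sets mult.assoc)
    qed
    finally show "(\<integral>\<^sup>+ y. ennreal (exp (t * h y)) * indicator (ball x \<gamma>) y \<partial>M) \<le> (\<integral>\<^sup>+ y. ennreal (3 / 2 * v) * indicator (ball x \<gamma>) y \<partial>M)" .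
  qed (use inv in auto)
  have mE: "emeasure M E \<le> ennreal (1 / 2) * emeasure M B"
  proof -
    have "(\<integral>\<^sup>+ y. ennreal (2 * A) * indicator E y \<partial>M) \<le> (\<integral>\<^sup>+ y. ennreal (h y) * indicator E y \<partial>M)"
      unfolding E_def
    proof (rule stopping_compare[of ?Q \<gamma>0])
      fix x \<gamma> assume "?Q x \<gamma>"
      then show "(\<integral>\<^sup>+ y. ennreal (2 * A) * indicator (ball x \<gamma>) y \<partial>M) \<le> (\<integral>\<^sup>+ y. ennreal (h y) * indicator (ball x \<gamma>) y \<partial>M)"
        unfolding hint_eq using A by (simp add: nn_integral_cmult_indicator emeasure_ball ennreal_mult[symmetric] ennreal_leI mult_right_mono)
    qed (use inv in auto)
    also have "\<dots> \<le> (\<integral>\<^sup>+ y. ennreal (h y) * indicator B y \<partial>M)"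
      using EB by (intro nn_integral_mono) (auto simp: indicator_def)
    also have "\<dots> \<le> ennreal (A * measure M B)"
      unfolding B_def hint_eq using hB by (intro ennreal_leI mult_right_mono) (auto simp: B_def)
    finally have "ennreal (2 * A) * emeasure M E \<le> ennreal (A * measure M B)"
      by (simp add: nn_integral_cmult_indicator)
    then have le: "ennreal (1 / (2 * A)) * (ennreal (2 * A) * emeasure M E) \<le> ennreal (1 / (2 * A)) * ennreal (A * measure M B)"
      by (rule mult_left_mono) simp
    have "emeasure M E = ennreal (1 / (2 * A) * (2 * A)) * emeasure M E" using A by simp
    also have "\<dots> = ennreal (1 / (2 * A)) * (ennreal (2 * A) * emeasure M E)"
      using A by (subst ennreal_mult) (auto simp: mult.assoc)
    also note le
    also have "ennreal (1 / (2 * A)) * ennreal (A * measure M B) = ennreal (1 / (2 * A) * (A * measure M B))"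
      using A by (intro ennreal_mult[symmetric]) auto
    also have "1 / (2 * A) * (A * measure M B) = 1 / 2 * measure M B" using A by simp
    also have "ennreal (1 / 2 * measure M B) = ennreal (1 / 2) * emeasure M B"
      unfolding B_def emeasure_ball by (rule ennreal_mult) auto
    finally show ?thesis .
  qed
  have out: "AE y in M. y \<in> B - E \<longrightarrow> h y \<le> 2 * A"
  proof -
    have "AE y in M. h y * indicator (B - E) y \<le> 2 * A"
    proof (rule AE_le_of_ball_integrals)
      fix x \<gamma>
      show "(\<integral>\<^sup>+ y. ennreal (h y * indicator (B - E) y) * indicator (ball x \<gamma>) y \<partial>M) \<le> ennreal (2 * A) * emeasure M (ball x \<gamma>)"
      proof (cases "\<exists>z. z \<in> ball x \<gamma> \<and> z \<in> B - E")
        case True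
        then obtain z where z: "z \<in> ball x \<gamma>" "z \<in> B" "z \<notin> E" by blast
        have be: "ball x \<gamma> = ball z \<gamma>" using ball_eq[OF z(1)] by simp
        show ?thesis
        proof (cases "\<gamma> \<le> \<gamma>0")
          case True
          then have "avg M h (ball z \<gamma>) \<le> 2 * A" using z by (force simp: E_def not_less)
          have "(\<integral>\<^sup>+ y. ennreal (h y * indicator (B - E) y) * indicator (ball x \<gamma>) y \<partial>M) \<le> (\<integral>\<^sup>+ y. ennreal (h y) * indicator (ball z \<gamma>) y \<partial>M)"
            unfolding be by (intro nn_integral_mono) (auto simp: indicator_def)
          also have "\<dots> \<le> ennreal (2 * A * measure M (ball z \<gamma>))"
            unfolding hint_eq using \<open>avg M h (ball z \<gamma>) \<le> 2 * A\<close> by (intro ennreal_leI mult_right_mono) auto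
          finally show ?thesis unfolding be emeasure_ball using A by (simp add: ennreal_mult)
        next
          case False
          have "(\<integral>\<^sup>+ y. ennreal (h y * indicator (B - E) y) * indicator (ball x \<gamma>) y \<partial>M) \<le> (\<integral>\<^sup>+ y. ennreal (h y) * indicator B y \<partial>M)"
            by (intro nn_integral_mono) (auto simp: indicator_def)
          also have "\<dots> \<le> ennreal (A * measure M B)"
            unfolding B_def hint_eq using hB by (intro ennreal_leI mult_right_mono) (auto simp: B_def)
          also have "\<dots> \<le> ennreal (2 * A * measure M (ball x \<gamma>))"
            using A D False by (intro ennreal_leI mult_mono) (auto simp: B_def measure_ball)
          finally show ?thesis unfolding emeasure_ball using A by (simp add: ennreal_mult)
        qed
      next
        case False
        then have "(\<integral>\<^sup>+ y. ennreal (h y * indicator (B - E) y) * indicator (ball x \<gamma>) y \<partial>M) = (\<integral>\<^sup>+ y. 0 \<partial>M)"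
          by (intro nn_integral_cong) (auto simp: indicator_def)
        then show ?thesis by simp
      qed
    qed (use A hnn in auto)
    then show ?thesis by eventually_elim (auto simp: indicator_def)
  qed
  have "(\<integral>\<^sup>+ y. ennreal (exp (t * h y)) * indicator B y \<partial>M)
      \<le> (\<integral>\<^sup>+ y. ennreal (exp (t * h y)) * indicator E y + ennreal (3 / 2) * indicator B y \<partial>M)"
  proof (rule nn_integral_mono_AE)
    show "AE y in M. ennreal (exp (t * h y)) * indicator B y \<le> ennreal (exp (t * h y)) * indicator E y + ennreal (3 / 2) * indicator B y"
      using out
    proof eventually_elim
      case (elim y)
      show ?case
      proof (cases "y \<in> B - E")
        case True
        then have "t * h y \<le> t * (2 * A)" using elim t0 by simp
        then have "exp (t * h y) \<le> 3 / 2" using t2 by (meson exp_le_cancel_iff order_trans)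
        then have "ennreal (exp (t * h y)) \<le> ennreal (3 / 2)" by (rule ennreal_leI)
        then show ?thesis using True by (simp add: indicator_def)
      qed (auto simp: indicator_def)
    qed
  qed
  also have "\<dots> = (\<integral>\<^sup>+ y. ennreal (exp (t * h y)) * indicator E y \<partial>M) + ennreal (3 / 2) * emeasure M B"
    by (subst nn_integral_add) (auto simp: nn_integral_cmult_indicator)
  also have "\<dots> \<le> ennreal (3 / 2 * v) * (ennreal (1 / 2) * emeasure M B) + ennreal (3 / 2) * emeasure M B"
  proof (rule add_mono)
    have "(\<integral>\<^sup>+ y. ennreal (exp (t * h y)) * indicator E y \<partial>M) \<le> ennreal (3 / 2 * v) * emeasure M E"
      using sE by (simp add: nn_integral_cmult_indicator)
    also have "\<dots> \<le> ennreal (3 / 2 * v) * (ennreal (1 / 2) * emeasure M B)" by (intro mult_left_mono mE) simp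
    finally show "(\<integral>\<^sup>+ y. ennreal (exp (t * h y)) * indicator E y \<partial>M) \<le> ennreal (3 / 2 * v) * (ennreal (1 / 2) * emeasure M B)" .
  qed simp
  also have "\<dots> = ennreal (3 / 2 + 3 / 4 * v) * emeasure M B"
  proof -
    have "ennreal (3 / 2 + 3 / 4 * v) = ennreal ((3 / 2 * v) * (1 / 2) + 3 / 2)" by (simp add: algebra_simps)
    also have "\<dots> = ennreal ((3 / 2 * v) * (1 / 2)) + ennreal (3 / 2)" by (rule ennreal_plus) (use v in auto)
    also have "ennreal ((3 / 2 * v) * (1 / 2)) = ennreal (3 / 2 * v) * ennreal (1 / 2)" by (rule ennreal_mult) (use v in auto)
    finally show ?thesis by (simp only: distrib_right mult.assoc)
  qed
  finally show ?thesis by (simp add: h_def bB_def B_def)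
qed

text \<open>Iterating the affine contraction leads to its fixed point 6. Boundedness of
  \<open>b\<close> enters through the finite starting value \<open>v0\<close> only, so the final
  bound is free of \<open>L\<close>.\<close>

lemma John_Nirenberg_bounded:
  fixes b :: "'a \<Rightarrow> real"
  assumes bm [measurable]: "b \<in> borel_measurable M"
    and int: "\<And>x \<gamma>. set_integrable M (ball x \<gamma>) b" and A: "0 < A"
    and osc: "\<And>x \<gamma>. avg M (\<lambda>y. \<bar>b y - avg M b (ball x \<gamma>)\<bar>) (ball x \<gamma>) \<le> A"
    and t: "t = ln (3 / 2) / (2 * D * A)"
    and L: "\<And>x. \<bar>b x\<bar> \<le> L"
  shows "(\<integral>\<^sup>+ y. ennreal (exp (t * \<bar>b y - avg M b (ball x \<gamma>)\<bar>)) * indicator (ball x \<gamma>) y \<partial>M)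
      \<le> 6 * emeasure M (ball x \<gamma>)"
proof -
  have D: "1 < D" by (rule D_gt_1)
  have t0: "0 < t" using A D by (simp add: t)
  define v0 where "v0 = exp (t * (2 * L))"
  have it: "(\<integral>\<^sup>+ y. ennreal (exp (t * \<bar>b y - avg M b (ball x \<gamma>)\<bar>)) * indicator (ball x \<gamma>) y \<partial>M)
      \<le> ennreal (6 + (3 / 4) ^ n * v0) * emeasure M (ball x \<gamma>)" for n x \<gamma>
  proof (induction n arbitrary: x \<gamma>)
    case 0
    let ?B = "ball x \<gamma>"
    have "avg M (\<lambda>y. \<bar>b y - 0\<bar>) ?B \<le> L"
    proof -
      have "(LINT y:?B|M. \<bar>b y - 0\<bar>) \<le> (LINT y:?B|M. L)"
        by (rule set_integral_mono[OF set_integrable_abs_diff[OF int]])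
          (use L finite_ball[of x \<gamma>] in \<open>auto simp: set_integrable_def integrable_mult_left_iff\<close>)
      also have "\<dots> = L * measure M ?B" by (simp add: set_lebesgue_integral_def)
      finally show ?thesis using measure_ball_pos[of x \<gamma>] by (simp add: avg_def divide_le_eq)
    qed
    then have "\<bar>avg M b ?B\<bar> \<le> L" using avg_abs_diff_le[OF int[of x \<gamma>], of 0] by simp
    then have "\<bar>b y - avg M b ?B\<bar> \<le> 2 * L" for y using L[of y] by linarith
    then have "exp (t * \<bar>b y - avg M b ?B\<bar>) \<le> v0" for y using t0 by (simp add: v0_def)
    then have "exp (t * \<bar>b y - avg M b ?B\<bar>) \<le> 6 + (3 / 4) ^ 0 * v0" for y by (simp add: add_increasing)
    then have "(\<integral>\<^sup>+ y. ennreal (exp (t * \<bar>b y - avg M b ?B\<bar>)) * indicator ?B y \<partial>M) \<le> (\<integral>\<^sup>+ y. ennreal (6 + (3 / 4) ^ 0 * v0) * indicator ?B y \<partial>M)"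
      by (intro nn_integral_mono mult_right_mono ennreal_leI) auto
    then show ?case by (simp add: nn_integral_cmult_indicator)
  next
    case (Suc n)
    have "0 \<le> 6 + (3 / 4) ^ n * v0" by (simp add: v0_def)
    note st = John_Nirenberg_step[OF bm int A this osc t Suc.IH, of x \<gamma>]
    have eq: "3 / 2 + 3 / 4 * (6 + (3 / 4) ^ n * v0) = 6 + (3 / 4) ^ Suc n * v0" by (simp add: algebra_simps)
    show ?case using st unfolding eq .
  qed
  show ?thesis
  proof (rule ennreal_le_epsilon)
    fix e :: real assume e: "0 < e"
    have v0: "0 < v0" by (simp add: v0_def)
    obtain n where n: "(3 / 4 :: real) ^ n < e / (v0 * measure M (ball x \<gamma>))"
      using real_arch_pow_inv[of "e / (v0 * measure M (ball x \<gamma>))" "3 / 4"] e measure_ball_pos[of x \<gamma>] v0 by auto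
    then have "(3 / 4) ^ n * v0 * measure M (ball x \<gamma>) \<le> e"
      using measure_ball_pos[of x \<gamma>] v0 by (simp add: field_simps)
    then have "ennreal (6 + (3 / 4) ^ n * v0) * emeasure M (ball x \<gamma>) \<le> 6 * emeasure M (ball x \<gamma>) + ennreal e"
      unfolding emeasure_ball using v0 e
      by (simp add: ennreal_mult[symmetric] ennreal_plus[symmetric] ennreal_numeral[symmetric] algebra_simps del: ennreal_plus ennreal_numeral)
    with it[of x \<gamma> n] show "(\<integral>\<^sup>+ y. ennreal (exp (t * \<bar>b y - avg M b (ball x \<gamma>)\<bar>)) * indicator (ball x \<gamma>) y \<partial>M)
      \<le> 6 * emeasure M (ball x \<gamma>) + ennreal e" by (rule order_trans)
  qed
qed

text \<open>Truncation of \<open>b\<close> and Fatou's lemma. Truncation is 1-Lipschitz, and the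
  oscillation of the truncated function about its own mean is at most twice that about the truncated
  mean of \<open>b\<close>; this doubling turns \<open>2 * D * A\<close> into
  \<open>4 * D * A\<close>.\<close>

theorem John_Nirenberg:
  fixes b :: "'a \<Rightarrow> real"
  assumes [measurable]: "b \<in> borel_measurable M"
    and int: "\<And>x \<gamma>. set_integrable M (ball x \<gamma>) b" and A: "0 < A"
    and osc: "\<And>x \<gamma>. avg M (\<lambda>y. \<bar>b y - avg M b (ball x \<gamma>)\<bar>) (ball x \<gamma>) \<le> A"
    and t: "t = ln (3 / 2) / (4 * D * A)"
  shows "(\<integral>\<^sup>+ y. ennreal (exp (t * \<bar>b y - avg M b (ball x \<gamma>)\<bar>)) * indicator (ball x \<gamma>) y \<partial>M)
      \<le> 6 * emeasure M (ball x \<gamma>)"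
proof -
  define T where "T = (\<lambda>n (s::real). max (- real n) (min (real n) s))"
  define bn where "bn = (\<lambda>n y. T n (b y))"
  have [measurable]: "bn n \<in> borel_measurable M" for n unfolding bn_def T_def by measurable
  have T1: "\<bar>T n s - T n s'\<bar> \<le> \<bar>s - s'\<bar>" for n s s' unfolding T_def by (auto simp: max_def min_def)
  have T2: "\<bar>T n s\<bar> \<le> \<bar>s\<bar>" "\<bar>T n s\<bar> \<le> real n" for n s unfolding T_def by (auto simp: max_def min_def)
  have T3: "(\<lambda>n. T n s) \<longlonglongrightarrow> s" for s
  proof (rule tendsto_eventually)
    have "\<forall>\<^sub>F n in sequentially. \<bar>s\<bar> \<le> real n" using eventually_ge_at_top[of "nat \<lceil>\<bar>s\<bar>\<rceil>"] by eventually_elim linarith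
    then show "\<forall>\<^sub>F n in sequentially. T n s = s" by eventually_elim (auto simp: T_def)
  qed
  have bint: "set_integrable M (ball x \<gamma>) (bn n)" for x \<gamma> n
    by (rule set_integrable_bound[OF int[of x \<gamma>]]) (use T2 in \<open>auto simp: bn_def[symmetric] set_borel_measurable_def, auto simp: bn_def\<close>)
  have osc2: "avg M (\<lambda>y. \<bar>bn n y - avg M (bn n) (ball x \<gamma>)\<bar>) (ball x \<gamma>) \<le> 2 * A" for n x \<gamma>
  proof -
    let ?B = "ball x \<gamma>" let ?c = "T n (avg M b ?B)" let ?a = "avg M (bn n) ?B"
    have m: "0 < measure M ?B" by (rule measure_ball_pos)
    have ci: "set_integrable M ?B (\<lambda>_. \<bar>?a - ?c\<bar>)"
      using finite_ball[of x \<gamma>] by (simp add: set_integrable_def integrable_mult_left_iff)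
    have "(LINT y:?B|M. \<bar>bn n y - ?a\<bar>) \<le> (LINT y:?B|M. \<bar>bn n y - ?c\<bar> + \<bar>?a - ?c\<bar>)"
      by (rule set_integral_mono[OF set_integrable_abs_diff[OF bint] set_integral_add(1)[OF set_integrable_abs_diff[OF bint] ci]]) auto
    also have "\<dots> = (LINT y:?B|M. \<bar>bn n y - ?c\<bar>) + \<bar>?a - ?c\<bar> * measure M ?B"
      by (subst set_integral_add(2)[OF set_integrable_abs_diff[OF bint] ci]) (simp add: set_lebesgue_integral_def)
    finally have "avg M (\<lambda>y. \<bar>bn n y - ?a\<bar>) ?B \<le> avg M (\<lambda>y. \<bar>bn n y - ?c\<bar>) ?B + \<bar>?a - ?c\<bar>"
      using m by (simp add: avg_def field_simps)
    also have "\<dots> \<le> 2 * avg M (\<lambda>y. \<bar>bn n y - ?c\<bar>) ?B" using avg_abs_diff_le[OF bint[of x \<gamma> n], of ?c] by simp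
    also have "avg M (\<lambda>y. \<bar>bn n y - ?c\<bar>) ?B \<le> avg M (\<lambda>y. \<bar>b y - avg M b ?B\<bar>) ?B"
      unfolding avg_def[of M "\<lambda>y. \<bar>bn n y - ?c\<bar>"] avg_def[of M "\<lambda>y. \<bar>b y - avg M b ?B\<bar>"]
      by (intro divide_right_mono set_integral_mono set_integrable_abs_diff bint int) (use T1 in \<open>auto simp: bn_def\<close>)
    also note osc
    finally show ?thesis by simp
  qed
  let ?B = "ball x \<gamma>"
  have lim_avg: "(\<lambda>n. avg M (bn n) ?B) \<longlonglongrightarrow> avg M b ?B"
  proof -
    have "(\<lambda>n. LINT y|M. indicator ?B y *\<^sub>R bn n y) \<longlonglongrightarrow> (LINT y|M. indicator ?B y *\<^sub>R b y)"
    proof (rule integral_dominated_convergence)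
      show "integrable M (\<lambda>y. norm (indicator ?B y *\<^sub>R b y))"
        using int[of x \<gamma>] unfolding set_integrable_def by (rule integrable_norm)
      show "AE y in M. (\<lambda>n. indicator ?B y *\<^sub>R bn n y) \<longlonglongrightarrow> indicator ?B y *\<^sub>R b y"
        unfolding bn_def by (intro AE_I2 tendsto_intros T3)
      show "AE y in M. norm (indicator ?B y *\<^sub>R bn n y) \<le> norm (indicator ?B y *\<^sub>R b y)" for n
        using T2(1) by (auto simp: bn_def indicator_def)
    qed measurable
    then show ?thesis unfolding avg_def set_lebesgue_integral_def
      by (intro tendsto_divide tendsto_const) (use measure_ball_pos[of x \<gamma>] in auto)
  qed
  have "(\<integral>\<^sup>+ y. ennreal (exp (t * \<bar>b y - avg M b ?B\<bar>)) * indicator ?B y \<partial>M)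
      = (\<integral>\<^sup>+ y. liminf (\<lambda>n. ennreal (exp (t * \<bar>bn n y - avg M (bn n) ?B\<bar>)) * indicator ?B y) \<partial>M)"
  proof (rule nn_integral_cong)
    fix y
    have "(\<lambda>n. ennreal (exp (t * \<bar>bn n y - avg M (bn n) ?B\<bar>) * indicator ?B y)) \<longlonglongrightarrow> ennreal (exp (t * \<bar>b y - avg M b ?B\<bar>) * indicator ?B y)"
    proof (intro tendsto_intros lim_avg)
      show "(\<lambda>n. bn n y) \<longlonglongrightarrow> b y" unfolding bn_def by (rule T3)
    qed
    then have "liminf (\<lambda>n. ennreal (exp (t * \<bar>bn n y - avg M (bn n) ?B\<bar>) * indicator ?B y)) = ennreal (exp (t * \<bar>b y - avg M b ?B\<bar>) * indicator ?B y)"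
      by (intro lim_imp_Liminf) auto
    then show "ennreal (exp (t * \<bar>b y - avg M b ?B\<bar>)) * indicator ?B y
      = liminf (\<lambda>n. ennreal (exp (t * \<bar>bn n y - avg M (bn n) ?B\<bar>)) * indicator ?B y)"
      by (simp add: ennreal_mult' ennreal_indicator)
  qed
  also have "\<dots> \<le> liminf (\<lambda>n. (\<integral>\<^sup>+ y. ennreal (exp (t * \<bar>bn n y - avg M (bn n) ?B\<bar>)) * indicator ?B y \<partial>M))"
    by (rule nn_integral_liminf) measurable
  also have "\<dots> \<le> liminf (\<lambda>n. 6 * emeasure M ?B)"
  proof (intro Liminf_mono always_eventually allI)
    fix n
    show "(\<integral>\<^sup>+ y. ennreal (exp (t * \<bar>bn n y - avg M (bn n) ?B\<bar>)) * indicator ?B y \<partial>M) \<le> 6 * emeasure M ?B"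
    proof (rule John_Nirenberg_bounded[where A = "2 * A" and L = "real n"])
      show "\<bar>bn n y\<bar> \<le> real n" for y unfolding bn_def by (rule T2)
    qed (use bint osc2 A t in auto)
  qed
  also have "\<dots> = 6 * emeasure M ?B" by (simp add: Liminf_const)
  finally show ?thesis .
qed

end

section \<open>Maximal functions and variable exponents\<close>

text \<open>If \<open>s\<close> is at least \<open>(pb + n) powr (- n0)\<close>, then
  \<open>s powr (a - b)\<close> is bounded because the logarithm cancels; if \<open>s\<close> is
  smaller, \<open>s powr a \<le> s\<close> is itself below the error term.\<close>

lemma powr_compare:
  fixes s :: real
  assumes s: "0 \<le> s" "s \<le> 1" and a: "1 \<le> a" and n: "0 \<le> n" "0 \<le> n0" and pb: "1 < pb"
    and ab: "\<bar>a - b\<bar> \<le> C / log pb (pb + n)"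
  shows "s powr a \<le> pb powr (n0 * C) * s powr b + (pb + n) powr (- n0)"
proof (cases "s = 0")
  case False
  then have s0: "0 < s" using s by simp
  define R where "R = (pb + n) powr (- n0)"
  have R0: "0 < R" using pb n by (simp add: R_def)
  show ?thesis
  proof (cases "R \<le> s")
    case True
    have l: "0 < log pb (pb + n)" using pb n by simp
    have "s powr (a - b) \<le> s powr (- \<bar>a - b\<bar>)" using s s0 by (intro powr_mono') auto
    also have "\<dots> \<le> R powr (- \<bar>a - b\<bar>)" using True R0 by (intro powr_mono2') auto
    also have "\<dots> = (pb + n) powr (n0 * \<bar>a - b\<bar>)" by (simp add: R_def powr_powr)
    also have "\<dots> \<le> (pb + n) powr (n0 * (C / log pb (pb + n)))"
      using pb n ab by (intro powr_mono mult_left_mono) auto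
    also have "\<dots> = (pb powr log pb (pb + n)) powr (n0 * (C / log pb (pb + n)))"
      using pb n by simp
    also have "\<dots> = pb powr (n0 * C)" unfolding powr_powr using l by simp
    finally have "s powr (a - b) * s powr b \<le> pb powr (n0 * C) * s powr b" by (rule mult_right_mono) simp
    then have "s powr a \<le> pb powr (n0 * C) * s powr b" by (simp add: powr_add[symmetric])
    then show ?thesis by (rule order_trans) simp
  next
    case False
    have "s powr a \<le> s powr 1" using s s0 a by (intro powr_mono') auto
    also have "\<dots> \<le> R" using False s0 by simp
    finally show ?thesis unfolding R_def by (rule order_trans) simp
  qed
qed simp

locale normed_ball_space = ball_space ball M D for ball :: "'a \<Rightarrow> int \<Rightarrow> 'a set" and M D +
  fixes org :: 'a and nrm :: "'a \<Rightarrow> real" and pb :: real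
  assumes pb_gt_1: "1 < pb" and nrm_nonneg: "0 \<le> nrm x"
    and nrm_ball: "y \<in> ball org \<gamma> \<longleftrightarrow> nrm y \<le> pb powr real_of_int \<gamma>"
begin

text \<open>Locally \<open>P\<close> is compared with a constant rather than with its essential bounds, which makes the
  condition stable under Lipschitz maps; balls with \<open>\<gamma> \<ge> 0\<close> impose nothing beyond boundedness.\<close>

definition log_holder :: "('a \<Rightarrow> real) \<Rightarrow> real \<Rightarrow> real \<Rightarrow> bool" where
  "log_holder P lo hi \<longleftrightarrow> P \<in> borel_measurable M \<and> (AE x in M. lo \<le> P x \<and> P x \<le> hi) \<and>
    (\<exists>C\<ge>0. (\<forall>x \<gamma>. \<gamma> < 0 \<longrightarrow> (\<exists>c\<in>{lo..hi}. AE y in M. y \<in> ball x \<gamma> \<longrightarrow> \<bar>P y - c\<bar> \<le> C / real_of_int (- \<gamma>)))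
      \<and> (\<exists>c\<in>{lo..hi}. AE x in M. \<bar>P x - c\<bar> \<le> C / log pb (pb + nrm x)))"

text \<open>Serves for \<open>q\<close> as a function of \<open>r\<close> and for the dual exponent
  in the extrapolation; both are Lipschitz images of \<open>r\<close> on its range.\<close>

lemma log_holder_transform:
  assumes P: "log_holder P lo hi" and [measurable]: "P' \<in> borel_measurable M"
    and eq: "AE x in M. P' x = \<phi> (P x)" and L: "0 \<le> L"
    and lip: "\<And>s t. s \<in> {lo..hi} \<Longrightarrow> t \<in> {lo..hi} \<Longrightarrow> \<bar>\<phi> s - \<phi> t\<bar> \<le> L * \<bar>s - t\<bar>"
    and ran: "\<And>s. s \<in> {lo..hi} \<Longrightarrow> \<phi> s \<in> {lo'..hi'}"
  shows "log_holder P' lo' hi'"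
proof -
  from P obtain C where C: "0 \<le> C"
    "\<And>x \<gamma>. \<gamma> < 0 \<Longrightarrow> (\<exists>c\<in>{lo..hi}. AE y in M. y \<in> ball x \<gamma> \<longrightarrow> \<bar>P y - c\<bar> \<le> C / real_of_int (- \<gamma>))"
    "\<exists>c\<in>{lo..hi}. AE x in M. \<bar>P x - c\<bar> \<le> C / log pb (pb + nrm x)"
    and b: "AE x in M. lo \<le> P x \<and> P x \<le> hi" unfolding log_holder_def by blast
  have 1: "\<exists>c\<in>{lo'..hi'}. AE y in M. y \<in> ball x \<gamma> \<longrightarrow> \<bar>P' y - c\<bar> \<le> L * C / real_of_int (- \<gamma>)" if g: "\<gamma> < 0" for x \<gamma>
  proof -
    obtain c where c: "c \<in> {lo..hi}" "AE y in M. y \<in> ball x \<gamma> \<longrightarrow> \<bar>P y - c\<bar> \<le> C / real_of_int (- \<gamma>)"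
      using C(2)[OF g] by blast
    have "AE y in M. y \<in> ball x \<gamma> \<longrightarrow> \<bar>P' y - \<phi> c\<bar> \<le> L * C / real_of_int (- \<gamma>)"
      using c(2) b eq
    proof eventually_elim
      case (elim y)
      show ?case
      proof
        assume "y \<in> ball x \<gamma>"
        then have "\<bar>P y - c\<bar> \<le> C / real_of_int (- \<gamma>)" using elim by blast
        then have "L * \<bar>P y - c\<bar> \<le> L * (C / real_of_int (- \<gamma>))" by (rule mult_left_mono[OF _ L])
        moreover have "\<bar>P' y - \<phi> c\<bar> \<le> L * \<bar>P y - c\<bar>" using lip[of "P y" c] elim c by simp
        ultimately show "\<bar>P' y - \<phi> c\<bar> \<le> L * C / real_of_int (- \<gamma>)" by simp
      qed
    qed
    then show ?thesis using ran[OF c(1)] by blast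
  qed
  have 2: "\<exists>c\<in>{lo'..hi'}. AE x in M. \<bar>P' x - c\<bar> \<le> L * C / log pb (pb + nrm x)"
  proof -
    obtain c where c: "c \<in> {lo..hi}" "AE x in M. \<bar>P x - c\<bar> \<le> C / log pb (pb + nrm x)" using C(3) by blast
    have "AE x in M. \<bar>P' x - \<phi> c\<bar> \<le> L * C / log pb (pb + nrm x)"
      using c(2) b eq
    proof eventually_elim
      case (elim x)
      have "L * \<bar>P x - c\<bar> \<le> L * (C / log pb (pb + nrm x))" by (rule mult_left_mono[OF _ L]) (use elim in simp)
      moreover have "\<bar>P' x - \<phi> c\<bar> \<le> L * \<bar>P x - c\<bar>" using lip[of "P x" c] elim c by simp
      ultimately show ?case by simp
    qed
    then show ?thesis using ran[OF c(1)] by blast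
  qed
  have 3: "AE x in M. lo' \<le> P' x \<and> P' x \<le> hi'"
    using b eq by eventually_elim (use ran in fastforce)
  show ?thesis unfolding log_holder_def using 1 2 3 L C(1)
    by (intro conjI exI[of _ "L * C"]) auto
qed

text \<open>The integrable error committed when a variable exponent is replaced by its value at infinity.\<close>

definition decay :: "'a \<Rightarrow> ennreal" where
  "decay x = (\<Sum>k. ennreal (2 * D) * (ennreal (1 / (2 * D)) ^ k * indicator (ball org (int k)) x))"

lemma decay_measurable [measurable]: "decay \<in> borel_measurable M"
  unfolding decay_def by measurable

lemma decay_finite: "(\<integral>\<^sup>+ x. decay x \<partial>M) < \<infinity>"
proof -
  have D: "1 < D" by (rule D_gt_1)
  have "(\<integral>\<^sup>+ x. decay x \<partial>M) = (\<Sum>k. \<integral>\<^sup>+ x. ennreal (2 * D) * (ennreal (1 / (2 * D)) ^ k * indicator (ball org (int k)) x) \<partial>M)"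
    unfolding decay_def by (rule nn_integral_suminf) measurable
  also have "\<dots> = (\<Sum>k. ennreal (2 * D * (1 / 2) ^ k))"
  proof (intro suminf_cong)
    fix k
    have "(\<integral>\<^sup>+ x. ennreal (2 * D) * (ennreal (1 / (2 * D)) ^ k * indicator (ball org (int k)) x) \<partial>M)
        = ennreal (2 * D) * (ennreal (1 / (2 * D)) ^ k * emeasure M (ball org (int k)))"
    proof -
      have "(\<integral>\<^sup>+ x. ennreal (2 * D) * (ennreal (1 / (2 * D)) ^ k * indicator (ball org (int k)) x) \<partial>M)
          = ennreal (2 * D) * (\<integral>\<^sup>+ x. ennreal (1 / (2 * D)) ^ k * indicator (ball org (int k)) x \<partial>M)"
        by (rule nn_integral_cmult) measurable
      then show ?thesis by (simp only: nn_integral_cmult_indicator ball_in_sets)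
    qed
    also have "\<dots> = ennreal (2 * D * ((1 / (2 * D)) ^ k * D ^ k))"
      using D by (simp add: emeasure_ball_powr powr_realpow ennreal_power ennreal_mult[symmetric])
    also have "2 * D * ((1 / (2 * D)) ^ k * D ^ k) = 2 * D * (1 / 2) ^ k"
    proof -
      have "(1 / (2 * D)) ^ k * D ^ k = (1 / (2 * D) * D) ^ k" by (simp only: power_mult_distrib)
      then show ?thesis using D by simp
    qed
    finally show "(\<integral>\<^sup>+ x. ennreal (2 * D) * (ennreal (1 / (2 * D)) ^ k * indicator (ball org (int k)) x) \<partial>M) = ennreal (2 * D * (1 / 2) ^ k)" .
  qed
  also have "\<dots> < \<infinity>"
  proof -
    have "summable (\<lambda>k. 2 * D * (1 / 2 :: real) ^ k)" by (intro summable_mult summable_geometric) simp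
    then show ?thesis using D by (subst suminf_ennreal2) auto
  qed
  finally show ?thesis .
qed

text \<open>The exponent is chosen so that the power falls by the factor \<open>2 * D\<close> from
  one sphere to the next, while the measure of the balls grows by \<open>D\<close> only. The extra
  factor \<open>2 * D\<close> in \<open>decay\<close> pays for estimating the norm on a sphere by
  that of the sphere below.\<close>

lemma powr_le_decay: "ennreal ((pb + nrm x) powr (- log pb (2 * D))) \<le> decay x"
proof -
  have D: "1 < D" by (rule D_gt_1)
  have pb: "1 < pb" by (rule pb_gt_1)
  have ex: "\<exists>k::nat. nrm x \<le> pb ^ k" using real_arch_pow[OF pb, of "nrm x"] by (meson less_imp_le)
  define k where "k = (LEAST k. nrm x \<le> pb ^ k)"
  have k: "nrm x \<le> pb ^ k" unfolding k_def by (rule LeastI_ex[OF ex])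
  have "x \<in> ball org (int k)" using k pb by (simp add: nrm_ball powr_realpow)
  then have term_le: "ennreal (2 * D) * ennreal (1 / (2 * D)) ^ k \<le> decay x"
  proof -
    assume x: "x \<in> ball org (int k)"
    have "(\<Sum>i\<in>{k}. ennreal (2 * D) * (ennreal (1 / (2 * D)) ^ i * indicator (ball org (int i)) x)) \<le> decay x"
      unfolding decay_def by (rule sum_le_suminf) auto
    then show ?thesis using x by simp
  qed
  have "(pb + nrm x) powr (- log pb (2 * D)) \<le> 2 * D * (1 / (2 * D)) ^ k"
  proof (cases k)
    case 0
    have "(pb + nrm x) powr (- log pb (2 * D)) \<le> (pb + nrm x) powr 0"
      using pb nrm_nonneg[of x] D by (intro powr_mono) auto
    also have "\<dots> \<le> 2 * D * (1 / (2 * D)) ^ k" using 0 D pb nrm_nonneg[of x] by simp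
    finally show ?thesis .
  next
    case (Suc j)
    have "\<not> nrm x \<le> pb ^ j" using not_less_Least[of j "\<lambda>k. nrm x \<le> pb ^ k"] Suc unfolding k_def by auto
    then have "(pb + nrm x) powr (- log pb (2 * D)) \<le> (pb ^ j) powr (- log pb (2 * D))"
      using pb D nrm_nonneg[of x] by (intro powr_mono2') auto
    also have "\<dots> = (pb powr log pb (2 * D)) powr (- real j)"
    proof -
      have e: "pb ^ j = pb powr real j" using pb by (simp add: powr_realpow)
      show ?thesis unfolding e powr_powr by (simp add: mult.commute)
    qed
    also have "\<dots> = (1 / (2 * D)) ^ j"
    proof -
      have e: "pb powr log pb (2 * D) = 2 * D" using pb D by simp
      show ?thesis unfolding e using D by (simp add: powr_minus_divide powr_realpow power_one_over)
    qed
    also have "\<dots> = 2 * D * (1 / (2 * D)) ^ k" using Suc D by simp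
    finally show ?thesis .
  qed
  then have "ennreal ((pb + nrm x) powr (- log pb (2 * D))) \<le> ennreal (2 * D * (1 / (2 * D)) ^ k)" by (rule ennreal_leI)
  also have "\<dots> = ennreal (2 * D) * ennreal (1 / (2 * D)) ^ k" using D by (simp add: ennreal_mult ennreal_power)
  also note term_le
  finally show ?thesis .
qed

section \<open>Boundedness of the maximal operator for variable exponents\<close>

lemma avg_powr_le_ge1:
  assumes [measurable]: "f \<in> borel_measurable M" and nn: "\<And>x. 0 \<le> f x" and p: "1 \<le> p"
  shows "ennreal (avg M f (ball x \<gamma>) powr p * measure M (ball x \<gamma>))
    \<le> (\<integral>\<^sup>+ y. ennreal (f y powr p) * indicator (ball x \<gamma>) y \<partial>M)"
proof (cases "p = 1")
  case True
  show ?thesis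
  proof (cases "avg M f (ball x \<gamma>) = 0")
    case False
    from nn_integral_ball_avg[OF avg_integrable[OF False] nn measure_ball_pos]
    show ?thesis using True nn avg_nonneg[of f, OF nn] by simp
  qed simp
next
  case False
  then show ?thesis using avg_powr_le[OF assms(1) nn] p by simp
qed

text \<open>Diening's pointwise estimate for functions without small nonzero values, whose powers
  increase with the exponent. Jensen is applied with a lower bound \<open>m\<close> of
  \<open>P\<close> on the ball. The leftover power \<open>Y powr e\<close> is bounded since the
  modular gives \<open>Y \<le> D powr (- \<gamma>)\<close> and local log-Hoelder continuity gives
  \<open>e \<le> 2 * C / (- \<gamma>)\<close>.\<close>

lemma avg_large_modular:
  fixes f P :: "'a \<Rightarrow> real"
  assumes [measurable]: "f \<in> borel_measurable M" "P \<in> borel_measurable M"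
    and f01: "\<And>x. f x = 0 \<or> 1 \<le> f x" and lo: "1 \<le> lo"
    and b: "AE x in M. lo \<le> P x \<and> P x \<le> hi" and C: "0 \<le> C"
    and loc: "\<And>x \<gamma>. \<gamma> < 0 \<Longrightarrow> (\<exists>c\<in>{lo..hi}. AE y in M. y \<in> ball x \<gamma> \<longrightarrow> \<bar>P y - c\<bar> \<le> C / real_of_int (- \<gamma>))"
    and mod: "(\<integral>\<^sup>+ x. ennreal (f x powr P x) \<partial>M) \<le> 1"
  shows "AE x in M. \<forall>\<gamma>. avg M f (ball x \<gamma>) powr P x
    \<le> D powr (2 * C) * avg M (\<lambda>x. f x powr (P x / lo)) (ball x \<gamma>) powr lo"
proof -
  have D: "1 < D" by (rule D_gt_1)
  define g where "g = (\<lambda>x. f x powr (P x / lo))"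
  have [measurable]: "g \<in> borel_measurable M" unfolding g_def by measurable
  have gnn: "0 \<le> g x" for x by (simp add: g_def)
  have fnn: "0 \<le> f x" for x using f01[of x] by auto
  have fp: "f x powr s \<le> f x powr s'" if "s \<le> s'" for x s s'
    using f01[of x] that by (auto intro: powr_mono)
  have gP: "AE x in M. g x \<le> f x powr P x"
    using b
  proof eventually_elim
    case (elim x)
    then have "P x / lo \<le> P x" using lo by (simp add: divide_le_eq mult_le_cancel_left1)
    then show ?case unfolding g_def by (rule fp)
  qed
  have gB: "(\<integral>\<^sup>+ y. ennreal (g y) * indicator (ball x \<gamma>) y \<partial>M) \<le> 1" for x \<gamma>
  proof -
    have "(\<integral>\<^sup>+ y. ennreal (g y) * indicator (ball x \<gamma>) y \<partial>M) \<le> (\<integral>\<^sup>+ y. ennreal (f y powr P y) \<partial>M)"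
      by (rule nn_integral_mono_AE) (use gP in eventually_elim, auto simp: indicator_def intro: ennreal_leI)
    then show ?thesis using mod by simp
  qed
  have gint: "set_integrable M (ball x \<gamma>) g" for x \<gamma>
    unfolding set_integrable_def
  proof (rule integrableI_bounded)
    have "(\<integral>\<^sup>+ y. ennreal (norm (indicator (ball x \<gamma>) y *\<^sub>R g y)) \<partial>M) = (\<integral>\<^sup>+ y. ennreal (g y) * indicator (ball x \<gamma>) y \<partial>M)"
      by (intro nn_integral_cong) (auto simp: indicator_def gnn)
    then show "(\<integral>\<^sup>+ y. ennreal (norm (indicator (ball x \<gamma>) y *\<^sub>R g y)) \<partial>M) < \<infinity>" using gB[of x \<gamma>] by (auto intro: le_less_trans)
  qed measurable
  have "AE x in M. x \<in> ball z \<gamma> \<longrightarrow> avg M f (ball z \<gamma>) powr P x \<le> D powr (2 * C) * avg M g (ball z \<gamma>) powr lo" for z \<gamma>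
  proof -
    let ?B = "ball z \<gamma>"
    define Y where "Y = avg M g ?B"
    define t where "t = avg M f ?B"
    have m0: "0 < measure M ?B" by (rule measure_ball_pos)
    have Y0: "0 \<le> Y" unfolding Y_def by (rule avg_nonneg[OF gnn])
    have t0: "0 \<le> t" unfolding t_def by (rule avg_nonneg[OF fnn])
    have Yeq: "(\<integral>\<^sup>+ y. ennreal (g y) * indicator ?B y \<partial>M) = ennreal (Y * measure M ?B)"
      unfolding Y_def by (rule nn_integral_ball_avg[OF gint gnn m0])
    then have "Y * measure M ?B \<le> 1" using gB[of z \<gamma>] by simp
    then have YD: "Y \<le> D powr real_of_int (- \<gamma>)" using m0 D by (simp add: measure_ball powr_minus field_simps)
    obtain m where m: "lo \<le> m" "AE y in M. y \<in> ?B \<longrightarrow> m \<le> P y \<and> (\<gamma> < 0 \<longrightarrow> P y \<le> m + 2 * C / real_of_int (- \<gamma>))"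
    proof (cases "\<gamma> < 0")
      case True
      obtain c where c: "c \<in> {lo..hi}" "AE y in M. y \<in> ?B \<longrightarrow> \<bar>P y - c\<bar> \<le> C / real_of_int (- \<gamma>)"
        using loc[OF True] by blast
      have "AE y in M. y \<in> ?B \<longrightarrow> max lo (c - C / real_of_int (- \<gamma>)) \<le> P y \<and> (\<gamma> < 0 \<longrightarrow> P y \<le> max lo (c - C / real_of_int (- \<gamma>)) + 2 * C / real_of_int (- \<gamma>))"
        using c(2) b
      proof eventually_elim
        case (elim y)
        have e2: "2 * C / real_of_int (- \<gamma>) = C / real_of_int (- \<gamma>) + C / real_of_int (- \<gamma>)" by simp
        show ?case unfolding e2 using elim by auto
      qed
      then show ?thesis using that[of "max lo (c - C / real_of_int (- \<gamma>))"] by simp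
    next
      case False
      have "AE y in M. y \<in> ?B \<longrightarrow> lo \<le> P y \<and> (\<gamma> < 0 \<longrightarrow> P y \<le> lo + 2 * C / real_of_int (- \<gamma>))"
        using b False by auto
      then show ?thesis using that[of lo] by simp
    qed
    have mlo: "1 \<le> m / lo" using m lo by simp
    have tY: "t powr (m / lo) \<le> Y"
    proof -
      have "ennreal (t powr (m / lo) * measure M ?B) \<le> (\<integral>\<^sup>+ y. ennreal (f y powr (m / lo)) * indicator ?B y \<partial>M)"
        unfolding t_def by (rule avg_powr_le_ge1) (use fnn mlo in auto)
      also have "\<dots> \<le> (\<integral>\<^sup>+ y. ennreal (g y) * indicator ?B y \<partial>M)"
      proof (rule nn_integral_mono_AE)
        show "AE y in M. ennreal (f y powr (m / lo)) * indicator ?B y \<le> ennreal (g y) * indicator ?B y"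
          using m(2)
        proof eventually_elim
          case (elim y)
          show ?case
          proof (cases "y \<in> ?B")
            case True
            then have "m / lo \<le> P y / lo" using elim lo by (simp add: divide_right_mono)
            then show ?thesis using True fp by (simp add: g_def ennreal_leI)
          qed simp
        qed
      qed
      finally show ?thesis unfolding Yeq using m0 Y0 by (simp add: ennreal_le_iff)
    qed
    show ?thesis
      using m(2)
    proof eventually_elim
      case (elim y)
      show ?case
      proof
        assume y: "y \<in> ?B"
        then have P: "m \<le> P y" "\<gamma> < 0 \<Longrightarrow> P y \<le> m + 2 * C / real_of_int (- \<gamma>)" using elim by auto
        have "t powr P y \<le> D powr (2 * C) * Y powr lo"
        proof (cases "t = 0")
          case False
          then have "0 < t" using t0 by simp
          then have Yp: "0 < Y" using tY less_le_trans[of 0 "t powr (m / lo)" Y] by simp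
          define e where "e = lo * (P y - m) / m"
          have mpos: "0 < m" "0 < lo" using m lo by auto
          have e0: "0 \<le> e" using P mpos by (simp add: e_def)
          have eP: "e \<le> P y - m"
          proof -
            have "lo / m \<le> 1" using m mpos by simp
            then have "lo / m * (P y - m) \<le> 1 * (P y - m)" using P by (intro mult_right_mono) auto
            then show ?thesis by (simp add: e_def)
          qed
          have "t powr P y = (t powr (m / lo)) powr (lo * P y / m)"
            using mpos by (simp add: powr_powr)
          also have "\<dots> \<le> Y powr (lo * P y / m)"
            using tY mpos P by (intro powr_mono2) auto
          also have "lo * P y / m = lo + e" using mpos by (simp add: e_def field_simps)
          also have "Y powr (lo + e) = Y powr e * Y powr lo" by (simp add: powr_add)
          also have "\<dots> \<le> D powr (2 * C) * Y powr lo"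
          proof (rule mult_right_mono)
            show "Y powr e \<le> D powr (2 * C)"
            proof (cases "Y \<le> 1")
              case True
              then have "Y powr e \<le> 1" using Yp e0 by (intro powr_le1) auto
              also have "1 \<le> D powr (2 * C)" using D C by (intro ge_one_powr_ge_zero) auto
              finally show ?thesis .
            next
              case False
              \<comment> \<open>Only balls of negative level can have \<open>Y > 1\<close>; this is
                why the local condition concerns negative levels alone.\<close>
              have g: "\<gamma> < 0"
              proof (rule ccontr)
                assume "\<not> \<gamma> < 0"
                then have "D powr real_of_int (- \<gamma>) \<le> D powr 0" using D by (intro powr_mono) auto
                then show False using YD False D by simp
              qed
              have "Y powr e \<le> (D powr real_of_int (- \<gamma>)) powr e" using YD Y0 e0 by (intro powr_mono2) auto
              also have "\<dots> = D powr (real_of_int (- \<gamma>) * e)" by (simp add: powr_powr)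
              also have "\<dots> \<le> D powr (2 * C)"
              proof (rule powr_mono)
                have "real_of_int (- \<gamma>) * e \<le> real_of_int (- \<gamma>) * (2 * C / real_of_int (- \<gamma>))"
                  using eP P(2)[OF g] g by (intro mult_left_mono) auto
                then show "real_of_int (- \<gamma>) * e \<le> 2 * C" using g by simp
              qed (use D in simp)
              finally show ?thesis .
            qed
          qed simp
          finally show ?thesis .
        qed simp
        then show "avg M f ?B powr P y \<le> D powr (2 * C) * avg M g ?B powr lo" by (simp add: t_def Y_def)
      qed
    qed
  qed
  then have "AE x in M. \<forall>B\<in>range (\<lambda>(x, \<gamma>). ball x \<gamma>). x \<in> B \<longrightarrow> avg M f B powr P x \<le> D powr (2 * C) * avg M g B powr lo"
    by (subst AE_ball_countable[OF countable_balls]) auto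
  then show ?thesis unfolding g_def
    by eventually_elim (use ball_self in auto)
qed

lemma set_integrable_of_modular:
  fixes f P :: "'a \<Rightarrow> real"
  assumes [measurable]: "f \<in> borel_measurable M" "P \<in> borel_measurable M"
    and fnn: "\<And>x. 0 \<le> f x" and b: "AE x in M. 1 \<le> P x"
    and mod: "(\<integral>\<^sup>+ x. ennreal (f x powr P x) \<partial>M) < \<infinity>"
  shows "set_integrable M (ball x \<gamma>) f"
  unfolding set_integrable_def
proof (rule integrableI_bounded)
  have "(\<integral>\<^sup>+ y. ennreal (norm (indicator (ball x \<gamma>) y *\<^sub>R f y)) \<partial>M)
      \<le> (\<integral>\<^sup>+ y. ennreal (f y powr P y) + indicator (ball x \<gamma>) y \<partial>M)"
  proof (rule nn_integral_mono_AE)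
    show "AE y in M. ennreal (norm (indicator (ball x \<gamma>) y *\<^sub>R f y)) \<le> ennreal (f y powr P y) + indicator (ball x \<gamma>) y"
      using b
    proof eventually_elim
      case (elim y)
      have "f y \<le> f y powr P y + 1"
      proof (cases "1 \<le> f y")
        case True
        then have "f y powr 1 \<le> f y powr P y" using elim by (intro powr_mono) auto
        then show ?thesis using True by simp
      qed (auto intro: add_increasing)
      then have "ennreal (f y) \<le> ennreal (f y powr P y) + 1"
        using ennreal_leI[of "f y" "f y powr P y + 1"] by (simp add: ennreal_plus)
      then show ?case using fnn[of y] by (auto simp: indicator_def)
    qed
  qed
  also have "\<dots> = (\<integral>\<^sup>+ y. ennreal (f y powr P y) \<partial>M) + emeasure M (ball x \<gamma>)"
    by (subst nn_integral_add) auto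
  also have "\<dots> < \<infinity>" using mod finite_ball[of x \<gamma>] by simp
  finally show "(\<integral>\<^sup>+ y. ennreal (norm (indicator (ball x \<gamma>) y *\<^sub>R f y)) \<partial>M) < \<infinity>" .
qed measurable

lemma avg_mono_add:
  assumes "set_integrable M (ball x \<gamma>) f1" "set_integrable M (ball x \<gamma>) f2"
  shows "avg M (\<lambda>y. f1 y + f2 y) (ball x \<gamma>) = avg M f1 (ball x \<gamma>) + avg M f2 (ball x \<gamma>)"
  unfolding avg_def using set_integral_add(2)[OF assms] by (simp add: add_divide_distrib)

text \<open>\<open>f\<close> is split at height 1. For the large part the pointwise estimate reduces
  everything to the maximal theorem with constant exponent \<open>lo\<close>, applied to
  \<open>f1\<close> to the power \<open>P / lo\<close>. The small part is compared with the exponent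
  \<open>c\<close> at infinity, at the price of the integrable function
  \<open>decay\<close>.\<close>

theorem maximal_modular:
  assumes P: "log_holder P lo hi" and lo: "1 < lo"
  shows "\<exists>K\<ge>0. \<forall>f N. f \<in> borel_measurable M \<longrightarrow> (\<forall>x. 0 \<le> f x) \<longrightarrow> (\<integral>\<^sup>+ x. ennreal (f x powr P x) \<partial>M) \<le> 1
    \<longrightarrow> (\<integral>\<^sup>+ x. ennreal (mx N (avg M f) x powr P x) \<partial>M) \<le> ennreal K"
proof -
  have D: "1 < D" by (rule D_gt_1)
  from P obtain C c where C: "0 \<le> C"
    "\<And>x \<gamma>. \<gamma> < 0 \<Longrightarrow> (\<exists>c\<in>{lo..hi}. AE y in M. y \<in> ball x \<gamma> \<longrightarrow> \<bar>P y - c\<bar> \<le> C / real_of_int (- \<gamma>))"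
    and c: "c \<in> {lo..hi}" "AE x in M. \<bar>P x - c\<bar> \<le> C / log pb (pb + nrm x)"
    and b: "AE x in M. lo \<le> P x \<and> P x \<le> hi" and [measurable]: "P \<in> borel_measurable M"
    unfolding log_holder_def by blast
  define E where "E = pb powr (log pb (2 * D) * C)"
  define S where "S = (\<lambda>p::real. p * 2 powr p / (p - 1))"
  have S0: "0 \<le> S p" if "1 < p" for p using that by (simp add: S_def)
  obtain R0 where R0: "0 \<le> R0" "(\<integral>\<^sup>+ x. decay x \<partial>M) = ennreal R0"
    using decay_finite by (cases "\<integral>\<^sup>+ x. decay x \<partial>M") auto
  define K1 where "K1 = (D powr (2 * C)) * S lo"
  define K2 where "K2 = E * (S c * (E + R0)) + R0"
  have c1: "1 < c" using c lo by simp
  have E0: "0 \<le> E" by (simp add: E_def)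
  \<comment> \<open>Both directions are used: \<open>f2\<close> passes to the exponent
    \<open>c\<close> before the maximal theorem is applied, and its maximal function passes back to
    \<open>P\<close> afterwards.\<close>
  have cmp: "AE x in M. \<forall>s. 0 \<le> s \<longrightarrow> s \<le> 1 \<longrightarrow> ennreal (s powr P x) \<le> ennreal E * ennreal (s powr c) + decay x
      \<and> ennreal (s powr c) \<le> ennreal E * ennreal (s powr P x) + decay x"
    using c(2) b
  proof eventually_elim
    case (elim x)
    have n0: "0 \<le> log pb (2 * D)" using pb_gt_1 D by simp
    show ?case
    proof (intro allI impI conjI)
      fix s :: real assume s: "0 \<le> s" "s \<le> 1"
      have u: "s powr P x \<le> E * s powr c + (pb + nrm x) powr (- log pb (2 * D))"
        unfolding E_def using elim lo by (intro powr_compare s nrm_nonneg n0 pb_gt_1) auto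
      have v: "s powr c \<le> E * s powr P x + (pb + nrm x) powr (- log pb (2 * D))"
        unfolding E_def using elim c1 by (intro powr_compare s nrm_nonneg n0 pb_gt_1) (auto simp: abs_minus_commute)
      have "ennreal (s powr P x) \<le> ennreal E * ennreal (s powr c) + ennreal ((pb + nrm x) powr (- log pb (2 * D)))"
        using ennreal_leI[OF u] E0 by (simp add: ennreal_mult)
      then show "ennreal (s powr P x) \<le> ennreal E * ennreal (s powr c) + decay x"
        using powr_le_decay[of x] by (meson add_left_mono order_trans)
      have "ennreal (s powr c) \<le> ennreal E * ennreal (s powr P x) + ennreal ((pb + nrm x) powr (- log pb (2 * D)))"
        using ennreal_leI[OF v] E0 by (simp add: ennreal_mult)
      then show "ennreal (s powr c) \<le> ennreal E * ennreal (s powr P x) + decay x"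
        using powr_le_decay[of x] by (meson add_left_mono order_trans)
    qed
  qed
  have main: "(\<integral>\<^sup>+ x. ennreal (mx N (avg M f) x powr P x) \<partial>M) \<le> ennreal (2 powr hi * (K1 + K2))"
    if [measurable]: "f \<in> borel_measurable M" and fnn: "\<And>x. 0 \<le> f x"
      and mod: "(\<integral>\<^sup>+ x. ennreal (f x powr P x) \<partial>M) \<le> 1" for f N
  proof -
    define f1 where "f1 = (\<lambda>x. if 1 \<le> f x then f x else 0)"
    define f2 where "f2 = (\<lambda>x. if 1 \<le> f x then 0 else f x)"
    have [measurable]: "f1 \<in> borel_measurable M" "f2 \<in> borel_measurable M" unfolding f1_def f2_def by measurable
    have nn: "0 \<le> f1 x" "0 \<le> f2 x" "f2 x \<le> 1" "f1 x = 0 \<or> 1 \<le> f1 x" for x using fnn[of x] by (auto simp: f1_def f2_def)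
    have fsum: "f = (\<lambda>x. f1 x + f2 x)" by (auto simp: f1_def f2_def)
    have mod1: "(\<integral>\<^sup>+ x. ennreal (f1 x powr P x) \<partial>M) \<le> 1" 
      by (rule order_trans[OF _ mod]) (auto intro!: nn_integral_mono ennreal_leI simp: f1_def)
    have mod2: "(\<integral>\<^sup>+ x. ennreal (f2 x powr P x) \<partial>M) \<le> 1"
      by (rule order_trans[OF _ mod]) (auto intro!: nn_integral_mono ennreal_leI simp: f2_def)
    have b1: "AE x in M. 1 \<le> P x" using b by eventually_elim (use lo in auto)
    have i1: "set_integrable M (ball x \<gamma>) f1" for x \<gamma>
      by (rule set_integrable_of_modular[OF _ _ _ b1]) (use nn mod1 in \<open>auto intro: le_less_trans\<close>)
    have i2: "set_integrable M (ball x \<gamma>) f2" for x \<gamma>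
      by (rule set_integrable_of_modular[OF _ _ _ b1]) (use nn mod2 in \<open>auto intro: le_less_trans\<close>)
    define m1 where "m1 = mx N (avg M f1)"
    define m2 where "m2 = mx N (avg M f2)"
    have [measurable]: "m1 \<in> borel_measurable M" "m2 \<in> borel_measurable M" unfolding m1_def m2_def by auto
    have mnn: "0 \<le> m1 x" "0 \<le> m2 x" for x unfolding m1_def m2_def by (auto intro!: mx_nonneg avg_nonneg nn)
    have sum: "mx N (avg M f) x \<le> m1 x + m2 x" for x
      unfolding mx_le_iff
    proof
      fix \<gamma> assume g: "\<gamma> \<in> {- int N..int N}"
      show "avg M f (ball x \<gamma>) \<le> m1 x + m2 x"
        unfolding fsum avg_mono_add[OF i1 i2] m1_def m2_def by (intro add_mono mx_ge g)
    qed
    have I1: "(\<integral>\<^sup>+ x. ennreal (m1 x powr P x) \<partial>M) \<le> ennreal K1"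
    proof -
      let ?g = "\<lambda>x. f1 x powr (P x / lo)"
      have "(\<integral>\<^sup>+ x. ennreal (m1 x powr P x) \<partial>M) \<le> (\<integral>\<^sup>+ x. ennreal (D powr (2 * C)) * ennreal (mx N (avg M ?g) x powr lo) \<partial>M)"
      proof (rule nn_integral_mono_AE)
        have lo1: "1 \<le> lo" using lo by simp
        have "AE x in M. \<forall>\<gamma>. avg M f1 (ball x \<gamma>) powr P x \<le> D powr (2 * C) * avg M ?g (ball x \<gamma>) powr lo"
          by (rule avg_large_modular[OF _ _ nn(4) lo1 b C mod1]) auto
        then show "AE x in M. ennreal (m1 x powr P x) \<le> ennreal (D powr (2 * C)) * ennreal (mx N (avg M ?g) x powr lo)"
        proof eventually_elim
          case (elim x)
          obtain \<gamma> where g: "\<gamma> \<in> {- int N..int N}" "m1 x = avg M f1 (ball x \<gamma>)" unfolding m1_def by (rule mx_attained)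
          have "m1 x powr P x \<le> D powr (2 * C) * avg M ?g (ball x \<gamma>) powr lo" unfolding g(2) using elim by blast
          also have "\<dots> \<le> D powr (2 * C) * mx N (avg M ?g) x powr lo"
            using lo g(1) by (intro mult_left_mono powr_mono2 mx_ge avg_nonneg) auto
          finally show ?case using ennreal_leI by (simp add: ennreal_mult[symmetric])
        qed
      qed
      also have "\<dots> = ennreal (D powr (2 * C)) * (\<integral>\<^sup>+ x. ennreal (mx N (avg M ?g) x powr lo) \<partial>M)"
        by (rule nn_integral_cmult) measurable
      also have "\<dots> \<le> ennreal (D powr (2 * C)) * (ennreal (S lo) * (\<integral>\<^sup>+ x. ennreal (?g x powr lo) \<partial>M))"
        unfolding S_def by (intro mult_left_mono maximal_strong_type) (use lo in auto)
      also have "(\<integral>\<^sup>+ x. ennreal (?g x powr lo) \<partial>M) = (\<integral>\<^sup>+ x. ennreal (f1 x powr P x) \<partial>M)"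
        using lo by (simp add: powr_powr)
      also have "ennreal (D powr (2 * C)) * (ennreal (S lo) * \<dots>) \<le> ennreal (D powr (2 * C)) * (ennreal (S lo) * 1)"
        by (intro mult_left_mono mod1) auto
      finally show ?thesis using S0[OF lo] by (simp add: K1_def ennreal_mult)
    qed
    \<comment> \<open>The comparison of exponents is valid on the unit interval only, so the maximal
      function has to stay in it.\<close>
    have m2_le: "m2 x \<le> 1" for x
      unfolding m2_def mx_le_iff
    proof
      fix \<gamma>
      have "(LINT y:ball x \<gamma>|M. f2 y) \<le> (LINT y:ball x \<gamma>|M. 1)"
        by (rule set_integral_mono[OF i2]) (use nn finite_ball[of x \<gamma>] in \<open>auto simp: set_integrable_def\<close>)
      then show "avg M f2 (ball x \<gamma>) \<le> 1"
        using measure_ball_pos[of x \<gamma>] by (simp add: avg_def set_lebesgue_integral_def[of _ _ "\<lambda>_. 1"])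
    qed
    have I2: "(\<integral>\<^sup>+ x. ennreal (m2 x powr P x) \<partial>M) \<le> ennreal K2"
    proof -
      have A: "(\<integral>\<^sup>+ x. ennreal (f2 x powr c) \<partial>M) \<le> ennreal (E + R0)"
      proof -
        have "(\<integral>\<^sup>+ x. ennreal (f2 x powr c) \<partial>M) \<le> (\<integral>\<^sup>+ x. ennreal E * ennreal (f2 x powr P x) + decay x \<partial>M)"
          by (rule nn_integral_mono_AE) (use cmp in eventually_elim, use nn in auto)
        also have "\<dots> = ennreal E * (\<integral>\<^sup>+ x. ennreal (f2 x powr P x) \<partial>M) + ennreal R0"
          unfolding R0(2)[symmetric] by (subst nn_integral_add) (auto simp: nn_integral_cmult)
        also have "\<dots> \<le> ennreal E * 1 + ennreal R0" by (intro add_mono mult_left_mono mod2) auto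
        finally show ?thesis using E0 R0 by (simp add: ennreal_plus)
      qed
      have "(\<integral>\<^sup>+ x. ennreal (m2 x powr P x) \<partial>M) \<le> (\<integral>\<^sup>+ x. ennreal E * ennreal (m2 x powr c) + decay x \<partial>M)"
        by (rule nn_integral_mono_AE) (use cmp in eventually_elim, use mnn m2_le in auto)
      also have "\<dots> = ennreal E * (\<integral>\<^sup>+ x. ennreal (m2 x powr c) \<partial>M) + ennreal R0"
        unfolding R0(2)[symmetric] by (subst nn_integral_add) (auto simp: nn_integral_cmult)
      also have "\<dots> \<le> ennreal E * (ennreal (S c) * (\<integral>\<^sup>+ x. ennreal (f2 x powr c) \<partial>M)) + ennreal R0"
        unfolding S_def m2_def by (intro add_mono mult_left_mono maximal_strong_type order_refl) (use c1 nn in auto)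
      also have "\<dots> \<le> ennreal E * (ennreal (S c) * ennreal (E + R0)) + ennreal R0"
        by (intro add_mono mult_left_mono A order_refl) auto
      also have "\<dots> = ennreal K2"
        using S0[OF c1] E0 R0 by (simp add: K2_def ennreal_mult ennreal_plus)
      finally show ?thesis .
    qed
    have "(\<integral>\<^sup>+ x. ennreal (mx N (avg M f) x powr P x) \<partial>M)
        \<le> (\<integral>\<^sup>+ x. ennreal (2 powr hi) * (ennreal (m1 x powr P x) + ennreal (m2 x powr P x)) \<partial>M)"
    proof (rule nn_integral_mono_AE)
      show "AE x in M. ennreal (mx N (avg M f) x powr P x) \<le> ennreal (2 powr hi) * (ennreal (m1 x powr P x) + ennreal (m2 x powr P x))"
        using b
      proof eventually_elim
        case (elim x)
        have P0: "0 \<le> P x" using elim lo by simp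
        have "mx N (avg M f) x powr P x \<le> (2 * max (m1 x) (m2 x)) powr P x"
          using sum[of x] P0 fnn by (intro powr_mono2 mx_nonneg avg_nonneg) auto
        also have "\<dots> = 2 powr P x * max (m1 x) (m2 x) powr P x" using mnn[of x] by (simp add: powr_mult)
        also have "\<dots> \<le> 2 powr hi * (m1 x powr P x + m2 x powr P x)"
          using elim by (intro mult_mono powr_mono) (auto simp: max_def)
        finally show ?case using ennreal_leI by (simp add: ennreal_mult[symmetric] ennreal_plus[symmetric] del: ennreal_plus)
      qed
    qed
    also have "\<dots> = ennreal (2 powr hi) * ((\<integral>\<^sup>+ x. ennreal (m1 x powr P x) \<partial>M) + (\<integral>\<^sup>+ x. ennreal (m2 x powr P x) \<partial>M))"
      by (subst nn_integral_cmult) (auto simp: nn_integral_add)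
    also have "\<dots> \<le> ennreal (2 powr hi) * (ennreal K1 + ennreal K2)"
      by (intro mult_left_mono add_mono I1 I2) auto
    also have "\<dots> = ennreal (2 powr hi * (K1 + K2))"
      using S0[OF lo] S0[OF c1] E0 R0 by (simp add: K1_def K2_def ennreal_mult ennreal_plus)
    finally show ?thesis .
  qed
  show ?thesis
    by (rule exI[of _ "2 powr hi * (K1 + K2)"]) (use main S0[OF lo] S0[OF c1] E0 R0 in \<open>auto simp: K1_def K2_def\<close>)
qed

end

section \<open>Extrapolation to variable exponents\<close>

context normed_ball_space
begin

text \<open>Any ball can be enlarged to contain a given point, so the maximal function of a
  nontrivial function is positive everywhere; the weight built from it can then be raised to
  negative powers.\<close>

lemma avg_eventually_pos:
  fixes g :: "'a \<Rightarrow> real"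
  assumes [measurable]: "g \<in> borel_measurable M" and nn: "\<And>x. 0 \<le> g x"
    and int: "\<And>x \<gamma>. set_integrable M (ball x \<gamma>) g" and nz: "\<not> (AE x in M. g x = 0)"
  shows "\<exists>\<gamma>. 0 < avg M g (ball x \<gamma>)"
proof -
  have "\<exists>z \<delta>. \<not> (AE y in M. y \<in> ball z \<delta> \<longrightarrow> g y = 0)" using nz AE_from_balls[of "\<lambda>y. g y = 0"] by blast
  then obtain z \<delta> where z: "\<not> (AE y in M. y \<in> ball z \<delta> \<longrightarrow> g y = 0)" by blast
  obtain \<gamma> where "z \<in> ball x \<gamma>" using ball_cover by blast
  then have "z \<in> ball x (max \<gamma> \<delta>)" using ball_mono[of \<gamma> "max \<gamma> \<delta>" x] by auto
  then have sub: "ball z \<delta> \<subseteq> ball x (max \<gamma> \<delta>)" by (intro ball_meet[of _ _ z]) (auto simp: ball_self)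
  let ?B = "ball x (max \<gamma> \<delta>)"
  have "0 < avg M g ?B"
  proof (rule ccontr)
    assume "\<not> ?thesis"
    then have "avg M g ?B = 0" using avg_nonneg[of g ?B] nn by simp
    then have "(\<integral>\<^sup>+ y. ennreal (g y) * indicator ?B y \<partial>M) = 0"
      using nn_integral_ball_avg[OF int nn measure_ball_pos, of x "max \<gamma> \<delta>"] by simp
    then have "AE y in M. ennreal (g y) * indicator ?B y = 0" by (subst (asm) nn_integral_0_iff_AE) auto
    then have "AE y in M. y \<in> ball z \<delta> \<longrightarrow> g y = 0"
    proof eventually_elim
      case (elim y)
      show ?case
      proof
        assume "y \<in> ball z \<delta>"
        then have "y \<in> ?B" using sub by blast
        then show "g y = 0" using elim nn[of y] by (simp add: ennreal_eq_0_iff)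
      qed
    qed
    then show False using z by blast
  qed
  then show ?thesis by blast
qed

text \<open>A substitute for the Rubio de Francia iteration: a power less than one of a maximal function
  is an \<open>A\<^sub>1\<close> weight (Coifman and Rochberg).\<close>

lemma A1_majorant:
  assumes P: "log_holder P lo hi" and lo: "1 < lo" and \<delta>: "0 < \<delta>" "\<delta> < 1"
  shows "\<exists>K\<ge>0. \<forall>g. g \<in> borel_measurable M \<longrightarrow> (\<forall>x. 0 \<le> g x) \<longrightarrow> (\<integral>\<^sup>+ x. ennreal (g x powr P x) \<partial>M) \<le> 1
    \<longrightarrow> \<not> (AE x in M. g x = 0) \<longrightarrow>
    (\<exists>m. m \<in> borel_measurable M \<and> (\<forall>x. 0 < m x) \<and> (AE x in M. g x \<le> m x)
      \<and> (\<integral>\<^sup>+ x. ennreal (m x powr P x) \<partial>M) \<le> ennreal K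
      \<and> (\<forall>x \<gamma>. AE y in M. y \<in> ball x \<gamma> \<longrightarrow>
          (\<integral>\<^sup>+ z. ennreal (m z powr \<delta>) * indicator (ball x \<gamma>) z \<partial>M) \<le> ennreal (m y powr \<delta> / (1 - \<delta>)) * emeasure M (ball x \<gamma>)))"
proof -
  obtain K where K: "0 \<le> K" "\<And>f N. f \<in> borel_measurable M \<Longrightarrow> (\<And>x. 0 \<le> f x) \<Longrightarrow> (\<integral>\<^sup>+ x. ennreal (f x powr P x) \<partial>M) \<le> 1
    \<Longrightarrow> (\<integral>\<^sup>+ x. ennreal (mx N (avg M f) x powr P x) \<partial>M) \<le> ennreal K"
    using maximal_modular[OF P lo] by blast
  have [measurable]: "P \<in> borel_measurable M" and b: "AE x in M. lo \<le> P x \<and> P x \<le> hi"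
    using P unfolding log_holder_def by auto
  have P0: "AE x in M. 0 < P x" and P1: "AE x in M. 1 \<le> P x"
    using b by (eventually_elim, use lo in simp)+
  show ?thesis
  proof (intro exI[of _ K] conjI K(1) allI impI)
    fix g assume [measurable]: "g \<in> borel_measurable M" and nn': "\<forall>x. 0 \<le> g x"
      and mod: "(\<integral>\<^sup>+ x. ennreal (g x powr P x) \<partial>M) \<le> 1" and nz: "\<not> (AE x in M. g x = 0)"
    have nn: "0 \<le> g x" for x using nn' by simp
    define F where "F = (\<lambda>N. mx N (avg M g))"
    have [measurable]: "F N \<in> borel_measurable M" for N unfolding F_def by measurable
    have Fnn: "0 \<le> F N x" for N x unfolding F_def by (intro mx_nonneg avg_nonneg nn)
    have Finc: "F N x \<le> F (Suc N) x" for N x unfolding F_def by (rule mx_incseq) simp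
    have FK: "(\<integral>\<^sup>+ x. ennreal (F N x powr P x) \<partial>M) \<le> ennreal K" for N unfolding F_def by (rule K(2)) (use nn mod in auto)
    have int: "set_integrable M (ball x \<gamma>) g" for x \<gamma>
      by (rule set_integrable_of_modular[OF _ _ nn P1]) (use mod in \<open>auto intro: le_less_trans\<close>)
    define S where "S = (\<lambda>x. SUP N. ennreal (F N x))"
    have [measurable]: "S \<in> borel_measurable M" unfolding S_def by measurable
    \<comment> \<open>On the null set where the maximal function is infinite the value 1 is put in,
      so that \<open>m\<close> is real and positive everywhere.\<close>
    define m where "m = (\<lambda>x. if S x = \<infinity> then 1 else enn2real (S x))"
    have [measurable]: "m \<in> borel_measurable M" unfolding m_def by measurable
    have good: "AE x in M. S x \<noteq> \<infinity>"
    proof -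
      have "AE x in M. \<exists>K\<ge>0. \<forall>N. F N x \<le> K"
        by (rule modular_limit_bounded[where F = F and P = P and C = "ennreal K"]) (use P0 Fnn Finc FK in auto)
      then show ?thesis
      proof eventually_elim
        case (elim x)
        then obtain k where "\<forall>N. F N x \<le> k" by blast
        then have "S x \<le> ennreal k" unfolding S_def by (intro SUP_least ennreal_leI) auto
        then show ?case by (auto simp: top_unique)
      qed
    qed
    have Fm: "F N x \<le> m x" if "S x \<noteq> \<infinity>" for N x
    proof -
      have "ennreal (F N x) \<le> S x" unfolding S_def by (rule SUP_upper) simp
      also have "S x = ennreal (m x)" using that by (simp add: m_def less_top)
      finally show ?thesis using Fnn[of N x] by (auto simp: m_def split: if_splits)
    qed
    have avm: "avg M g (ball x \<gamma>) \<le> m x" if "S x \<noteq> \<infinity>" for x \<gamma>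
    proof -
      have "\<gamma> \<in> {- int (nat \<bar>\<gamma>\<bar>)..int (nat \<bar>\<gamma>\<bar>)}" by auto
      from mx_ge[OF this, of "avg M g" x] show ?thesis
        using Fm[OF that, of "nat \<bar>\<gamma>\<bar>"] unfolding F_def by (rule order_trans)
    qed
    have mle: "m x \<le> k" if "S x \<noteq> \<infinity>" "0 \<le> k" "\<And>N. F N x \<le> k" for x k
    proof -
      have "S x \<le> ennreal k" unfolding S_def using that by (intro SUP_least ennreal_leI) auto
      then have "enn2real (S x) \<le> enn2real (ennreal k)" by (rule enn2real_mono) simp
      then show ?thesis using that by (simp add: m_def)
    qed
    have mpos: "0 < m x" for x
    proof (cases "S x = \<infinity>")
      case False
      obtain \<gamma> where "0 < avg M g (ball x \<gamma>)" using avg_eventually_pos[OF _ nn int nz] by auto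
      then show ?thesis using avm[OF False, of \<gamma>] by simp
    qed (simp add: m_def)
    have mle2: "AE x in M. \<forall>k\<ge>0. (\<forall>\<gamma>. avg M g (ball x \<gamma>) \<le> k) \<longrightarrow> m x \<le> k"
      using good by eventually_elim (auto intro!: mle simp: F_def mx_le_iff)
    have "AE x in M. g x \<le> m x"
      using AE_le_maximal[OF _ nn int] good by (auto elim: eventually_elim2 simp: avm)
    moreover have "(\<integral>\<^sup>+ x. ennreal (m x powr P x) \<partial>M) \<le> ennreal K"
    proof (rule modular_limit[where F = F and P = P])
      show "AE x in M. 0 \<le> m x \<and> (\<forall>k\<ge>0. (\<forall>N. F N x \<le> k) \<longrightarrow> m x \<le> k)"
        using good by eventually_elim (auto intro!: mle simp: less_imp_le[OF mpos])
    qed (use P0 Fnn Finc FK in auto)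
    moreover have "AE y in M. y \<in> ball x \<gamma> \<longrightarrow>
          (\<integral>\<^sup>+ z. ennreal (m z powr \<delta>) * indicator (ball x \<gamma>) z \<partial>M) \<le> ennreal (m y powr \<delta> / (1 - \<delta>)) * emeasure M (ball x \<gamma>)" for x \<gamma>
      using good
    proof eventually_elim
      case (elim y)
      show ?case
      proof
        assume "y \<in> ball x \<gamma>"
        then have e: "ball x \<gamma> = ball y \<gamma>" using ball_eq by simp
        show "(\<integral>\<^sup>+ z. ennreal (m z powr \<delta>) * indicator (ball x \<gamma>) z \<partial>M) \<le> ennreal (m y powr \<delta> / (1 - \<delta>)) * emeasure M (ball x \<gamma>)"
          unfolding e by (rule Coifman_Rochberg[OF _ _ nn int \<delta> less_imp_le[OF mpos] mle2 avm[OF elim]]) auto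
      qed
    qed
    ultimately show "\<exists>m. m \<in> borel_measurable M \<and> (\<forall>x. 0 < m x) \<and> (AE x in M. g x \<le> m x)
      \<and> (\<integral>\<^sup>+ x. ennreal (m x powr P x) \<partial>M) \<le> ennreal K
      \<and> (\<forall>x \<gamma>. AE y in M. y \<in> ball x \<gamma> \<longrightarrow>
          (\<integral>\<^sup>+ z. ennreal (m z powr \<delta>) * indicator (ball x \<gamma>) z \<partial>M) \<le> ennreal (m y powr \<delta> / (1 - \<delta>)) * emeasure M (ball x \<gamma>))"
      using mpos by (intro exI[of _ m]) auto
  qed
qed

text \<open>\<open>V\<close> is controlled from both sides up to a constant \<open>c\<close>
  depending on the ball, and \<open>w powr s\<close> is an A1 weight. Hoelder separates the two
  factors in the integral of the \<open>q\<close>-th power; in the negative power \<open>w\<close>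
  is bounded below through the mean \<open>W\<close> of \<open>w powr s\<close>. The quantities
  \<open>c\<close> and \<open>W\<close> cancel in the product. The gain \<open>s > 1\<close> leaves
  room for the high powers of \<open>V\<close>.\<close>

lemma Apq_product_weight:
  fixes V w :: "'a \<Rightarrow> real"
  assumes [measurable]: "V \<in> borel_measurable M" "w \<in> borel_measurable M"
    and pos: "\<And>x. 0 < V x" "\<And>x. 0 < w x"
    and p: "1 < p" and q: "0 < q" and s: "1 < s" and \<beta>: "\<beta> = 1 / p - 1 / q" and k: "0 \<le> k" and e: "0 < e"
    and a: "q * (s / (s - 1)) \<le> a" "p / (p - 1) \<le> a"
    and V: "\<exists>c>0. (\<integral>\<^sup>+ y. ennreal ((V y / c) powr a) * indicator (ball x \<gamma>) y \<partial>M) \<le> ennreal k * emeasure M (ball x \<gamma>)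
        \<and> (\<integral>\<^sup>+ y. ennreal ((c / V y) powr a) * indicator (ball x \<gamma>) y \<partial>M) \<le> ennreal k * emeasure M (ball x \<gamma>)"
    and A1: "AE y in M. y \<in> ball x \<gamma> \<longrightarrow>
          (\<integral>\<^sup>+ z. ennreal (w z powr s) * indicator (ball x \<gamma>) z \<partial>M) \<le> ennreal (w y powr s / e) * emeasure M (ball x \<gamma>)"
  shows "\<exists>U S. 0 \<le> U \<and> 0 \<le> S
      \<and> (\<integral>\<^sup>+ y. ennreal ((V y * w y powr (1 / q)) powr q) * indicator (ball x \<gamma>) y \<partial>M) \<le> ennreal U
      \<and> (\<integral>\<^sup>+ y. ennreal ((V y * w y powr (1 / q)) powr (- (p / (p - 1)))) * indicator (ball x \<gamma>) y \<partial>M) \<le> ennreal S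
      \<and> U powr (1 / q) * S powr (1 / (p / (p - 1)))
        \<le> ((1 + k) powr (1 / (s / (s - 1)) / q) * (1 + k) powr (1 / (p / (p - 1))) * e powr (- (1 / (q * s))))
          * measure M (ball x \<gamma>) powr (1 - \<beta>)"
proof -
  let ?B = "ball x \<gamma>"
  define n where "n = measure M ?B"
  have n: "0 < n" "emeasure M ?B = ennreal n" unfolding n_def using measure_ball_pos emeasure_ball by auto
  define pp where "pp = p / (p - 1)"
  define ss where "ss = s / (s - 1)"
  have pp: "1 < pp" "1 / p + 1 / pp = 1" using p by (auto simp: pp_def field_simps)
  have ss: "1 < ss" "1 / ss + 1 / s = 1" using s by (auto simp: ss_def field_simps)
  have a': "q * ss \<le> a" "pp \<le> a" using a by (auto simp: ss_def pp_def)
  obtain c where c: "0 < c"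
    "(\<integral>\<^sup>+ y. ennreal ((V y / c) powr a) * indicator ?B y \<partial>M) \<le> ennreal k * emeasure M ?B"
    "(\<integral>\<^sup>+ y. ennreal ((c / V y) powr a) * indicator ?B y \<partial>M) \<le> ennreal k * emeasure M ?B"
    using V by blast
  \<comment> \<open>A power below the \<open>a\<close>-th is at most 1 plus the \<open>a\<close>-th
    power; this is the origin of \<open>1 + k\<close>.\<close>
  have low: "(\<integral>\<^sup>+ y. ennreal (h y powr i) * indicator ?B y \<partial>M) \<le> ennreal ((1 + k) * n)"
    if [measurable]: "h \<in> borel_measurable M" and hp: "\<And>y. 0 < h y" and i: "0 \<le> i" "i \<le> a"
      and hk: "(\<integral>\<^sup>+ y. ennreal (h y powr a) * indicator ?B y \<partial>M) \<le> ennreal k * emeasure M ?B" for h i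
  proof -
    have "(\<integral>\<^sup>+ y. ennreal (h y powr i) * indicator ?B y \<partial>M) \<le> (\<integral>\<^sup>+ y. indicator ?B y + ennreal (h y powr a) * indicator ?B y \<partial>M)"
    proof (rule nn_integral_mono)
      fix y
      have "h y powr i \<le> 1 + h y powr a"
      proof (cases "1 \<le> h y")
        case True
        then have "h y powr i \<le> h y powr a" using i by (intro powr_mono) auto
        then show ?thesis by simp
      next
        case False
        then have "h y powr i \<le> 1" using hp[of y] i by (intro powr_le1) auto
        then show ?thesis by (rule order_trans) simp
      qed
      then have "ennreal (h y powr i) \<le> 1 + ennreal (h y powr a)"
        using ennreal_leI[of "h y powr i" "1 + h y powr a"] by (simp add: ennreal_plus)
      then show "ennreal (h y powr i) * indicator ?B y \<le> indicator ?B y + ennreal (h y powr a) * indicator ?B y"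
        by (auto simp: indicator_def)
    qed
    also have "\<dots> = emeasure M ?B + (\<integral>\<^sup>+ y. ennreal (h y powr a) * indicator ?B y \<partial>M)"
      by (subst nn_integral_add) auto
    also have "\<dots> \<le> ennreal n + ennreal k * ennreal n" using hk n by (simp add: add_left_mono)
    also have "\<dots> = ennreal ((1 + k) * n)" using k n by (simp add: ennreal_mult[symmetric] ennreal_plus[symmetric] algebra_simps del: ennreal_plus)
    finally show ?thesis .
  qed
  have V1: "(\<integral>\<^sup>+ y. ennreal ((V y / c) powr (q * ss)) * indicator ?B y \<partial>M) \<le> ennreal ((1 + k) * n)"
    by (rule low) (use pos c a' q ss in auto)
  have V2: "(\<integral>\<^sup>+ y. ennreal ((c / V y) powr pp) * indicator ?B y \<partial>M) \<le> ennreal ((1 + k) * n)"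
    by (rule low) (use pos c a' pp in auto)
  obtain W where W: "0 < W" "(\<integral>\<^sup>+ z. ennreal (w z powr s) * indicator ?B z \<partial>M) = ennreal (W * n)"
  proof -
    \<comment> \<open>The A1 condition at a single point already shows that the mean is finite, and
      such a point exists because balls are not null.\<close>
    have "\<exists>y. y \<in> ?B \<and> (\<integral>\<^sup>+ z. ennreal (w z powr s) * indicator ?B z \<partial>M) \<le> ennreal (w y powr s / e) * emeasure M ?B"
    proof (rule ccontr)
      assume "\<not> ?thesis"
      with A1 have "AE y in M. y \<notin> ?B" by (auto elim: eventually_mono)
      then have "emeasure M ?B = 0" by (subst (asm) AE_iff_measurable[of ?B]) auto
      then show False using n by simp
    qed
    then obtain y where "(\<integral>\<^sup>+ z. ennreal (w z powr s) * indicator ?B z \<partial>M) \<le> ennreal (w y powr s / e) * emeasure M ?B"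
      by blast
    then have fin: "(\<integral>\<^sup>+ z. ennreal (w z powr s) * indicator ?B z \<partial>M) < \<infinity>"
      unfolding n(2) by (rule le_less_trans) (simp add: ennreal_mult_less_top)
    have "0 < (\<integral>\<^sup>+ z. ennreal (w z powr s) * indicator ?B z \<partial>M)"
      by (rule nn_integral_ball_pos) (use pos(2) in \<open>auto simp: less_imp_neq[symmetric]\<close>)
    with fin obtain J where J: "0 < J" "(\<integral>\<^sup>+ z. ennreal (w z powr s) * indicator ?B z \<partial>M) = ennreal J"
      by (cases "\<integral>\<^sup>+ z. ennreal (w z powr s) * indicator ?B z \<partial>M") auto
    show ?thesis by (rule that[of "J / n"]) (use J n in auto)
  qed
  have wlow: "AE y in M. y \<in> ?B \<longrightarrow> e * W \<le> w y powr s"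
    using A1
  proof eventually_elim
    case (elim y)
    show ?case
    proof
      assume "y \<in> ?B"
      then have "ennreal (W * n) \<le> ennreal (w y powr s / e * n)"
        using elim W n e by (simp add: ennreal_mult[symmetric])
      then have "W * n \<le> w y powr s / e * n" using e n by (simp add: ennreal_le_iff)
      then show "e * W \<le> w y powr s" using n e by (simp add: field_simps)
    qed
  qed
  define U where "U = c powr q * (1 + k) powr (1 / ss) * W powr (1 / s) * n"
  define S where "S = (e * W) powr (- (pp / (q * s))) * c powr (- pp) * (1 + k) * n"
  have US: "0 \<le> U" "0 \<le> S" using n k by (auto simp: U_def S_def)
  have i1: "(\<integral>\<^sup>+ y. ennreal ((V y * w y powr (1 / q)) powr q) * indicator ?B y \<partial>M) \<le> ennreal U"
  proof -
    have "(\<integral>\<^sup>+ y. ennreal (((V y / c) powr q * indicator ?B y) * (w y * indicator ?B y)) \<partial>M)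
        \<le> ennreal (((1 + k) * n) powr (1 / ss) * (W * n) powr (1 / s))"
    proof (rule Holder_nn_integral)
      have "(\<integral>\<^sup>+ y. ennreal (((V y / c) powr q * indicator ?B y) powr ss) \<partial>M) = (\<integral>\<^sup>+ y. ennreal ((V y / c) powr (q * ss)) * indicator ?B y \<partial>M)"
        by (intro nn_integral_cong) (auto simp: indicator_def powr_powr)
      then show "(\<integral>\<^sup>+ y. ennreal (((V y / c) powr q * indicator ?B y) powr ss) \<partial>M) \<le> ennreal ((1 + k) * n)" using V1 by simp
      have "(\<integral>\<^sup>+ y. ennreal ((w y * indicator ?B y) powr s) \<partial>M) = (\<integral>\<^sup>+ y. ennreal (w y powr s) * indicator ?B y \<partial>M)"
        by (intro nn_integral_cong) (auto simp: indicator_def)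
      then show "(\<integral>\<^sup>+ y. ennreal ((w y * indicator ?B y) powr s) \<partial>M) \<le> ennreal (W * n)" using W by simp
    qed (use ss s k n W pos in \<open>auto simp: less_imp_le\<close>)
    also have "((1 + k) * n) powr (1 / ss) * (W * n) powr (1 / s) = (1 + k) powr (1 / ss) * W powr (1 / s) * n powr (1 / ss + 1 / s)"
      using k n W by (simp add: powr_mult powr_add)
    also have "n powr (1 / ss + 1 / s) = n" using ss n by simp
    finally have h: "(\<integral>\<^sup>+ y. ennreal (((V y / c) powr q * indicator ?B y) * (w y * indicator ?B y)) \<partial>M) \<le> ennreal ((1 + k) powr (1 / ss) * W powr (1 / s) * n)" .
    have "(\<integral>\<^sup>+ y. ennreal ((V y * w y powr (1 / q)) powr q) * indicator ?B y \<partial>M)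
        = (\<integral>\<^sup>+ y. ennreal (c powr q) * ennreal (((V y / c) powr q * indicator ?B y) * (w y * indicator ?B y)) \<partial>M)"
    proof (rule nn_integral_cong)
      fix y
      have "(V y * w y powr (1 / q)) powr q = c powr q * ((V y / c) powr q * w y)"
        using pos(1)[of y] pos(2)[of y] c q by (simp add: powr_mult powr_powr powr_divide)
      then show "ennreal ((V y * w y powr (1 / q)) powr q) * indicator ?B y = ennreal (c powr q) * ennreal (((V y / c) powr q * indicator ?B y) * (w y * indicator ?B y))"
        using pos(2)[of y] by (simp add: ennreal_mult[symmetric] indicator_def)
    qed
    also have "\<dots> = ennreal (c powr q) * (\<integral>\<^sup>+ y. ennreal (((V y / c) powr q * indicator ?B y) * (w y * indicator ?B y)) \<partial>M)"
      by (rule nn_integral_cmult) measurable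
    also have "\<dots> \<le> ennreal (c powr q) * ennreal ((1 + k) powr (1 / ss) * W powr (1 / s) * n)"
      by (intro mult_left_mono h) simp
    also have "\<dots> = ennreal U" using n by (simp add: U_def ennreal_mult[symmetric] mult.assoc)
    finally show ?thesis .
  qed
  have i2: "(\<integral>\<^sup>+ y. ennreal ((V y * w y powr (1 / q)) powr (- pp)) * indicator ?B y \<partial>M) \<le> ennreal S"
  proof -
    define d where "d = (e * W) powr (- (pp / (q * s))) * c powr (- pp)"
    have "(\<integral>\<^sup>+ y. ennreal ((V y * w y powr (1 / q)) powr (- pp)) * indicator ?B y \<partial>M)
        \<le> (\<integral>\<^sup>+ y. ennreal d * (ennreal ((c / V y) powr pp) * indicator ?B y) \<partial>M)"
    proof (rule nn_integral_mono_AE)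
      show "AE y in M. ennreal ((V y * w y powr (1 / q)) powr (- pp)) * indicator ?B y \<le> ennreal d * (ennreal ((c / V y) powr pp) * indicator ?B y)"
        using wlow
      proof eventually_elim
        case (elim y)
        show ?case
        proof (cases "y \<in> ?B")
          case True
          have "w y powr (- (pp / q)) = (w y powr s) powr (- (pp / (q * s)))" using s by (simp add: powr_powr)
          also have "\<dots> \<le> (e * W) powr (- (pp / (q * s)))"
            using elim True e W q s pp by (intro powr_mono2') auto
          finally have wl: "w y powr (- (pp / q)) \<le> (e * W) powr (- (pp / (q * s)))" .
          have "(V y * w y powr (1 / q)) powr (- pp) = V y powr (- pp) * w y powr (- (pp / q))"
            using pos(1)[of y] pos(2)[of y] by (simp add: powr_mult powr_powr)
          also have "\<dots> \<le> V y powr (- pp) * (e * W) powr (- (pp / (q * s)))" by (intro mult_left_mono wl) simp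
          also have "\<dots> = d * (c / V y) powr pp"
          proof -
            have "(c / V y) powr pp = c powr pp / V y powr pp" using pos(1)[of y] c by (simp add: powr_divide)
            then have "V y powr (- pp) = c powr (- pp) * (c / V y) powr pp"
              using c by (simp add: powr_minus_divide)
            then show ?thesis by (simp add: d_def)
          qed
          finally show ?thesis using True by (simp add: ennreal_mult[symmetric] d_def ennreal_leI)
        qed simp
      qed
    qed
    also have "\<dots> = ennreal d * (\<integral>\<^sup>+ y. ennreal ((c / V y) powr pp) * indicator ?B y \<partial>M)"
      by (rule nn_integral_cmult) measurable
    also have "\<dots> \<le> ennreal d * ennreal ((1 + k) * n)" by (intro mult_left_mono V2) simp
    also have "\<dots> = ennreal S" using k n by (simp add: S_def d_def ennreal_mult[symmetric] mult.assoc)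
    finally show ?thesis .
  qed
  have prod: "U powr (1 / q) * S powr (1 / pp) = ((1 + k) powr (1 / ss / q) * (1 + k) powr (1 / pp) * e powr (- (1 / (q * s)))) * n powr (1 - \<beta>)"
  proof -
    have h1: "U powr (1 / q) = c * (1 + k) powr (1 / ss / q) * W powr (1 / (q * s)) * n powr (1 / q)"
      using c k W n q by (simp add: U_def powr_mult powr_powr mult.commute)
    have h2: "S powr (1 / pp) = e powr (- (1 / (q * s))) * W powr (- (1 / (q * s))) * (1 / c) * (1 + k) powr (1 / pp) * n powr (1 / pp)"
      using c k W n q pp e by (simp add: S_def powr_mult powr_powr)
    have W1: "W powr (1 / (q * s)) * W powr (- (1 / (q * s))) = 1" using W by (simp add: powr_minus)
    have n1: "n powr (1 / q) * n powr (1 / pp) = n powr (1 - \<beta>)"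
      unfolding powr_add[symmetric] using \<beta> pp by (intro arg_cong2[of _ _ _ _ "(powr)"]) auto
    have c1: "c * (1 / c) = 1" using c by simp
    have "U powr (1 / q) * S powr (1 / pp)
      = (c * (1 / c)) * (W powr (1 / (q * s)) * W powr (- (1 / (q * s))))
        * ((1 + k) powr (1 / ss / q) * (1 + k) powr (1 / pp) * e powr (- (1 / (q * s)))) * (n powr (1 / q) * n powr (1 / pp))"
      unfolding h1 h2 by (simp only: mult_ac)
    then show ?thesis by (simp only: W1 n1 c1 mult_1_left)
  qed
  show ?thesis
    by (intro exI[of _ U] exI[of _ S] conjI US i1 i2[unfolded pp_def])
      (use prod in \<open>simp add: pp_def ss_def n_def\<close>)
qed

end

context normed_ball_space
begin

text \<open>Extrapolation from a constant pair \<open>r0\<close>, \<open>q0\<close> with the same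
  gap \<open>\<beta>\<close>. The modular of exponent \<open>q\<close> is tested by integrating the
  \<open>q0\<close>-th power against a function \<open>h\<close> with exponent
  \<open>Q (r x)\<close>, the conjugate of \<open>q x / q0\<close>. Majorizing \<open>h\<close> by
  \<open>w\<close> with \<open>w powr s\<close> in A1 makes \<open>V\<close> times
  \<open>w powr (1 / q0)\<close> a weight for the constant exponent bound. The same exponent
  \<open>Q (r x)\<close> reappears when the weight is removed on the right by Young's inequality.
  The power \<open>a\<close> depends on the exponents only, so \<open>V\<close> can be chosen
  afterwards.\<close>

theorem extrapolation:
  assumes r: "log_holder r lo hi" and lo: "1 < lo" and \<beta>: "0 < \<beta>" "hi * \<beta> < 1"
    and [measurable]: "q \<in> borel_measurable M" and q: "AE x in M. 1 / q x = 1 / r x - \<beta>"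
  shows "\<exists>a>0. \<forall>V k. V \<in> borel_measurable M \<longrightarrow> (\<forall>x. 0 < V x) \<longrightarrow> 0 \<le> k \<longrightarrow>
    (\<forall>x \<gamma>. \<exists>c>0. (\<integral>\<^sup>+ y. ennreal ((V y / c) powr a) * indicator (ball x \<gamma>) y \<partial>M) \<le> ennreal k * emeasure M (ball x \<gamma>)
        \<and> (\<integral>\<^sup>+ y. ennreal ((c / V y) powr a) * indicator (ball x \<gamma>) y \<partial>M) \<le> ennreal k * emeasure M (ball x \<gamma>)) \<longrightarrow>
    (\<exists>K\<ge>0. \<forall>f N. f \<in> borel_measurable M \<longrightarrow> (\<forall>x. 0 \<le> f x) \<longrightarrow> (\<integral>\<^sup>+ x. ennreal (f x powr r x) \<partial>M) \<le> 1 \<longrightarrow>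
      (\<integral>\<^sup>+ x. ennreal ((V x * mx N (\<lambda>B. measure M B powr (\<beta> - 1) * (LINT y:B|M. f y / V y)) x) powr q x) \<partial>M) \<le> ennreal K)"
proof -
  have rm [measurable]: "r \<in> borel_measurable M" and rb: "AE x in M. lo \<le> r x \<and> r x \<le> hi" and lohi: "lo \<le> hi"
    using r unfolding log_holder_def by auto
  define r0 where "r0 = (1 + lo) / 2"
  have r0: "1 < r0" "r0 < lo" using lo by (auto simp: r0_def)
  have hi0: "0 < hi" "0 < lo" "0 < r0" using lo lohi r0 by auto
  have bhi: "\<beta> < 1 / hi" using \<beta> hi0 by (simp add: field_simps)
  have hr: "1 / hi < 1 / r0" using r0 lohi hi0 by (simp add: frac_less2)
  define q0 where "q0 = 1 / (1 / r0 - \<beta>)"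
  have q0: "0 < q0" "\<beta> = 1 / r0 - 1 / q0" using bhi hr by (auto simp: q0_def)
  \<comment> \<open>\<open>elo\<close> and \<open>ehi\<close> are the extreme values of the
    reciprocal of the dual exponent; \<open>ehi < 1\<close> is a restatement of
    \<open>hi * \<beta> < 1\<close>.\<close>
  define ehi where "ehi = q0 * (1 / r0 - 1 / hi)"
  define elo where "elo = q0 * (1 / r0 - 1 / lo)"
  have ehi: "0 < ehi" using q0 hr by (simp add: ehi_def)
  have ehi1: "ehi < 1"
  proof -
    have "ehi < q0 * (1 / r0 - \<beta>)" unfolding ehi_def using q0 bhi by (intro mult_strict_left_mono) auto
    also have "\<dots> = 1" using bhi hr by (simp add: q0_def)
    finally show ?thesis .
  qed
  have elo: "0 < elo" using q0 r0 hi0 by (simp add: elo_def frac_less2)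
  define cq where "cq = 1 / ehi"
  have cq: "1 < cq" using ehi ehi1 by (simp add: cq_def)
  \<comment> \<open>Two steps of room between 1 and the smallest dual exponent \<open>cq\<close>:
    \<open>s1 < cq\<close> keeps \<open>Q / s1\<close> above 1, so that the maximal operator is
    bounded there, and \<open>s < s1\<close> makes \<open>\<delta> < 1\<close> in the
    Coifman-Rochberg estimate, whose weight becomes \<open>w powr s\<close>.\<close>
  define s1 where "s1 = (1 + cq) / 2"
  define s where "s = (1 + s1) / 2"
  have s1: "1 < s1" "s1 < cq" using cq by (auto simp: s1_def)
  have s: "1 < s" "s < s1" using s1 by (auto simp: s_def)
  define \<delta> where "\<delta> = s / s1"
  have \<delta>: "0 < \<delta>" "\<delta> < 1" using s s1 by (auto simp: \<delta>_def)
  define Q where "Q = (\<lambda>\<rho>::real. 1 / (q0 * (1 / r0 - 1 / \<rho>)))"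
  have Qr: "Q \<rho> = r0 * \<rho> / (q0 * (\<rho> - r0))" if "r0 < \<rho>" for \<rho>
    using that q0 hi0 by (simp add: Q_def field_simps)
  have Qran: "cq \<le> Q \<rho> \<and> Q \<rho> \<le> 1 / elo" if "\<rho> \<in> {lo..hi}" for \<rho>
  proof -
    have \<rho>: "0 < \<rho>" "lo \<le> \<rho>" "\<rho> \<le> hi" using that hi0 by auto
    have "1 / hi \<le> 1 / \<rho>" "1 / \<rho> \<le> 1 / lo" using \<rho> hi0 by (auto simp: frac_le)
    then have "elo \<le> q0 * (1 / r0 - 1 / \<rho>)" "q0 * (1 / r0 - 1 / \<rho>) \<le> ehi"
      unfolding elo_def ehi_def using q0 by (auto intro!: mult_left_mono)
    then show ?thesis unfolding Q_def cq_def using elo ehi by (auto intro!: frac_le)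
  qed
  have [measurable]: "(\<lambda>x. Q (r x)) \<in> borel_measurable M" unfolding Q_def by measurable
  define P where "P = (\<lambda>x. Q (r x) / s1)"
  have [measurable]: "P \<in> borel_measurable M" unfolding P_def by measurable
  have Plh: "log_holder P (cq / s1) (1 / elo / s1)"
  proof (rule log_holder_transform[OF r, where \<phi> = "\<lambda>\<rho>. Q \<rho> / s1" and L = "r0 * r0 / (q0 * s1 * (lo - r0)\<^sup>2)"])
    show "0 \<le> r0 * r0 / (q0 * s1 * (lo - r0)\<^sup>2)" using r0 q0 s1 by simp
    fix u v assume uv: "u \<in> {lo..hi}" "v \<in> {lo..hi}"
    then have uv0: "0 < u - r0" "0 < v - r0" using r0 by auto
    have "Q u / s1 - Q v / s1 = r0 * r0 / (q0 * s1) * ((v - u) / ((u - r0) * (v - r0)))"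
    proof -
      have Q2: "Q t / s1 = r0 / (q0 * s1) + r0 * r0 / (q0 * s1) * (1 / (t - r0))" if "0 < t - r0" for t
        using Qr[of t] that q0 s1 by (simp add: divide_simps) (simp add: algebra_simps)
      have e: "1 / (u - r0) - 1 / (v - r0) = (v - u) / ((u - r0) * (v - r0))" using uv0 by (simp add: diff_frac_eq)
      show ?thesis
        by (simp only: Q2[OF uv0(1)] Q2[OF uv0(2)] add_diff_cancel_left right_diff_distrib[symmetric] e)
    qed
    then have "\<bar>Q u / s1 - Q v / s1\<bar> = r0 * r0 / (q0 * s1) * (\<bar>u - v\<bar> / ((u - r0) * (v - r0)))"
      using uv0 q0 s1 hi0 by (simp add: abs_mult abs_minus_commute)
    also have "\<dots> \<le> r0 * r0 / (q0 * s1) * (\<bar>u - v\<bar> / (lo - r0)\<^sup>2)"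
      using uv uv0 r0 q0 s1 hi0 by (intro mult_left_mono divide_left_mono) (auto simp: power2_eq_square intro!: mult_mono)
    finally show "\<bar>Q u / s1 - Q v / s1\<bar> \<le> r0 * r0 / (q0 * s1 * (lo - r0)\<^sup>2) * \<bar>u - v\<bar>"
      by (simp add: field_simps)
  next
    fix u assume "u \<in> {lo..hi}"
    then show "Q u / s1 \<in> {cq / s1..1 / elo / s1}" using Qran[of u] s1 divide_right_mono[of "Q u" "1 / elo" s1] divide_right_mono[of cq "Q u" s1] by auto
  qed (auto simp: P_def)
  have Plo: "1 < cq / s1" using s1 by simp
  define qh where "qh = 1 / (1 / hi - \<beta>)"
  have pw: "AE x in M. lo \<le> r x \<and> r x \<le> hi \<and> 0 < q x \<and> q x \<le> qh \<and> q0 < q x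
      \<and> (q x - q0) * Q (r x) = q x \<and> cq \<le> Q (r x)"
    using rb q
  proof eventually_elim
    case (elim x)
    have rx: "0 < r x" using elim hi0 by simp
    have i1: "1 / hi \<le> 1 / r x" "1 / r x \<le> 1 / lo" using elim rx hi0 by (auto simp: frac_le)
    have "0 < 1 / q x" using i1 bhi elim by simp
    then have qx: "0 < q x" by simp
    have "q x = 1 / (1 / r x - \<beta>)" using elim(2) by (metis div_by_1 divide_divide_eq_right mult.left_neutral)
    also have "\<dots> \<le> qh" unfolding qh_def using i1 bhi by (intro frac_le) auto
    finally have q1: "q x \<le> qh" .
    have "1 / lo < 1 / r0" using r0 hi0 by (simp add: frac_less2)
    then have "1 / q x < 1 / q0" using elim(2) i1 q0(2) by simp
    then have q2: "q0 < q x" using qx q0 by (simp add: field_simps)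
    have "q0 * (1 / r0 - 1 / r x) = q0 * (1 / q0 - 1 / q x)" using elim(2) q0(2) by simp
    also have "\<dots> = (q x - q0) / q x" using q0 qx by (simp add: field_simps)
    finally have "Q (r x) = q x / (q x - q0)" by (simp add: Q_def)
    then have "(q x - q0) * Q (r x) = q x" using q2 by simp
    then show ?case using elim qx q1 q2 Qran[of "r x"] by simp
  qed
  obtain K1 where K1: "0 \<le> K1" "\<And>g. g \<in> borel_measurable M \<Longrightarrow> (\<And>x. 0 \<le> g x) \<Longrightarrow> (\<integral>\<^sup>+ x. ennreal (g x powr P x) \<partial>M) \<le> 1
    \<Longrightarrow> \<not> (AE x in M. g x = 0) \<Longrightarrow>
    (\<exists>m. m \<in> borel_measurable M \<and> (\<forall>x. 0 < m x) \<and> (AE x in M. g x \<le> m x)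
      \<and> (\<integral>\<^sup>+ x. ennreal (m x powr P x) \<partial>M) \<le> ennreal K1
      \<and> (\<forall>x \<gamma>. AE y in M. y \<in> ball x \<gamma> \<longrightarrow>
          (\<integral>\<^sup>+ z. ennreal (m z powr \<delta>) * indicator (ball x \<gamma>) z \<partial>M) \<le> ennreal (m y powr \<delta> / (1 - \<delta>)) * emeasure M (ball x \<gamma>)))"
    using A1_majorant[OF Plh Plo \<delta>] by blast
  define a where "a = max (q0 * (s / (s - 1))) (r0 / (r0 - 1))"
  have a: "q0 * (s / (s - 1)) \<le> a" "r0 / (r0 - 1) \<le> a" "0 < a" using r0 by (auto simp: a_def less_max_iff_disj)
  have "\<exists>K\<ge>0. \<forall>f N. f \<in> borel_measurable M \<longrightarrow> (\<forall>x. 0 \<le> f x) \<longrightarrow> (\<integral>\<^sup>+ x. ennreal (f x powr r x) \<partial>M) \<le> 1 \<longrightarrow>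
      (\<integral>\<^sup>+ x. ennreal ((V x * mx N (\<lambda>B. measure M B powr (\<beta> - 1) * (LINT y:B|M. f y / V y)) x) powr q x) \<partial>M) \<le> ennreal K"
    if [measurable]: "V \<in> borel_measurable M" and Vpos: "\<And>x. 0 < V x" and k: "0 \<le> k"
      and V: "\<And>x \<gamma>. \<exists>c>0. (\<integral>\<^sup>+ y. ennreal ((V y / c) powr a) * indicator (ball x \<gamma>) y \<partial>M) \<le> ennreal k * emeasure M (ball x \<gamma>)
        \<and> (\<integral>\<^sup>+ y. ennreal ((c / V y) powr a) * indicator (ball x \<gamma>) y \<partial>M) \<le> ennreal k * emeasure M (ball x \<gamma>)" for V k
  proof -
    define pp where "pp = r0 / (r0 - 1)"
    define Kw where "Kw = (1 + k) powr (1 / (s / (s - 1)) / q0) * (1 + k) powr (1 / (r0 / (r0 - 1))) * (1 - \<delta>) powr (- (1 / (q0 * s)))"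
    define K3 where "K3 = Kw powr (q0 + pp) * ((1 + pp / q0) * 2 powr (1 + pp / q0) / (pp / q0)) * (r0 * 2 powr r0 / (r0 - 1)) * (1 + K1) powr (q0 / r0)"
    have pp0: "0 < pp" using r0 by (simp add: pp_def)
    have Kw0: "0 \<le> Kw" by (simp add: Kw_def)
    have K30: "0 \<le> K3" using pp0 q0 r0 by (simp add: K3_def)
    have dual: "(\<integral>\<^sup>+ x. ennreal ((V x * mx N (\<lambda>B. measure M B powr (\<beta> - 1) * (LINT y:B|M. f y / V y)) x) powr q0 * h x) \<partial>M) \<le> ennreal K3"
      if [measurable]: "f \<in> borel_measurable M" and fnn: "\<And>x. 0 \<le> f x" and fmod: "(\<integral>\<^sup>+ x. ennreal (f x powr r x) \<partial>M) \<le> 1"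
        and [measurable]: "h \<in> borel_measurable M" and hnn: "\<And>x. 0 \<le> h x" and hmod: "(\<integral>\<^sup>+ x. ennreal (h x powr Q (r x)) \<partial>M) \<le> 1" for f h N
    proof (cases "AE x in M. h x = 0")
      case True
      then have "(\<integral>\<^sup>+ x. ennreal ((V x * mx N (\<lambda>B. measure M B powr (\<beta> - 1) * (LINT y:B|M. f y / V y)) x) powr q0 * h x) \<partial>M) = (\<integral>\<^sup>+ x. 0 \<partial>M)"
        by (intro nn_integral_cong_AE) (auto elim: eventually_mono)
      then show ?thesis by simp
    next
      case False
      define g where "g = (\<lambda>x. h x powr s1)"
      have [measurable]: "g \<in> borel_measurable M" unfolding g_def by measurable
      have "(\<integral>\<^sup>+ x. ennreal (g x powr P x) \<partial>M) \<le> 1" using hmod s1 by (simp add: g_def P_def powr_powr)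
      moreover have "\<not> (AE x in M. g x = 0)" using False by (simp add: g_def)
      ultimately obtain m where [measurable]: "m \<in> borel_measurable M" and mpos: "\<And>x. 0 < m x" and gm: "AE x in M. g x \<le> m x"
        and mmod: "(\<integral>\<^sup>+ x. ennreal (m x powr P x) \<partial>M) \<le> ennreal K1"
        and mA: "\<And>x \<gamma>. AE y in M. y \<in> ball x \<gamma> \<longrightarrow>
          (\<integral>\<^sup>+ z. ennreal (m z powr \<delta>) * indicator (ball x \<gamma>) z \<partial>M) \<le> ennreal (m y powr \<delta> / (1 - \<delta>)) * emeasure M (ball x \<gamma>)"
        using K1(2)[of g] by (auto simp: g_def)
      define w where "w = (\<lambda>x. m x powr (1 / s1))"
      have [measurable]: "w \<in> borel_measurable M" unfolding w_def by measurable
      have wpos: "0 < w x" for x using mpos[of x] by (simp add: w_def)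
      have ws: "w x powr s = m x powr \<delta>" for x by (simp add: w_def powr_powr \<delta>_def)
      have hw: "AE x in M. h x \<le> w x"
        using gm
      proof eventually_elim
        case (elim x)
        then have "g x powr (1 / s1) \<le> w x" unfolding w_def using s1 by (intro powr_mono2) (auto simp: g_def)
        then show ?case using s1 hnn[of x] by (simp add: g_def powr_powr)
      qed
      have wmod: "(\<integral>\<^sup>+ x. ennreal (w x powr Q (r x)) \<partial>M) \<le> ennreal K1"
        using mmod s1 by (simp add: w_def P_def powr_powr)
      define v where "v = (\<lambda>y. V y * w y powr (1 / q0))"
      have [measurable]: "v \<in> borel_measurable M" unfolding v_def by measurable
      have vpos: "0 < v x" for x using Vpos[of x] wpos[of x] by (simp add: v_def)
      define X where "X = (\<lambda>B. measure M B powr (\<beta> - 1) * (LINT y:B|M. f y / V y))"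
      have fVnn: "0 \<le> f y / V y" for y using fnn[of y] Vpos[of y] by simp
      have Xnn: "0 \<le> X B" for B
        unfolding X_def set_lebesgue_integral_def
        by (intro mult_nonneg_nonneg integral_nonneg_AE AE_I2) (auto simp: indicator_def fVnn simp del: divide_nonneg_nonneg)
      have wt: "\<exists>U S. 0 \<le> U \<and> 0 \<le> S
        \<and> (\<integral>\<^sup>+ y. ennreal (v y powr q0) * indicator (ball x \<gamma>) y \<partial>M) \<le> ennreal U
        \<and> (\<integral>\<^sup>+ y. ennreal (v y powr (- (r0 / (r0 - 1)))) * indicator (ball x \<gamma>) y \<partial>M) \<le> ennreal S
        \<and> U powr (1 / q0) * S powr (1 / (r0 / (r0 - 1))) \<le> Kw * measure M (ball x \<gamma>) powr (1 - \<beta>)" for x \<gamma>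
        unfolding v_def Kw_def
      proof (rule Apq_product_weight[OF _ _ Vpos wpos r0(1) q0(1) s(1) q0(2) k _ a(1,2) V])
        show "AE y in M. y \<in> ball x \<gamma> \<longrightarrow> (\<integral>\<^sup>+ z. ennreal (w z powr s) * indicator (ball x \<gamma>) z \<partial>M) \<le> ennreal (w y powr s / (1 - \<delta>)) * emeasure M (ball x \<gamma>)"
          unfolding ws by (rule mA)
      qed (use \<delta> in auto)
      \<comment> \<open>Young with exponents \<open>r / r0\<close> and \<open>r / (r - r0)\<close>:
        the power of \<open>w\<close> becomes exactly \<open>Q (r x)\<close>, whose modular is at
        most \<open>K1\<close>.\<close>
      have Imod: "(\<integral>\<^sup>+ x. ennreal ((f x / V x * v x) powr r0) \<partial>M) \<le> ennreal (1 + K1)"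
      proof -
        have "(\<integral>\<^sup>+ x. ennreal ((f x / V x * v x) powr r0) \<partial>M) \<le> (\<integral>\<^sup>+ x. ennreal (f x powr r x) + ennreal (w x powr Q (r x)) \<partial>M)"
        proof (rule nn_integral_mono_AE)
          show "AE x in M. ennreal ((f x / V x * v x) powr r0) \<le> ennreal (f x powr r x) + ennreal (w x powr Q (r x))"
            using rb
          proof eventually_elim
            case (elim x)
            have rr: "r0 < r x" using elim r0 by simp
            let ?p = "r x / r0" and ?p' = "r x / (r x - r0)"
            have y: "1 < ?p" "1 < ?p'" "1 / ?p + 1 / ?p' = 1" using rr hi0 by (auto simp: field_simps)
            have "(f x / V x * v x) powr r0 = f x powr r0 * w x powr (r0 / q0)"
              using Vpos[of x] fnn[of x] wpos[of x] by (simp add: v_def powr_mult powr_powr)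
            also have "\<dots> \<le> (f x powr r0) powr ?p / ?p + (w x powr (r0 / q0)) powr ?p' / ?p'"
              by (rule Youngs_inequality) (use y in auto)
            also have "(f x powr r0) powr ?p = f x powr r x" using hi0 by (simp add: powr_powr)
            also have "(w x powr (r0 / q0)) powr ?p' = w x powr Q (r x)"
              using Qr[OF rr] by (simp add: powr_powr)
            also have "f x powr r x / ?p + w x powr Q (r x) / ?p' \<le> f x powr r x + w x powr Q (r x)"
            proof -
              have dl: "t / k \<le> t" if "0 \<le> t" "1 < k" for t k :: real
                using that by (simp add: divide_le_eq mult_le_cancel_left1)
              show ?thesis by (intro add_mono dl y) auto
            qed
            finally show ?case by (simp add: ennreal_plus[symmetric] ennreal_leI del: ennreal_plus)
          qed
        qed
        also have "\<dots> = (\<integral>\<^sup>+ x. ennreal (f x powr r x) \<partial>M) + (\<integral>\<^sup>+ x. ennreal (w x powr Q (r x)) \<partial>M)"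
          by (rule nn_integral_add) measurable
        also have "\<dots> \<le> 1 + ennreal K1" by (intro add_mono fmod wmod)
        finally show ?thesis using K1 by (simp add: ennreal_plus)
      qed
      have "(\<integral>\<^sup>+ x. ennreal ((V x * mx N X x) powr q0 * h x) \<partial>M) \<le> (\<integral>\<^sup>+ x. ennreal (mx N X x powr q0 * v x powr q0) \<partial>M)"
      proof (rule nn_integral_mono_AE)
        show "AE x in M. ennreal ((V x * mx N X x) powr q0 * h x) \<le> ennreal (mx N X x powr q0 * v x powr q0)"
          using hw
        proof eventually_elim
          case (elim x)
          have "(V x * mx N X x) powr q0 * h x \<le> (V x * mx N X x) powr q0 * w x" by (intro mult_left_mono elim) simp
          also have "\<dots> = mx N X x powr q0 * v x powr q0"
            using Vpos[of x] wpos[of x] mx_nonneg[of X N x] Xnn q0 by (simp add: v_def powr_mult powr_powr mult_ac)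
          finally show ?case by (rule ennreal_leI)
        qed
      qed
      also have "\<dots> \<le> ennreal K3"
        unfolding X_def K3_def pp_def
        by (rule fractional_maximal_weighted[OF _ vpos r0(1) q0(1) \<beta>(1) q0(2) Kw0 wt _ fVnn _ Imod]) (use K1 in auto)
      finally show ?thesis unfolding X_def .
    qed
    define K where "K = max 1 (K3 powr (1 / (1 - 1 / cq)))"
    have "(\<integral>\<^sup>+ x. ennreal ((V x * mx N (\<lambda>B. measure M B powr (\<beta> - 1) * (LINT y:B|M. f y / V y)) x) powr q x) \<partial>M) \<le> ennreal K"
      if [measurable]: "f \<in> borel_measurable M" and fnn: "\<And>x. 0 \<le> f x" and fmod: "(\<integral>\<^sup>+ x. ennreal (f x powr r x) \<partial>M) \<le> 1" for f N
    proof -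
      define X where "X = (\<lambda>B. measure M B powr (\<beta> - 1) * (LINT y:B|M. f y / V y))"
      have fVnn: "0 \<le> f y / V y" for y using fnn[of y] Vpos[of y] by simp
      have Xnn: "0 \<le> X B" for B
        unfolding X_def set_lebesgue_integral_def
        by (intro mult_nonneg_nonneg integral_nonneg_AE AE_I2) (auto simp: indicator_def fVnn simp del: divide_nonneg_nonneg)
      define G where "G = (\<lambda>x. V x * mx N X x)"
      have [measurable]: "G \<in> borel_measurable M" unfolding G_def by measurable
      have Gnn: "0 \<le> G x" for x unfolding G_def using Vpos[of x] mx_nonneg[of X N x] Xnn by simp
      \<comment> \<open>Truncation in height and in space makes the modular finite beforehand, as
        the argument divides by a power of it.\<close>
      define Gk where "Gk = (\<lambda>(k::nat) x. min (G x) (real k) * indicator (ball org (int k)) x)"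
      have [measurable]: "Gk k \<in> borel_measurable M" for k unfolding Gk_def by measurable
      have Gknn: "0 \<le> Gk k x" for k x using Gnn[of x] by (simp add: Gk_def)
      have GkG: "Gk k x \<le> G x" for k x using Gnn[of x] by (auto simp: Gk_def indicator_def)
      have Gkinc: "Gk k x \<le> Gk (Suc k) x" for k x
        using Gnn[of x] ball_mono[of "int k" "int (Suc k)" org] by (auto simp: Gk_def indicator_def)
      have mod: "(\<integral>\<^sup>+ x. ennreal (Gk k x powr q x) \<partial>M) \<le> ennreal K" for k
      proof -
        have "(\<integral>\<^sup>+ x. ennreal (Gk k x powr q x) \<partial>M) < \<infinity>"
        proof -
          have "(\<integral>\<^sup>+ x. ennreal (Gk k x powr q x) \<partial>M) \<le> (\<integral>\<^sup>+ x. ennreal ((1 + real k) powr qh) * indicator (ball org (int k)) x \<partial>M)"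
          proof (rule nn_integral_mono_AE)
            show "AE x in M. ennreal (Gk k x powr q x) \<le> ennreal ((1 + real k) powr qh) * indicator (ball org (int k)) x"
              using pw
            proof eventually_elim
              case (elim x)
              have "Gk k x powr q x \<le> (1 + real k) powr q x" using elim Gknn by (intro powr_mono2) (auto simp: Gk_def indicator_def)
              also have "\<dots> \<le> (1 + real k) powr qh" using elim by (intro powr_mono) auto
              finally show ?case by (auto simp: Gk_def indicator_def ennreal_leI)
            qed
          qed
          also have "\<dots> < \<infinity>" using finite_ball[of org "int k"] by (simp add: nn_integral_cmult_indicator ennreal_mult_less_top)
          finally show ?thesis .
        qed
        then obtain A where A: "0 \<le> A" "(\<integral>\<^sup>+ x. ennreal (Gk k x powr q x) \<partial>M) = ennreal A"
          by (cases "\<integral>\<^sup>+ x. ennreal (Gk k x powr q x) \<partial>M") auto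
        have "A \<le> K"
        proof (cases "A \<le> 1")
          case False
          \<comment> \<open>Up to normalization this is the extremal function of Hoelder's
            inequality, since \<open>(q - q0) * Q = q\<close>. As \<open>A > 1\<close> and
            \<open>Q\<close> is at least \<open>cq\<close>, the factor
            \<open>A powr (- (1 / cq))\<close> brings the modular of \<open>h\<close> down to at
            most 1, and the test leaves \<open>A powr (1 - 1 / cq)\<close>.\<close>
          define h where "h = (\<lambda>x. Gk k x powr (q x - q0) * A powr (- (1 / cq)))"
          have [measurable]: "h \<in> borel_measurable M" unfolding h_def by measurable
          have hmod: "(\<integral>\<^sup>+ x. ennreal (h x powr Q (r x)) \<partial>M) \<le> 1"
          proof -
            have "(\<integral>\<^sup>+ x. ennreal (h x powr Q (r x)) \<partial>M) \<le> (\<integral>\<^sup>+ x. ennreal (A powr (- 1)) * ennreal (Gk k x powr q x) \<partial>M)"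
            proof (rule nn_integral_mono_AE)
              show "AE x in M. ennreal (h x powr Q (r x)) \<le> ennreal (A powr (- 1)) * ennreal (Gk k x powr q x)"
                using pw
              proof eventually_elim
                case (elim x)
                have "h x powr Q (r x) = Gk k x powr ((q x - q0) * Q (r x)) * A powr (- (1 / cq) * Q (r x))"
                  using Gknn[of k x] False by (simp add: h_def powr_mult powr_powr)
                also have "(q x - q0) * Q (r x) = q x" using elim by simp
                also have "Gk k x powr q x * A powr (- (1 / cq) * Q (r x)) \<le> Gk k x powr q x * A powr (- 1)"
                proof (intro mult_left_mono powr_mono)
                  have "1 \<le> 1 / cq * Q (r x)" using elim cq by simp
                  then show "- (1 / cq) * Q (r x) \<le> - 1" by simp
                qed (use False in auto)
                finally show ?case by (simp add: ennreal_mult[symmetric] ennreal_leI mult.commute)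
              qed
            qed
            also have "\<dots> = ennreal (A powr (- 1)) * ennreal A" unfolding A(2)[symmetric] by (rule nn_integral_cmult) measurable
            also have "\<dots> = 1" using False by (simp add: ennreal_mult[symmetric] powr_minus)
            finally show ?thesis .
          qed
          have "ennreal (A powr (1 - 1 / cq)) = ennreal (A powr (- (1 / cq))) * ennreal A"
            using False by (simp add: ennreal_mult[symmetric] powr_diff powr_minus divide_inverse mult.commute)
          also have "\<dots> = (\<integral>\<^sup>+ x. ennreal (A powr (- (1 / cq))) * ennreal (Gk k x powr q x) \<partial>M)"
            unfolding A(2)[symmetric] by (rule nn_integral_cmult[symmetric]) measurable
          also have "\<dots> \<le> (\<integral>\<^sup>+ x. ennreal (G x powr q0 * h x) \<partial>M)"
          proof (rule nn_integral_mono)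
            fix x
            have "A powr (- (1 / cq)) * Gk k x powr q x = Gk k x powr q0 * h x"
              by (simp add: h_def powr_add[symmetric] mult_ac)
            also have "\<dots> \<le> G x powr q0 * h x"
              using GkG[of k x] Gknn[of k x] q0 by (intro mult_right_mono powr_mono2) (auto simp: h_def)
            finally show "ennreal (A powr (- (1 / cq))) * ennreal (Gk k x powr q x) \<le> ennreal (G x powr q0 * h x)"
              by (simp add: ennreal_mult[symmetric] ennreal_leI)
          qed
          also have "\<dots> \<le> ennreal K3" unfolding G_def X_def
            by (rule dual[OF _ fnn fmod _ _ hmod]) (auto simp: h_def)
          finally have "A powr (1 - 1 / cq) \<le> K3" using K30 by simp
          then have "(A powr (1 - 1 / cq)) powr (1 / (1 - 1 / cq)) \<le> K3 powr (1 / (1 - 1 / cq))"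
            using cq by (intro powr_mono2) auto
          then show ?thesis using cq False by (simp add: powr_powr K_def)
        qed (simp add: K_def)
        then show ?thesis unfolding A(2) by (rule ennreal_leI)
      qed
      have "(\<integral>\<^sup>+ x. ennreal (G x powr q x) \<partial>M) \<le> ennreal K"
      proof (rule modular_limit[where F = Gk and P = q])
        show "AE x in M. 0 < q x" using pw by eventually_elim simp
        show "AE x in M. 0 \<le> G x \<and> (\<forall>K\<ge>0. (\<forall>N. Gk N x \<le> K) \<longrightarrow> G x \<le> K)"
        proof (intro AE_I2 conjI Gnn allI impI)
          fix x L assume L: "\<forall>N. Gk N x \<le> L"
          obtain \<gamma> where g: "x \<in> ball org \<gamma>" using ball_cover by blast
          define n where "n = nat (max \<lceil>G x\<rceil> \<gamma>)"
          have "\<gamma> \<le> int n" "G x \<le> real n" by (auto simp: n_def le_max_iff_disj) linarith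
          then have "Gk n x = G x" using g ball_mono[of \<gamma> "int n" org] by (auto simp: Gk_def)
          then show "G x \<le> L" using L by metis
        qed
      qed (use mod Gknn Gkinc in auto)
      then show ?thesis by (simp add: G_def X_def)
    qed
    then show ?thesis by (intro exI[of _ K]) (auto simp: K_def)
  qed
  with a(3) show ?thesis by blast
qed

end

section \<open>The commutator\<close>

context normed_ball_space
begin

text \<open>Here \<open>\<beta>\<close> plays the role of \<open>\<alpha> / n\<close>, so that the
  dimension no longer appears.\<close>

definition fmax :: "real \<Rightarrow> ('a \<Rightarrow> real) \<Rightarrow> 'a \<Rightarrow> ennreal" where
  "fmax \<beta> f x = (SUP \<gamma>::int. ennreal (measure M (ball x \<gamma>) powr (\<beta> - 1))
     * (\<integral>\<^sup>+ y. indicator (ball x \<gamma>) y * ennreal \<bar>f y\<bar> \<partial>M))"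

definition fcomm :: "real \<Rightarrow> ('a \<Rightarrow> real) \<Rightarrow> ('a \<Rightarrow> real) \<Rightarrow> 'a \<Rightarrow> real" where
  "fcomm \<beta> b f x = b x * enn2real (fmax \<beta> f x) - enn2real (fmax \<beta> (\<lambda>y. b y * f y) x)"

lemma measurable_fmax [measurable]: "fmax \<beta> f \<in> borel_measurable M"
  unfolding fmax_def
  by (rule borel_measurable_SUP) (auto intro: measurable_ball_fun[where c = "\<lambda>B. ennreal (measure M B powr (\<beta> - 1)) * (\<integral>\<^sup>+ y. indicator B y * ennreal \<bar>f y\<bar> \<partial>M)"])

lemma measurable_fcomm [measurable]: "b \<in> borel_measurable M \<Longrightarrow> fcomm \<beta> b f \<in> borel_measurable M"
proof -
  have [measurable]: "(\<lambda>x. enn2real (fmax \<beta> g x)) \<in> borel_measurable M" for g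
    using measurable_fmax by (rule borel_measurable_enn2real)
  assume [measurable]: "b \<in> borel_measurable M"
  show ?thesis unfolding fcomm_def by measurable
qed

text \<open>Real valued counterpart of a single term of \<open>fmax\<close>, so that truncated
  maxima and limits can be taken in the reals.\<close>

definition fterm :: "real \<Rightarrow> ('a \<Rightarrow> real) \<Rightarrow> 'a set \<Rightarrow> real" where
  "fterm \<beta> f B = measure M B powr (\<beta> - 1) * (LINT y:B|M. \<bar>f y\<bar>)"

lemma fterm_nonneg: "0 \<le> fterm \<beta> f B"
  unfolding fterm_def set_lebesgue_integral_def by (intro mult_nonneg_nonneg integral_nonneg_AE AE_I2) auto

lemma fterm_nn_integral:
  assumes "set_integrable M (ball x \<gamma>) f"
  shows "ennreal (measure M (ball x \<gamma>) powr (\<beta> - 1)) * (\<integral>\<^sup>+ y. indicator (ball x \<gamma>) y * ennreal \<bar>f y\<bar> \<partial>M) = ennreal (fterm \<beta> f (ball x \<gamma>))"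
proof -
  have "(\<integral>\<^sup>+ y. indicator (ball x \<gamma>) y * ennreal \<bar>f y\<bar> \<partial>M) = ennreal (LINT y:ball x \<gamma>|M. \<bar>f y\<bar>)"
    by (subst nn_integral_ball_eq[symmetric]) (use set_integrable_abs[OF assms] in \<open>auto simp: mult.commute\<close>)
  moreover have "0 \<le> (LINT y:ball x \<gamma>|M. \<bar>f y\<bar>)"
    unfolding set_lebesgue_integral_def by (intro integral_nonneg_AE AE_I2) auto
  ultimately show ?thesis by (simp add: fterm_def ennreal_mult)
qed

lemma fmax_SUP:
  assumes "\<And>\<gamma>. set_integrable M (ball x \<gamma>) f"
  shows "fmax \<beta> f x = (SUP N. ennreal (mx N (fterm \<beta> f) x))"
proof (rule antisym)
  show "fmax \<beta> f x \<le> (SUP N. ennreal (mx N (fterm \<beta> f) x))"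
    unfolding fmax_def
  proof (rule SUP_least)
    fix \<gamma> :: int
    have "fterm \<beta> f (ball x \<gamma>) \<le> mx (nat \<bar>\<gamma>\<bar>) (fterm \<beta> f) x" by (rule mx_ge) auto
    then have "ennreal (fterm \<beta> f (ball x \<gamma>)) \<le> ennreal (mx (nat \<bar>\<gamma>\<bar>) (fterm \<beta> f) x)" by (rule ennreal_leI)
    also have "\<dots> \<le> (SUP N. ennreal (mx N (fterm \<beta> f) x))" by (rule SUP_upper) simp
    finally show "ennreal (measure M (ball x \<gamma>) powr (\<beta> - 1)) * (\<integral>\<^sup>+ y. indicator (ball x \<gamma>) y * ennreal \<bar>f y\<bar> \<partial>M)
        \<le> (SUP N. ennreal (mx N (fterm \<beta> f) x))" unfolding fterm_nn_integral[OF assms] .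
  qed
  show "(SUP N. ennreal (mx N (fterm \<beta> f) x)) \<le> fmax \<beta> f x"
  proof (rule SUP_least)
    fix N
    obtain \<gamma> where "mx N (fterm \<beta> f) x = fterm \<beta> f (ball x \<gamma>)" by (rule mx_attained)
    then show "ennreal (mx N (fterm \<beta> f) x) \<le> fmax \<beta> f x"
      unfolding fmax_def by (simp only: fterm_nn_integral[OF assms, symmetric]) (rule SUP_upper, simp)
  qed
qed

text \<open>Justifies passing from truncations to \<open>enn2real\<close>. Finiteness is part of the
  conclusion because \<open>enn2real\<close> sends infinity to 0.\<close>

lemma fmax_limit:
  assumes int: "\<And>\<gamma>. set_integrable M (ball x \<gamma>) f" and K: "0 \<le> K" "\<And>N. mx N (fterm \<beta> f) x \<le> K"
  shows "fmax \<beta> f x < \<infinity>" "(\<lambda>N. mx N (fterm \<beta> f) x) \<longlonglongrightarrow> enn2real (fmax \<beta> f x)"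
proof -
  have "fmax \<beta> f x \<le> ennreal K" unfolding fmax_SUP[OF int] by (intro SUP_least ennreal_leI K)
  then show fin: "fmax \<beta> f x < \<infinity>" by (rule le_less_trans) simp
  have "(\<lambda>N. ennreal (mx N (fterm \<beta> f) x)) \<longlonglongrightarrow> fmax \<beta> f x"
    unfolding fmax_SUP[OF int] by (rule LIMSEQ_SUP) (auto intro!: incseq_SucI ennreal_leI mx_incseq)
  also have "fmax \<beta> f x = ennreal (enn2real (fmax \<beta> f x))" using fin by (simp add: less_top)
  finally show "(\<lambda>N. mx N (fterm \<beta> f) x) \<longlonglongrightarrow> enn2real (fmax \<beta> f x)"
    by (subst (asm) tendsto_ennreal_iff) (auto intro!: always_eventually mx_nonneg fterm_nonneg)
qed

text \<open>The exponential bound for \<open>\<bar>b x - b y\<bar>\<close> factors into a function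
  of \<open>x\<close> and one of \<open>y\<close>, so one average turns into two weighted averages.
  \<open>\<bar>b x\<bar>\<close> appears because \<open>fterm\<close> only sees
  \<open>\<bar>b y * f y\<bar>\<close>; the difference to \<open>b x\<close> is charged to the
  negative part later.\<close>

lemma fterm_diff_bound:
  assumes [measurable]: "b \<in> borel_measurable M" "f \<in> borel_measurable M" and \<tau>: "0 < \<tau>"
    and f0: "set_integrable M (ball x \<gamma>) f"
    and f1: "set_integrable M (ball x \<gamma>) (\<lambda>y. \<bar>f y\<bar> / exp (\<tau> * b y))"
    and f2: "set_integrable M (ball x \<gamma>) (\<lambda>y. \<bar>f y\<bar> / exp (- \<tau> * b y))"
  shows "set_integrable M (ball x \<gamma>) (\<lambda>y. b y * f y)"
    and "\<bar>\<bar>b x\<bar> * fterm \<beta> f (ball x \<gamma>) - fterm \<beta> (\<lambda>y. b y * f y) (ball x \<gamma>)\<bar>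
      \<le> 1 / \<tau> * (exp (\<tau> * b x) * fterm \<beta> (\<lambda>y. \<bar>f y\<bar> / exp (\<tau> * b y)) (ball x \<gamma>)
              + exp (- \<tau> * b x) * fterm \<beta> (\<lambda>y. \<bar>f y\<bar> / exp (- \<tau> * b y)) (ball x \<gamma>))"
proof -
  let ?B = "ball x \<gamma>"
  define k where "k = (\<lambda>y. 1 / \<tau> * (exp (\<tau> * b x) * (\<bar>f y\<bar> / exp (\<tau> * b y)) + exp (- \<tau> * b x) * (\<bar>f y\<bar> / exp (- \<tau> * b y))))"
  have kint: "set_integrable M ?B k" unfolding k_def
    by (intro set_integrable_mult_right set_integral_add(1) f1 f2)
  have pw: "\<bar>b x - b y\<bar> * \<bar>f y\<bar> \<le> k y" for y
  proof -
    define d where "d = b x - b y"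
    have "1 + \<tau> * \<bar>d\<bar> \<le> exp (\<tau> * \<bar>d\<bar>)" by (rule exp_ge_add_one_self)
    then have "\<tau> * \<bar>d\<bar> \<le> exp (\<tau> * \<bar>d\<bar>)" by linarith
    also have "\<dots> \<le> exp (\<tau> * d) + exp (- \<tau> * d)" by (auto simp: abs_if)
    finally have "\<bar>d\<bar> \<le> 1 / \<tau> * (exp (\<tau> * d) + exp (- \<tau> * d))" using \<tau> by (simp add: field_simps)
    then have "\<bar>d\<bar> * \<bar>f y\<bar> \<le> (1 / \<tau> * (exp (\<tau> * d) + exp (- \<tau> * d))) * \<bar>f y\<bar>" by (rule mult_right_mono) simp
    also have "\<dots> = k y" unfolding k_def d_def
      by (simp add: right_diff_distrib exp_diff exp_minus field_simps)
    finally show ?thesis by (simp add: d_def)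
  qed
  have bf_le: "\<bar>b y * f y\<bar> \<le> \<bar>b x\<bar> * \<bar>f y\<bar> + k y" and bf_ge: "\<bar>b x\<bar> * \<bar>f y\<bar> \<le> \<bar>b y * f y\<bar> + k y" for y
  proof -
    have "\<bar>b y\<bar> * \<bar>f y\<bar> \<le> (\<bar>b x\<bar> + \<bar>b x - b y\<bar>) * \<bar>f y\<bar>" "\<bar>b x\<bar> * \<bar>f y\<bar> \<le> (\<bar>b y\<bar> + \<bar>b x - b y\<bar>) * \<bar>f y\<bar>"
      by (intro mult_right_mono; simp)+
    then show "\<bar>b y * f y\<bar> \<le> \<bar>b x\<bar> * \<bar>f y\<bar> + k y" "\<bar>b x\<bar> * \<bar>f y\<bar> \<le> \<bar>b y * f y\<bar> + k y"
      using pw[of y] by (simp_all add: abs_mult distrib_right)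
  qed
  have bxf: "set_integrable M ?B (\<lambda>y. \<bar>b x\<bar> * \<bar>f y\<bar>)" by (intro set_integrable_mult_right set_integrable_abs f0)
  have knn: "0 \<le> k y" for y by (rule order_trans[OF _ pw]) simp
  show bfint: "set_integrable M ?B (\<lambda>y. b y * f y)"
  proof (rule set_integrable_bound[OF set_integral_add(1)[OF bxf kint]])
    show "set_borel_measurable M ?B (\<lambda>y. b y * f y)" unfolding set_borel_measurable_def by measurable
    show "AE y in M. y \<in> ?B \<longrightarrow> norm (b y * f y) \<le> norm (\<bar>b x\<bar> * \<bar>f y\<bar> + k y)"
      using bf_le knn by (intro AE_I2) (auto intro: order_trans[OF _ abs_ge_self])
  qed
  have abf: "set_integrable M ?B (\<lambda>y. \<bar>b y * f y\<bar>)" by (rule set_integrable_abs[OF bfint])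
  have 1: "(LINT y:?B|M. \<bar>b y * f y\<bar>) \<le> \<bar>b x\<bar> * (LINT y:?B|M. \<bar>f y\<bar>) + (LINT y:?B|M. k y)"
  proof -
    have "(LINT y:?B|M. \<bar>b y * f y\<bar>) \<le> (LINT y:?B|M. \<bar>b x\<bar> * \<bar>f y\<bar> + k y)"
      by (rule set_integral_mono[OF abf set_integral_add(1)[OF bxf kint] bf_le])
    then show ?thesis by (simp add: set_integral_add(2)[OF bxf kint])
  qed
  have 2: "\<bar>b x\<bar> * (LINT y:?B|M. \<bar>f y\<bar>) \<le> (LINT y:?B|M. \<bar>b y * f y\<bar>) + (LINT y:?B|M. k y)"
  proof -
    have "(LINT y:?B|M. \<bar>b x\<bar> * \<bar>f y\<bar>) \<le> (LINT y:?B|M. \<bar>b y * f y\<bar> + k y)"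
      by (rule set_integral_mono[OF bxf set_integral_add(1)[OF abf kint] bf_ge])
    then show ?thesis by (simp add: set_integral_add(2)[OF abf kint])
  qed
  have 3: "(LINT y:?B|M. k y) = 1 / \<tau> * (exp (\<tau> * b x) * (LINT y:?B|M. \<bar>f y\<bar> / exp (\<tau> * b y)) + exp (- \<tau> * b x) * (LINT y:?B|M. \<bar>f y\<bar> / exp (- \<tau> * b y)))"
  proof -
    have "(LINT y:?B|M. k y) = 1 / \<tau> * (LINT y:?B|M. exp (\<tau> * b x) * (\<bar>f y\<bar> / exp (\<tau> * b y)) + exp (- \<tau> * b x) * (\<bar>f y\<bar> / exp (- \<tau> * b y)))"
      unfolding k_def by (rule set_integral_mult_right)
    then show ?thesis
      by (simp only: set_integral_add(2)[OF set_integrable_mult_right[OF f1] set_integrable_mult_right[OF f2]] set_integral_mult_right)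
  qed
  define m where "m = measure M ?B powr (\<beta> - 1)"
  define a where "a = \<bar>b x\<bar> * (LINT y:?B|M. \<bar>f y\<bar>)"
  define d where "d = (LINT y:?B|M. \<bar>b y * f y\<bar>)"
  have "\<bar>a - d\<bar> \<le> (LINT y:?B|M. k y)" using 1 2 by (simp add: a_def d_def abs_le_iff)
  then have "m * \<bar>a - d\<bar> \<le> m * (LINT y:?B|M. k y)" by (rule mult_left_mono) (simp add: m_def)
  moreover have "m * \<bar>a - d\<bar> = \<bar>\<bar>b x\<bar> * fterm \<beta> f ?B - fterm \<beta> (\<lambda>y. b y * f y) ?B\<bar>"
  proof -
    have "m * \<bar>a - d\<bar> = \<bar>m * (a - d)\<bar>" by (simp add: abs_mult m_def)
    also have "m * (a - d) = \<bar>b x\<bar> * fterm \<beta> f ?B - fterm \<beta> (\<lambda>y. b y * f y) ?B"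
      by (simp add: fterm_def m_def a_def d_def right_diff_distrib mult_ac)
    finally show ?thesis .
  qed
  moreover have "m * (LINT y:?B|M. k y) = 1 / \<tau> * (exp (\<tau> * b x) * fterm \<beta> (\<lambda>y. \<bar>f y\<bar> / exp (\<tau> * b y)) ?B
              + exp (- \<tau> * b x) * fterm \<beta> (\<lambda>y. \<bar>f y\<bar> / exp (- \<tau> * b y)) ?B)"
    unfolding 3 fterm_def m_def by (simp add: distrib_left mult_ac)
  ultimately show "\<bar>\<bar>b x\<bar> * fterm \<beta> f (ball x \<gamma>) - fterm \<beta> (\<lambda>y. b y * f y) (ball x \<gamma>)\<bar>
      \<le> 1 / \<tau> * (exp (\<tau> * b x) * fterm \<beta> (\<lambda>y. \<bar>f y\<bar> / exp (\<tau> * b y)) (ball x \<gamma>)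
              + exp (- \<tau> * b x) * fterm \<beta> (\<lambda>y. \<bar>f y\<bar> / exp (- \<tau> * b y)) (ball x \<gamma>))" by simp
qed

text \<open>By \<open>\<bar>s\<bar> \<le> (e\<^bsup>\<tau>s\<^esup> + e\<^bsup>-\<tau>s\<^esup>) / \<tau>\<close> the maximal commutator is controlled by weighted fractional
  maximal functions with weights \<open>e\<^bsup>\<tau>b\<^esup>\<close> and \<open>e\<^bsup>-\<tau>b\<^esup>\<close>, to which extrapolation applies for small \<open>\<tau>\<close>
  because of the John--Nirenberg inequality.\<close>

theorem commutator_modular:
  fixes b :: "'a \<Rightarrow> real"
  assumes r: "log_holder r lo hi" and lo: "1 < lo" and \<beta>: "0 < \<beta>" "hi * \<beta> < 1"
    and qm [measurable]: "q \<in> borel_measurable M" and q: "AE x in M. 1 / q x = 1 / r x - \<beta>"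
    and bm [measurable]: "b \<in> borel_measurable M" and bint: "\<And>x \<gamma>. set_integrable M (ball x \<gamma>) b"
    and osc: "\<And>x \<gamma>. avg M (\<lambda>y. \<bar>b y - avg M b (ball x \<gamma>)\<bar>) (ball x \<gamma>) \<le> A"
    and neg: "AE x in M. - b x \<le> C0"
  shows "\<exists>K\<ge>0. \<forall>f. f \<in> borel_measurable M \<longrightarrow> (\<integral>\<^sup>+ x. ennreal (\<bar>f x\<bar> powr r x) \<partial>M) \<le> 1 \<longrightarrow>
    (AE x in M. fmax \<beta> f x < \<infinity> \<and> fmax \<beta> (\<lambda>y. b y * f y) x < \<infinity>)
    \<and> (\<integral>\<^sup>+ x. ennreal (\<bar>fcomm \<beta> b f x\<bar> powr q x) \<partial>M) \<le> ennreal K"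
proof -
  have rm [measurable]: "r \<in> borel_measurable M" and rb: "AE x in M. lo \<le> r x \<and> r x \<le> hi" and lohi: "lo \<le> hi"
    using r unfolding log_holder_def by auto
  have bhi: "0 < 1 / hi - \<beta>" using \<beta> lo lohi by (simp add: field_simps)
  define qh where "qh = 1 / (1 / hi - \<beta>)"
  have qb: "AE x in M. 0 < q x \<and> q x \<le> qh"
    using rb q
  proof eventually_elim
    case (elim x)
    have i1: "1 / hi \<le> 1 / r x" using elim lo by (auto simp: frac_le)
    have pos: "0 < 1 / q x" using i1 bhi elim by simp
    have "q x = 1 / (1 / r x - \<beta>)" using elim(2) by (metis div_by_1 divide_divide_eq_right mult.left_neutral)
    also have "\<dots> \<le> qh" unfolding qh_def using i1 bhi by (intro frac_le) auto
    finally show ?case using pos by simp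
  qed
  define A' where "A' = max 1 A"
  define t where "t = ln (3 / 2) / (4 * D * A')"
  have t0: "0 < t" using D_gt_1 by (simp add: t_def A'_def)
  have JN: "(\<integral>\<^sup>+ y. ennreal (exp (t * \<bar>b y - avg M b (ball x \<gamma>)\<bar>)) * indicator (ball x \<gamma>) y \<partial>M) \<le> 6 * emeasure M (ball x \<gamma>)" for x \<gamma>
  proof (rule John_Nirenberg[where A = A'])
    show "avg M (\<lambda>y. \<bar>b y - avg M b (ball x \<gamma>)\<bar>) (ball x \<gamma>) \<le> A'" for x \<gamma>
      by (rule order_trans[OF osc]) (simp add: A'_def)
  qed (use bint in \<open>auto simp: A'_def t_def\<close>)
  obtain a where a: "0 < a" and ext: "\<And>V k. V \<in> borel_measurable M \<Longrightarrow> (\<forall>x. 0 < V x) \<Longrightarrow> 0 \<le> k \<Longrightarrow>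
    (\<forall>x \<gamma>. \<exists>c>0. (\<integral>\<^sup>+ y. ennreal ((V y / c) powr a) * indicator (ball x \<gamma>) y \<partial>M) \<le> ennreal k * emeasure M (ball x \<gamma>)
        \<and> (\<integral>\<^sup>+ y. ennreal ((c / V y) powr a) * indicator (ball x \<gamma>) y \<partial>M) \<le> ennreal k * emeasure M (ball x \<gamma>)) \<Longrightarrow>
    (\<exists>K\<ge>0. \<forall>f N. f \<in> borel_measurable M \<longrightarrow> (\<forall>x. 0 \<le> f x) \<longrightarrow> (\<integral>\<^sup>+ x. ennreal (f x powr r x) \<partial>M) \<le> 1 \<longrightarrow>
      (\<integral>\<^sup>+ x. ennreal ((V x * mx N (\<lambda>B. measure M B powr (\<beta> - 1) * (LINT y:B|M. f y / V y)) x) powr q x) \<partial>M) \<le> ennreal K)"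
    using extrapolation[OF r lo \<beta> qm q] by blast
  define lp where "lp = lo / (lo - 1)"
  have lp: "1 < lp" "1 / lo + 1 / lp = 1" using lo by (auto simp: lp_def field_simps)
  \<comment> \<open>Small enough for two purposes: the power \<open>a\<close> demanded by the
    extrapolation, and the power \<open>lp\<close> conjugate to \<open>lo\<close>, which makes
    \<open>f\<close> divided by the weight locally integrable.\<close>
  define \<tau> where "\<tau> = t / max a lp"
  have \<tau>: "0 < \<tau>" "\<tau> * a \<le> t" "\<tau> * lp \<le> t"
    using t0 a lp by (auto simp: \<tau>_def field_simps less_max_iff_disj)
  have expB: "(\<integral>\<^sup>+ y. ennreal (exp (e * b y) powr i) * indicator (ball x \<gamma>) y \<partial>M)
      \<le> ennreal (exp (e * i * avg M b (ball x \<gamma>)) * 6) * emeasure M (ball x \<gamma>)"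
    if ei: "\<bar>e\<bar> = \<tau>" "0 \<le> i" "\<tau> * i \<le> t" for e i x \<gamma>
  proof -
    let ?c = "avg M b (ball x \<gamma>)"
    have "(\<integral>\<^sup>+ y. ennreal (exp (e * b y) powr i) * indicator (ball x \<gamma>) y \<partial>M)
      \<le> (\<integral>\<^sup>+ y. ennreal (exp (e * i * ?c)) * (ennreal (exp (t * \<bar>b y - ?c\<bar>)) * indicator (ball x \<gamma>) y) \<partial>M)"
    proof (rule nn_integral_mono)
      fix y
      have "e * i * (b y - ?c) \<le> \<bar>e * i * (b y - ?c)\<bar>" by simp
      also have "\<dots> = \<tau> * i * \<bar>b y - ?c\<bar>" using ei by (simp add: abs_mult)
      also have "\<dots> \<le> t * \<bar>b y - ?c\<bar>" by (intro mult_right_mono ei) simp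
      finally have "exp (e * b y) powr i \<le> exp (e * i * ?c) * exp (t * \<bar>b y - ?c\<bar>)"
        by (simp add: powr_def exp_add[symmetric] algebra_simps)
      then show "ennreal (exp (e * b y) powr i) * indicator (ball x \<gamma>) y
          \<le> ennreal (exp (e * i * ?c)) * (ennreal (exp (t * \<bar>b y - ?c\<bar>)) * indicator (ball x \<gamma>) y)"
        by (simp add: mult.assoc[symmetric] ennreal_mult[symmetric] mult_right_mono ennreal_leI)
    qed
    also have "\<dots> = ennreal (exp (e * i * ?c)) * (\<integral>\<^sup>+ y. ennreal (exp (t * \<bar>b y - ?c\<bar>)) * indicator (ball x \<gamma>) y \<partial>M)"
      by (rule nn_integral_cmult) measurable
    also have "\<dots> \<le> ennreal (exp (e * i * ?c)) * (6 * emeasure M (ball x \<gamma>))" by (intro mult_left_mono JN) simp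
    also have "\<dots> = ennreal (exp (e * i * ?c) * 6) * emeasure M (ball x \<gamma>)" by (simp add: ennreal_mult mult.assoc)
    finally show ?thesis .
  qed
  \<comment> \<open>The case \<open>e = 0\<close> is the unweighted fractional maximal function; it
    pays for replacing \<open>b\<close> by \<open>\<bar>b\<bar>\<close>.\<close>
  have extV: "\<exists>K\<ge>0. \<forall>f N. f \<in> borel_measurable M \<longrightarrow> (\<forall>x. 0 \<le> f x) \<longrightarrow> (\<integral>\<^sup>+ x. ennreal (f x powr r x) \<partial>M) \<le> 1 \<longrightarrow>
      (\<integral>\<^sup>+ x. ennreal ((exp (e * b x) * mx N (\<lambda>B. measure M B powr (\<beta> - 1) * (LINT y:B|M. f y / exp (e * b y))) x) powr q x) \<partial>M) \<le> ennreal K"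
    if e: "\<bar>e\<bar> = \<tau> \<or> e = 0" for e
  proof (rule ext[where V = "\<lambda>x. exp (e * b x)" and k = 6])
    show "\<forall>x \<gamma>. \<exists>c>0. (\<integral>\<^sup>+ y. ennreal ((exp (e * b y) / c) powr a) * indicator (ball x \<gamma>) y \<partial>M) \<le> ennreal 6 * emeasure M (ball x \<gamma>)
        \<and> (\<integral>\<^sup>+ y. ennreal ((c / exp (e * b y)) powr a) * indicator (ball x \<gamma>) y \<partial>M) \<le> ennreal 6 * emeasure M (ball x \<gamma>)"
    proof (intro allI exI conjI)
      fix x \<gamma>
      let ?c = "avg M b (ball x \<gamma>)"
      show "0 < exp (e * ?c)" by simp
      have le: "e * a * (b y - ?c) \<le> t * \<bar>b y - ?c\<bar>" "- (e * a * (b y - ?c)) \<le> t * \<bar>b y - ?c\<bar>" for y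
      proof -
        have "\<bar>e * a * (b y - ?c)\<bar> \<le> t * \<bar>b y - ?c\<bar>"
          using e \<tau>(2) a t0 by (auto simp: abs_mult intro!: mult_right_mono)
        then show "e * a * (b y - ?c) \<le> t * \<bar>b y - ?c\<bar>" "- (e * a * (b y - ?c)) \<le> t * \<bar>b y - ?c\<bar>" by auto
      qed
      have "(\<integral>\<^sup>+ y. ennreal ((exp (e * b y) / exp (e * ?c)) powr a) * indicator (ball x \<gamma>) y \<partial>M)
          \<le> (\<integral>\<^sup>+ y. ennreal (exp (t * \<bar>b y - ?c\<bar>)) * indicator (ball x \<gamma>) y \<partial>M)"
        using le(1) by (intro nn_integral_mono mult_right_mono ennreal_leI) (auto simp: exp_diff[symmetric] powr_def algebra_simps)
      then show "(\<integral>\<^sup>+ y. ennreal ((exp (e * b y) / exp (e * ?c)) powr a) * indicator (ball x \<gamma>) y \<partial>M) \<le> ennreal 6 * emeasure M (ball x \<gamma>)"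
        using JN[of x \<gamma>] by simp
      have "(\<integral>\<^sup>+ y. ennreal ((exp (e * ?c) / exp (e * b y)) powr a) * indicator (ball x \<gamma>) y \<partial>M)
          \<le> (\<integral>\<^sup>+ y. ennreal (exp (t * \<bar>b y - ?c\<bar>)) * indicator (ball x \<gamma>) y \<partial>M)"
        using le(2) by (intro nn_integral_mono mult_right_mono ennreal_leI) (auto simp: exp_diff[symmetric] powr_def algebra_simps)
      then show "(\<integral>\<^sup>+ y. ennreal ((exp (e * ?c) / exp (e * b y)) powr a) * indicator (ball x \<gamma>) y \<partial>M) \<le> ennreal 6 * emeasure M (ball x \<gamma>)"
        using JN[of x \<gamma>] by simp
    qed
  qed auto
  define G where "G = (\<lambda>f e N x. exp (e * b x) * mx N (fterm \<beta> (\<lambda>y. \<bar>f y\<bar> / exp (e * b y))) x)"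
  have Gm [measurable]: "G f e N \<in> borel_measurable M" for f e N unfolding G_def by measurable
  have Gnn: "0 \<le> G f e N x" for f e N x unfolding G_def by (intro mult_nonneg_nonneg mx_nonneg fterm_nonneg) auto
  have Ginc: "G f e N x \<le> G f e (Suc N) x" for f e N x unfolding G_def by (intro mult_left_mono mx_incseq) auto
  have "\<exists>K\<ge>0. \<forall>f N. f \<in> borel_measurable M \<longrightarrow> (\<integral>\<^sup>+ x. ennreal (\<bar>f x\<bar> powr r x) \<partial>M) \<le> 1 \<longrightarrow>
      (\<integral>\<^sup>+ x. ennreal (G f e N x powr q x) \<partial>M) \<le> ennreal K"
    if ee: "\<bar>e\<bar> = \<tau> \<or> e = 0" for e
  proof -
    obtain K where K: "0 \<le> K" "\<And>f N. f \<in> borel_measurable M \<Longrightarrow> (\<forall>x. 0 \<le> f x) \<Longrightarrow> (\<integral>\<^sup>+ x. ennreal (f x powr r x) \<partial>M) \<le> 1 \<Longrightarrow>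
      (\<integral>\<^sup>+ x. ennreal ((exp (e * b x) * mx N (\<lambda>B. measure M B powr (\<beta> - 1) * (LINT y:B|M. f y / exp (e * b y))) x) powr q x) \<partial>M) \<le> ennreal K"
      using extV[OF ee] by blast
    have ft: "fterm \<beta> (\<lambda>y. \<bar>f y\<bar> / exp (e * b y)) = (\<lambda>B. measure M B powr (\<beta> - 1) * (LINT y:B|M. \<bar>f y\<bar> / exp (e * b y)))" for f
      by (simp add: fterm_def fun_eq_iff)
    show ?thesis
      by (rule exI[of _ K]) (use K(1) K(2)[of "\<lambda>x. \<bar>_ x\<bar>"] in \<open>auto simp: G_def ft\<close>)
  qed
  note GK = this
  obtain K1 where K1: "0 \<le> K1" "\<And>f N. f \<in> borel_measurable M \<Longrightarrow> (\<integral>\<^sup>+ x. ennreal (\<bar>f x\<bar> powr r x) \<partial>M) \<le> 1 \<Longrightarrow> (\<integral>\<^sup>+ x. ennreal (G f \<tau> N x powr q x) \<partial>M) \<le> ennreal K1"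
    using GK[of \<tau>] \<tau> by auto
  obtain K2 where K2: "0 \<le> K2" "\<And>f N. f \<in> borel_measurable M \<Longrightarrow> (\<integral>\<^sup>+ x. ennreal (\<bar>f x\<bar> powr r x) \<partial>M) \<le> 1 \<Longrightarrow> (\<integral>\<^sup>+ x. ennreal (G f (- \<tau>) N x powr q x) \<partial>M) \<le> ennreal K2"
    using GK[of "- \<tau>"] \<tau> by auto
  obtain K3 where K3: "0 \<le> K3" "\<And>f N. f \<in> borel_measurable M \<Longrightarrow> (\<integral>\<^sup>+ x. ennreal (\<bar>f x\<bar> powr r x) \<partial>M) \<le> 1 \<Longrightarrow> (\<integral>\<^sup>+ x. ennreal (G f 0 N x powr q x) \<partial>M) \<le> ennreal K3"
    using GK[of 0] by auto
  define C1 where "C1 = max 1 C0"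
  \<comment> \<open>The factor 3 comes from bounding a sum of three terms by three times their
    maximum.\<close>
  define \<kappa> where "\<kappa> = 3 * max (1 / \<tau>) (2 * C1)"
  have C1: "1 \<le> C1" by (simp add: C1_def)
  have \<kappa>: "1 \<le> \<kappa>" "3 * (1 / \<tau>) \<le> \<kappa>" "3 * (2 * C1) \<le> \<kappa>" using C1 by (auto simp: \<kappa>_def)
  define K where "K = \<kappa> powr qh * (K1 + K2 + K3)"
  have "(AE x in M. fmax \<beta> f x < \<infinity> \<and> fmax \<beta> (\<lambda>y. b y * f y) x < \<infinity>)
    \<and> (\<integral>\<^sup>+ x. ennreal (\<bar>fcomm \<beta> b f x\<bar> powr q x) \<partial>M) \<le> ennreal K"
    if fm [measurable]: "f \<in> borel_measurable M" and fmod: "(\<integral>\<^sup>+ x. ennreal (\<bar>f x\<bar> powr r x) \<partial>M) \<le> 1" for f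
  proof -
    define F where "F = (\<lambda>N x. 1 / \<tau> * (G f \<tau> N x + G f (- \<tau>) N x) + 2 * C1 * G f 0 N x)"
    have [measurable]: "F N \<in> borel_measurable M" for N unfolding F_def by measurable
    have Fnn: "0 \<le> F N x" for N x unfolding F_def using \<tau> C1 Gnn by simp
    have Finc: "F N x \<le> F (Suc N) x" for N x unfolding F_def using \<tau> C1
      by (intro add_mono mult_left_mono Ginc) auto
    have FK: "(\<integral>\<^sup>+ x. ennreal (F N x powr q x) \<partial>M) \<le> ennreal K" for N
    proof -
      have "(\<integral>\<^sup>+ x. ennreal (F N x powr q x) \<partial>M)
        \<le> (\<integral>\<^sup>+ x. ennreal (\<kappa> powr qh) * (ennreal (G f \<tau> N x powr q x) + ennreal (G f (- \<tau>) N x powr q x) + ennreal (G f 0 N x powr q x)) \<partial>M)"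
      proof (rule nn_integral_mono_AE)
        show "AE x in M. ennreal (F N x powr q x) \<le> ennreal (\<kappa> powr qh) * (ennreal (G f \<tau> N x powr q x) + ennreal (G f (- \<tau>) N x powr q x) + ennreal (G f 0 N x powr q x))"
          using qb
        proof eventually_elim
          case (elim x)
          define m where "m = max (G f \<tau> N x) (max (G f (- \<tau>) N x) (G f 0 N x))"
          have m0: "0 \<le> m" using Gnn[of f \<tau> N x] by (simp add: m_def)
          have "1 / \<tau> * G f \<tau> N x \<le> \<kappa> / 3 * m" "1 / \<tau> * G f (- \<tau>) N x \<le> \<kappa> / 3 * m" "2 * C1 * G f 0 N x \<le> \<kappa> / 3 * m"
            using \<kappa> Gnn by (intro mult_mono; simp add: m_def)+
          then have "F N x \<le> \<kappa> * m" unfolding F_def distrib_left by linarith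
          then have "F N x powr q x \<le> (\<kappa> * m) powr q x" using elim Fnn by (intro powr_mono2) auto
          also have "\<dots> = \<kappa> powr q x * m powr q x" using \<kappa> m0 by (simp add: powr_mult)
          also have "\<dots> \<le> \<kappa> powr qh * (G f \<tau> N x powr q x + G f (- \<tau>) N x powr q x + G f 0 N x powr q x)"
            using elim \<kappa> by (intro mult_mono powr_mono) (auto simp: m_def max_def)
          finally have "ennreal (F N x powr q x) \<le> ennreal (\<kappa> powr qh * (G f \<tau> N x powr q x + G f (- \<tau>) N x powr q x + G f 0 N x powr q x))"
            by (rule ennreal_leI)
          then show ?case by (simp add: ennreal_mult ennreal_plus)
        qed
      qed
      also have "\<dots> = ennreal (\<kappa> powr qh) * ((\<integral>\<^sup>+ x. ennreal (G f \<tau> N x powr q x) \<partial>M) + (\<integral>\<^sup>+ x. ennreal (G f (- \<tau>) N x powr q x) \<partial>M) + (\<integral>\<^sup>+ x. ennreal (G f 0 N x powr q x) \<partial>M))"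
        by (subst nn_integral_cmult) (auto simp: nn_integral_add)
      also have "\<dots> \<le> ennreal (\<kappa> powr qh) * (ennreal K1 + ennreal K2 + ennreal K3)"
        by (intro mult_left_mono add_mono K1 K2 K3 fm fmod) auto
      also have "\<dots> = ennreal K" using K1(1) K2(1) K3(1) by (simp add: K_def ennreal_mult ennreal_plus)
      finally show ?thesis .
    qed
    have r1: "AE x in M. 1 \<le> r x" using rb by eventually_elim (use lo in auto)
    have fint: "set_integrable M (ball x \<gamma>) (\<lambda>y. \<bar>f y\<bar>)" for x \<gamma>
      by (rule set_integrable_of_modular[OF _ rm _ r1]) (use fmod in \<open>auto intro: le_less_trans\<close>)
    have fint': "set_integrable M (ball x \<gamma>) f" for x \<gamma>
      by (rule set_integrable_bound[OF fint[of x \<gamma>]]) (auto simp: set_borel_measurable_def)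
    \<comment> \<open>Young with \<open>lo\<close> and \<open>lp\<close>; the exponential factor is
      integrable over balls by the John-Nirenberg inequality.\<close>
    have fe: "set_integrable M (ball x \<gamma>) (\<lambda>y. \<bar>f y\<bar> / exp (e * b y))" if e: "\<bar>e\<bar> = \<tau>" for e x \<gamma>
      unfolding set_integrable_def
    proof (rule integrableI_bounded)
      have "(\<integral>\<^sup>+ y. ennreal (norm (indicator (ball x \<gamma>) y *\<^sub>R (\<bar>f y\<bar> / exp (e * b y)))) \<partial>M)
        \<le> (\<integral>\<^sup>+ y. ennreal (\<bar>f y\<bar> powr r y) + (indicator (ball x \<gamma>) y + ennreal (exp (- e * b y) powr lp) * indicator (ball x \<gamma>) y) \<partial>M)"
      proof (rule nn_integral_mono_AE)
        show "AE y in M. ennreal (norm (indicator (ball x \<gamma>) y *\<^sub>R (\<bar>f y\<bar> / exp (e * b y))))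
          \<le> ennreal (\<bar>f y\<bar> powr r y) + (indicator (ball x \<gamma>) y + ennreal (exp (- e * b y) powr lp) * indicator (ball x \<gamma>) y)"
          using rb
        proof eventually_elim
          case (elim y)
          have dl: "t / k \<le> t" if "0 \<le> t" "1 < k" for t k :: real
            using that by (simp add: divide_le_eq mult_le_cancel_left1)
          have "\<bar>f y\<bar> * exp (- e * b y) \<le> \<bar>f y\<bar> powr lo / lo + exp (- e * b y) powr lp / lp"
            by (rule Youngs_inequality) (use lo lp in auto)
          also have "\<dots> \<le> \<bar>f y\<bar> powr lo + exp (- e * b y) powr lp"
            by (intro add_mono dl lo lp) auto
          also have "\<bar>f y\<bar> powr lo \<le> \<bar>f y\<bar> powr r y + 1"
          proof (cases "1 \<le> \<bar>f y\<bar>")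
            case True
            then have "\<bar>f y\<bar> powr lo \<le> \<bar>f y\<bar> powr r y" using elim by (intro powr_mono) auto
            then show ?thesis by simp
          next
            case False
            then have "\<bar>f y\<bar> powr lo \<le> 1" using lo by (intro powr_le1) auto
            then show ?thesis by (rule order_trans) simp
          qed
          finally have "\<bar>f y\<bar> / exp (e * b y) \<le> \<bar>f y\<bar> powr r y + (1 + exp (- e * b y) powr lp)"
            by (simp add: exp_minus divide_inverse)
          then have "ennreal (\<bar>f y\<bar> / exp (e * b y)) \<le> ennreal (\<bar>f y\<bar> powr r y + (1 + exp (- e * b y) powr lp))"
            by (rule ennreal_leI)
          also have "\<dots> = ennreal (\<bar>f y\<bar> powr r y) + (1 + ennreal (exp (- e * b y) powr lp))"
            by (simp add: ennreal_plus)
          finally show ?case by (simp add: indicator_def)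
        qed
      qed
      also have "\<dots> = (\<integral>\<^sup>+ y. ennreal (\<bar>f y\<bar> powr r y) \<partial>M) + (emeasure M (ball x \<gamma>) + (\<integral>\<^sup>+ y. ennreal (exp (- e * b y) powr lp) * indicator (ball x \<gamma>) y \<partial>M))"
        by (subst nn_integral_add; (subst nn_integral_add)?; simp)
      also have "\<dots> < \<infinity>"
      proof -
        have "(\<integral>\<^sup>+ y. ennreal (exp (- e * b y) powr lp) * indicator (ball x \<gamma>) y \<partial>M) \<le> ennreal (exp (- e * lp * avg M b (ball x \<gamma>)) * 6) * emeasure M (ball x \<gamma>)"
          by (rule expB) (use e lp \<tau> in auto)
        also have "\<dots> < \<infinity>" using finite_ball[of x \<gamma>] by (simp add: ennreal_mult_less_top)
        finally have "(\<integral>\<^sup>+ y. ennreal (exp (- e * b y) powr lp) * indicator (ball x \<gamma>) y \<partial>M) < \<infinity>" .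
        moreover have "(\<integral>\<^sup>+ y. ennreal (\<bar>f y\<bar> powr r y) \<partial>M) < \<infinity>" using fmod by (auto intro: le_less_trans)
        ultimately show ?thesis using finite_ball[of x \<gamma>] by simp
      qed
      finally show "(\<integral>\<^sup>+ y. ennreal (norm (indicator (ball x \<gamma>) y *\<^sub>R (\<bar>f y\<bar> / exp (e * b y)))) \<partial>M) < \<infinity>" .
    qed measurable
    \<comment> \<open>A bound for all \<open>F N x\<close> at one point bounds both maximal
      functions and the commutator there. The two truncated maxima may be attained at different
      levels, so each is compared with the other one at its own level.\<close>
    have pw: "fmax \<beta> f x < \<infinity> \<and> fmax \<beta> (\<lambda>y. b y * f y) x < \<infinity> \<and> \<bar>fcomm \<beta> b f x\<bar> \<le> k"
      if k: "0 \<le> k" "\<forall>N. F N x \<le> k" and bx: "- b x \<le> C0" for x k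
    proof -
      define aN where "aN = (\<lambda>N. mx N (fterm \<beta> f) x)"
      define dN where "dN = (\<lambda>N. mx N (fterm \<beta> (\<lambda>y. b y * f y)) x)"
      define S where "S = (\<lambda>N. 1 / \<tau> * (G f \<tau> N x + G f (- \<tau>) N x))"
      have bfint: "set_integrable M (ball x \<gamma>) (\<lambda>y. b y * f y)" for \<gamma>
        by (rule fterm_diff_bound(1)[OF _ _ \<tau>(1) fint' fe fe]) (use \<tau> in auto)
      have "fterm \<beta> (\<lambda>y. \<bar>f y\<bar>) = fterm \<beta> f" by (simp add: fterm_def fun_eq_iff)
      then have aN: "aN N = G f 0 N x" for N by (simp add: aN_def G_def)
      have aN0: "0 \<le> aN N" for N by (simp add: aN Gnn)
      have S0: "0 \<le> S N" for N using \<tau> Gnn by (simp add: S_def)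
      have diff: "\<bar>\<bar>b x\<bar> * fterm \<beta> f (ball x \<gamma>) - fterm \<beta> (\<lambda>y. b y * f y) (ball x \<gamma>)\<bar> \<le> S N" if g: "\<gamma> \<in> {- int N..int N}" for \<gamma> N
      proof -
        have "\<bar>\<bar>b x\<bar> * fterm \<beta> f (ball x \<gamma>) - fterm \<beta> (\<lambda>y. b y * f y) (ball x \<gamma>)\<bar>
          \<le> 1 / \<tau> * (exp (\<tau> * b x) * fterm \<beta> (\<lambda>y. \<bar>f y\<bar> / exp (\<tau> * b y)) (ball x \<gamma>)
              + exp (- \<tau> * b x) * fterm \<beta> (\<lambda>y. \<bar>f y\<bar> / exp (- \<tau> * b y)) (ball x \<gamma>))"
          by (rule fterm_diff_bound(2)[OF _ _ \<tau>(1) fint' fe fe]) (use \<tau> in auto)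
        also have "\<dots> \<le> S N" unfolding S_def G_def using \<tau>
          by (intro mult_left_mono add_mono mx_ge g) auto
        finally show ?thesis .
      qed
      have dN_le: "dN N \<le> \<bar>b x\<bar> * aN N + S N" for N
      proof -
        obtain \<gamma> where g: "\<gamma> \<in> {- int N..int N}" "dN N = fterm \<beta> (\<lambda>y. b y * f y) (ball x \<gamma>)" unfolding dN_def by (rule mx_attained)
        have "\<bar>b x\<bar> * fterm \<beta> f (ball x \<gamma>) \<le> \<bar>b x\<bar> * aN N" unfolding aN_def by (intro mult_left_mono mx_ge g) simp
        then show ?thesis using diff[OF g(1)] g(2) by linarith
      qed
      have aN_le: "\<bar>b x\<bar> * aN N \<le> dN N + S N" for N
      proof -
        obtain \<gamma> where g: "\<gamma> \<in> {- int N..int N}" "aN N = fterm \<beta> f (ball x \<gamma>)" unfolding aN_def by (rule mx_attained)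
        have "fterm \<beta> (\<lambda>y. b y * f y) (ball x \<gamma>) \<le> dN N" unfolding dN_def by (intro mx_ge g)
        then show ?thesis unfolding g(2) using diff[OF g(1)] by linarith
      qed
      have tot: "S N + 2 * C1 * aN N \<le> k" for N using k(2) by (simp add: F_def S_def aN)
      have aNk: "aN N \<le> k" for N
      proof -
        have "aN N * 1 \<le> aN N * (2 * C1)" using C1 aN0 by (intro mult_left_mono) auto
        then show ?thesis using tot[of N] S0[of N] by (simp add: mult.commute)
      qed
      have Sk: "S N \<le> k" for N using tot[of N] aN0[of N] C1 by (smt (verit, best) mult_nonneg_nonneg)
      have dNk: "dN N \<le> \<bar>b x\<bar> * k + k" for N
      proof -
        have "\<bar>b x\<bar> * aN N \<le> \<bar>b x\<bar> * k" by (intro mult_left_mono aNk) simp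
        then show ?thesis using dN_le[of N] Sk[of N] by linarith
      qed
      have fin1: "fmax \<beta> f x < \<infinity>" and lim1: "aN \<longlonglongrightarrow> enn2real (fmax \<beta> f x)"
        using fmax_limit[OF fint' k(1) aNk[unfolded aN_def]] by (simp_all add: aN_def)
      have kk: "0 \<le> \<bar>b x\<bar> * k + k" using k(1) by simp
      have fin2: "fmax \<beta> (\<lambda>y. b y * f y) x < \<infinity>" and lim2: "dN \<longlonglongrightarrow> enn2real (fmax \<beta> (\<lambda>y. b y * f y) x)"
        using fmax_limit[OF bfint kk dNk[unfolded dN_def]] by (simp_all add: dN_def)
      have "\<bar>b x * aN N - dN N\<bar> \<le> k" for N
      proof -
        have "\<bar>b x * aN N - dN N\<bar> \<le> \<bar>\<bar>b x\<bar> * aN N - dN N\<bar> + \<bar>\<bar>b x\<bar> * aN N - b x * aN N\<bar>" by linarith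
        also have "\<bar>\<bar>b x\<bar> * aN N - dN N\<bar> \<le> S N" using dN_le[of N] aN_le[of N] by linarith
        also have "\<bar>\<bar>b x\<bar> * aN N - b x * aN N\<bar> \<le> 2 * C1 * aN N"
        proof -
          \<comment> \<open>The left side is twice the negative part of \<open>b\<close>.\<close>
          have "\<bar>b x\<bar> - b x \<le> 2 * C1" "0 \<le> \<bar>b x\<bar> - b x" using bx C1 by (auto simp: C1_def)
          then have "(\<bar>b x\<bar> - b x) * aN N \<le> 2 * C1 * aN N" "0 \<le> (\<bar>b x\<bar> - b x) * aN N"
            using aN0[of N] by (auto intro!: mult_right_mono)
          then show ?thesis by (simp add: left_diff_distrib)
        qed
        finally show ?thesis using tot[of N] by linarith
      qed
      moreover have "(\<lambda>N. \<bar>b x * aN N - dN N\<bar>) \<longlonglongrightarrow> \<bar>fcomm \<beta> b f x\<bar>"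
        unfolding fcomm_def by (intro tendsto_intros lim1 lim2)
      ultimately have "\<bar>fcomm \<beta> b f x\<bar> \<le> k" by (intro LIMSEQ_le_const2) auto
      then show ?thesis using fin1 fin2 by simp
    qed
    have q0: "AE x in M. 0 < q x" using qb by eventually_elim simp
    have bdd: "AE x in M. \<exists>k\<ge>0. \<forall>N. F N x \<le> k"
      by (rule modular_limit_bounded[where F = F and P = q and C = "ennreal K"]) (use q0 Fnn Finc FK in auto)
    have "AE x in M. fmax \<beta> f x < \<infinity> \<and> fmax \<beta> (\<lambda>y. b y * f y) x < \<infinity>"
      using bdd neg by eventually_elim (use pw in blast)
    moreover have "(\<integral>\<^sup>+ x. ennreal (\<bar>fcomm \<beta> b f x\<bar> powr q x) \<partial>M) \<le> ennreal K"
    proof (rule modular_limit[where F = F and P = q])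
      show "AE x in M. 0 \<le> \<bar>fcomm \<beta> b f x\<bar> \<and> (\<forall>k\<ge>0. (\<forall>N. F N x \<le> k) \<longrightarrow> \<bar>fcomm \<beta> b f x\<bar> \<le> k)"
        using neg by eventually_elim (use pw in auto)
    qed (use q0 Fnn Finc FK in auto)
    ultimately show ?thesis by blast
  qed
  then show ?thesis by (intro exI[of _ K]) (use K1(1) K2(1) K3(1) in \<open>auto simp: K_def\<close>)
qed

end

section \<open>Characteristic functions and the local maximal function\<close>

context normed_ball_space
begin

definition vnorm :: "('a \<Rightarrow> real) \<Rightarrow> ('a \<Rightarrow> real) \<Rightarrow> ennreal" where
  "vnorm q f = (INF \<eta>\<in>{\<eta>::real. 0 < \<eta> \<and> (\<integral>\<^sup>+ x. ennreal ((\<bar>f x\<bar> / \<eta>) powr q x) \<partial>M) \<le> 1}. ennreal \<eta>)"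

definition fmax_loc :: "real \<Rightarrow> 'a set \<Rightarrow> ('a \<Rightarrow> real) \<Rightarrow> 'a \<Rightarrow> ennreal" where
  "fmax_loc \<beta> Bs f x = (SUP \<gamma>\<in>{\<gamma>::int. ball x \<gamma> \<subseteq> Bs}. ennreal (measure M (ball x \<gamma>) powr (\<beta> - 1))
     * (\<integral>\<^sup>+ y. indicator (ball x \<gamma>) y * ennreal \<bar>f y\<bar> \<partial>M))"

lemma vnorm_upper: "0 < \<eta> \<Longrightarrow> (\<integral>\<^sup>+ x. ennreal ((\<bar>f x\<bar> / \<eta>) powr q x) \<partial>M) \<le> 1 \<Longrightarrow> vnorm q f \<le> ennreal \<eta>"
  unfolding vnorm_def by (rule INF_lower) simp

lemma vnorm_less:
  assumes "vnorm q f < ennreal c"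
  obtains \<eta> where "0 < \<eta>" "\<eta> < c" "(\<integral>\<^sup>+ x. ennreal ((\<bar>f x\<bar> / \<eta>) powr q x) \<partial>M) \<le> 1"
proof -
  obtain \<eta> where "0 < \<eta>" "(\<integral>\<^sup>+ x. ennreal ((\<bar>f x\<bar> / \<eta>) powr q x) \<partial>M) \<le> 1" "ennreal \<eta> < ennreal c"
    using assms unfolding vnorm_def INF_less_iff by blast
  then show ?thesis using that by (auto simp: ennreal_less_iff)
qed

text \<open>Passes estimates between modulars at height 1 to norms. An arbitrarily small
  \<open>e\<close> is spent because the infimum is only approximated.\<close>

lemma vnorm_scale_le:
  assumes c: "0 < c" and le: "\<And>\<eta>. 0 < \<eta> \<Longrightarrow> (\<integral>\<^sup>+ x. ennreal ((\<bar>f x\<bar> / \<eta>) powr q x) \<partial>M) \<le> 1 \<Longrightarrow> (\<integral>\<^sup>+ x. ennreal ((\<bar>g x\<bar> / (c * \<eta>)) powr q' x) \<partial>M) \<le> 1"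
  shows "vnorm q' g \<le> ennreal c * vnorm q f"
proof (cases "vnorm q f = \<infinity>")
  case True
  then show ?thesis using c by (simp add: ennreal_mult_top)
next
  case False
  then obtain v where v: "0 \<le> v" "vnorm q f = ennreal v" by (cases "vnorm q f") auto
  show ?thesis
  proof (rule ennreal_le_epsilon)
    fix e :: real assume e: "0 < e"
    have "vnorm q f < ennreal (v + e / c)" unfolding v(2) using v c e by (intro ennreal_lessI) (auto intro: add_nonneg_pos)
    then obtain \<eta> where \<eta>: "0 < \<eta>" "\<eta> < v + e / c" "(\<integral>\<^sup>+ x. ennreal ((\<bar>f x\<bar> / \<eta>) powr q x) \<partial>M) \<le> 1"
      by (rule vnorm_less)
    have "vnorm q' g \<le> ennreal (c * \<eta>)" by (rule vnorm_upper) (use c \<eta> le in auto)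
    also have "\<dots> \<le> ennreal (c * v + e)"
    proof (rule ennreal_leI)
      have "c * \<eta> \<le> c * (v + e / c)" using c \<eta> by (intro mult_left_mono) auto
      then show "c * \<eta> \<le> c * v + e" using c by (simp add: distrib_left)
    qed
    also have "\<dots> = ennreal c * vnorm q f + ennreal e" using c v e by (simp add: ennreal_mult)
    finally show "vnorm q' g \<le> ennreal c * vnorm q f + ennreal e" .
  qed
qed

lemma vnorm_mono_scale:
  assumes c: "0 < c" and q: "AE x in M. 0 < q x" and le: "\<And>x. \<bar>g x\<bar> \<le> c * \<bar>f x\<bar>"
  shows "vnorm q g \<le> ennreal c * vnorm q f"
proof (rule vnorm_scale_le[OF c])
  fix \<eta> :: real assume \<eta>: "0 < \<eta>" "(\<integral>\<^sup>+ x. ennreal ((\<bar>f x\<bar> / \<eta>) powr q x) \<partial>M) \<le> 1"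
  have "(\<integral>\<^sup>+ x. ennreal ((\<bar>g x\<bar> / (c * \<eta>)) powr q x) \<partial>M) \<le> (\<integral>\<^sup>+ x. ennreal ((\<bar>f x\<bar> / \<eta>) powr q x) \<partial>M)"
  proof (rule nn_integral_mono_AE)
    show "AE x in M. ennreal ((\<bar>g x\<bar> / (c * \<eta>)) powr q x) \<le> ennreal ((\<bar>f x\<bar> / \<eta>) powr q x)"
      using q
    proof eventually_elim
      case (elim x)
      have "\<bar>g x\<bar> / (c * \<eta>) \<le> c * \<bar>f x\<bar> / (c * \<eta>)" using le[of x] c \<eta> by (intro divide_right_mono) auto
      also have "\<dots> = \<bar>f x\<bar> / \<eta>" using c by simp
      finally show ?case using elim c \<eta> by (intro ennreal_leI powr_mono2) auto
    qed
  qed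
  then show "(\<integral>\<^sup>+ x. ennreal ((\<bar>g x\<bar> / (c * \<eta>)) powr q x) \<partial>M) \<le> 1" using \<eta>(2) by (rule order_trans)
qed

text \<open>With \<open>m\<close> the measure of the ball, the norm lies between
  \<open>min 1 m\<close> and \<open>max 1 m\<close>. Quotients by this norm are therefore meaningful
  in the extended reals.\<close>

lemma vnorm_ball_finite:
  assumes q: "AE x in M. 1 \<le> q x"
  shows "vnorm q (indicator (ball x \<gamma>)) < \<infinity>" "0 < vnorm q (indicator (ball x \<gamma>))"
proof -
  let ?B = "ball x \<gamma>"
  define m where "m = measure M ?B"
  have m: "0 < m" "emeasure M ?B = ennreal m" unfolding m_def using measure_ball_pos emeasure_ball by auto
  define \<eta> where "\<eta> = max 1 m"
  have \<eta>: "1 \<le> \<eta>" "m \<le> \<eta>" by (auto simp: \<eta>_def)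
  have "(\<integral>\<^sup>+ x. ennreal ((\<bar>indicator ?B x\<bar> / \<eta>) powr q x) \<partial>M) \<le> (\<integral>\<^sup>+ x. ennreal (1 / \<eta>) * indicator ?B x \<partial>M)"
  proof (rule nn_integral_mono_AE)
    show "AE x in M. ennreal ((\<bar>indicator ?B x\<bar> / \<eta>) powr q x) \<le> ennreal (1 / \<eta>) * indicator ?B x"
      using q
    proof eventually_elim
      case (elim x)
      have "(1 / \<eta>) powr q x \<le> (1 / \<eta>) powr 1" using elim \<eta> by (intro powr_mono') auto
      then show ?case using \<eta> by (auto simp: indicator_def intro!: ennreal_leI)
    qed
  qed
  also have "\<dots> = ennreal (1 / \<eta> * m)" using m \<eta> by (simp add: nn_integral_cmult_indicator ennreal_mult[symmetric])
  also have "\<dots> \<le> 1" using m \<eta> by simp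
  finally have "vnorm q (indicator ?B) \<le> ennreal \<eta>" using \<eta> by (intro vnorm_upper) auto
  then show "vnorm q (indicator ?B) < \<infinity>" by (rule le_less_trans) simp
  have "ennreal (min 1 m) \<le> vnorm q (indicator ?B)"
    unfolding vnorm_def
  proof (rule INF_greatest, clarify)
    fix \<eta> :: real assume \<eta>: "0 < \<eta>" "(\<integral>\<^sup>+ x. ennreal ((\<bar>indicator ?B x\<bar> / \<eta>) powr q x) \<partial>M) \<le> 1"
    have "min 1 m \<le> \<eta>"
    proof (cases "1 \<le> \<eta>")
      case False
      have "ennreal (1 / \<eta> * m) = (\<integral>\<^sup>+ x. ennreal (1 / \<eta>) * indicator ?B x \<partial>M)"
        using m \<eta> by (simp add: nn_integral_cmult_indicator ennreal_mult[symmetric])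
      also have "\<dots> \<le> (\<integral>\<^sup>+ x. ennreal ((\<bar>indicator ?B x\<bar> / \<eta>) powr q x) \<partial>M)"
      proof (rule nn_integral_mono_AE)
        show "AE x in M. ennreal (1 / \<eta>) * indicator ?B x \<le> ennreal ((\<bar>indicator ?B x\<bar> / \<eta>) powr q x)"
          using q
        proof eventually_elim
          case (elim x)
          have "(1 / \<eta>) powr 1 \<le> (1 / \<eta>) powr q x" using elim \<eta> False by (intro powr_mono) auto
          then show ?case using \<eta> by (auto simp: indicator_def intro!: ennreal_leI)
        qed
      qed
      finally have "ennreal (1 / \<eta> * m) \<le> 1" using \<eta>(2) by (rule order_trans)
      then have "m \<le> \<eta>" using \<eta>(1) m by (simp add: divide_le_eq)
      then show ?thesis by simp
    qed simp
    then show "ennreal (min 1 m) \<le> ennreal \<eta>" by (rule ennreal_leI)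
  qed
  then show "0 < vnorm q (indicator ?B)" using m by (auto intro: less_le_trans[rotated])
qed

text \<open>Hoelder's inequality with the constant exponent \<open>1/\<beta>\<close>.\<close>

lemma vnorm_ball_fractional:
  assumes [measurable]: "q \<in> borel_measurable M" and r: "AE x in M. 1 \<le> r x \<and> 0 < q x" and \<beta>: "0 < \<beta>" and q: "AE x in M. 1 / q x = 1 / r x - \<beta>"
  shows "vnorm r (indicator (ball x \<gamma>)) \<le> ennreal (2 * measure M (ball x \<gamma>) powr \<beta>) * vnorm q (indicator (ball x \<gamma>))"
proof (rule vnorm_scale_le)
  let ?B = "ball x \<gamma>"
  define m where "m = measure M ?B"
  have m: "0 < m" "emeasure M ?B = ennreal m" unfolding m_def using measure_ball_pos emeasure_ball by auto
  show "0 < 2 * measure M ?B powr \<beta>" using measure_ball_pos[of x \<gamma>] by simp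
  fix \<eta> :: real assume \<eta>: "0 < \<eta>" "(\<integral>\<^sup>+ x. ennreal ((\<bar>indicator ?B x\<bar> / \<eta>) powr q x) \<partial>M) \<le> 1"
  have "(\<integral>\<^sup>+ x. ennreal ((\<bar>indicator ?B x\<bar> / (2 * m powr \<beta> * \<eta>)) powr r x) \<partial>M)
      \<le> (\<integral>\<^sup>+ x. ennreal (1 / 2) * (ennreal ((\<bar>indicator ?B x\<bar> / \<eta>) powr q x) + ennreal (1 / m) * indicator ?B x) \<partial>M)"
  proof (rule nn_integral_mono_AE)
    show "AE x in M. ennreal ((\<bar>indicator ?B x\<bar> / (2 * m powr \<beta> * \<eta>)) powr r x)
        \<le> ennreal (1 / 2) * (ennreal ((\<bar>indicator ?B x\<bar> / \<eta>) powr q x) + ennreal (1 / m) * indicator ?B x)"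
      using r q
    proof eventually_elim
      case (elim x)
      have rx: "0 < r x" "0 < q x" using elim by auto
      have "1 / q x < 1 / r x" using elim \<beta> by simp
      then have rq: "r x < q x" using rx by (simp add: field_simps)
      have br: "\<beta> * r x + r x / q x = 1"
      proof -
        have "r x * (1 / q x) = r x * (1 / r x - \<beta>)" using elim by simp
        then show ?thesis using rx by (simp add: right_diff_distrib mult.commute)
      qed
      \<comment> \<open>\<open>1 / r\<close> is the sum of \<open>1 / q\<close> and
        \<open>\<beta>\<close>, so these two exponents are conjugate. The factor 2 in the claim
        compensates for the sum of two modulars.\<close>
      have y: "1 < q x / r x" "1 < 1 / (\<beta> * r x)" "1 / (q x / r x) + 1 / (1 / (\<beta> * r x)) = 1"
      proof -
        show "1 < q x / r x" using rq rx by simp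
        have "\<beta> * r x < 1" using br rx by (smt (verit) divide_pos_pos)
        then show "1 < 1 / (\<beta> * r x)" using \<beta> rx by simp
        show "1 / (q x / r x) + 1 / (1 / (\<beta> * r x)) = 1" using br by simp
      qed
      have "(1 / \<eta>) powr r x * (1 / m powr \<beta>) powr r x
        \<le> ((1 / \<eta>) powr r x) powr (q x / r x) / (q x / r x) + ((1 / m powr \<beta>) powr r x) powr (1 / (\<beta> * r x)) / (1 / (\<beta> * r x))"
        by (rule Youngs_inequality) (use y in auto)
      also have "((1 / \<eta>) powr r x) powr (q x / r x) = (1 / \<eta>) powr q x" using rx by (simp add: powr_powr)
      also have "((1 / m powr \<beta>) powr r x) powr (1 / (\<beta> * r x)) = 1 / m"
      proof -
        have e: "1 / m powr \<beta> = m powr (- \<beta>)" by (simp add: powr_minus_divide)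
        show ?thesis unfolding e powr_powr using rx \<beta> m by simp
      qed
      also have "(1 / \<eta>) powr q x / (q x / r x) + 1 / m / (1 / (\<beta> * r x)) \<le> (1 / \<eta>) powr q x + 1 / m"
      proof -
        have dl: "t / k \<le> t" if "0 \<le> t" "1 < k" for t k :: real
          using that by (simp add: divide_le_eq mult_le_cancel_left1)
        show ?thesis using m by (intro add_mono dl y) auto
      qed
      finally have 1: "(1 / \<eta>) powr r x * (1 / m powr \<beta>) powr r x \<le> (1 / \<eta>) powr q x + 1 / m" .
      have "(1 / (2 * m powr \<beta> * \<eta>)) powr r x = (1 / 2 * ((1 / \<eta>) * (1 / m powr \<beta>))) powr r x" by (simp add: mult_ac)
      also have "\<dots> = (1 / 2) powr r x * ((1 / \<eta>) powr r x * (1 / m powr \<beta>) powr r x)"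
        using \<eta> m by (subst powr_mult; (subst powr_mult)?; simp)
      also have "\<dots> \<le> (1 / 2) powr 1 * ((1 / \<eta>) powr q x + 1 / m)"
        using elim m by (intro mult_mono 1 powr_mono') auto
      finally have 2: "(1 / (2 * m powr \<beta> * \<eta>)) powr r x \<le> 1 / 2 * ((1 / \<eta>) powr q x + 1 / m)" by simp
      show ?case
      proof (cases "x \<in> ?B")
        case True
        have "ennreal (1 / 2 * ((1 / \<eta>) powr q x + 1 / m)) = ennreal (1 / 2) * (ennreal ((1 / \<eta>) powr q x) + ennreal (1 / m))"
          using m by (subst ennreal_mult; (subst ennreal_plus)?; simp)
        then show ?thesis using True ennreal_leI[OF 2] by simp
      qed simp
    qed
  qed
  also have "\<dots> = ennreal (1 / 2) * ((\<integral>\<^sup>+ x. ennreal ((\<bar>indicator ?B x\<bar> / \<eta>) powr q x) \<partial>M) + ennreal (1 / m) * emeasure M ?B)"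
    by (subst nn_integral_cmult; (subst nn_integral_add)?; simp add: nn_integral_cmult_indicator)
  also have "\<dots> \<le> ennreal (1 / 2) * (1 + ennreal (1 / m) * emeasure M ?B)"
    by (intro mult_left_mono add_right_mono \<eta>(2)) simp
  also have "\<dots> = 1"
  proof -
    have "ennreal (1 / m) * emeasure M ?B = 1" using m by (simp add: ennreal_mult[symmetric])
    then have "ennreal (1 / 2) * (1 + ennreal (1 / m) * emeasure M ?B) = ennreal (1 / 2) * ennreal 2" by simp
    also have "\<dots> = ennreal 1" by (subst ennreal_mult[symmetric]) auto
    finally show ?thesis by simp
  qed
  finally show "(\<integral>\<^sup>+ x. ennreal ((\<bar>indicator ?B x\<bar> / (2 * measure M ?B powr \<beta> * \<eta>)) powr r x) \<partial>M) \<le> 1" by (simp add: m_def)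
qed

text \<open>Replaces the duality estimate for norms of characteristic functions. If \<open>s\<close>
  is the mean of the normalized \<open>g\<close>, then \<open>s\<close> times the indicator lies
  below the maximal function of the latter, so boundedness of the maximal operator bounds
  \<open>s\<close> by a multiple of the reciprocal norm of the indicator.\<close>

lemma avg_le_of_vnorm:
  assumes P: "log_holder q lo hi" and lo: "1 < lo"
  shows "\<exists>K0\<ge>1. \<forall>g x \<gamma> K. g \<in> borel_measurable M \<longrightarrow> (\<forall>y. 0 \<le> g y) \<longrightarrow> 0 \<le> K \<longrightarrow> (\<forall>y. y \<notin> ball x \<gamma> \<longrightarrow> g y = 0) \<longrightarrow>
    vnorm q g \<le> ennreal K * vnorm q (indicator (ball x \<gamma>)) \<longrightarrow>
    (\<integral>\<^sup>+ y. ennreal (g y) * indicator (ball x \<gamma>) y \<partial>M) \<le> ennreal ((K + 1) * K0) * emeasure M (ball x \<gamma>)"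
proof -
  obtain K0 where K0: "0 \<le> K0" "\<And>f N. f \<in> borel_measurable M \<Longrightarrow> (\<And>x. 0 \<le> f x) \<Longrightarrow> (\<integral>\<^sup>+ x. ennreal (f x powr q x) \<partial>M) \<le> 1
    \<Longrightarrow> (\<integral>\<^sup>+ x. ennreal (mx N (avg M f) x powr q x) \<partial>M) \<le> ennreal K0"
    using maximal_modular[OF P lo] by blast
  have [measurable]: "q \<in> borel_measurable M" and b: "AE x in M. lo \<le> q x \<and> q x \<le> hi"
    using P unfolding log_holder_def by auto
  have q1: "AE x in M. 1 \<le> q x" using b by eventually_elim (use lo in auto)
  define K' where "K' = max 1 K0"
  have K': "1 \<le> K'" "K0 \<le> K'" by (auto simp: K'_def)
  have main: "(\<integral>\<^sup>+ y. ennreal (g y) * indicator (ball x \<gamma>) y \<partial>M) \<le> ennreal ((K + 1) * K') * emeasure M (ball x \<gamma>)"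
    if [measurable]: "g \<in> borel_measurable M" and gnn: "\<And>y. 0 \<le> g y" and K: "0 \<le> K"
      and le: "vnorm q g \<le> ennreal K * vnorm q (indicator (ball x \<gamma>))" for g x \<gamma> K
  proof -
    let ?B = "ball x \<gamma>"
    obtain l where l: "0 < l" "vnorm q (indicator ?B) = ennreal l"
      using vnorm_ball_finite[OF q1, of x \<gamma>] by (cases "vnorm q (indicator ?B)") auto
    have "vnorm q g \<le> ennreal (K * l)" using le l K by (simp add: ennreal_mult)
    \<comment> \<open>Enlarging \<open>K\<close> to \<open>K + 1\<close> gives the strict inequality
      that yields an actual \<open>\<eta>\<close> from the infimum.\<close>
    also have "\<dots> < ennreal ((K + 1) * l)" using l K by (intro ennreal_lessI) (auto simp: distrib_right intro: add_nonneg_pos)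
    finally obtain \<eta> where \<eta>: "0 < \<eta>" "\<eta> < (K + 1) * l" "(\<integral>\<^sup>+ x. ennreal ((\<bar>g x\<bar> / \<eta>) powr q x) \<partial>M) \<le> 1"
      by (rule vnorm_less)
    define f where "f = (\<lambda>y. g y / \<eta>)"
    have [measurable]: "f \<in> borel_measurable M" unfolding f_def by measurable
    have fnn: "0 \<le> f y" for y using gnn \<eta> by (simp add: f_def)
    have fmod: "(\<integral>\<^sup>+ x. ennreal (f x powr q x) \<partial>M) \<le> 1" using \<eta>(3) gnn by (simp add: f_def)
    have fint: "set_integrable M ?B f"
      by (rule set_integrable_of_modular[OF _ _ fnn q1]) (use fmod in \<open>auto intro: le_less_trans\<close>)
    define s where "s = avg M f ?B"
    have s0: "0 \<le> s" unfolding s_def by (rule avg_nonneg[OF fnn])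
    have sl: "s \<le> K' / l"
    proof (cases "s = 0")
      case False
      then have s: "0 < s" using s0 by simp
      have mB: "s \<le> mx (nat \<bar>\<gamma>\<bar>) (avg M f) y" if "y \<in> ?B" for y
        unfolding s_def ball_eq[OF that, symmetric] by (rule mx_ge) auto
      have "(\<integral>\<^sup>+ y. ennreal ((\<bar>indicator ?B y\<bar> / (K' / s)) powr q y) \<partial>M)
        \<le> (\<integral>\<^sup>+ y. ennreal (1 / K') * ennreal (mx (nat \<bar>\<gamma>\<bar>) (avg M f) y powr q y) \<partial>M)"
      proof (rule nn_integral_mono_AE)
        show "AE y in M. ennreal ((\<bar>indicator ?B y\<bar> / (K' / s)) powr q y) \<le> ennreal (1 / K') * ennreal (mx (nat \<bar>\<gamma>\<bar>) (avg M f) y powr q y)"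
          using q1
        proof eventually_elim
          case (elim y)
          show ?case
          proof (cases "y \<in> ?B")
            case True
            have "(1 / (K' / s)) powr q y = (1 / K') powr q y * s powr q y"
              using s K' by (simp add: powr_mult[symmetric])
            also have "\<dots> \<le> (1 / K') powr 1 * mx (nat \<bar>\<gamma>\<bar>) (avg M f) y powr q y"
              using elim K' s mB[OF True] by (intro mult_mono powr_mono' powr_mono2) auto
            finally show ?thesis using True K' by (simp add: ennreal_mult[symmetric] ennreal_leI)
          qed simp
        qed
      qed
      also have "\<dots> = ennreal (1 / K') * (\<integral>\<^sup>+ y. ennreal (mx (nat \<bar>\<gamma>\<bar>) (avg M f) y powr q y) \<partial>M)"
        by (rule nn_integral_cmult) measurable
      also have "\<dots> \<le> ennreal (1 / K') * ennreal K0" by (intro mult_left_mono K0(2) fnn fmod) auto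
      also have "\<dots> \<le> 1" using K' K0 by (simp add: ennreal_mult[symmetric])
      finally have "vnorm q (indicator ?B) \<le> ennreal (K' / s)" using s K' by (intro vnorm_upper) auto
      then have "l \<le> K' / s" using l s K' by simp
      then show ?thesis using s l by (simp add: field_simps)
    qed (use K' l in simp)
    have "\<eta> * s \<le> (K + 1) * l * (K' / l)" using \<eta> sl s0 K l by (intro mult_mono) auto
    then have es: "\<eta> * s \<le> (K + 1) * K'" using l by simp
    have "(\<integral>\<^sup>+ y. ennreal (g y) * indicator ?B y \<partial>M) = (\<integral>\<^sup>+ y. ennreal \<eta> * (ennreal (f y) * indicator ?B y) \<partial>M)"
      using \<eta> gnn by (intro nn_integral_cong) (simp add: f_def mult.assoc[symmetric] ennreal_mult[symmetric])
    also have "\<dots> = ennreal \<eta> * (\<integral>\<^sup>+ y. ennreal (f y) * indicator ?B y \<partial>M)"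
      by (rule nn_integral_cmult) measurable
    also have "\<dots> = ennreal \<eta> * ennreal (s * measure M ?B)"
      unfolding s_def by (subst nn_integral_ball_avg[OF fint fnn measure_ball_pos]) simp
    also have "\<dots> = ennreal (\<eta> * s) * emeasure M ?B"
      using \<eta> s0 by (simp add: emeasure_ball ennreal_mult[symmetric] mult.assoc)
    also have "\<dots> \<le> ennreal ((K + 1) * K') * emeasure M ?B" by (intro mult_right_mono ennreal_leI es) simp
    finally show ?thesis .
  qed
  show ?thesis using main K' by (intro exI[of _ K']) auto
qed

text \<open>The term of level \<open>\<gamma>\<close> is a power of \<open>D\<close> whose exponent
  increases with slope \<open>\<beta>\<close> below \<open>\<gamma>0\<close> and decreases with
  slope \<open>\<beta> - 1\<close> above, so the supremum is attained at
  \<open>\<gamma>0\<close>.\<close>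

lemma fmax_indicator:
  assumes x: "x \<in> ball z \<gamma>0" and \<beta>: "0 < \<beta>" "\<beta> < 1"
  shows "fmax \<beta> (indicator (ball z \<gamma>0)) x = ennreal (measure M (ball z \<gamma>0) powr \<beta>)"
proof -
  let ?B = "ball z \<gamma>0"
  have B: "ball x \<gamma>0 = ?B" by (rule ball_eq[OF x])
  have D: "1 < D" by (rule D_gt_1)
  have e: "ennreal (measure M (ball x \<gamma>) powr (\<beta> - 1)) * (\<integral>\<^sup>+ y. indicator (ball x \<gamma>) y * ennreal \<bar>indicator ?B y\<bar> \<partial>M)
      = ennreal (measure M (ball x \<gamma>) powr (\<beta> - 1) * measure M (ball x (min \<gamma> \<gamma>0)))" for \<gamma>
  proof -
    have "ball x \<gamma> \<inter> ?B = ball x (min \<gamma> \<gamma>0)"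
      unfolding B[symmetric] using ball_mono[of \<gamma> \<gamma>0 x] ball_mono[of \<gamma>0 \<gamma> x] by (auto simp: min_def)
    moreover have "(\<integral>\<^sup>+ y. indicator (ball x \<gamma>) y * ennreal \<bar>indicator ?B y\<bar> \<partial>M) = (\<integral>\<^sup>+ y. indicator (ball x \<gamma> \<inter> ?B) y \<partial>M)"
      by (intro nn_integral_cong) (auto simp: indicator_def)
    ultimately show ?thesis by (simp add: emeasure_ball ennreal_mult)
  qed
  show ?thesis
    unfolding fmax_def e
  proof (rule antisym)
    show "(SUP \<gamma>. ennreal (measure M (ball x \<gamma>) powr (\<beta> - 1) * measure M (ball x (min \<gamma> \<gamma>0)))) \<le> ennreal (measure M ?B powr \<beta>)"
    proof (intro SUP_least ennreal_leI)
      fix \<gamma> :: int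
      have "(\<beta> - 1) * \<gamma> + min \<gamma> \<gamma>0 \<le> \<beta> * \<gamma>0"
      proof (cases "\<gamma> \<le> \<gamma>0")
        case True
        then show ?thesis using \<beta> by (simp add: algebra_simps mult_left_mono)
      next
        case False
        then have "(\<beta> - 1) * \<gamma> \<le> (\<beta> - 1) * \<gamma>0" using \<beta> by (intro mult_left_mono_neg) auto
        then show ?thesis using False by (simp add: algebra_simps)
      qed
      then have "D powr ((\<beta> - 1) * \<gamma> + min \<gamma> \<gamma>0) \<le> D powr (\<beta> * \<gamma>0)" using D by (intro powr_mono) auto
      then show "measure M (ball x \<gamma>) powr (\<beta> - 1) * measure M (ball x (min \<gamma> \<gamma>0)) \<le> measure M ?B powr \<beta>"
        by (simp add: measure_ball powr_powr powr_add[symmetric] mult.commute add.commute)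
    qed
    have "measure M ?B powr \<beta> = measure M (ball x \<gamma>0) powr (\<beta> - 1) * measure M (ball x (min \<gamma>0 \<gamma>0))"
      using measure_ball_pos[of z \<gamma>0] by (simp add: B powr_diff)
    then show "ennreal (measure M ?B powr \<beta>) \<le> (SUP \<gamma>. ennreal (measure M (ball x \<gamma>) powr (\<beta> - 1) * measure M (ball x (min \<gamma> \<gamma>0))))"
      by (metis (no_types, lifting) SUP_upper UNIV_I)
  qed
qed

text \<open>The measure of a ball grows strictly with its level, so inclusion, which is what
  \<open>fmax_loc\<close> quantifies over, becomes a comparison of levels.\<close>

lemma ball_subset_iff: "x \<in> ball z \<gamma>0 \<Longrightarrow> ball x \<gamma> \<subseteq> ball z \<gamma>0 \<longleftrightarrow> \<gamma> \<le> \<gamma>0"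
proof
  assume x: "x \<in> ball z \<gamma>0" and "\<gamma> \<le> \<gamma>0"
  then show "ball x \<gamma> \<subseteq> ball z \<gamma>0" using ball_mono ball_eq by blast
next
  assume "ball x \<gamma> \<subseteq> ball z \<gamma>0"
  then have "emeasure M (ball x \<gamma>) \<le> emeasure M (ball z \<gamma>0)" by (intro emeasure_mono) auto
  then show "\<gamma> \<le> \<gamma>0" using D_gt_1 by (simp add: emeasure_ball_powr)
qed

lemma fmax_cut:
  assumes x: "x \<in> ball z \<gamma>0" and \<beta>: "\<beta> < 1"
  shows "fmax \<beta> (\<lambda>y. b y * indicator (ball z \<gamma>0) y) x = fmax_loc \<beta> (ball z \<gamma>0) b x"
proof -
  let ?B = "ball z \<gamma>0"
  let ?t = "\<lambda>f \<gamma>. ennreal (measure M (ball x \<gamma>) powr (\<beta> - 1)) * (\<integral>\<^sup>+ y. indicator (ball x \<gamma>) y * ennreal \<bar>f y\<bar> \<partial>M)"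
  have B: "ball x \<gamma>0 = ?B" by (rule ball_eq[OF x])
  have in_eq: "?t (\<lambda>y. b y * indicator ?B y) \<gamma> = ?t b \<gamma>" if "\<gamma> \<le> \<gamma>0" for \<gamma>
  proof -
    have "ball x \<gamma> \<subseteq> ?B" using that ball_subset_iff[OF x] by simp
    then have "indicator (ball x \<gamma>) y * ennreal \<bar>b y * indicator ?B y\<bar> = indicator (ball x \<gamma>) y * ennreal \<bar>b y\<bar>" for y
      by (cases "y \<in> ball x \<gamma>") auto
    then show ?thesis by simp
  qed
  show ?thesis unfolding fmax_def fmax_loc_def
  proof (rule antisym)
    show "(SUP \<gamma>. ?t (\<lambda>y. b y * indicator ?B y) \<gamma>) \<le> (SUP \<gamma>\<in>{\<gamma>. ball x \<gamma> \<subseteq> ?B}. ?t b \<gamma>)"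
    proof (rule SUP_least)
      fix \<gamma>
      show "?t (\<lambda>y. b y * indicator ?B y) \<gamma> \<le> (SUP \<gamma>\<in>{\<gamma>. ball x \<gamma> \<subseteq> ?B}. ?t b \<gamma>)"
      proof (cases "\<gamma> \<le> \<gamma>0")
        case True
        then show ?thesis unfolding in_eq[OF True] by (intro SUP_upper) (simp add: ball_subset_iff[OF x])
      next
        case False
        have "?t (\<lambda>y. b y * indicator ?B y) \<gamma> \<le> ?t b \<gamma>0"
        proof (rule mult_mono)
          show "ennreal (measure M (ball x \<gamma>) powr (\<beta> - 1)) \<le> ennreal (measure M (ball x \<gamma>0) powr (\<beta> - 1))"
            using False \<beta> D_gt_1 by (intro ennreal_leI powr_mono2') (auto simp: measure_ball)
          show "(\<integral>\<^sup>+ y. indicator (ball x \<gamma>) y * ennreal \<bar>b y * indicator ?B y\<bar> \<partial>M) \<le> (\<integral>\<^sup>+ y. indicator (ball x \<gamma>0) y * ennreal \<bar>b y\<bar> \<partial>M)"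
            unfolding B by (intro nn_integral_mono) (auto simp: indicator_def)
        qed auto
        also have "\<dots> \<le> (SUP \<gamma>\<in>{\<gamma>. ball x \<gamma> \<subseteq> ?B}. ?t b \<gamma>)" by (intro SUP_upper) (simp add: B)
        finally show ?thesis .
      qed
    qed
    show "(SUP \<gamma>\<in>{\<gamma>. ball x \<gamma> \<subseteq> ?B}. ?t b \<gamma>) \<le> (SUP \<gamma>. ?t (\<lambda>y. b y * indicator ?B y) \<gamma>)"
    proof (rule SUP_least)
      fix \<gamma> assume "\<gamma> \<in> {\<gamma>. ball x \<gamma> \<subseteq> ?B}"
      then have le: "\<gamma> \<le> \<gamma>0" using ball_subset_iff[OF x] by simp
      show "?t b \<gamma> \<le> (SUP \<gamma>. ?t (\<lambda>y. b y * indicator ?B y) \<gamma>)"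
        unfolding in_eq[OF le, symmetric] by (rule SUP_upper) simp
    qed
  qed
qed

text \<open>By the weak type bound the set where averages over subballs exceed every integer is
  null. Otherwise \<open>enn2real\<close> would turn an infinite local maximal function into 0, and
  its lower bound by the mean of \<open>\<bar>b\<bar>\<close> would break down.\<close>

lemma fmax_loc_finite:
  assumes bm [measurable]: "b \<in> borel_measurable M" and int: "\<And>x \<gamma>. set_integrable M (ball x \<gamma>) b" and \<beta>: "0 < \<beta>"
  shows "AE x in M. x \<in> ball z \<gamma>0 \<longrightarrow> fmax_loc \<beta> (ball z \<gamma>0) b x < \<infinity>"
proof -
  let ?B = "ball z \<gamma>0"
  define f where "f = (\<lambda>y. \<bar>b y\<bar> * indicator ?B y)"
  have [measurable]: "f \<in> borel_measurable M" unfolding f_def by measurable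
  have fnn: "0 \<le> f y" for y by (simp add: f_def)
  define J where "J = (\<integral>\<^sup>+ x. ennreal (f x) \<partial>M)"
  have aint: "set_integrable M (ball x \<gamma>) (\<lambda>y. \<bar>b y\<bar>)" for x \<gamma> by (rule set_integrable_abs[OF int])
  have J: "J < \<infinity>"
  proof -
    have "J = (\<integral>\<^sup>+ x. ennreal \<bar>b x\<bar> * indicator ?B x \<partial>M)" unfolding J_def f_def by (intro nn_integral_cong) (auto simp: indicator_def)
    also have "\<dots> = ennreal (LINT x:?B|M. \<bar>b x\<bar>)" by (rule nn_integral_ball_eq[OF aint]) auto
    finally show ?thesis by simp
  qed
  define E where "E = (\<lambda>n::nat. {x. \<exists>\<gamma>\<in>{..\<gamma>0}. real (Suc n) < avg M f (ball x \<gamma>)})"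
  have oE: "ball_open (E n)" for n
    unfolding ball_open_def E_def
  proof
    fix x assume "x \<in> {x. \<exists>\<gamma>\<in>{..\<gamma>0}. real (Suc n) < avg M f (ball x \<gamma>)}"
    then obtain \<gamma> where g: "\<gamma> \<le> \<gamma>0" "real (Suc n) < avg M f (ball x \<gamma>)" by auto
    have "ball x \<gamma> \<subseteq> {x. \<exists>\<gamma>\<in>{..\<gamma>0}. real (Suc n) < avg M f (ball x \<gamma>)}"
    proof
      fix y assume "y \<in> ball x \<gamma>"
      then have "ball y \<gamma> = ball x \<gamma>" by (rule ball_eq)
      then show "y \<in> {x. \<exists>\<gamma>\<in>{..\<gamma>0}. real (Suc n) < avg M f (ball x \<gamma>)}" using g by (auto intro!: bexI[of _ \<gamma>])
    qed
    then show "\<exists>\<gamma>. ball x \<gamma> \<subseteq> {x. \<exists>\<gamma>\<in>{..\<gamma>0}. real (Suc n) < avg M f (ball x \<gamma>)}" by blast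
  qed
  have [measurable]: "E n \<in> sets M" for n by (rule ball_open_sets[OF oE])
  have mE: "ennreal (real (Suc n)) * emeasure M (E n) \<le> J" for n
  proof -
    have "ennreal (real (Suc n)) * (\<integral>\<^sup>+ x. indicator (E n) x \<partial>M) \<le> (\<integral>\<^sup>+ x. ennreal (f x) * indicator (E n) x \<partial>M)"
      unfolding E_def by (rule weak_type[of _ _ \<gamma>0]) (use fnn in auto)
    also have "\<dots> \<le> J" unfolding J_def by (intro nn_integral_mono) (auto simp: indicator_def)
    finally show ?thesis by simp
  qed
  obtain j where j: "0 \<le> j" "J = ennreal j" using J by (cases J) auto
  have "emeasure M (\<Inter>n. E n) = 0"
  proof (rule ccontr)
    assume "emeasure M (\<Inter>n. E n) \<noteq> 0"
    then obtain e where e: "0 < e" "ennreal e \<le> emeasure M (\<Inter>n. E n)"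
    proof -
      assume a: "emeasure M (\<Inter>n. E n) \<noteq> 0"
      show thesis
      proof (cases "emeasure M (\<Inter>n. E n)")
        case (real e)
        then show thesis using that[of e] a by auto
      next
        case top
        then show thesis using that[of 1] by simp
      qed
    qed
    obtain n where n: "j / e < real (Suc n)" using reals_Archimedean2[of "j / e"] by (metis less_trans of_nat_less_iff lessI)
    have "ennreal (real (Suc n) * e) \<le> ennreal (real (Suc n)) * emeasure M (E n)"
    proof -
      have "emeasure M (\<Inter>n. E n) \<le> emeasure M (E n)" by (rule emeasure_mono) auto
      then have "ennreal e \<le> emeasure M (E n)" using e by (meson order_trans)
      then show ?thesis using e by (simp add: ennreal_mult mult_left_mono del: of_nat_Suc)
    qed
    also have "\<dots> \<le> ennreal j" using mE[of n] j by simp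
    finally have "real (Suc n) * e \<le> j" using j by (simp del: of_nat_Suc)
    then show False using n e by (simp add: field_simps del: of_nat_Suc)
  qed
  then have "AE x in M. x \<notin> (\<Inter>n. E n)" by (intro AE_not_in) (auto simp: null_sets_def)
  then show ?thesis
  proof eventually_elim
    case (elim x)
    show ?case
    proof
      assume x: "x \<in> ?B"
      obtain n where n: "x \<notin> E n" using elim by blast
      have "fmax_loc \<beta> ?B b x \<le> ennreal (measure M ?B powr \<beta> * real (Suc n))"
        unfolding fmax_loc_def
      proof (rule SUP_least)
        fix \<gamma> assume "\<gamma> \<in> {\<gamma>. ball x \<gamma> \<subseteq> ?B}"
        then have g: "\<gamma> \<le> \<gamma>0" "ball x \<gamma> \<subseteq> ?B" using ball_subset_iff[OF x] by auto
        let ?m = "measure M (ball x \<gamma>)"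
        have m: "0 < ?m" by (rule measure_ball_pos)
        have "avg M f (ball x \<gamma>) \<le> real (Suc n)" using n g by (auto simp: E_def not_less)
        moreover have "avg M f (ball x \<gamma>) = avg M (\<lambda>y. \<bar>b y\<bar>) (ball x \<gamma>)" using g by (intro avg_cong_ball) (auto simp: f_def)
        ultimately have av: "avg M (\<lambda>y. \<bar>b y\<bar>) (ball x \<gamma>) \<le> real (Suc n)" by simp
        have av0: "0 \<le> avg M (\<lambda>y. \<bar>b y\<bar>) (ball x \<gamma>)" by (rule avg_nonneg) simp
        have "(\<integral>\<^sup>+ y. indicator (ball x \<gamma>) y * ennreal \<bar>b y\<bar> \<partial>M) = ennreal (avg M (\<lambda>y. \<bar>b y\<bar>) (ball x \<gamma>) * ?m)"
          by (subst nn_integral_ball_avg[OF aint _ m, symmetric]) (auto simp: mult.commute)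
        then have "ennreal (?m powr (\<beta> - 1)) * (\<integral>\<^sup>+ y. indicator (ball x \<gamma>) y * ennreal \<bar>b y\<bar> \<partial>M)
            = ennreal (?m powr (\<beta> - 1) * (avg M (\<lambda>y. \<bar>b y\<bar>) (ball x \<gamma>) * ?m))"
          using av0 by (simp add: ennreal_mult)
        also have "?m powr (\<beta> - 1) * (avg M (\<lambda>y. \<bar>b y\<bar>) (ball x \<gamma>) * ?m) = ?m powr \<beta> * avg M (\<lambda>y. \<bar>b y\<bar>) (ball x \<gamma>)"
          using m by (simp add: powr_diff)
        also have "ennreal \<dots> \<le> ennreal (measure M ?B powr \<beta> * real (Suc n))"
          using g(1) \<beta> D_gt_1 av av0 by (intro ennreal_leI mult_mono powr_mono2) (auto simp: measure_ball)
        finally show "ennreal (?m powr (\<beta> - 1)) * (\<integral>\<^sup>+ y. indicator (ball x \<gamma>) y * ennreal \<bar>b y\<bar> \<partial>M)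
            \<le> ennreal (measure M ?B powr \<beta> * real (Suc n))" .
      qed
      then show "fmax_loc \<beta> ?B b x < \<infinity>" by (rule le_less_trans) simp
    qed
  qed
qed

text \<open>Let \<open>a\<close> be the mean of \<open>\<bar>b\<bar>\<close> over a ball. The scaled
  local maximal function is at least \<open>a\<close>, so \<open>a - b\<close> is at most the
  function integrated in \<open>st\<close>. The part of \<open>b\<close> below its mean accounts for
  half of the oscillation, and that mean is at most \<open>a\<close>; this gives the first claim.
  The mean of \<open>\<bar>b\<bar> - b\<close> equals that of \<open>a - b\<close>, hence is at most
  \<open>C\<close> on every ball, and differentiation gives the second.\<close>

lemma oscillation_of_local_bound:
  fixes b :: "'a \<Rightarrow> real"
  assumes bm [measurable]: "b \<in> borel_measurable M" and int: "\<And>x \<gamma>. set_integrable M (ball x \<gamma>) b" and \<beta>: "0 < \<beta>" and C: "0 \<le> C"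
    and st: "\<And>z \<gamma>. (\<integral>\<^sup>+ y. ennreal \<bar>b y - measure M (ball z \<gamma>) powr (- \<beta>) * enn2real (fmax_loc \<beta> (ball z \<gamma>) b y)\<bar> * indicator (ball z \<gamma>) y \<partial>M)
      \<le> ennreal C * emeasure M (ball z \<gamma>)"
  shows "avg M (\<lambda>y. \<bar>b y - avg M b (ball z \<gamma>)\<bar>) (ball z \<gamma>) \<le> 2 * C"
    and "AE x in M. \<bar>b x\<bar> - b x \<le> C"
proof -
  have abm: "set_integrable M (ball z \<gamma>) (\<lambda>y. \<bar>b y\<bar>)" for z \<gamma> by (rule set_integrable_abs[OF int])
  have low: "AE y in M. y \<in> ball z \<gamma> \<longrightarrow> avg M (\<lambda>y. \<bar>b y\<bar>) (ball z \<gamma>) - b y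
      \<le> \<bar>b y - measure M (ball z \<gamma>) powr (- \<beta>) * enn2real (fmax_loc \<beta> (ball z \<gamma>) b y)\<bar>" for z \<gamma>
    using fmax_loc_finite[OF bm int \<beta>, of z \<gamma>]
  proof eventually_elim
    case (elim y)
    show ?case
    proof
      let ?B = "ball z \<gamma>" let ?m = "measure M ?B" let ?a = "avg M (\<lambda>y. \<bar>b y\<bar>) ?B"
      assume y: "y \<in> ?B"
      have m: "0 < ?m" by (rule measure_ball_pos)
      have B: "ball y \<gamma> = ?B" by (rule ball_eq[OF y])
      have a0: "0 \<le> ?a" by (rule avg_nonneg) simp
      have "(\<integral>\<^sup>+ x. indicator ?B x * ennreal \<bar>b x\<bar> \<partial>M) = ennreal (?a * ?m)"
        by (subst nn_integral_ball_avg[OF abm _ m, symmetric]) (auto simp: mult.commute)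
      then have "ennreal (?m powr (\<beta> - 1) * (?a * ?m)) = ennreal (?m powr (\<beta> - 1)) * (\<integral>\<^sup>+ x. indicator (ball y \<gamma>) x * ennreal \<bar>b x\<bar> \<partial>M)"
        using a0 B by (simp add: ennreal_mult)
      also have "\<dots> \<le> fmax_loc \<beta> ?B b y" unfolding fmax_loc_def B[symmetric]
        by (rule SUP_upper) (simp add: ball_eq)
      finally have "?m powr (\<beta> - 1) * (?a * ?m) \<le> enn2real (fmax_loc \<beta> ?B b y)"
        using elim y a0 by (subst (asm) ennreal_enn2real[symmetric]) (auto simp: ennreal_le_iff)
      then have "?m powr (- \<beta>) * (?m powr (\<beta> - 1) * (?a * ?m)) \<le> ?m powr (- \<beta>) * enn2real (fmax_loc \<beta> ?B b y)"
        by (rule mult_left_mono) simp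
      moreover have "?m powr (- \<beta>) * (?m powr (\<beta> - 1) * (?a * ?m)) = ?a"
      proof -
        have "?m powr (- \<beta>) * (?m powr (\<beta> - 1) * (?a * ?m)) = ?a * (?m powr (- \<beta>) * ?m powr (\<beta> - 1) * ?m powr 1)"
          using m by simp
        also have "\<dots> = ?a * ?m powr (- \<beta> + (\<beta> - 1) + 1)" by (simp only: powr_add)
        finally show ?thesis using m by simp
      qed
      ultimately show "?a - b y \<le> \<bar>b y - ?m powr (- \<beta>) * enn2real (fmax_loc \<beta> ?B b y)\<bar>" by simp
    qed
  qed
  have pos: "(\<integral>\<^sup>+ y. ennreal (max 0 (avg M (\<lambda>y. \<bar>b y\<bar>) (ball z \<gamma>) - b y)) * indicator (ball z \<gamma>) y \<partial>M) \<le> ennreal C * emeasure M (ball z \<gamma>)" for z \<gamma>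
  proof (rule order_trans[OF nn_integral_mono_AE st])
    show "AE y in M. ennreal (max 0 (avg M (\<lambda>y. \<bar>b y\<bar>) (ball z \<gamma>) - b y)) * indicator (ball z \<gamma>) y
      \<le> ennreal \<bar>b y - measure M (ball z \<gamma>) powr (- \<beta>) * enn2real (fmax_loc \<beta> (ball z \<gamma>) b y)\<bar> * indicator (ball z \<gamma>) y"
      using low by eventually_elim (auto simp: indicator_def intro!: ennreal_leI)
  qed
  have ci: "set_integrable M (ball z \<gamma>) (\<lambda>_. c)" for z \<gamma> c
    using finite_ball[of z \<gamma>] by (simp add: set_integrable_def integrable_mult_left_iff)
  have LC: "(LINT y:ball z \<gamma>|M. c) = c * measure M (ball z \<gamma>)" for z \<gamma> c by (simp add: set_lebesgue_integral_def)
  have pint: "set_integrable M (ball z \<gamma>) (\<lambda>y. max 0 (c - b y))" for z \<gamma> c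
  proof (rule set_integrable_bound[OF set_integrable_abs_diff[OF int[of z \<gamma>], of c]])
    show "set_borel_measurable M (ball z \<gamma>) (\<lambda>y. max 0 (c - b y))" unfolding set_borel_measurable_def by measurable
  qed auto
  have Lpos: "(LINT y:ball z \<gamma>|M. max 0 (avg M (\<lambda>y. \<bar>b y\<bar>) (ball z \<gamma>) - b y)) \<le> C * measure M (ball z \<gamma>)" for z \<gamma>
  proof -
    have "ennreal (LINT y:ball z \<gamma>|M. max 0 (avg M (\<lambda>y. \<bar>b y\<bar>) (ball z \<gamma>) - b y)) \<le> ennreal (C * measure M (ball z \<gamma>))"
      using pos[of z \<gamma>] C by (subst nn_integral_ball_eq[OF pint, symmetric]) (auto simp: emeasure_ball ennreal_mult)
    then show ?thesis using C by (simp add: ennreal_le_iff)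
  qed
  show "avg M (\<lambda>y. \<bar>b y - avg M b (ball z \<gamma>)\<bar>) (ball z \<gamma>) \<le> 2 * C"
  proof -
    let ?B = "ball z \<gamma>" let ?c = "avg M b ?B" let ?a = "avg M (\<lambda>y. \<bar>b y\<bar>) ?B"
    have m: "0 < measure M ?B" by (rule measure_ball_pos)
    have ca: "?c \<le> ?a" using avg_abs_diff_le[OF int[of z \<gamma>], of 0] by simp
    \<comment> \<open>The absolute value of \<open>t\<close> is \<open>2 * max 0 (- t) + t\<close>,
      and the linear part integrates to 0.\<close>
    have "(LINT y:?B|M. \<bar>b y - ?c\<bar>) = (LINT y:?B|M. 2 * max 0 (?c - b y) + (b y - ?c))"
      by (rule arg_cong[where f = "set_lebesgue_integral M ?B"]) (auto simp: fun_eq_iff max_def)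
    also have "\<dots> = 2 * (LINT y:?B|M. max 0 (?c - b y)) + ((LINT y:?B|M. b y) - ?c * measure M ?B)"
      by (subst set_integral_add(2)[OF set_integrable_mult_right[OF pint] set_integral_diff(1)[OF int ci]])
        (simp add: set_integral_diff(2)[OF int ci] LC)
    also have "(LINT y:?B|M. b y) - ?c * measure M ?B = 0" using m by (simp add: avg_def)
    also have "(LINT y:?B|M. max 0 (?c - b y)) \<le> (LINT y:?B|M. max 0 (?a - b y))"
      by (rule set_integral_mono[OF pint pint]) (use ca in auto)
    also have "\<dots> \<le> C * measure M ?B" by (rule Lpos)
    finally show ?thesis using m by (simp add: avg_def divide_le_eq)
  qed
  show "AE x in M. \<bar>b x\<bar> - b x \<le> C"
  proof (rule AE_le_of_ball_integrals)
    fix z \<gamma>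
    let ?B = "ball z \<gamma>" let ?a = "avg M (\<lambda>y. \<bar>b y\<bar>) ?B"
    have m: "0 < measure M ?B" by (rule measure_ball_pos)
    have dint: "set_integrable M ?B (\<lambda>y. \<bar>b y\<bar> - b y)" by (rule set_integral_diff(1)[OF abm int])
    have "(LINT y:?B|M. \<bar>b y\<bar> - b y) = (LINT y:?B|M. \<bar>b y\<bar>) - (LINT y:?B|M. b y)"
      by (rule set_integral_diff(2)[OF abm int])
    also have "(LINT y:?B|M. \<bar>b y\<bar>) = (LINT y:?B|M. ?a)" unfolding LC using m by (simp add: avg_def)
    also have "(LINT y:?B|M. ?a) - (LINT y:?B|M. b y) = (LINT y:?B|M. ?a - b y)"
      by (rule set_integral_diff(2)[OF ci int, symmetric])
    also have "\<dots> \<le> (LINT y:?B|M. max 0 (?a - b y))"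
      by (rule set_integral_mono[OF set_integral_diff(1)[OF ci int] pint]) auto
    also have "\<dots> \<le> C * measure M ?B" by (rule Lpos)
    finally have "(LINT y:?B|M. \<bar>b y\<bar> - b y) \<le> C * measure M ?B" .
    then show "(\<integral>\<^sup>+ y. ennreal (\<bar>b y\<bar> - b y) * indicator ?B y \<partial>M) \<le> ennreal C * emeasure M ?B"
      using C by (subst nn_integral_ball_eq[OF dint]) (auto simp: emeasure_ball ennreal_mult[symmetric] intro!: ennreal_leI)
  qed (use C in auto)
qed

end

section \<open>The ultrametric structure of the p-adic space\<close>

text \<open>Congruence of rationals modulo the integer multiples of \<open>P powi m\<close>, with
  \<open>m\<close> possibly negative. For \<open>P\<close> equal to p and numbers in Z[1/p] it is
  congruence modulo p^m Z_p.\<close>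

definition zcong :: "rat \<Rightarrow> int \<Rightarrow> rat \<Rightarrow> rat \<Rightarrow> bool" where
  "zcong P m r s \<longleftrightarrow> (\<exists>z::int. r - s = of_int z * P powi m)"

lemma zcong_refl [simp]: "zcong P m r r" unfolding zcong_def by (rule exI[of _ 0]) simp

lemma zcong_sym: "zcong P m r s \<Longrightarrow> zcong P m s r"
proof -
  assume "zcong P m r s"
  then obtain z :: int where "r - s = of_int z * P powi m" unfolding zcong_def by blast
  then have "s - r = of_int (- z) * P powi m" by simp
  then show ?thesis unfolding zcong_def by blast
qed

lemma zcong_trans: "zcong P m r s \<Longrightarrow> zcong P m s t \<Longrightarrow> zcong P m r t"
proof -
  assume "zcong P m r s" "zcong P m s t"
  then obtain z z' :: int where "r - s = of_int z * P powi m" "s - t = of_int z' * P powi m" unfolding zcong_def by blast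
  then have "r - t = of_int (z + z') * P powi m" by (simp add: algebra_simps)
  then show ?thesis unfolding zcong_def by blast
qed

lemma zcong_add: "zcong P m r s \<Longrightarrow> zcong P m r' s' \<Longrightarrow> zcong P m (r + r') (s + s')"
proof -
  assume "zcong P m r s" "zcong P m r' s'"
  then obtain z z' :: int where "r - s = of_int z * P powi m" "r' - s' = of_int z' * P powi m" unfolding zcong_def by blast
  then have "(r + r') - (s + s') = of_int (z + z') * P powi m" by (simp add: algebra_simps)
  then show ?thesis unfolding zcong_def by blast
qed

lemma zcong_neg: "zcong P m r s \<Longrightarrow> zcong P m (- r) (- s)"
proof -
  assume "zcong P m r s"
  then obtain z :: int where "r - s = of_int z * P powi m" unfolding zcong_def by blast
  then have "- r - - s = of_int (- z) * P powi m" by simp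
  then show ?thesis unfolding zcong_def by blast
qed

lemma zcong_diff: "zcong P m r s \<Longrightarrow> zcong P m r' s' \<Longrightarrow> zcong P m (r - r') (s - s')"
  using zcong_add[OF _ zcong_neg, of P m r s r' s'] by simp

lemma zcong_diff_0: "zcong P m (r - s) 0 \<longleftrightarrow> zcong P m r s"
  by (simp add: zcong_def)

lemma zcong_mono:
  assumes "zcong (of_nat p) m r s" "m' \<le> m" "0 < p"
  shows "zcong (of_nat p) m' r s"
proof -
  obtain z :: int where z: "r - s = of_int z * of_nat p powi m" using assms(1) unfolding zcong_def by blast
  have "(of_nat p :: rat) powi m = of_nat p powi (int (nat (m - m')) + m')" using assms(2) by simp
  also have "\<dots> = of_nat p powi int (nat (m - m')) * of_nat p powi m'" by (rule power_int_add) (use assms(3) in auto)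
  also have "(of_nat p :: rat) powi int (nat (m - m')) = of_nat p ^ nat (m - m')" by (rule power_int_of_nat)
  finally have "r - s = of_int (z * int p ^ nat (m - m')) * of_nat p powi m'" using z by simp
  then show ?thesis unfolding zcong_def by blast
qed

text \<open>Two numbers of the interval differ by less than the modulus. Equalities between
  coordinates are reduced to congruences by this.\<close>

lemma zcong_range_unique:
  assumes "zcong P m r s" "0 \<le> r" "r < P powi m" "0 \<le> s" "s < P powi m"
  shows "r = s"
proof -
  obtain z :: int where z: "r - s = of_int z * P powi m" using assms(1) unfolding zcong_def by blast
  have P: "0 < P powi m" using assms by simp
  have "r - s < 1 * P powi m" "(- 1) * P powi m < r - s" using assms by auto
  then have "(of_int z :: rat) < 1" "(- 1 :: rat) < of_int z" unfolding z by (simp_all only: mult_less_cancel_right_pos[OF P])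
  then have "z = 0" by simp
  then show ?thesis using z by simp
qed

lemma rmod_zcong: "0 < P powi m \<Longrightarrow> zcong P m (rmod r (P powi m)) r"
  unfolding zcong_def rmod_def by (rule exI[of _ "- \<lfloor>r / P powi m\<rfloor>"]) (simp add: mult.commute)

lemma rmod_range: "0 < M \<Longrightarrow> 0 \<le> rmod r M \<and> rmod r M < M"
proof -
  assume M: "0 < M"
  show ?thesis using floor_divide_lower[OF M, of r] floor_divide_upper[OF M, of r]
    unfolding rmod_def by (simp add: algebra_simps)
qed

lemma rmod_eq_iff:
  assumes "0 < P powi m"
  shows "rmod r (P powi m) = rmod s (P powi m) \<longleftrightarrow> zcong P m r s"
proof
  assume "rmod r (P powi m) = rmod s (P powi m)"
  then show "zcong P m r s" using rmod_zcong[OF assms, of r] rmod_zcong[OF assms, of s] by (metis zcong_sym zcong_trans)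
next
  assume "zcong P m r s"
  then have "zcong P m (rmod r (P powi m)) (rmod s (P powi m))"
    using rmod_zcong[OF assms, of r] rmod_zcong[OF assms, of s] by (meson zcong_sym zcong_trans)
  then show "rmod r (P powi m) = rmod s (P powi m)"
    using rmod_range[OF assms] by (intro zcong_range_unique) auto
qed

definition is_zp :: "nat \<Rightarrow> rat \<Rightarrow> bool" where
  "is_zp p r \<longleftrightarrow> (\<exists>z::int. \<exists>j::nat. r = of_int z / of_nat p ^ j)"

lemma is_zp_zcong: "is_zp p r \<longleftrightarrow> (\<exists>j::nat. zcong (of_nat p) (- int j) r 0)"
proof -
  have "(of_nat p :: rat) powi (- int j) = inverse (of_nat p ^ j)" for j :: nat by (simp add: power_int_minus)
  then show ?thesis unfolding is_zp_def zcong_def by (subst ex_comm) (simp add: divide_inverse)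
qed

lemma is_zp_add:
  assumes "is_zp p r" "is_zp p s" "0 < p" shows "is_zp p (r + s)"
proof -
  obtain j k :: nat where "zcong (of_nat p) (- int j) r 0" "zcong (of_nat p) (- int k) s 0"
    using assms by (auto simp only: is_zp_zcong)
  then have "zcong (of_nat p) (- int (max j k)) r 0" "zcong (of_nat p) (- int (max j k)) s 0"
    using assms(3) by (auto intro: zcong_mono)
  then have "zcong (of_nat p) (- int (max j k)) (r + s) (0 + 0)" by (rule zcong_add)
  then have "zcong (of_nat p) (- int (max j k)) (r + s) 0" by simp
  then show ?thesis using assms(3) is_zp_zcong by blast
qed

lemma is_zp_uminus: "is_zp p r \<Longrightarrow> is_zp p (- r)"
proof -
  assume "is_zp p r"
  then obtain z :: int and j :: nat where "r = of_int z / of_nat p ^ j" unfolding is_zp_def by blast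
  then have "- r = of_int (- z) / of_nat p ^ j" by simp
  then show ?thesis unfolding is_zp_def by blast
qed

lemma is_zp_zcong_trans:
  assumes "is_zp p r" "zcong (of_nat p) m s r" "0 < p" shows "is_zp p s"
proof -
  have "zcong (of_nat p) m (s - r) 0" using assms(2) by (simp add: zcong_diff_0)
  then have "zcong (of_nat p) (- int (nat (- m))) (s - r) 0" by (rule zcong_mono) (use assms in auto)
  then have "is_zp p (s - r)" using assms(3) is_zp_zcong by blast
  from is_zp_add[OF this assms(1,3)] show ?thesis by simp
qed

section \<open>Coordinates of the inverse limit and congruence of p-adic numbers\<close>

lemma pq_pos: "0 < (of_nat CARD('p::finite) :: rat) powi m" "0 < (of_nat CARD('p::finite) :: rat)" by (simp_all add: zero_less_power_int)

lemma Rep_props: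
  fixes x :: "'p::finite qp"
  shows "is_zp CARD('p) (Rep_qp x k)" "0 \<le> Rep_qp x k" "Rep_qp x k < (of_nat CARD('p)) powi int k"
    "zcong (of_nat CARD('p)) (int k) (Rep_qp x (Suc k)) (Rep_qp x k)"
proof -
  have "qp_rep CARD('p) (Rep_qp x)" using Rep_qp[of x] by simp
  then have r: "\<exists>z::int. \<exists>j::nat. Rep_qp x k = of_int z / of_nat CARD('p) ^ j" "0 \<le> Rep_qp x k"
      "Rep_qp x k < of_nat CARD('p) ^ k" "Rep_qp x k = rmod (Rep_qp x (Suc k)) (of_nat CARD('p) ^ k)"
    unfolding qp_rep_def by blast+
  show "is_zp CARD('p) (Rep_qp x k)" "0 \<le> Rep_qp x k" "Rep_qp x k < (of_nat CARD('p)) powi int k"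
    using r(1-3) unfolding is_zp_def by (simp_all only: power_int_of_nat)
  have "Rep_qp x k = rmod (Rep_qp x (Suc k)) ((of_nat CARD('p)) powi int k)"
    unfolding power_int_of_nat by (rule r(4))
  then show "zcong (of_nat CARD('p)) (int k) (Rep_qp x (Suc k)) (Rep_qp x k)"
    using rmod_zcong[OF pq_pos(1), of "int k" "Rep_qp x (Suc k)"] by (metis zcong_sym)
qed

lemma Rep_zcong:
  fixes x :: "'p::finite qp"
  assumes "k \<le> l" shows "zcong (of_nat CARD('p)) (int k) (Rep_qp x l) (Rep_qp x k)"
  using assms
proof (induction l rule: dec_induct)
  case (step l)
  have "zcong (of_nat CARD('p)) (int l) (Rep_qp x (Suc l)) (Rep_qp x l)" by (rule Rep_props(4))
  then have "zcong (of_nat CARD('p)) (int k) (Rep_qp x (Suc l)) (Rep_qp x l)" by (rule zcong_mono) (use step in auto)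
  then show ?case using step.IH by (rule zcong_trans)
qed simp

lemma Rep_Abs:
  fixes t :: "nat \<Rightarrow> rat"
  assumes zp: "\<And>k. is_zp CARD('p::finite) (t k)" and co: "\<And>k. zcong (of_nat CARD('p)) (int k) (t (Suc k)) (t k)"
  shows "Rep_qp (Abs_qp (\<lambda>k. rmod (t k) ((of_nat CARD('p)) ^ k)) :: 'p qp) = (\<lambda>k. rmod (t k) ((of_nat CARD('p)) ^ k))"
proof (rule Abs_qp_inverse, simp, unfold qp_rep_def, intro allI conjI)
  fix k
  have P: "(of_nat CARD('p)) ^ k = (of_nat CARD('p)) powi int k" for k by simp
  have "zcong (of_nat CARD('p)) (int k) (rmod (t k) ((of_nat CARD('p)) ^ k)) (t k)" unfolding P by (rule rmod_zcong[OF pq_pos(1)])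
  from is_zp_zcong_trans[OF zp this] show "\<exists>z j. rmod (t k) ((of_nat CARD('p)) ^ k) = of_int z / (of_nat CARD('p)) ^ j"
    by (simp add: is_zp_def)
  show "0 \<le> rmod (t k) ((of_nat CARD('p)) ^ k)" "rmod (t k) ((of_nat CARD('p)) ^ k) < (of_nat CARD('p)) ^ k"
    using rmod_range[OF pq_pos(1), of "t k" "int k"] by auto
  have "zcong (of_nat CARD('p)) (int (Suc k)) (rmod (t (Suc k)) ((of_nat CARD('p)) ^ Suc k)) (t (Suc k))"
    unfolding P by (rule rmod_zcong[OF pq_pos(1)])
  then have "zcong (of_nat CARD('p)) (int k) (rmod (t (Suc k)) ((of_nat CARD('p)) ^ Suc k)) (t (Suc k))" by (rule zcong_mono) auto
  then have "zcong (of_nat CARD('p)) (int k) (rmod (t (Suc k)) ((of_nat CARD('p)) ^ Suc k)) (t k)" using co by (rule zcong_trans)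
  then show "rmod (t k) ((of_nat CARD('p)) ^ k) = rmod (rmod (t (Suc k)) ((of_nat CARD('p)) ^ Suc k)) ((of_nat CARD('p)) ^ k)"
    unfolding P rmod_eq_iff[OF pq_pos(1)] by (rule zcong_sym)
qed

lemma Rep_mk_zcong:
  assumes zp: "\<And>k. is_zp CARD('p::finite) (t k)" and co: "\<And>k. zcong (of_nat CARD('p)) (int k) (t (Suc k)) (t k)"
  shows "zcong (of_nat CARD('p)) (int k) (Rep_qp (Abs_qp (\<lambda>k. rmod (t k) ((of_nat CARD('p)) ^ k)) :: 'p qp) k) (t k)"
  unfolding Rep_Abs[OF assms] using rmod_zcong[OF pq_pos(1), of "int k" "t k"] by simp

lemma Rep_add:
  fixes x y :: "'p::finite qp"
  shows "zcong (of_nat CARD('p)) (int k) (Rep_qp (qp_add x y) k) (Rep_qp x k + Rep_qp y k)"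
  unfolding qp_add_def by (rule Rep_mk_zcong) (auto intro: is_zp_add zcong_add Rep_props)

lemma Rep_sub:
  fixes x y :: "'p::finite qp"
  shows "zcong (of_nat CARD('p)) (int k) (Rep_qp (qp_sub x y) k) (Rep_qp x k - Rep_qp y k)"
  unfolding qp_sub_def
proof (rule Rep_mk_zcong)
  show "is_zp CARD('p) (Rep_qp x k - Rep_qp y k)" for k
    using is_zp_add[OF Rep_props(1) is_zp_uminus[OF Rep_props(1)], of x k y k] by simp
qed (auto intro: zcong_diff Rep_props)

lemma Rep_zero: "Rep_qp (qp_zero :: 'p::finite qp) k = 0"
proof -
  have "Rep_qp (Abs_qp (\<lambda>k. rmod 0 ((of_nat CARD('p)) ^ k)) :: 'p qp) = (\<lambda>k. rmod 0 ((of_nat CARD('p)) ^ k))"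
    by (rule Rep_Abs) (auto simp: is_zp_def intro: exI[of _ 0])
  then show ?thesis by (simp add: qp_zero_def rmod_def)
qed

lemma qp_eqI:
  fixes x y :: "'p::finite qp"
  assumes "\<And>k. zcong (of_nat CARD('p)) (int k) (Rep_qp x k) (Rep_qp y k)" shows "x = y"
proof -
  have "Rep_qp x k = Rep_qp y k" for k
    by (rule zcong_range_unique[OF assms Rep_props(2,3) Rep_props(2,3)])
  then show ?thesis by (simp add: Rep_qp_inject[symmetric] fun_eq_iff)
qed

text \<open>Says that the difference lies in p^m Z_p. One coordinate decides: coordinate
  \<open>nat m\<close> determines a number modulo p^m, and for negative \<open>m\<close> coordinate
  0 carries more than enough information.\<close>

definition qrel :: "int \<Rightarrow> 'p::finite qp \<Rightarrow> 'p qp \<Rightarrow> bool" where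
  "qrel m y x \<longleftrightarrow> zcong (of_nat CARD('p)) m (Rep_qp y (nat m)) (Rep_qp x (nat m))"

lemma qrel_at:
  fixes x y :: "'p::finite qp"
  assumes "m \<le> int k" shows "qrel m y x \<longleftrightarrow> zcong (of_nat CARD('p)) m (Rep_qp y k) (Rep_qp x k)"
proof -
  have "zcong (of_nat CARD('p)) m (Rep_qp z k) (Rep_qp z (nat m))" for z :: "'p qp"
  proof -
    have "zcong (of_nat CARD('p)) (int (nat m)) (Rep_qp z k) (Rep_qp z (nat m))" by (rule Rep_zcong) (use assms in auto)
    then show ?thesis by (rule zcong_mono) auto
  qed
  then show ?thesis unfolding qrel_def by (meson zcong_sym zcong_trans)
qed

text \<open>\<open>qp_in\<close> concerns all coordinates. For \<open>k \<ge> m\<close> the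
  condition is the same congruence read at a later coordinate; for \<open>k < m\<close> the
  congruence forces the coordinate of the difference, a representative below p^k, to be 0.\<close>

lemma qp_in_sub: "qp_in (qp_sub y x) m \<longleftrightarrow> qrel m y x" for x y :: "'p::finite qp"
proof -
  have in0: "qp_in (qp_sub y x) m \<longleftrightarrow> (\<forall>k. zcong (of_nat CARD('p)) m (Rep_qp (qp_sub y x) k) 0)"
    by (simp add: qp_in_def zcong_def)
  have S: "zcong (of_nat CARD('p)) m (Rep_qp (qp_sub y x) k) (Rep_qp y k - Rep_qp x k)" if "m \<le> int k" for k
    using Rep_sub by (rule zcong_mono) (use that in auto)
  show ?thesis
  proof
    assume "qp_in (qp_sub y x) m"
    then have "zcong (of_nat CARD('p)) m (Rep_qp (qp_sub y x) (nat m)) 0" using in0 by blast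
    then have "zcong (of_nat CARD('p)) m (Rep_qp y (nat m) - Rep_qp x (nat m)) 0"
      by (rule zcong_trans[OF zcong_sym[OF S], rotated]) simp
    then show "qrel m y x" by (simp add: qrel_def zcong_diff_0)
  next
    assume r: "qrel m y x"
    show "qp_in (qp_sub y x) m" unfolding in0
    proof
      fix k
      show "zcong (of_nat CARD('p)) m (Rep_qp (qp_sub y x) k) 0"
      proof (cases "m \<le> int k")
        case True
        then have "zcong (of_nat CARD('p)) m (Rep_qp y k - Rep_qp x k) 0" using r qrel_at zcong_diff_0 by blast
        then show ?thesis using S[OF True] zcong_trans by blast
      next
        case False
        have "zcong (of_nat CARD('p)) m (Rep_qp y (nat m)) (Rep_qp x (nat m))" using r by (simp add: qrel_def)
        then have "zcong (of_nat CARD('p)) (int k) (Rep_qp y (nat m)) (Rep_qp x (nat m))" by (rule zcong_mono) (use False in auto)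
        moreover have "zcong (of_nat CARD('p)) (int k) (Rep_qp z (nat m)) (Rep_qp z k)" for z :: "'p qp" by (rule Rep_zcong) (use False in auto)
        ultimately have "zcong (of_nat CARD('p)) (int k) (Rep_qp y k) (Rep_qp x k)" by (meson zcong_sym zcong_trans)
        then have "zcong (of_nat CARD('p)) (int k) (Rep_qp y k - Rep_qp x k) 0" by (simp add: zcong_diff_0)
        then have "zcong (of_nat CARD('p)) (int k) (Rep_qp (qp_sub y x) k) 0" by (rule zcong_trans[OF Rep_sub])
        then have "Rep_qp (qp_sub y x) k = 0"
          by (rule zcong_range_unique) (use Rep_props(2,3)[of "qp_sub y x" k] pq_pos in auto)
        then show ?thesis by simp
      qed
    qed
  qed
qed

lemma qp_in_down: "qp_in x m \<Longrightarrow> m' \<le> m \<Longrightarrow> qp_in x m'" for x :: "'p::finite qp"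
proof -
  assume "qp_in x m" "m' \<le> m"
  then have "zcong (of_nat CARD('p)) m (Rep_qp x k) 0" for k by (simp add: qp_in_def zcong_def)
  then have "zcong (of_nat CARD('p)) m' (Rep_qp x k) 0" for k by (rule zcong_mono) (use \<open>m' \<le> m\<close> in auto)
  then show ?thesis by (simp add: qp_in_def zcong_def)
qed

lemma qp_in_ex: "\<exists>j::nat. qp_in x (- int j)" for x :: "'p::finite qp"
proof -
  obtain j :: nat where j: "zcong (of_nat CARD('p)) (- int j) (Rep_qp x 0) 0" using Rep_props(1)[of x 0] by (auto simp: is_zp_zcong)
  have "zcong (of_nat CARD('p)) (- int j) (Rep_qp x k) 0" for k
  proof -
    have "zcong (of_nat CARD('p)) (int 0) (Rep_qp x k) (Rep_qp x 0)" by (rule Rep_zcong) simp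
    then have "zcong (of_nat CARD('p)) (- int j) (Rep_qp x k) (Rep_qp x 0)" by (rule zcong_mono) auto
    then show ?thesis using j by (rule zcong_trans)
  qed
  then show ?thesis by (auto simp: qp_in_def zcong_def)
qed

text \<open>The point is that the \<open>GREATEST\<close> in \<open>qp_val\<close> exists for a
  nonzero number: a nonzero coordinate \<open>k\<close> bounds the valuation from above, and every
  number lies in some p^(-j) Z_p.\<close>

lemma qp_abs_le_iff:
  fixes x :: "'p::finite qp"
  assumes p: "1 < CARD('p)"
  shows "qp_abs x \<le> real CARD('p) powi \<gamma> \<longleftrightarrow> qp_in x (- \<gamma>)"
proof (cases "x = qp_zero")
  case True
  then show ?thesis by (auto simp: qp_abs_def qp_in_def Rep_zero intro: exI[of _ 0])
next
  case False
  obtain k where k: "Rep_qp x k \<noteq> 0"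
  proof (rule ccontr)
    assume "\<not> thesis"
    then have "Rep_qp x k = 0" for k using that by blast
    then have "x = qp_zero" by (intro qp_eqI) (simp add: Rep_zero)
    then show False using False by simp
  qed
  have bd: "m < int k" if "qp_in x m" for m
  proof (rule ccontr)
    assume "\<not> m < int k"
    then have "qp_in x (int k)" by (intro qp_in_down[OF that]) simp
    then have "zcong (of_nat CARD('p)) (int k) (Rep_qp x k) 0" by (simp add: qp_in_def zcong_def)
    then have "Rep_qp x k = 0" by (rule zcong_range_unique) (use Rep_props(2,3)[of x k] pq_pos in auto)
    then show False using k by simp
  qed
  obtain j :: nat where j: "qp_in x (- int j)" using qp_in_ex by blast
  define S where "S = {m. - int j \<le> m \<and> qp_in x m}"
  have fin: "finite S" by (rule finite_subset[of _ "{- int j..int k}"]) (use bd in \<open>force simp: S_def\<close>)+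
  have jS: "- int j \<in> S" using j by (simp add: S_def)
  have MS: "Max S \<in> S" using fin jS Max_in by blast
  have v: "qp_val x = Max S"
    unfolding qp_val_def
  proof (rule Greatest_equality)
    show "qp_in x (Max S)" using MS by (simp add: S_def)
    show "y \<le> Max S" if "qp_in x y" for y
    proof (cases "- int j \<le> y")
      case True
      then show ?thesis using that fin by (intro Max_ge) (auto simp: S_def)
    next
      case False
      then show ?thesis using MS by (simp add: S_def)
    qed
  qed
  have iff: "qp_in x m \<longleftrightarrow> m \<le> Max S" for m
  proof
    assume "qp_in x m"
    then show "m \<le> Max S" using MS fin by (cases "- int j \<le> m") (auto simp: S_def intro: Max_ge)
  next
    assume "m \<le> Max S"
    moreover have "qp_in x (Max S)" using MS by (simp add: S_def)
    ultimately show "qp_in x m" using qp_in_down by blast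
  qed
  have pw: "real CARD('p) powi i \<le> real CARD('p) powi j \<longleftrightarrow> i \<le> j" for i j
    using p power_int_strict_increasing[of j i "real CARD('p)"] power_int_increasing[of i j "real CARD('p)"] by force
  have "qp_abs x \<le> real CARD('p) powi \<gamma> \<longleftrightarrow> - qp_val x \<le> \<gamma>"
    using False by (simp add: qp_abs_def pw)
  then show ?thesis unfolding iff v by auto
qed

lemma qrel_refl [simp]: "qrel m x x" by (simp add: qrel_def)

lemma qrel_sym: "qrel m x y \<Longrightarrow> qrel m y x" unfolding qrel_def by (rule zcong_sym)

lemma qrel_trans: "qrel m x y \<Longrightarrow> qrel m y z \<Longrightarrow> qrel m x z" unfolding qrel_def by (rule zcong_trans)

lemma qrel_mono: "qrel m y x \<Longrightarrow> m' \<le> m \<Longrightarrow> qrel m' y x" for x y :: "'p::finite qp"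
proof -
  assume r: "qrel m y x" and m: "m' \<le> m"
  have "zcong (of_nat CARD('p)) m (Rep_qp y (nat m)) (Rep_qp x (nat m))" using r by (simp add: qrel_def)
  then have "zcong (of_nat CARD('p)) m' (Rep_qp y (nat m)) (Rep_qp x (nat m))" by (rule zcong_mono) (use m in auto)
  then show ?thesis using qrel_at[of m' "nat m" y x] m by auto
qed

lemma qrel_ex: "\<exists>j::nat. qrel (- int j) y x"
  using qp_in_ex[of "qp_sub y x"] by (simp add: qp_in_sub)

lemma qrel_add: "qrel m (qp_add a y) (qp_add a x) \<longleftrightarrow> qrel m y x" for a x y :: "'p::finite qp"
proof -
  have A: "zcong (of_nat CARD('p)) m (Rep_qp (qp_add a z) (nat m)) (Rep_qp a (nat m) + Rep_qp z (nat m))" for z :: "'p qp"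
    using Rep_add by (rule zcong_mono) auto
  have "qrel m (qp_add a y) (qp_add a x) \<longleftrightarrow> zcong (of_nat CARD('p)) m (Rep_qp a (nat m) + Rep_qp y (nat m)) (Rep_qp a (nat m) + Rep_qp x (nat m))"
    unfolding qrel_def using A[of x] A[of y] by (meson zcong_sym zcong_trans)
  also have "\<dots> \<longleftrightarrow> qrel m y x" by (simp add: qrel_def zcong_def)
  finally show ?thesis .
qed

lemma qp_add_sub: "qp_add a (qp_sub z a) = z" for a z :: "'p::finite qp"
proof (rule qp_eqI)
  fix k
  have "zcong (of_nat CARD('p)) (int k) (Rep_qp (qp_add a (qp_sub z a)) k) (Rep_qp a k + Rep_qp (qp_sub z a) k)" by (rule Rep_add)
  moreover have "zcong (of_nat CARD('p)) (int k) (Rep_qp a k + Rep_qp (qp_sub z a) k) (Rep_qp a k + (Rep_qp z k - Rep_qp a k))"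
    by (intro zcong_add zcong_refl Rep_sub)
  ultimately have "zcong (of_nat CARD('p)) (int k) (Rep_qp (qp_add a (qp_sub z a)) k) (Rep_qp a k + (Rep_qp z k - Rep_qp a k))" by (rule zcong_trans)
  then show "zcong (of_nat CARD('p)) (int k) (Rep_qp (qp_add a (qp_sub z a)) k) (Rep_qp z k)" by simp
qed

lemma qp_sub_add: "qp_sub (qp_add a z) a = z" for a z :: "'p::finite qp"
proof (rule qp_eqI)
  fix k
  have "zcong (of_nat CARD('p)) (int k) (Rep_qp (qp_sub (qp_add a z) a) k) (Rep_qp (qp_add a z) k - Rep_qp a k)" by (rule Rep_sub)
  moreover have "zcong (of_nat CARD('p)) (int k) (Rep_qp (qp_add a z) k - Rep_qp a k) ((Rep_qp a k + Rep_qp z k) - Rep_qp a k)"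
    by (intro zcong_diff zcong_refl Rep_add)
  ultimately have "zcong (of_nat CARD('p)) (int k) (Rep_qp (qp_sub (qp_add a z) a) k) ((Rep_qp a k + Rep_qp z k) - Rep_qp a k)" by (rule zcong_trans)
  then show "zcong (of_nat CARD('p)) (int k) (Rep_qp (qp_sub (qp_add a z) a) k) (Rep_qp z k)" by simp
qed

lemma qp_sub_zero: "qp_sub z qp_zero = z" for z :: "'p::finite qp"
  by (rule qp_eqI) (use Rep_sub[of _ z qp_zero] in \<open>simp add: Rep_zero\<close>)

lemma qp_add_zero: "qp_add z qp_zero = z" for z :: "'p::finite qp"
  by (rule qp_eqI) (use Rep_add[of _ z qp_zero] in \<open>simp add: Rep_zero\<close>)

text \<open>Canonical name of the class modulo p^m, a rational in [0, p^m). It makes countability of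
  the balls evident, and it is what digit reversal produces.\<close>

definition qkey :: "int \<Rightarrow> 'p::finite qp \<Rightarrow> rat" where
  "qkey m x = rmod (Rep_qp x (nat m)) ((of_nat CARD('p)) powi m)"

lemma qkey_eq_iff: "qkey m y = qkey m x \<longleftrightarrow> qrel m y x"
  by (simp add: qkey_def qrel_def rmod_eq_iff[OF pq_pos(1)])

lemma qkey_props:
  fixes x :: "'p::finite qp"
  shows "0 \<le> qkey m x" "qkey m x < (of_nat CARD('p)) powi m" "is_zp CARD('p) (qkey m x)"
proof -
  show "0 \<le> qkey m x" "qkey m x < (of_nat CARD('p)) powi m" using rmod_range[OF pq_pos(1)] by (auto simp: qkey_def)
  show "is_zp CARD('p) (qkey m x)" unfolding qkey_def
    by (rule is_zp_zcong_trans[OF Rep_props(1) rmod_zcong[OF pq_pos(1)]]) simp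
qed

lemma mem_qball_iff:
  fixes x y :: "('p::finite) qp ^ ('n::finite)"
  assumes "1 < CARD('p)"
  shows "y \<in> qball x \<gamma> \<longleftrightarrow> (\<forall>i. qrel (- \<gamma>) (y $ i) (x $ i))"
proof -
  have "y \<in> qball x \<gamma> \<longleftrightarrow> (\<forall>i. qp_abs (qp_sub (y $ i) (x $ i)) \<le> real CARD('p) powi \<gamma>)"
    unfolding qball_def qpn_abs_def qpn_sub_def by (subst mem_Collect_eq, subst Max_le_iff) auto
  then show ?thesis by (simp add: qp_abs_le_iff[OF assms] qp_in_sub)
qed

lemma qball_translate:
  fixes a x :: "('p::finite) qp ^ ('n::finite)"
  assumes "1 < CARD('p)"
  shows "qpn_add a y \<in> qball (qpn_add a x) \<gamma> \<longleftrightarrow> y \<in> qball x \<gamma>"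
  by (simp add: mem_qball_iff[OF assms] qpn_add_def qrel_add)

lemma qpn_add_sub: "qpn_add a (qpn_sub z a) = z" "qpn_sub (qpn_add a z) a = z" "qpn_add z qpn_zero = z" "qpn_sub z qpn_zero = z"
  by (simp_all add: vec_eq_iff qpn_add_def qpn_sub_def qpn_zero_def qp_add_sub qp_sub_add qp_add_zero qp_sub_zero)

lemma qpn_sub_mem:
  fixes z a x :: "'p::finite qp ^ 'n::finite"
  assumes "1 < CARD('p)"
  shows "qpn_sub z a \<in> qball x \<gamma> \<longleftrightarrow> z \<in> qball (qpn_add a x) \<gamma>"
  using qball_translate[OF assms, of a "qpn_sub z a" x \<gamma>] by (simp add: qpn_add_sub)

lemma qpn_add_image: "qpn_add a ` A = (\<lambda>z. qpn_sub z a) -` A"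
proof (intro set_eqI iffI)
  fix z assume "z \<in> (\<lambda>z. qpn_sub z a) -` A"
  then have "qpn_add a (qpn_sub z a) \<in> qpn_add a ` A" by (intro imageI) simp
  then show "z \<in> qpn_add a ` A" by (simp add: qpn_add_sub)
qed (auto simp: qpn_add_sub)

section \<open>Haar measure\<close>

text \<open>Haar measure is the image of Lebesgue measure on \<open>[0, \<infinity>)\<^sup>n\<close> under the digit reversal
  \<open>\<Sum> a\<^sub>j p\<^bsup>-j-1\<^esup> \<mapsto> \<Sum> a\<^sub>j p\<^bsup>j\<^esup>\<close>: preimages of balls are products of intervals of the right length.
  The function \<open>rev_digits p m\<close> reverses the digits of \<open>\<lfloor>p\<^bsup>m\<^esup> u\<rfloor>\<close>.\<close>

function rev_digits :: "nat \<Rightarrow> int \<Rightarrow> nat \<Rightarrow> rat" where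
  "rev_digits p m N = (if N = 0 \<or> p \<le> 1 then 0
     else rev_digits p (m - 1) (N div p) + of_nat (N mod p) * of_nat p powi (m - 1))"
  by pat_completeness auto
termination by (relation "Wellfounded.measure (\<lambda>(p, m, N). N)") auto

declare rev_digits.simps [simp del]

lemma rev_digits_rec:
  assumes "1 < p"
  shows "rev_digits p m N = rev_digits p (m - 1) (N div p) + of_nat (N mod p) * of_nat p powi (m - 1)"
proof (cases "N = 0")
  case True
  then show ?thesis by (simp add: rev_digits.simps[of p m 0] rev_digits.simps[of p "m - 1" 0])
next
  case False
  then show ?thesis using assms by (subst rev_digits.simps) simp
qed

lemma rev_digits_0 [simp]: "rev_digits p m 0 = 0"
  by (simp add: rev_digits.simps)

lemma powi_step: "1 < p \<Longrightarrow> (of_nat p :: rat) powi m = of_nat p * of_nat p powi (m - 1)"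
  using power_int_add[of "of_nat p :: rat" 1 "m - 1"] by simp

lemma rev_digits_bounds:
  assumes p: "1 < p"
  shows "0 \<le> rev_digits p m N \<and> rev_digits p m N < of_nat p powi m \<and> is_zp p (rev_digits p m N)"
proof (induction N arbitrary: m rule: less_induct)
  case (less N)
  have pos: "0 < (of_nat p :: rat) powi i" for i using p by (simp add: zero_less_power_int)
  show ?case
  proof (cases "N = 0")
    case True
    then show ?thesis using pos by (auto simp: is_zp_def intro: exI[of _ 0])
  next
    case False
    let ?a = "rev_digits p (m - 1) (N div p)" and ?P = "(of_nat p :: rat) powi (m - 1)"
    have IH: "0 \<le> ?a" "?a < ?P" "is_zp p ?a" using less.IH[of "N div p" "m - 1"] False p by auto
    have "N mod p \<le> p - 1" using p by (simp add: Suc_leI less_Suc_eq_le[symmetric])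
    then have "(of_nat (N mod p) :: rat) \<le> of_nat (p - 1)" by (rule of_nat_mono)
    then have "of_nat (N mod p) * ?P \<le> (of_nat p - 1) * ?P" using p pos[of "m - 1"] by (intro mult_right_mono) (auto simp: of_nat_diff)
    then have "?a + of_nat (N mod p) * ?P < of_nat p * ?P" using IH by (simp add: algebra_simps)
    moreover have "is_zp p (?a + of_nat (N mod p) * ?P)"
    proof (rule is_zp_zcong_trans[OF IH(3)])
      show "zcong (of_nat p) (m - 1) (?a + of_nat (N mod p) * ?P) ?a"
        unfolding zcong_def by (rule exI[of _ "int (N mod p)"]) simp
    qed (use p in simp)
    ultimately show ?thesis using IH pos[of "m - 1"] by (simp add: rev_digits_rec[OF p, of m N] powi_step[OF p, of m])
  qed
qed

text \<open>Dropping the last \<open>j\<close> digits of \<open>N\<close> removes multiples of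
  p^(m-j) only, because the low digits carry the high powers. This is the compatibility required of
  the coordinates of a p-adic number.\<close>

lemma rev_digits_zcong:
  assumes p: "1 < p" shows "zcong (of_nat p) (m - int j) (rev_digits p m N) (rev_digits p (m - int j) (N div p ^ j))"
proof (induction j)
  case (Suc j)
  have "zcong (of_nat p) (m - int (Suc j)) (rev_digits p m N) (rev_digits p (m - int j) (N div p ^ j))"
    using Suc by (rule zcong_mono) (use p in auto)
  moreover have "zcong (of_nat p) (m - int (Suc j)) (rev_digits p (m - int j) (N div p ^ j)) (rev_digits p (m - int (Suc j)) (N div p ^ Suc j))"
  proof -
    have e: "m - int j - 1 = m - int (Suc j)" "N div p ^ j div p = N div p ^ Suc j"
      by (simp_all add: power_Suc2 div_mult2_eq del: power_Suc)
    show ?thesis unfolding rev_digits_rec[OF p, of "m - int j"] e zcong_def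
      by (rule exI[of _ "int (N div p ^ j mod p)"]) simp
  qed
  ultimately show ?case by (rule zcong_trans)
qed simp

lemma rev_digits_inj:
  assumes p: "1 < p" and "rev_digits p m N = rev_digits p m N'" shows "N = N'"
  using assms(2)
proof (induction "N + N'" arbitrary: m N N' rule: less_induct)
  case less
  let ?P = "(of_nat p :: rat) powi (m - 1)"
  let ?a = "rev_digits p (m - 1) (N div p)" and ?b = "rev_digits p (m - 1) (N' div p)"
  show ?case
  proof (cases "N = 0 \<and> N' = 0")
    case False
    have e: "?a + of_nat (N mod p) * ?P = ?b + of_nat (N' mod p) * ?P"
      using less.prems by (simp add: rev_digits_rec[OF p, of m])
    have "zcong (of_nat p) (m - 1) ?a ?b"
      unfolding zcong_def by (rule exI[of _ "int (N' mod p) - int (N mod p)"]) (use e in \<open>simp add: algebra_simps\<close>)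
    then have ab: "?a = ?b" by (rule zcong_range_unique) (use rev_digits_bounds[OF p] in auto)
    then have "of_nat (N mod p) * ?P = of_nat (N' mod p) * ?P" using e by simp
    then have md: "N mod p = N' mod p" using p by simp
    have dN: "n div p < n" if "n \<noteq> 0" for n using that p by simp
    have "N div p \<le> N" "N' div p \<le> N'" by auto
    moreover have "N div p < N \<or> N' div p < N'" using False dN by blast
    ultimately have "N div p + N' div p < N + N'" by linarith
    then have "N div p = N' div p" using less.hyps[OF _ ab] by blast
    then show ?thesis using md by (metis div_mult_mod_eq)
  qed simp
qed

text \<open>Induction on the number \<open>j\<close> of powers of p available below p^m: the top
  digit of \<open>\<kappa>\<close> becomes the last digit of its preimage.\<close>

lemma rev_digits_surj:
  assumes p: "1 < p" and "is_zp p \<kappa>" "0 \<le> \<kappa>" "\<kappa> < of_nat p powi m"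
  shows "\<exists>N. rev_digits p m N = \<kappa>"
proof -
  have pos: "0 < (of_nat p :: rat) powi i" for i using p by (simp add: zero_less_power_int)
  have *: "\<exists>N. rev_digits p m N = \<kappa>" if "zcong (of_nat p) (m - int j) \<kappa> 0" "0 \<le> \<kappa>" "\<kappa> < of_nat p powi m" for j m \<kappa>
    using that
  proof (induction j arbitrary: m \<kappa>)
    case 0
    then have "\<kappa> = 0" using pos[of m] by (intro zcong_range_unique[of "of_nat p" m]) auto
    then show ?case by (intro exI[of _ 0]) simp
  next
    case (Suc j)
    let ?P = "(of_nat p :: rat) powi (m - 1)"
    define \<kappa>' where "\<kappa>' = rmod \<kappa> ?P"
    have r: "0 \<le> \<kappa>'" "\<kappa>' < ?P" using rmod_range[OF pos] by (auto simp: \<kappa>'_def)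
    have "zcong (of_nat p) (m - 1) \<kappa>' \<kappa>" unfolding \<kappa>'_def by (rule rmod_zcong[OF pos])
    then have "zcong (of_nat p) (m - int (Suc j)) \<kappa>' \<kappa>" by (rule zcong_mono) (use p in auto)
    then have "zcong (of_nat p) (m - int (Suc j)) \<kappa>' 0" using Suc.prems(1) by (rule zcong_trans)
    then have "zcong (of_nat p) (m - 1 - int j) \<kappa>' 0" by (simp add: algebra_simps)
    then obtain N' where N': "rev_digits p (m - 1) N' = \<kappa>'" using Suc.IH r by blast
    define d where "d = \<lfloor>\<kappa> / ?P\<rfloor>"
    have d0: "0 \<le> d" using Suc.prems pos[of "m - 1"] by (simp add: d_def)
    have dp: "d < int p"
    proof -
      have "\<kappa> / ?P < of_nat p" using Suc.prems(3) pos[of "m - 1"] powi_step[OF p, of m] by (simp add: divide_less_eq)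
      then show ?thesis by (simp add: d_def floor_less_iff)
    qed
    have "\<kappa> = \<kappa>' + of_nat (nat d) * ?P" using d0 by (simp add: \<kappa>'_def rmod_def d_def mult.commute)
    moreover have "(p * N' + nat d) div p = N'" "(p * N' + nat d) mod p = nat d" using dp d0 p by (auto simp: nat_less_iff)
    ultimately have "rev_digits p m (p * N' + nat d) = \<kappa>" by (simp add: rev_digits_rec[OF p, of m] N')
    then show ?case by blast
  qed
  obtain j :: nat where "zcong (of_nat p) (- int j) \<kappa> 0" using assms(2) by (auto simp: is_zp_zcong)
  then have "zcong (of_nat p) (m - int (nat (m + int j))) \<kappa> 0"  
    by (rule zcong_mono) (use p in auto)
  then show ?thesis using * assms by blast
qed

text \<open>A section of Monna's map from Q_p to the half line. Coordinate \<open>k\<close> uses the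
  integer part of \<open>u\<close> and its first \<open>k\<close> digits after the point. Negative
  \<open>u\<close> go to 0 because of \<open>nat\<close>; they are excluded later by restricting
  Lebesgue measure.\<close>

definition monna :: "real \<Rightarrow> 'p::finite qp" where
  "monna u = Abs_qp (\<lambda>k. rmod (rev_digits CARD('p) (int k) (nat \<lfloor>real CARD('p) ^ k * u\<rfloor>)) (of_nat CARD('p) ^ k))"

lemma nat_floor_div:
  assumes "0 < p" shows "nat \<lfloor>real p ^ j * v\<rfloor> div p ^ j = nat \<lfloor>v\<rfloor>"
proof (cases "0 \<le> v")
  case True
  have "\<lfloor>(real p ^ j * v) / real_of_int (int (p ^ j))\<rfloor> = \<lfloor>real p ^ j * v\<rfloor> div int (p ^ j)"
    by (rule floor_divide_real_eq_div) simp
  then have "\<lfloor>v\<rfloor> = \<lfloor>real p ^ j * v\<rfloor> div int (p ^ j)" using assms by simp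
  then have "nat \<lfloor>v\<rfloor> = nat \<lfloor>real p ^ j * v\<rfloor> div nat (int (p ^ j))"
    using True by (simp only: nat_div_distrib[symmetric] zero_le_floor mult_nonneg_nonneg of_nat_0_le_iff zero_le_power) 
  then show ?thesis by (simp only: nat_int)
next
  case False
  then have "real p ^ j * v \<le> 0" by (simp add: mult_nonneg_nonpos)
  then have "nat \<lfloor>real p ^ j * v\<rfloor> = 0" "nat \<lfloor>v\<rfloor> = 0" using False by linarith+
  then show ?thesis by simp
qed

lemma qkey_monna:
  assumes p: "1 < CARD('p::finite)"
  shows "qkey m (monna u :: 'p qp) = rev_digits CARD('p) m (nat \<lfloor>real CARD('p) powi m * u\<rfloor>)"
proof -
  let ?p = "CARD('p)" 
  let ?t = "\<lambda>k. rev_digits ?p (int k) (nat \<lfloor>real ?p ^ k * u\<rfloor>)"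
  have zp: "is_zp ?p (?t k)" for k using rev_digits_bounds[OF p] by blast
  have co: "zcong (of_nat ?p) (int k) (?t (Suc k)) (?t k)" for k
    using rev_digits_zcong[OF p, of "int (Suc k)" 1 "nat \<lfloor>real ?p ^ Suc k * u\<rfloor>"] nat_floor_div[of ?p 1 "real ?p ^ k * u"]
    by (simp add: mult.assoc)
  have R: "zcong (of_nat ?p) (int k) (Rep_qp (monna u :: 'p qp) k) (?t k)" for k
    unfolding monna_def by (rule Rep_mk_zcong[OF zp co])
  have "zcong (of_nat ?p) m (Rep_qp (monna u :: 'p qp) (nat m)) (?t (nat m))" using R by (rule zcong_mono) auto
  moreover have "zcong (of_nat ?p) m (?t (nat m)) (rev_digits ?p m (nat \<lfloor>real ?p powi m * u\<rfloor>))"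
  proof (cases "0 \<le> m")
    case True
    then have "real ?p powi m = real ?p ^ nat m" by (simp add: power_int_def)
    then show ?thesis using True by simp
  next
    case False
    define j where "j = nat (- m)"
    have j: "m = - int j" "nat m = 0" using False by (auto simp: j_def)
    have e: "real ?p ^ j * (real ?p powi m * u) = u" using p by (simp add: j power_int_minus)
    have "nat \<lfloor>u\<rfloor> div ?p ^ j = nat \<lfloor>real ?p powi m * u\<rfloor>"
      using nat_floor_div[of ?p j "real ?p powi m * u"] p unfolding e by simp
    then show ?thesis using rev_digits_zcong[OF p, of 0 j "nat \<lfloor>u\<rfloor>"] by (simp add: j)
  qed
  ultimately have z: "zcong (of_nat ?p) m (Rep_qp (monna u :: 'p qp) (nat m)) (rev_digits ?p m (nat \<lfloor>real ?p powi m * u\<rfloor>))" by (rule zcong_trans)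
  have "zcong (of_nat ?p) m (qkey m (monna u :: 'p qp)) (rev_digits ?p m (nat \<lfloor>real ?p powi m * u\<rfloor>))"
    unfolding qkey_def using rmod_zcong[OF pq_pos(1)] z by (rule zcong_trans)
  then show ?thesis
    by (rule zcong_range_unique) (use qkey_props[of m "monna u :: 'p qp"] rev_digits_bounds[OF p] in auto)
qed

text \<open>At level \<open>m\<close>, \<open>rev_digits\<close> is a bijection from the natural
  numbers to the keys, so the condition fixes the integer part of p^m u, and this describes a single
  interval.\<close>

lemma monna_preimage:
  fixes x :: "'p::finite qp"
  assumes p: "1 < CARD('p)"
  shows "\<exists>N::nat. \<forall>u\<ge>0. qrel m (monna u) x \<longleftrightarrow> u \<in> {real N / real CARD('p) powi m ..< real (Suc N) / real CARD('p) powi m}"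
proof -
  obtain N where N: "rev_digits CARD('p) m N = qkey m x" using rev_digits_surj[OF p] qkey_props by blast
  have P: "0 < real CARD('p) powi m" by (simp add: zero_less_power_int)
  have "qrel m (monna u) x \<longleftrightarrow> u \<in> {real N / real CARD('p) powi m ..< real (Suc N) / real CARD('p) powi m}" if u: "0 \<le> u" for u
  proof -
    have "qrel m (monna u) x \<longleftrightarrow> nat \<lfloor>real CARD('p) powi m * u\<rfloor> = N"
      unfolding qkey_eq_iff[symmetric] qkey_monna[OF p] N[symmetric] using rev_digits_inj[OF p] by blast
    also have "\<dots> \<longleftrightarrow> \<lfloor>real CARD('p) powi m * u\<rfloor> = int N" using u P by (auto simp: nat_eq_iff)
    also have "\<dots> \<longleftrightarrow> real N \<le> real CARD('p) powi m * u \<and> real CARD('p) powi m * u < real N + 1" by (simp add: floor_eq_iff)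
    also have "\<dots> \<longleftrightarrow> u \<in> {real N / real CARD('p) powi m ..< real (Suc N) / real CARD('p) powi m}"
      using P by (simp add: field_simps)
    finally show ?thesis .
  qed
  then show ?thesis by blast
qed

section \<open>An explicit translation invariant measure\<close>

definition qballs :: "('p::finite qp ^ 'n::finite) set set" where
  "qballs = range (\<lambda>(x, \<gamma>). qball x \<gamma>)"

definition monna_haar :: "('p::finite qp ^ ('n::finite)) measure" where
  "monna_haar = distr (PiM (UNIV :: 'n set) (\<lambda>_. restrict_space lborel {0::real..})) (sigma UNIV qballs) (\<lambda>f. \<chi> i. monna (f i))"

lemma sets_monna_haar: "sets (monna_haar :: ('p::finite qp ^ ('n::finite)) measure) = sigma_sets UNIV qballs"
  "space (monna_haar :: ('p::finite qp ^ ('n::finite)) measure) = UNIV"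
  by (simp_all add: monna_haar_def)

lemma monna_box:
  fixes z :: "'p::finite qp ^ 'n::finite"
  assumes p: "1 < CARD('p)"
  shows "\<exists>I. (\<forall>i. I i \<in> sets (restrict_space lborel {0::real..}) \<and> emeasure (restrict_space lborel {0..}) (I i) = ennreal (real CARD('p) powi \<delta>))
    \<and> (\<lambda>f. \<chi> i. monna (f i)) -` qball z \<delta> \<inter> space (PiM (UNIV :: 'n set) (\<lambda>_. restrict_space lborel {0::real..})) = PiE UNIV I"
proof -
  let ?P = "real CARD('p) powi (- \<delta>)"
  have P: "0 < ?P" by (simp add: zero_less_power_int)
  have "\<forall>i. \<exists>N::nat. \<forall>u\<ge>0. qrel (- \<delta>) (monna u) (z $ i) \<longleftrightarrow> u \<in> {real N / ?P ..< real (Suc N) / ?P}"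
    using monna_preimage[OF p] by blast
  then obtain N :: "'n \<Rightarrow> nat" where N: "\<And>i u. 0 \<le> u \<Longrightarrow> qrel (- \<delta>) (monna u) (z $ i) \<longleftrightarrow> u \<in> {real (N i) / ?P ..< real (Suc (N i)) / ?P}"
    by metis
  define I where "I = (\<lambda>i. {real (N i) / ?P ..< real (Suc (N i)) / ?P})"
  have I0: "I i \<subseteq> {0..}" for i using P by (auto simp: I_def intro: order_trans[rotated])
  have len: "emeasure (restrict_space lborel {0..}) (I i) = ennreal (real CARD('p) powi \<delta>)" for i
  proof -
    have "emeasure (restrict_space lborel {0..}) (I i) = emeasure lborel (I i)"
      by (rule emeasure_restrict_space) (use I0 in auto)
    also have "\<dots> = ennreal (real (Suc (N i)) / ?P - real (N i) / ?P)"
      unfolding I_def using P by (intro emeasure_lborel_Ico) (simp add: divide_right_mono)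
    also have "real (Suc (N i)) / ?P - real (N i) / ?P = 1 / ?P" by (simp add: diff_divide_distrib[symmetric])
    also have "\<dots> = real CARD('p) powi \<delta>" by (simp add: power_int_minus divide_inverse)
    finally show ?thesis .
  qed
  have "I i \<in> sets (restrict_space lborel {0::real..})" for i
    using I0[of i] by (subst sets_restrict_space_iff) (auto simp: I_def)
  moreover have "(\<lambda>f. \<chi> i. monna (f i)) -` qball z \<delta> \<inter> space (PiM (UNIV :: 'n set) (\<lambda>_. restrict_space lborel {0::real..})) = PiE UNIV I"
  proof (rule set_eqI)
    fix f :: "'n \<Rightarrow> real"
    have eq: "f i \<in> I i \<longleftrightarrow> 0 \<le> f i \<and> qrel (- \<delta>) (monna (f i)) (z $ i)" for i
      using N[of "f i" i] I0[of i] unfolding I_def by (metis atLeast_iff subsetD)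
    show "f \<in> (\<lambda>f. \<chi> i. monna (f i)) -` qball z \<delta> \<inter> space (PiM (UNIV :: 'n set) (\<lambda>_. restrict_space lborel {0::real..})) \<longleftrightarrow> f \<in> PiE UNIV I"
      by (auto simp: mem_qball_iff[OF p] space_PiM space_restrict_space PiE_iff eq)
  qed
  ultimately show ?thesis using len by blast
qed

lemma sigma_finite_restrict_lborel: "sigma_finite_measure (restrict_space lborel {0::real..})"
  by (rule sigma_finite_measure_restrict_space) (auto intro: lborel.sigma_finite_measure_axioms)

lemma measurable_monna:
  assumes p: "1 < CARD('p)"
  shows "(\<lambda>f. (\<chi> i. monna (f i)) :: 'p::finite qp ^ 'n::finite) \<in> measurable (PiM (UNIV :: 'n set) (\<lambda>_. restrict_space lborel {0::real..})) (sigma UNIV qballs)"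
proof (rule measurable_measure_of)
  fix B :: "('p qp ^ 'n) set" assume "B \<in> qballs"
  then obtain z \<delta> where B: "B = qball z \<delta>" by (auto simp: qballs_def)
  from monna_box[OF p, of \<delta> z] obtain I where "\<And>i. I i \<in> sets (restrict_space lborel {0::real..})"
    "(\<lambda>f. \<chi> i. monna (f i)) -` qball z \<delta> \<inter> space (PiM (UNIV :: 'n set) (\<lambda>_. restrict_space lborel {0::real..})) = PiE UNIV I" by blast
  then show "(\<lambda>f. \<chi> i. monna (f i)) -` B \<inter> space (PiM (UNIV :: 'n set) (\<lambda>_. restrict_space lborel {0::real..})) \<in> sets (PiM UNIV (\<lambda>_. restrict_space lborel {0::real..}))"
    unfolding B by (auto intro!: sets_PiM_I_finite)
qed auto

lemma monna_haar_ball: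
  fixes x :: "'p::finite qp ^ 'n::finite"
  assumes p: "1 < CARD('p)"
  shows "emeasure monna_haar (qball x \<gamma>) = ennreal ((real CARD('p) powi \<gamma>) ^ CARD('n))"
proof -
  interpret product_sigma_finite "\<lambda>_::'n. restrict_space lborel {0::real..}"
    unfolding product_sigma_finite_def using sigma_finite_restrict_lborel by simp
  have "qball x \<gamma> \<in> sets (sigma UNIV qballs)" by (simp add: qballs_def) (auto intro: sigma_sets.Basic)
  then have "emeasure monna_haar (qball x \<gamma>) = emeasure (PiM (UNIV :: 'n set) (\<lambda>_. restrict_space lborel {0::real..}))
    ((\<lambda>f. \<chi> i. monna (f i)) -` qball x \<gamma> \<inter> space (PiM (UNIV :: 'n set) (\<lambda>_. restrict_space lborel {0::real..})))"
    unfolding monna_haar_def by (intro emeasure_distr measurable_monna p)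
  also obtain I where I: "\<And>i. I i \<in> sets (restrict_space lborel {0::real..})" "\<And>i. emeasure (restrict_space lborel {0..}) (I i) = ennreal (real CARD('p) powi \<gamma>)"
    "(\<lambda>f. \<chi> i. monna (f i)) -` qball x \<gamma> \<inter> space (PiM (UNIV :: 'n set) (\<lambda>_. restrict_space lborel {0::real..})) = PiE UNIV I"
    using monna_box[OF p, of \<gamma> x] by blast
  note I(3)
  also have "emeasure (PiM (UNIV :: 'n set) (\<lambda>_. restrict_space lborel {0::real..})) (PiE UNIV I) = (\<Prod>i\<in>UNIV. emeasure (restrict_space lborel {0..}) (I i))"
    by (rule emeasure_PiM) (use I in auto)
  also have "\<dots> = ennreal ((real CARD('p) powi \<gamma>) ^ CARD('n))"
    by (simp add: I(2) ennreal_power zero_le_power_int)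
  finally show ?thesis .
qed

lemma ball_tree_qball:
  assumes p: "1 < CARD('p)"
  shows "ball_tree (qball :: 'p::finite qp ^ 'n::finite \<Rightarrow> int \<Rightarrow> _)"
proof
  fix x y :: "'p qp ^ 'n" and \<gamma> \<delta> :: int
  show "x \<in> qball x \<gamma>" by (simp add: mem_qball_iff[OF p])
  show "qball y \<gamma> = qball x \<gamma>" if "y \<in> qball x \<gamma>"
    using that unfolding set_eq_iff mem_qball_iff[OF p] by (meson qrel_sym qrel_trans)
  show "qball x \<gamma> \<subseteq> qball x \<delta>" if "\<gamma> \<le> \<delta>"
    using that unfolding subset_eq by (auto simp: mem_qball_iff[OF p] intro: qrel_mono[of "- \<gamma>" _ _ "- \<delta>"])
  show "\<exists>\<gamma>. y \<in> qball x \<gamma>"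
  proof -
    have "\<forall>i. \<exists>j::nat. qrel (- int j) (y $ i) (x $ i)" using qrel_ex by blast
    then obtain j :: "'n \<Rightarrow> nat" where j: "\<And>i. qrel (- int (j i)) (y $ i) (x $ i)" by metis
    have "qrel (- int (Max (range j))) (y $ i) (x $ i)" for i by (rule qrel_mono[OF j]) auto
    then show ?thesis by (intro exI[of _ "int (Max (range j))"]) (simp add: mem_qball_iff[OF p])
  qed
next
  \<comment> \<open>A ball is determined by its level and the rational keys of the coordinates of
    its centre; since \<open>'n\<close> is finite there are countably many such data.\<close>
  have "range (\<lambda>(x, \<gamma>). qball x \<gamma>) \<subseteq> range (\<lambda>(\<gamma>, \<kappa> :: 'n \<Rightarrow> rat). {y :: 'p qp ^ 'n. \<forall>i. qkey (- \<gamma>) (y $ i) = \<kappa> i})"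
  proof clarify
    fix x :: "'p qp ^ 'n" and \<gamma>
    have "qball x \<gamma> = {y. \<forall>i. qkey (- \<gamma>) (y $ i) = qkey (- \<gamma>) (x $ i)}"
      by (auto simp: mem_qball_iff[OF p] qkey_eq_iff)
    then show "qball x \<gamma> \<in> range (\<lambda>(\<gamma>, \<kappa> :: 'n \<Rightarrow> rat). {y :: 'p qp ^ 'n. \<forall>i. qkey (- \<gamma>) (y $ i) = \<kappa> i})"
      by (intro image_eqI[of _ _ "(\<gamma>, \<lambda>i. qkey (- \<gamma>) (x $ i))"]) auto
  qed
  then show "countable (range (\<lambda>(x, \<gamma>). qball x \<gamma> :: ('p qp ^ 'n) set))"
    by (rule countable_subset) auto
qed

text \<open>Translation permutes the balls of each level, and these all have the same measure, so
  the measure and its translate agree on balls. Together with the empty set the balls are stable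
  under intersection, which gives equality of the two measures.\<close>

lemma monna_haar_invariant:
  assumes p: "1 < CARD('p)" and M: "M = (monna_haar :: ('p::finite qp ^ 'n::finite) measure)"
  shows "space M = UNIV \<and> sets M = sigma_sets UNIV (range (\<lambda>(x, \<gamma>). qball x \<gamma>))
     \<and> (\<forall>a. \<forall>A\<in>sets M. emeasure M (qpn_add a ` A) = emeasure M A) \<and> emeasure M (qball qpn_zero 0) = 1"
proof (intro conjI allI ballI)
  interpret ball_tree "qball :: 'p qp ^ 'n \<Rightarrow> int \<Rightarrow> _" by (rule ball_tree_qball[OF p])
  show "space M = UNIV" "sets M = sigma_sets UNIV (range (\<lambda>(x, \<gamma>). qball x \<gamma>))"
    using sets_monna_haar unfolding M qballs_def by auto
  then have sp: "space M = UNIV" and sets: "sets M = sigma_sets UNIV (range (\<lambda>(x, \<gamma>). qball x \<gamma>))" by auto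
  show "emeasure M (qball qpn_zero 0) = 1" unfolding M monna_haar_ball[OF p] by simp
  fix a :: "'p qp ^ 'n" and A assume A: "A \<in> sets M"
  let ?s = "\<lambda>z. qpn_sub z a"
  have pre: "?s -` qball x \<gamma> = qball (qpn_add a x) \<gamma>" for x \<gamma> by (auto simp: qpn_sub_mem[OF p])
  have meas: "?s \<in> measurable M M"
  proof (rule measurable_sigma_sets[OF sets])
    fix B :: "('p qp ^ 'n) set" assume "B \<in> range (\<lambda>(x, \<gamma>). qball x \<gamma>)"
    then obtain x \<gamma> where "B = qball x \<gamma>" by auto
    then have "?s -` B \<inter> space M = qball (qpn_add a x) \<gamma>" by (simp add: pre sp)
    then show "?s -` B \<inter> space M \<in> sets M" unfolding sets by (auto intro: sigma_sets.Basic)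
  qed (auto simp: sp)
  let ?E = "insert {} (range (\<lambda>(x, \<gamma>). qball x \<gamma> :: ('p qp ^ 'n) set))"
  have sE: "sigma_sets UNIV (range (\<lambda>(x, \<gamma>). qball x \<gamma> :: ('p qp ^ 'n) set)) = sigma_sets UNIV ?E"
    by (rule sigma_sets_eqI) (auto intro: sigma_sets.Basic sigma_sets.Empty)
  have "M = distr M M ?s"
  proof (rule measure_eqI_generator_eq[where E = ?E and A = "\<lambda>i. qball qpn_zero (int i)" and \<Omega> = UNIV])
    show "Int_stable ?E"
    proof (rule Int_stableI)
      fix B C assume "B \<in> ?E" "C \<in> ?E"
      show "B \<inter> C \<in> ?E"
      proof (cases "B \<inter> C = {}")
        case False
        then obtain z where z: "z \<in> B" "z \<in> C" by blast
        obtain x \<gamma> where B: "B = qball x \<gamma>" using \<open>B \<in> ?E\<close> z by auto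
        obtain y \<delta> where C: "C = qball y \<delta>" using \<open>C \<in> ?E\<close> z by auto
        have "B \<subseteq> C \<or> C \<subseteq> B" using ball_meet[of \<gamma> \<delta> z x y] ball_meet[of \<delta> \<gamma> z y x] z B C by (metis linear)
        then show ?thesis using \<open>B \<in> ?E\<close> \<open>C \<in> ?E\<close> by (metis Int_absorb1 Int_absorb2)
      qed simp
    qed
    show "emeasure M X = emeasure (distr M M ?s) X" if XE: "X \<in> ?E" for X
    proof (cases "X = {}")
      case False
      then obtain x \<gamma> where X: "X = qball x \<gamma>" using XE by auto
      have "X \<in> sets M" unfolding sets X by (auto intro: sigma_sets.Basic)
      then have "emeasure (distr M M ?s) X = emeasure M (qball (qpn_add a x) \<gamma>)"
        by (simp add: emeasure_distr[OF meas] X pre sp)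
      then show ?thesis unfolding X M by (simp add: monna_haar_ball[OF p])
    qed simp
    show "(\<Union>i. qball qpn_zero (int i)) = (UNIV :: ('p qp ^ 'n) set)"
    proof (intro set_eqI iffI UNIV_I)
      fix y :: "'p qp ^ 'n"
      obtain \<gamma> where "y \<in> qball qpn_zero \<gamma>" using ball_cover by blast
      then have "y \<in> qball qpn_zero (int (nat \<gamma>))" using ball_mono[of \<gamma> "int (nat \<gamma>)" qpn_zero] by auto
      then show "y \<in> (\<Union>i. qball qpn_zero (int i))" by blast
    qed
    show "emeasure M (qball qpn_zero (int i)) \<noteq> \<infinity>" for i unfolding M monna_haar_ball[OF p] by simp
  qed (auto simp: sets sE)
  then have "emeasure M A = emeasure (distr M M ?s) A" by simp
  also have "\<dots> = emeasure M (?s -` A)" using A by (simp add: emeasure_distr[OF meas] sp)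
  finally show "emeasure M (qpn_add a ` A) = emeasure M A" by (simp add: qpn_add_image)
qed

text \<open>The explicit measure is only a witness for the choice operator: from here on
  \<open>haar\<close> is known through these properties alone.\<close>

lemma haar_props:
  assumes p: "1 < CARD('p)"
  defines "H \<equiv> (haar :: ('p::finite qp ^ 'n::finite) measure)"
  shows "space H = UNIV" "sets H = sigma_sets UNIV (range (\<lambda>(x, \<gamma>). qball x \<gamma>))"
    "\<And>a A. A \<in> sets H \<Longrightarrow> emeasure H (qpn_add a ` A) = emeasure H A" "emeasure H (qball qpn_zero 0) = 1"
proof -
  have "space H = UNIV \<and> sets H = sigma_sets UNIV (range (\<lambda>(x, \<gamma>). qball x \<gamma>))
     \<and> (\<forall>a. \<forall>A\<in>sets H. emeasure H (qpn_add a ` A) = emeasure H A) \<and> emeasure H (qball qpn_zero 0) = 1"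
    unfolding H_def haar_def by (rule someI[where x = monna_haar]) (rule monna_haar_invariant[OF p refl])
  then show "space H = UNIV" "sets H = sigma_sets UNIV (range (\<lambda>(x, \<gamma>). qball x \<gamma>))"
    "\<And>a A. A \<in> sets H \<Longrightarrow> emeasure H (qpn_add a ` A) = emeasure H A" "emeasure H (qball qpn_zero 0) = 1" by auto
qed

text \<open>The number of subballs of the next level need not be counted: it is read off from the explicit
  measure constructed above.\<close>

lemma emeasure_ball_subballs:
  fixes M :: "('p::finite qp ^ 'n::finite) measure"
  assumes p: "1 < CARD('p)" and sets: "sets M = sigma_sets UNIV (range (\<lambda>(x, \<gamma>). qball x \<gamma>))"
    and c: "\<And>y. emeasure M (qball y (\<gamma> - 1)) = c"
  shows "emeasure M (qball x \<gamma>) = c * emeasure (count_space ((\<lambda>y. qball y (\<gamma> - 1)) ` qball x \<gamma>)) ((\<lambda>y. qball y (\<gamma> - 1)) ` qball x \<gamma>)"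
proof -
  interpret ball_tree "qball :: 'p qp ^ 'n \<Rightarrow> int \<Rightarrow> _" by (rule ball_tree_qball[OF p])
  let ?F = "(\<lambda>y. qball y (\<gamma> - 1)) ` qball x \<gamma>"
  have "(\<Union>B\<in>?F. B) = qball x \<gamma>"
  proof (intro set_eqI iffI)
    fix z assume "z \<in> (\<Union>B\<in>?F. B)"
    then obtain y where y: "y \<in> qball x \<gamma>" "z \<in> qball y (\<gamma> - 1)" by blast
    have "qball y (\<gamma> - 1) \<subseteq> qball y \<gamma>" by (rule ball_mono) simp
    then show "z \<in> qball x \<gamma>" using y ball_eq[OF y(1)] by blast
  next
    fix z assume "z \<in> qball x \<gamma>"
    then show "z \<in> (\<Union>B\<in>?F. B)" using ball_self[of z "\<gamma> - 1"] by blast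
  qed
  then have "emeasure M (qball x \<gamma>) = emeasure M (\<Union>B\<in>?F. B)" by simp
  also have "\<dots> = (\<integral>\<^sup>+ B. emeasure M B \<partial>count_space ?F)"
  proof (rule emeasure_UN_countable)
    show "countable ?F" by (rule countable_subset[OF _ countable_balls]) auto
    show "disjoint_family_on (\<lambda>B. B) ?F"
      unfolding disjoint_family_on_def
    proof (intro ballI impI)
      fix A B assume "A \<in> ?F" "B \<in> ?F" "A \<noteq> B"
      then obtain y y' where "A = qball y (\<gamma> - 1)" "B = qball y' (\<gamma> - 1)" by blast
      then have "A = B" if "z \<in> A" "z \<in> B" for z
        using that ball_eq[of z y "\<gamma> - 1"] ball_eq[of z y' "\<gamma> - 1"] by simp
      then show "A \<inter> B = {}" using \<open>A \<noteq> B\<close> by blast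
    qed
  qed (auto simp: sets intro: sigma_sets.Basic)
  also have "\<dots> = (\<integral>\<^sup>+ B. c \<partial>count_space ?F)" by (rule nn_integral_cong) (auto simp: c)
  also have "\<dots> = c * emeasure (count_space ?F) ?F" by simp
  finally show ?thesis .
qed

text \<open>By invariance the measure of a ball depends on its level only, and it is multiplied by
  the number of subballs from one level to the next. That number is found by running the same count
  for the explicit measure. The normalization at level 0 starts an induction in both
  directions.\<close>

lemma haar_ball:
  fixes x :: "'p::finite qp ^ 'n::finite"
  assumes p: "1 < CARD('p)"
  shows "emeasure haar (qball x \<gamma>) = ennreal ((real CARD('p) ^ CARD('n)) powr real_of_int \<gamma>)"
proof -
  let ?D = "real CARD('p) ^ CARD('n)"
  note H = haar_props[OF p, where 'n = 'n]
  have D: "0 < ?D" by simp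
  have tr: "emeasure haar (qball y \<delta>) = emeasure haar (qball (qpn_zero :: 'p qp ^ 'n) \<delta>)" for y :: "'p qp ^ 'n" and \<delta>
  proof -
    have "qpn_add y ` qball qpn_zero \<delta> = qball y \<delta>"
      unfolding qpn_add_image using qpn_sub_mem[OF p, of _ y qpn_zero \<delta>] by (auto simp: qpn_add_sub)
    moreover have "qball (qpn_zero :: 'p qp ^ 'n) \<delta> \<in> sets haar" unfolding H(2) by (auto intro: sigma_sets.Basic)
    ultimately show ?thesis using H(3) by metis
  qed
  define E where "E = (\<lambda>\<delta>. emeasure haar (qball (qpn_zero :: 'p qp ^ 'n) \<delta>))"
  have mh: "emeasure monna_haar (qball y \<delta>) = ennreal (?D powr real_of_int \<delta>)" for y :: "'p qp ^ 'n" and \<delta>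
    unfolding monna_haar_ball[OF p] using D p
    by (simp add: powr_real_of_int' power_int_power power_int_mult[symmetric] power_int_power' mult.commute)
  have step: "E \<delta> = ennreal ?D * E (\<delta> - 1)" for \<delta>
  proof -
    let ?F = "(\<lambda>y. qball y (\<delta> - 1)) ` qball (qpn_zero :: 'p qp ^ 'n) \<delta>"
    have "ennreal (?D powr real_of_int \<delta>) = ennreal (?D powr real_of_int (\<delta> - 1)) * emeasure (count_space ?F) ?F"
      using emeasure_ball_subballs[OF p sets_monna_haar(1)[unfolded qballs_def] mh, of qpn_zero \<delta>] mh by simp
    then have "ennreal (?D powr real_of_int (1 - \<delta>)) * ennreal (?D powr real_of_int \<delta>)
      = ennreal (?D powr real_of_int (1 - \<delta>)) * ennreal (?D powr real_of_int (\<delta> - 1)) * emeasure (count_space ?F) ?F" by (simp add: mult.assoc)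
    then have "emeasure (count_space ?F) ?F = ennreal ?D"
      by (simp add: ennreal_mult[symmetric] powr_add[symmetric])
    moreover have "E \<delta> = E (\<delta> - 1) * emeasure (count_space ?F) ?F"
      unfolding E_def by (rule emeasure_ball_subballs[OF p H(2) tr])
    ultimately show ?thesis by (simp add: mult.commute)
  qed
  have "E \<delta> = ennreal (?D powr real_of_int \<delta>)" for \<delta>
  proof (induction \<delta> rule: int_induct[where k = 0])
    case base
    then show ?case using H(4) by (simp add: E_def)
  next
    case (step1 i)
    then show ?case using step[of "i + 1"] D by (simp add: ennreal_mult[symmetric] powr_add mult.commute)
  next
    case (step2 i)
    have "ennreal (1 / ?D) * E i = ennreal (1 / ?D) * ennreal ?D * E (i - 1)" using step[of i] by (simp add: mult.assoc)
    then have "E (i - 1) = ennreal (1 / ?D) * ennreal (?D powr real_of_int i)" using step2 D by (simp add: ennreal_mult[symmetric])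
    also have "\<dots> = ennreal (?D powr real_of_int (i - 1))" using D by (simp add: ennreal_mult[symmetric] powr_diff)
    finally show ?case .
  qed
  then show ?thesis using tr[of x \<gamma>] by (simp add: E_def)
qed

lemma normed_ball_space_haar:
  assumes p: "1 < CARD('p)"
  shows "normed_ball_space (qball :: 'p::finite qp ^ 'n::finite \<Rightarrow> int \<Rightarrow> _) haar (real CARD('p) ^ CARD('n)) qpn_zero qpn_abs (real CARD('p))"
proof -
  interpret ball_tree "qball :: 'p qp ^ 'n \<Rightarrow> int \<Rightarrow> _" by (rule ball_tree_qball[OF p])
  show ?thesis
  proof unfold_locales
    show "sets (haar :: ('p qp ^ 'n) measure) = sigma_sets UNIV (range (\<lambda>(x, \<gamma>). qball x \<gamma>))" by (rule haar_props(2)[OF p])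
    show "emeasure haar (qball x \<gamma>) < \<infinity>" for x :: "'p qp ^ 'n" and \<gamma> unfolding haar_ball[OF p] by simp
    show "1 < real CARD('p) ^ CARD('n)" using p by (intro one_less_power) auto
    show "measure haar (qball x \<gamma>) = (real CARD('p) ^ CARD('n)) powr real_of_int \<gamma>" for x :: "'p qp ^ 'n" and \<gamma>
      by (simp add: measure_def haar_ball[OF p])
    show "1 < real CARD('p)" using p by simp
    show "0 \<le> qpn_abs x" for x :: "'p qp ^ 'n"
    proof -
      have "0 \<le> qp_abs (x $ undefined)" by (simp add: qp_abs_def zero_le_power_int)
      also have "\<dots> \<le> qpn_abs x" unfolding qpn_abs_def by (rule Max_ge) auto
      finally show ?thesis .
    qed
    show "y \<in> qball qpn_zero \<gamma> \<longleftrightarrow> qpn_abs y \<le> real CARD('p) powr real_of_int \<gamma>" for y :: "'p qp ^ 'n" and \<gamma>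
      using p by (simp add: qball_def qpn_add_sub powr_real_of_int')
  qed
qed

section \<open>Characterization of BMO functions with bounded negative part\<close>

text \<open>The \<open>itself\<close> argument fixes the types \<open>'p\<close> and
  \<open>'n\<close>; the sublocale then makes the abstract theory available for them.\<close>

locale padic_space =
  fixes dom :: "('p::finite qp ^ 'n::finite) itself"
  assumes card_gt_1: "1 < CARD('p)"

sublocale padic_space \<subseteq> normed_ball_space "qball :: 'p qp ^ 'n \<Rightarrow> int \<Rightarrow> _" haar "real CARD('p) ^ CARD('n)" qpn_zero qpn_abs "real CARD('p)"
  by (rule normed_ball_space_haar[OF card_gt_1])

context padic_space
begin

section \<open>Transfer of the definitions to the abstract setting\<close>

lemma measure_powr_eq: "measure haar (qball x \<gamma>) powr (- \<alpha> / real CARD('n)) = measure haar (qball x \<gamma>) powr (- (\<alpha> / real CARD('n)))"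
  for x :: "'p qp ^ 'n"
  by simp

lemma frac_max_eq: "frac_max \<alpha> f = fmax (\<alpha> / real CARD('n)) f" for f :: "'p qp ^ 'n \<Rightarrow> real"
  by (simp add: frac_max_def fmax_def fun_eq_iff)

lemma frac_comm_eq: "frac_comm \<alpha> b f = fcomm (\<alpha> / real CARD('n)) b f" for f :: "'p qp ^ 'n \<Rightarrow> real"
  by (simp add: frac_comm_def fcomm_def fun_eq_iff frac_max_eq)

lemma frac_max_loc_eq: "frac_max_loc \<alpha> B f = fmax_loc (\<alpha> / real CARD('n)) B f" for f :: "'p qp ^ 'n \<Rightarrow> real"
  by (simp add: frac_max_loc_def fmax_loc_def fun_eq_iff)

lemma var_norm_eq: "var_norm q f = vnorm q f" for f :: "'p qp ^ 'n \<Rightarrow> real"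
  by (simp add: var_norm_def vnorm_def)

lemma ball_avg_eq: "ball_avg f B = avg haar f B" for f :: "'p qp ^ 'n \<Rightarrow> real"
  by (simp add: ball_avg_def avg_def)

lemma not_AE_False_ball: "\<not> (AE x in haar. x \<in> qball z \<gamma> \<longrightarrow> False)" for z :: "'p qp ^ 'n"
proof
  assume "AE x in haar. x \<in> qball z \<gamma> \<longrightarrow> False"
  then have "emeasure haar (qball z \<gamma>) = 0" by (subst (asm) AE_iff_measurable[of "qball z \<gamma>"]) auto
  then show False using measure_ball_pos[of z \<gamma>] by (simp add: emeasure_ball)
qed

lemma AE_ball_const: "(AE x in haar. x \<in> qball z \<gamma> \<longrightarrow> P) \<longleftrightarrow> P" for z :: "'p qp ^ 'n"
  using not_AE_False_ball[of z \<gamma>] by (cases P) auto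

lemma ess_inf_on_ball:
  fixes r :: "'p qp ^ 'n \<Rightarrow> real"
  assumes "AE x in haar. lo \<le> r x \<and> r x \<le> hi"
  shows "ereal lo \<le> ess_inf_on (qball z \<gamma>) r \<and> ess_inf_on (qball z \<gamma>) r \<le> ereal hi
    \<and> ereal lo \<le> ess_sup_on (qball z \<gamma>) r \<and> ess_sup_on (qball z \<gamma>) r \<le> ereal hi"
proof (intro conjI)
  show "ereal lo \<le> ess_inf_on (qball z \<gamma>) r" unfolding ess_inf_on_def
    by (rule Sup_upper) (use assms in \<open>auto elim: eventually_mono\<close>)
  show "ess_sup_on (qball z \<gamma>) r \<le> ereal hi" unfolding ess_sup_on_def
    by (rule Inf_lower) (use assms in \<open>auto elim: eventually_mono\<close>)
  show "ess_inf_on (qball z \<gamma>) r \<le> ereal hi" unfolding ess_inf_on_def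
  proof (rule Sup_least, clarify)
    fix u :: ereal assume "AE x in haar. x \<in> qball z \<gamma> \<longrightarrow> u \<le> ereal (r x)"
    then have "AE x in haar. x \<in> qball z \<gamma> \<longrightarrow> u \<le> ereal hi"
      using assms by eventually_elim (auto intro: order_trans)
    then show "u \<le> ereal hi" by (rule AE_ball_const[THEN iffD1])
  qed
  show "ereal lo \<le> ess_sup_on (qball z \<gamma>) r" unfolding ess_sup_on_def
  proof (rule Inf_greatest, clarify)
    fix u :: ereal assume "AE x in haar. x \<in> qball z \<gamma> \<longrightarrow> ereal (r x) \<le> u"
    then have "AE x in haar. x \<in> qball z \<gamma> \<longrightarrow> ereal lo \<le> u"
      using assms by eventually_elim (auto intro: order_trans[rotated])
    then show "ereal lo \<le> u" by (rule AE_ball_const[THEN iffD1])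
  qed
qed

text \<open>The essential bounds over the ball differ by at most \<open>C / (- \<gamma>)\<close>, as
  \<open>\<gamma>\<close> is negative. \<open>Sup\<close> and \<open>Inf\<close> are only
  approximated in the proof; the slack \<open>1 / (- \<gamma>)\<close> spent on this is the summand
  1 in the constant.\<close>

lemma local_log_holder:
  fixes r :: "'p qp ^ 'n \<Rightarrow> real"
  assumes b: "AE x in haar. lo \<le> r x \<and> r x \<le> hi"
    and C: "ereal (real_of_int \<gamma>) * (ess_inf_on (qball z \<gamma>) r - ess_sup_on (qball z \<gamma>) r) \<le> ereal C" and g: "\<gamma> < 0"
  shows "\<exists>c\<in>{lo..hi}. AE y in haar. y \<in> qball z \<gamma> \<longrightarrow> \<bar>r y - c\<bar> \<le> (\<bar>C\<bar> + 1) / real_of_int (- \<gamma>)"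
proof -
  let ?B = "qball z \<gamma>" and ?e = "1 / real_of_int (- \<gamma>)"
  have e: "0 < ?e" using g by simp
  note B = ess_inf_on_ball[OF b, of z \<gamma>]
  obtain a s where as: "ess_inf_on ?B r = ereal a" "ess_sup_on ?B r = ereal s" "lo \<le> a" "a \<le> hi"
    using B by (cases "ess_inf_on ?B r"; cases "ess_sup_on ?B r") auto
  have "real_of_int \<gamma> * (a - s) \<le> C" using C by (simp add: as)
  then have "real_of_int (- \<gamma>) * (s - a) \<le> C" by (simp add: algebra_simps)
  then have sa: "s - a \<le> C / real_of_int (- \<gamma>)" using g by (simp add: pos_le_divide_eq mult.commute del: of_int_minus)
  have "ereal (a - ?e) < ess_inf_on ?B r" using e by (simp add: as)
  then obtain u where u: "ereal (a - ?e) < u" "AE x in haar. x \<in> ?B \<longrightarrow> u \<le> ereal (r x)"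
    unfolding ess_inf_on_def less_Sup_iff by blast
  have "ess_sup_on ?B r < ereal (s + ?e)" using e by (simp add: as)
  then obtain v where v: "v < ereal (s + ?e)" "AE x in haar. x \<in> ?B \<longrightarrow> ereal (r x) \<le> v"
    unfolding ess_sup_on_def Inf_less_iff by blast
  have "AE y in haar. y \<in> ?B \<longrightarrow> \<bar>r y - a\<bar> \<le> (\<bar>C\<bar> + 1) / real_of_int (- \<gamma>)"
    using u(2) v(2)
  proof eventually_elim
    case (elim y)
    show ?case
    proof
      assume y: "y \<in> ?B"
      have "ereal (a - ?e) < ereal (r y)" using elim y u(1) by (meson less_le_trans)
      then have 1: "a - ?e < r y" by simp
      have "ereal (r y) < ereal (s + ?e)" using elim y v(1) by (meson le_less_trans)
      then have 2: "r y < s + ?e" by simp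
      have "C / real_of_int (- \<gamma>) \<le> \<bar>C\<bar> / real_of_int (- \<gamma>)" "0 \<le> \<bar>C\<bar> / real_of_int (- \<gamma>)"
        using g by (auto intro!: divide_right_mono divide_nonneg_nonneg simp del: of_int_minus)
      moreover have "(\<bar>C\<bar> + 1) / real_of_int (- \<gamma>) = \<bar>C\<bar> / real_of_int (- \<gamma>) + ?e" by (rule add_divide_distrib)
      ultimately show "\<bar>r y - a\<bar> \<le> (\<bar>C\<bar> + 1) / real_of_int (- \<gamma>)" using 1 2 sa by linarith
    qed
  qed
  then show ?thesis using as by auto
qed

text \<open>The condition at infinity compares pairs of points. A limit value arises by choosing
  points outside larger and larger balls with values between \<open>lo\<close> and \<open>hi\<close>
  and passing to a convergent subsequence; against far points the minimum of the two norms is that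
  of the fixed point.\<close>

lemma limit_log_holder:
  fixes r :: "'p qp ^ 'n \<Rightarrow> real"
  assumes b: "AE x in haar. lo \<le> r x \<and> r x \<le> hi"
    and C: "\<And>x y. \<bar>r x - r y\<bar> \<le> C / log (real CARD('p)) (real CARD('p) + min (qpn_abs x) (qpn_abs y))"
  shows "\<exists>c\<in>{lo..hi}. \<forall>x. \<bar>r x - c\<bar> \<le> C / log (real CARD('p)) (real CARD('p) + qpn_abs x)"
proof -
  let ?o = "qpn_zero :: 'p qp ^ 'n"
  \<comment> \<open>Otherwise almost every point would lie in one ball, which has smaller measure
    than the next larger one.\<close>
  have "\<exists>x. x \<notin> qball ?o (int k) \<and> lo \<le> r x \<and> r x \<le> hi" for k
  proof (rule ccontr)
    assume n: "\<not> ?thesis"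
    have "AE x in haar. x \<in> qball ?o (int k)" using b by eventually_elim (use n in blast)
    then have "emeasure haar (qball ?o (int k + 1)) \<le> emeasure haar (qball ?o (int k))"
      by (intro emeasure_mono_AE) (auto elim: eventually_mono)
    then show False using D_gt_1 by (simp add: emeasure_ball_powr)
  qed
  then obtain X where X: "\<And>k. X k \<notin> qball ?o (int k)" "\<And>k. r (X k) \<in> {lo..hi}" by (metis atLeastAtMost_iff)
  have "compact {lo..hi}" by simp
  then obtain c \<sigma> where c: "c \<in> {lo..hi}" "strict_mono \<sigma>" "((r \<circ> X) \<circ> \<sigma>) \<longlonglongrightarrow> c"
    using X(2) unfolding compact_def by (metis comp_apply)
  have "\<bar>r x - c\<bar> \<le> C / log (real CARD('p)) (real CARD('p) + qpn_abs x)" for x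
  proof (rule LIMSEQ_le_const2)
    show "(\<lambda>k. \<bar>r x - r (X (\<sigma> k))\<bar>) \<longlonglongrightarrow> \<bar>r x - c\<bar>"
      using c(3) by (intro tendsto_intros) (simp add: comp_def)
    obtain \<gamma> where g: "x \<in> qball ?o \<gamma>" using ball_cover by blast
    show "\<exists>N. \<forall>k\<ge>N. \<bar>r x - r (X (\<sigma> k))\<bar> \<le> C / log (real CARD('p)) (real CARD('p) + qpn_abs x)"
    proof (intro exI allI impI)
      fix k assume k: "nat \<gamma> \<le> k"
      have "k \<le> \<sigma> k" by (rule seq_suble[OF c(2)])
      then have "\<gamma> \<le> int (\<sigma> k)" using k by simp
      then have "x \<in> qball ?o (int (\<sigma> k))" using g ball_mono by blast
      then have "qpn_abs x \<le> real CARD('p) powr real_of_int (int (\<sigma> k))" by (simp only: nrm_ball)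
      moreover have "\<not> qpn_abs (X (\<sigma> k)) \<le> real CARD('p) powr real_of_int (int (\<sigma> k))" using X(1)[of "\<sigma> k"] unfolding nrm_ball .
      ultimately have "min (qpn_abs x) (qpn_abs (X (\<sigma> k))) = qpn_abs x" by linarith
      then show "\<bar>r x - r (X (\<sigma> k))\<bar> \<le> C / log (real CARD('p)) (real CARD('p) + qpn_abs x)" using C[of x "X (\<sigma> k)"] by simp
    qed
  qed
  then show ?thesis using c(1) by blast
qed

text \<open>The strict inequalities for the essential bounds leave room for real \<open>lo\<close>
  and \<open>hi\<close>. Regularity of \<open>q\<close> follows from that of \<open>r\<close>: as a
  function of \<open>\<rho>\<close> in \<open>{lo..hi}\<close> it is \<open>\<rho>\<close> divided
  by \<open>1 - \<rho> * \<beta>\<close>, which is Lipschitz because the denominator is at least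
  \<open>\<kappa>\<close>, and it increases values, so \<open>lo\<close> serves for \<open>q\<close>
  too.\<close>

lemma admissible_log_holder:
  fixes r q :: "'p qp ^ 'n \<Rightarrow> real"
  assumes adm: "admissible \<alpha> r q" and \<alpha>: "0 < \<alpha>"
  shows "\<exists>lo hi hi'. log_holder r lo hi \<and> 1 < lo \<and> hi * (\<alpha> / real CARD('n)) < 1 \<and> log_holder q lo hi'
    \<and> (\<forall>x. 1 / q x = 1 / r x - \<alpha> / real CARD('n))"
proof -
  define \<beta> where "\<beta> = \<alpha> / real CARD('n)"
  have \<beta>: "0 < \<beta>" using \<alpha> by (simp add: \<beta>_def)
  from adm have rP: "r \<in> borel_measurable haar" "1 < ess_inf_on UNIV r"
    and sup: "ess_sup_on UNIV r < ereal (real CARD('n) / \<alpha>)" and rq: "\<And>x. 1 / q x = 1 / r x - \<beta>"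
    and C0: "r \<in> Clog0" and CI: "r \<in> ClogInf"
    unfolding admissible_def var_exp_P_def Clog_def \<beta>_def by auto
  note [measurable] = rP(1)
  obtain u where u: "1 < u" "AE x in haar. x \<in> UNIV \<longrightarrow> u \<le> ereal (r x)"
    using rP(2) unfolding ess_inf_on_def less_Sup_iff by blast
  obtain lo where lo: "1 < ereal lo" "ereal lo < u" using ereal_dense2[OF u(1)] by auto
  obtain v where v: "v < ereal (real CARD('n) / \<alpha>)" "AE x in haar. x \<in> UNIV \<longrightarrow> ereal (r x) \<le> v"
    using sup unfolding ess_sup_on_def Inf_less_iff by blast
  obtain hi where hi: "v < ereal hi" "ereal hi < ereal (real CARD('n) / \<alpha>)" using ereal_dense2[OF v(1)] by auto
  have b: "AE x in haar. lo \<le> r x \<and> r x \<le> hi"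
    using u(2) v(2)
  proof eventually_elim
    case (elim x)
    have "ereal lo < ereal (r x)" using elim lo(2) by (meson UNIV_I less_le_trans)
    moreover have "ereal (r x) < ereal hi" using elim hi(1) by (meson UNIV_I le_less_trans)
    ultimately show ?case by simp
  qed
  have lo1: "1 < lo" using lo(1) by (simp add: one_ereal_def)
  have hb: "hi * \<beta> < 1" using hi(2) \<alpha> by (simp add: \<beta>_def field_simps)
  obtain C where C: "\<And>\<gamma> x. ereal (real_of_int \<gamma>) * (ess_inf_on (qball x \<gamma>) r - ess_sup_on (qball x \<gamma>) r) \<le> ereal C"
    using C0 unfolding Clog0_def by blast
  obtain C' where C': "\<And>x y. \<bar>r x - r y\<bar> \<le> C' / log (real CARD('p)) (real CARD('p) + min (qpn_abs x) (qpn_abs y))"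
    using CI unfolding ClogInf_def by blast
  obtain c where c: "c \<in> {lo..hi}" "\<And>x. \<bar>r x - c\<bar> \<le> C' / log (real CARD('p)) (real CARD('p) + qpn_abs x)"
    using limit_log_holder[OF b C'] by blast
  define K where "K = max (\<bar>C\<bar> + 1) \<bar>C'\<bar>"
  have rl: "log_holder r lo hi"
    unfolding log_holder_def
  proof (intro conjI exI[of _ K] allI impI)
    show "r \<in> borel_measurable haar" by (rule rP(1))
    show "AE x in haar. lo \<le> r x \<and> r x \<le> hi" by (rule b)
    show "0 \<le> K" by (simp add: K_def)
    show "\<exists>c\<in>{lo..hi}. AE y in haar. y \<in> qball x \<gamma> \<longrightarrow> \<bar>r y - c\<bar> \<le> K / real_of_int (- \<gamma>)" if g: "\<gamma> < 0" for x \<gamma>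
    proof -
      obtain d where d: "d \<in> {lo..hi}" "AE y in haar. y \<in> qball x \<gamma> \<longrightarrow> \<bar>r y - d\<bar> \<le> (\<bar>C\<bar> + 1) / real_of_int (- \<gamma>)"
        using local_log_holder[OF b C g] by blast
      have "(\<bar>C\<bar> + 1) / real_of_int (- \<gamma>) \<le> K / real_of_int (- \<gamma>)" using g by (intro divide_right_mono) (auto simp: K_def)
      then have "AE y in haar. y \<in> qball x \<gamma> \<longrightarrow> \<bar>r y - d\<bar> \<le> K / real_of_int (- \<gamma>)"
        using d(2) by (auto elim!: eventually_mono)
      then show ?thesis using d(1) by blast
    qed
    show "\<exists>c\<in>{lo..hi}. AE x in haar. \<bar>r x - c\<bar> \<le> K / log (real CARD('p)) (real CARD('p) + qpn_abs x)"
    proof (intro bexI[OF _ c(1)] AE_I2)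
      fix x :: "'p qp ^ 'n"
      have "0 < log (real CARD('p)) (real CARD('p) + qpn_abs x)" using pb_gt_1 nrm_nonneg[of x] by simp
      then have "C' / log (real CARD('p)) (real CARD('p) + qpn_abs x) \<le> K / log (real CARD('p)) (real CARD('p) + qpn_abs x)"
        by (intro divide_right_mono) (auto simp: K_def)
      then show "\<bar>r x - c\<bar> \<le> K / log (real CARD('p)) (real CARD('p) + qpn_abs x)" using c(2)[of x] by simp
    qed
  qed
  define \<kappa> where "\<kappa> = 1 - hi * \<beta>"
  have \<kappa>: "0 < \<kappa>" using hb by (simp add: \<kappa>_def)
  have \<rho>: "\<kappa> \<le> 1 - \<rho> * \<beta>" "1 - \<rho> * \<beta> < 1" "0 < \<rho>" if "\<rho> \<in> {lo..hi}" for \<rho>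
    using that \<beta> lo1 by (auto simp: \<kappa>_def intro!: mult_right_mono)
  have qr: "q x = 1 / (1 / r x - \<beta>)" for x using rq[of x] by (metis div_by_1 divide_divide_eq_right mult.left_neutral)
  have ql: "log_holder q lo (hi / \<kappa>)"
  proof (rule log_holder_transform[OF rl, where \<phi> = "\<lambda>\<rho>. 1 / (1 / \<rho> - \<beta>)" and L = "1 / \<kappa>\<^sup>2"])
    have "(\<lambda>x. 1 / (1 / r x - \<beta>)) \<in> borel_measurable haar" by measurable
    then show "q \<in> borel_measurable haar" by (simp add: qr[abs_def] cong: measurable_cong)
    show "AE x in haar. q x = 1 / (1 / r x - \<beta>)" using qr by simp
    show "0 \<le> 1 / \<kappa>\<^sup>2" by simp
    have \<phi>: "1 / (1 / \<rho> - \<beta>) = \<rho> / (1 - \<rho> * \<beta>)" if "\<rho> \<in> {lo..hi}" for \<rho>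
      using \<rho>[OF that] \<kappa> by (simp add: field_simps)
    show "\<bar>1 / (1 / s - \<beta>) - 1 / (1 / t - \<beta>)\<bar> \<le> 1 / \<kappa>\<^sup>2 * \<bar>s - t\<bar>" if st: "s \<in> {lo..hi}" "t \<in> {lo..hi}" for s t
    proof -
      have d: "0 < 1 - s * \<beta>" "0 < 1 - t * \<beta>" using \<rho>(1)[OF st(1)] \<rho>(1)[OF st(2)] \<kappa> by auto
      have "s / (1 - s * \<beta>) - t / (1 - t * \<beta>) = (s * (1 - t * \<beta>) - t * (1 - s * \<beta>)) / ((1 - s * \<beta>) * (1 - t * \<beta>))"
        using d by (subst diff_frac_eq) auto
      also have "s * (1 - t * \<beta>) - t * (1 - s * \<beta>) = s - t" by (simp add: algebra_simps)
      finally have "\<bar>s / (1 - s * \<beta>) - t / (1 - t * \<beta>)\<bar> = \<bar>s - t\<bar> / ((1 - s * \<beta>) * (1 - t * \<beta>))"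
        using d by (simp add: abs_mult)
      also have "\<dots> \<le> \<bar>s - t\<bar> / \<kappa>\<^sup>2"
        using \<rho>(1)[OF st(1)] \<rho>(1)[OF st(2)] \<kappa> by (intro divide_left_mono) (auto simp: power2_eq_square intro!: mult_mono)
      finally show ?thesis unfolding \<phi>[OF st(1)] \<phi>[OF st(2)] by simp
    qed
    show "1 / (1 / s - \<beta>) \<in> {lo..hi / \<kappa>}" if s: "s \<in> {lo..hi}" for s
    proof -
      have d: "0 < 1 - s * \<beta>" using \<rho>(1)[OF s] \<kappa> by simp
      have "s \<le> s / (1 - s * \<beta>)" using \<rho>(2,3)[OF s] d by (simp add: le_divide_eq mult_left_le)
      moreover have "s / (1 - s * \<beta>) \<le> hi / \<kappa>" using \<rho>[OF s] \<kappa> s by (intro frac_le) auto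
      ultimately show ?thesis unfolding \<phi>[OF s] using s by simp
    qed
  qed
  show ?thesis using rl lo1 hb ql rq unfolding \<beta>_def by blast
qed

lemma loc_int_measurable:
  assumes "loc_int (b :: 'p qp ^ 'n \<Rightarrow> real)" shows "b \<in> borel_measurable haar"
proof (rule borel_measurable_LIMSEQ_real)
  let ?o = "qpn_zero :: 'p qp ^ 'n"
  show "(\<lambda>x. indicator (qball ?o (int k)) x *\<^sub>R b x) \<in> borel_measurable haar" for k
    using assms unfolding loc_int_def set_integrable_def by (intro borel_measurable_integrable) blast
  fix x :: "'p qp ^ 'n"
  obtain \<gamma> where g: "x \<in> qball ?o \<gamma>" using ball_cover by blast
  have "x \<in> qball ?o (int k)" if "nat \<gamma> \<le> k" for k
  proof -
    have "\<gamma> \<le> int k" using that by simp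
    then show ?thesis using g ball_mono by blast
  qed
  then have "\<forall>\<^sub>F k in sequentially. indicator (qball ?o (int k)) x *\<^sub>R b x = b x"
    unfolding eventually_sequentially by (intro exI[of _ "nat \<gamma>"]) simp
  then show "(\<lambda>k. indicator (qball ?o (int k)) x *\<^sub>R b x) \<longlonglongrightarrow> b x" by (rule tendsto_eventually)
qed

text \<open>Constant exponents strictly between 1 and \<open>n / \<alpha>\<close>. Without an
  admissible pair the statements for all exponents would not imply those for some exponents.\<close>

lemma admissible_exists:
  assumes \<alpha>: "0 < \<alpha>" "\<alpha> < real CARD('n)"
  shows "\<exists>r q :: 'p qp ^ 'n \<Rightarrow> real. admissible \<alpha> r q"
proof -
  have "1 < real CARD('n) / \<alpha>" using \<alpha> by simp
  then obtain c where c: "1 < c" "c < real CARD('n) / \<alpha>" using dense by blast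
  have e: "ess_inf_on B (\<lambda>_ :: 'p qp ^ 'n. d) = ereal d" "ess_sup_on B (\<lambda>_ :: 'p qp ^ 'n. d) = ereal d" if B: "qball z \<gamma> \<subseteq> B" for d B z \<gamma>
  proof -
    have k: "(AE x in haar. x \<in> B \<longrightarrow> P) \<longleftrightarrow> P" for P
    proof
      assume "AE x in haar. x \<in> B \<longrightarrow> P"
      then have "AE x in haar. x \<in> qball z \<gamma> \<longrightarrow> P" by eventually_elim (use B in blast)
      then show P by (rule AE_ball_const[THEN iffD1])
    qed auto
    show "ess_inf_on B (\<lambda>_ :: 'p qp ^ 'n. d) = ereal d" "ess_sup_on B (\<lambda>_ :: 'p qp ^ 'n. d) = ereal d"
      unfolding ess_inf_on_def ess_sup_on_def k by (auto intro!: Sup_eqI Inf_eqI)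
  qed
  have cl: "(\<lambda>_ :: 'p qp ^ 'n. d) \<in> Clog" for d :: real
    unfolding Clog_def Clog0_def ClogInf_def by (auto simp: e[OF order_refl] intro!: exI[of _ 0])
  have P: "(\<lambda>_ :: 'p qp ^ 'n. c) \<in> var_exp_P"
    unfolding var_exp_P_def using c e[of qpn_zero 0 UNIV c] by (auto simp: one_ereal_def)
  have "admissible \<alpha> (\<lambda>_ :: 'p qp ^ 'n. c) (\<lambda>_. 1 / (1 / c - \<alpha> / real CARD('n)))"
    unfolding admissible_def using cl P c e[of qpn_zero 0 UNIV c] by auto
  then show ?thesis by blast
qed

section \<open>Homogeneity and the implications between the assertions\<close>

lemma fmax_scale:
  assumes "0 < \<eta>" and [measurable]: "f \<in> borel_measurable haar"
  shows "fmax \<beta> f x = ennreal \<eta> * fmax \<beta> (\<lambda>y. f y / \<eta>) x"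
proof -
  have "(\<integral>\<^sup>+ y. indicator (qball x \<gamma>) y * ennreal \<bar>f y\<bar> \<partial>haar) = ennreal \<eta> * (\<integral>\<^sup>+ y. indicator (qball x \<gamma>) y * ennreal \<bar>f y / \<eta>\<bar> \<partial>haar)" for \<gamma>
  proof -
    have "(\<integral>\<^sup>+ y. indicator (qball x \<gamma>) y * ennreal \<bar>f y\<bar> \<partial>haar) = (\<integral>\<^sup>+ y. ennreal \<eta> * (indicator (qball x \<gamma>) y * ennreal \<bar>f y / \<eta>\<bar>) \<partial>haar)"
    proof (rule nn_integral_cong)
      fix y
      have "ennreal \<bar>f y\<bar> = ennreal \<eta> * ennreal \<bar>f y / \<eta>\<bar>" using assms(1) by (simp add: ennreal_mult[symmetric])
      then show "indicator (qball x \<gamma>) y * ennreal \<bar>f y\<bar> = ennreal \<eta> * (indicator (qball x \<gamma>) y * ennreal \<bar>f y / \<eta>\<bar>)"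
        by (simp only: mult.left_commute)
    qed
    also have "\<dots> = ennreal \<eta> * (\<integral>\<^sup>+ y. indicator (qball x \<gamma>) y * ennreal \<bar>f y / \<eta>\<bar> \<partial>haar)"
      by (rule nn_integral_cmult) measurable
    finally show ?thesis .
  qed
  then show ?thesis unfolding fmax_def by (simp add: SUP_mult_left_ennreal mult.left_commute)
qed

lemma fcomm_scale:
  assumes \<eta>: "0 < \<eta>" and [measurable]: "f \<in> borel_measurable haar" "b \<in> borel_measurable haar"
  shows "fcomm \<beta> b f x = \<eta> * fcomm \<beta> b (\<lambda>y. f y / \<eta>) x"
  unfolding fcomm_def fmax_scale[OF assms(1,2)] using fmax_scale[OF \<eta>, of "\<lambda>y. b y * f y" \<beta> x] \<eta>
  by (simp add: enn2real_mult right_diff_distrib mult.left_commute)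

lemma comm_bounded_of_BMO:
  fixes b :: "'p qp ^ 'n \<Rightarrow> real"
  assumes adm: "admissible \<alpha> r q" and \<alpha>: "0 < \<alpha>" and b: "b \<in> BMO" and neg: "(\<lambda>x. - min (b x) 0) \<in> Linfty"
  shows "comm_bounded \<alpha> b r q"
proof -
  define \<beta> where "\<beta> = \<alpha> / real CARD('n)"
  have \<beta>: "0 < \<beta>" using \<alpha> by (simp add: \<beta>_def)
  obtain lo hi hi' where rl: "log_holder r lo hi" and lo: "1 < lo" and hb: "hi * \<beta> < 1" and ql: "log_holder q lo hi'"
    and rq: "\<And>x. 1 / q x = 1 / r x - \<beta>"
    using admissible_log_holder[OF adm \<alpha>] unfolding \<beta>_def by blast
  have [measurable]: "r \<in> borel_measurable haar" "q \<in> borel_measurable haar"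
    and rb: "AE x in haar. lo \<le> r x \<and> r x \<le> hi" and qb: "AE x in haar. lo \<le> q x \<and> q x \<le> hi'"
    using rl ql unfolding log_holder_def by auto
  have li: "loc_int b" using b by (simp add: BMO_def)
  note bm [measurable] = loc_int_measurable[OF li]
  have bint: "set_integrable haar (qball x \<gamma>) b" for x \<gamma> using li by (simp add: loc_int_def)
  obtain A where A: "\<And>x \<gamma>. avg haar (\<lambda>y. \<bar>b y - avg haar b (qball x \<gamma>)\<bar>) (qball x \<gamma>) \<le> A"
    using b unfolding BMO_def ball_avg_eq by blast
  obtain C0 where C0: "AE x in haar. \<bar>- min (b x) 0\<bar> \<le> C0" using neg by (auto simp: Linfty_def)
  have neg': "AE x in haar. - b x \<le> C0" using C0 by eventually_elim auto
  have rq': "AE x in haar. 1 / q x = 1 / r x - \<beta>" using rq by simp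
  obtain K where K: "0 \<le> K" "\<And>f. f \<in> borel_measurable haar \<Longrightarrow> (\<integral>\<^sup>+ x. ennreal (\<bar>f x\<bar> powr r x) \<partial>haar) \<le> 1 \<Longrightarrow>
    (AE x in haar. fmax \<beta> f x < \<infinity> \<and> fmax \<beta> (\<lambda>y. b y * f y) x < \<infinity>)
    \<and> (\<integral>\<^sup>+ x. ennreal (\<bar>fcomm \<beta> b f x\<bar> powr q x) \<partial>haar) \<le> ennreal K"
    using commutator_modular[OF rl lo \<beta> hb _ rq' bm bint A neg'] by auto
  \<comment> \<open>Dividing by \<open>C \<ge> 1\<close> lowers a modular with exponents at least 1
    by the factor \<open>C\<close> or more, so the modular bound \<open>K\<close> becomes the norm
    bound \<open>C\<close>.\<close>
  define C where "C = max 1 K"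
  have C: "1 \<le> C" "K \<le> C" by (auto simp: C_def)
  have one: "(AE x in haar. fmax \<beta> f x < \<infinity> \<and> fmax \<beta> (\<lambda>y. b y * f y) x < \<infinity>)
      \<and> (\<integral>\<^sup>+ x. ennreal ((\<bar>fcomm \<beta> b f x\<bar> / (C * \<eta>)) powr q x) \<partial>haar) \<le> 1"
    if [measurable]: "f \<in> borel_measurable haar" and \<eta>: "0 < \<eta>" "(\<integral>\<^sup>+ x. ennreal ((\<bar>f x\<bar> / \<eta>) powr r x) \<partial>haar) \<le> 1" for f \<eta>
  proof -
    define g where "g = (\<lambda>y. f y / \<eta>)"
    have [measurable]: "g \<in> borel_measurable haar" unfolding g_def by measurable
    have "(\<integral>\<^sup>+ x. ennreal (\<bar>g x\<bar> powr r x) \<partial>haar) \<le> 1" using \<eta> by (simp add: g_def)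
    from K(2)[OF _ this] have fin: "AE x in haar. fmax \<beta> g x < \<infinity> \<and> fmax \<beta> (\<lambda>y. b y * g y) x < \<infinity>"
      and le: "(\<integral>\<^sup>+ x. ennreal (\<bar>fcomm \<beta> b g x\<bar> powr q x) \<partial>haar) \<le> ennreal K" by auto
    have "AE x in haar. fmax \<beta> f x < \<infinity> \<and> fmax \<beta> (\<lambda>y. b y * f y) x < \<infinity>"
      using fin
    proof eventually_elim
      case (elim x)
      then show ?case using \<eta>(1) unfolding fmax_scale[OF \<eta>(1) \<open>f \<in> borel_measurable haar\<close>]
        using fmax_scale[OF \<eta>(1), of "\<lambda>y. b y * f y" \<beta> x] by (simp add: g_def ennreal_mult_less_top)
    qed
    moreover have "(\<integral>\<^sup>+ x. ennreal ((\<bar>fcomm \<beta> b f x\<bar> / (C * \<eta>)) powr q x) \<partial>haar) \<le> 1"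
    proof -
      have "(\<integral>\<^sup>+ x. ennreal ((\<bar>fcomm \<beta> b f x\<bar> / (C * \<eta>)) powr q x) \<partial>haar) \<le> (\<integral>\<^sup>+ x. ennreal (1 / C) * ennreal (\<bar>fcomm \<beta> b g x\<bar> powr q x) \<partial>haar)"
      proof (rule nn_integral_mono_AE)
        show "AE x in haar. ennreal ((\<bar>fcomm \<beta> b f x\<bar> / (C * \<eta>)) powr q x) \<le> ennreal (1 / C) * ennreal (\<bar>fcomm \<beta> b g x\<bar> powr q x)"
          using qb
        proof eventually_elim
          case (elim x)
          have "\<bar>fcomm \<beta> b f x\<bar> / (C * \<eta>) = 1 / C * \<bar>fcomm \<beta> b g x\<bar>"
            using fcomm_scale[OF \<eta>(1), of f b \<beta> x] \<eta>(1) C by (simp add: g_def abs_mult)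
          then have "(\<bar>fcomm \<beta> b f x\<bar> / (C * \<eta>)) powr q x = (1 / C) powr q x * \<bar>fcomm \<beta> b g x\<bar> powr q x"
            using C by (simp only: powr_mult)
          also have "\<dots> \<le> (1 / C) powr 1 * \<bar>fcomm \<beta> b g x\<bar> powr q x"
            using elim lo C by (intro mult_right_mono powr_mono') auto
          finally show ?case using C by (simp add: ennreal_mult[symmetric] ennreal_leI)
        qed
      qed
      also have "\<dots> = ennreal (1 / C) * (\<integral>\<^sup>+ x. ennreal (\<bar>fcomm \<beta> b g x\<bar> powr q x) \<partial>haar)"
        by (rule nn_integral_cmult) measurable
      also have "\<dots> \<le> ennreal (1 / C) * ennreal K" by (intro mult_left_mono le) simp
      also have "\<dots> \<le> 1" using C K(1) by (simp add: ennreal_mult[symmetric])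
      finally show ?thesis .
    qed
    ultimately show ?thesis by blast
  qed
  have "(AE x in haar. fmax \<beta> f x < \<infinity> \<and> fmax \<beta> (\<lambda>y. b y * f y) x < \<infinity>)
      \<and> fcomm \<beta> b f \<in> Lvar q \<and> vnorm q (fcomm \<beta> b f) \<le> ennreal C * vnorm r f" if fL: "f \<in> Lvar r" for f
  proof -
    from fL obtain \<eta>0 where fm [measurable]: "f \<in> borel_measurable haar" and \<eta>0: "0 < \<eta>0" "(\<integral>\<^sup>+ x. ennreal ((\<bar>f x\<bar> / \<eta>0) powr r x) \<partial>haar) < \<infinity>"
      by (auto simp: Lvar_def)
    obtain I where I: "0 \<le> I" "(\<integral>\<^sup>+ x. ennreal ((\<bar>f x\<bar> / \<eta>0) powr r x) \<partial>haar) = ennreal I"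
      using \<eta>0(2) by (cases "\<integral>\<^sup>+ x. ennreal ((\<bar>f x\<bar> / \<eta>0) powr r x) \<partial>haar") auto
    \<comment> \<open>The same device normalizes a function whose modular has the finite value
      \<open>I\<close>.\<close>
    define J where "J = max 1 I"
    have J: "1 \<le> J" "I \<le> J" by (auto simp: J_def)
    have "(\<integral>\<^sup>+ x. ennreal ((\<bar>f x\<bar> / (J * \<eta>0)) powr r x) \<partial>haar) \<le> (\<integral>\<^sup>+ x. ennreal (1 / J) * ennreal ((\<bar>f x\<bar> / \<eta>0) powr r x) \<partial>haar)"
    proof (rule nn_integral_mono_AE)
      show "AE x in haar. ennreal ((\<bar>f x\<bar> / (J * \<eta>0)) powr r x) \<le> ennreal (1 / J) * ennreal ((\<bar>f x\<bar> / \<eta>0) powr r x)"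
        using rb
      proof eventually_elim
        case (elim x)
        have "\<bar>f x\<bar> / (J * \<eta>0) = 1 / J * (\<bar>f x\<bar> / \<eta>0)" by simp
        then have "(\<bar>f x\<bar> / (J * \<eta>0)) powr r x = (1 / J) powr r x * (\<bar>f x\<bar> / \<eta>0) powr r x"
          using J \<eta>0 by (simp only: powr_mult)
        also have "\<dots> \<le> (1 / J) powr 1 * (\<bar>f x\<bar> / \<eta>0) powr r x"
          using elim lo J by (intro mult_right_mono powr_mono') auto
        finally show ?case using J by (simp add: ennreal_mult[symmetric] ennreal_leI)
      qed
    qed
    also have "\<dots> = ennreal (1 / J) * ennreal I" unfolding I(2)[symmetric] by (rule nn_integral_cmult) measurable
    also have "\<dots> \<le> 1" using J I by (simp add: ennreal_mult[symmetric])
    finally have fJ: "(\<integral>\<^sup>+ x. ennreal ((\<bar>f x\<bar> / (J * \<eta>0)) powr r x) \<partial>haar) \<le> 1" .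
    have J0: "0 < J * \<eta>0" using J \<eta>0 by simp
    note o = one[OF fm J0 fJ]
    have "fcomm \<beta> b f \<in> Lvar q"
      unfolding Lvar_def
    proof (intro CollectI conjI exI)
      show "fcomm \<beta> b f \<in> borel_measurable haar" by measurable
      show "0 < C * (J * \<eta>0)" using C J0 by simp
      show "(\<integral>\<^sup>+ x. ennreal ((\<bar>fcomm \<beta> b f x\<bar> / (C * (J * \<eta>0))) powr q x) \<partial>haar) < \<infinity>"
        using o by (auto intro: le_less_trans)
    qed
    moreover have "vnorm q (fcomm \<beta> b f) \<le> ennreal C * vnorm r f"
      by (rule vnorm_scale_le) (use C one[OF fm] in auto)
    ultimately show ?thesis using o by blast
  qed
  then show ?thesis
    unfolding comm_bounded_def frac_max_eq frac_comm_eq var_norm_eq \<beta>_def[symmetric] by blast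
qed

lemma star_cond_of_comm_bounded:
  fixes b :: "'p qp ^ 'n \<Rightarrow> real"
  assumes adm: "admissible \<alpha> r q" and \<alpha>: "0 < \<alpha>" "\<alpha> < real CARD('n)" and cb: "comm_bounded \<alpha> b r q"
  shows "star_cond \<alpha> b q"
proof -
  define \<beta> where "\<beta> = \<alpha> / real CARD('n)"
  have \<beta>: "0 < \<beta>" "\<beta> < 1" using \<alpha> by (auto simp: \<beta>_def)
  obtain lo hi hi' where rl: "log_holder r lo hi" and lo: "1 < lo" and ql: "log_holder q lo hi'"
    and rq: "\<And>x. 1 / q x = 1 / r x - \<beta>"
    using admissible_log_holder[OF adm \<alpha>(1)] unfolding \<beta>_def by blast
  have [measurable]: "r \<in> borel_measurable haar" and qm [measurable]: "q \<in> borel_measurable haar"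
    and rb: "AE x in haar. lo \<le> r x \<and> r x \<le> hi" and qb: "AE x in haar. lo \<le> q x \<and> q x \<le> hi'"
    using rl ql unfolding log_holder_def by auto
  have q1: "AE x in haar. 1 \<le> q x" and q0: "AE x in haar. 0 < q x" using qb by (eventually_elim, use lo in simp)+
  have rq0: "AE x in haar. 1 \<le> r x \<and> 0 < q x" using qb rb by eventually_elim (use lo in simp)
  obtain C where C: "\<And>f. f \<in> Lvar r \<Longrightarrow> vnorm q (fcomm \<beta> b f) \<le> ennreal C * vnorm r f"
    using cb unfolding comm_bounded_def frac_comm_eq var_norm_eq \<beta>_def[symmetric] by blast
  define C' where "C' = max 1 C"
  have ratio: "vnorm q (\<lambda>y. (b y - measure haar (qball x \<gamma>) powr (- \<beta>) * enn2real (fmax_loc \<beta> (qball x \<gamma>) b y)) * indicator (qball x \<gamma>) y)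
      / vnorm q (indicator (qball x \<gamma>)) \<le> ennreal (2 * C')" for x \<gamma>
  proof -
    let ?B = "qball x \<gamma>" let ?m = "measure haar ?B"
    let ?G = "\<lambda>y. (b y - ?m powr (- \<beta>) * enn2real (fmax_loc \<beta> ?B b y)) * indicator ?B y"
    have m: "0 < ?m" by (rule measure_ball_pos)
    have fin: "vnorm q (indicator ?B) < \<infinity>" "0 < vnorm q (indicator ?B)" using vnorm_ball_finite[OF q1] by auto
    have fL: "indicator ?B \<in> Lvar r"
      unfolding Lvar_def
    proof (intro CollectI conjI exI)
      show "(indicator ?B :: _ \<Rightarrow> real) \<in> borel_measurable haar" by measurable
      show "(0::real) < 1" by simp
      have "(\<integral>\<^sup>+ y. ennreal ((\<bar>indicator ?B y\<bar> / 1) powr r y) \<partial>haar) \<le> (\<integral>\<^sup>+ y. indicator ?B y \<partial>haar)"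
        by (intro nn_integral_mono) (auto simp: indicator_def)
      also have "\<dots> < \<infinity>" using finite_ball[of x \<gamma>] by simp
      finally show "(\<integral>\<^sup>+ y. ennreal ((\<bar>indicator ?B y\<bar> / 1) powr r y) \<partial>haar) < \<infinity>" .
    qed
    have Gle: "\<bar>?G y\<bar> \<le> ?m powr (- \<beta>) * \<bar>fcomm \<beta> b (indicator ?B) y\<bar>" for y
    proof (cases "y \<in> ?B")
      case True
      have "fcomm \<beta> b (indicator ?B) y = b y * ?m powr \<beta> - enn2real (fmax_loc \<beta> ?B b y)"
        unfolding fcomm_def fmax_indicator[OF True \<beta>] fmax_cut[OF True \<beta>(2)] by simp
      then have "?m powr (- \<beta>) * fcomm \<beta> b (indicator ?B) y = ?G y"
        using True m by (simp add: right_diff_distrib powr_minus)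
      then have "\<bar>?G y\<bar> = \<bar>?m powr (- \<beta>) * fcomm \<beta> b (indicator ?B) y\<bar>" by (rule arg_cong[OF sym])
      also have "\<dots> = ?m powr (- \<beta>) * \<bar>fcomm \<beta> b (indicator ?B) y\<bar>" by (simp only: abs_mult abs_of_nonneg[OF powr_ge_zero])
      finally show ?thesis by (rule eq_refl)
    qed simp
    have "vnorm q ?G \<le> ennreal (?m powr (- \<beta>)) * vnorm q (fcomm \<beta> b (indicator ?B))"
      by (rule vnorm_mono_scale[OF _ q0 Gle]) (use m in simp)
    also have "\<dots> \<le> ennreal (?m powr (- \<beta>)) * (ennreal C' * vnorm r (indicator ?B))"
    proof (intro mult_left_mono)
      have "ennreal C * vnorm r (indicator ?B) \<le> ennreal C' * vnorm r (indicator ?B)"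
        by (intro mult_right_mono ennreal_leI) (auto simp: C'_def)
      then show "vnorm q (fcomm \<beta> b (indicator ?B)) \<le> ennreal C' * vnorm r (indicator ?B)" using C[OF fL] by (rule order_trans[rotated])
    qed simp
    \<comment> \<open>The norm of the indicator with exponent \<open>r\<close> is traded for the one
      with exponent \<open>q\<close>; the powers of the measure of the ball then cancel.\<close>
    also have "\<dots> \<le> ennreal (?m powr (- \<beta>)) * (ennreal C' * (ennreal (2 * ?m powr \<beta>) * vnorm q (indicator ?B)))"
      by (intro mult_left_mono vnorm_ball_fractional[OF qm rq0 \<beta>(1)]) (use rq in auto)
    also have "\<dots> = ennreal (?m powr (- \<beta>) * (C' * (2 * ?m powr \<beta>))) * vnorm q (indicator ?B)"
      by (simp add: ennreal_mult C'_def mult.assoc)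
    also have "?m powr (- \<beta>) * (C' * (2 * ?m powr \<beta>)) = 2 * C'" using m by (simp add: powr_minus)
    finally have "vnorm q ?G / vnorm q (indicator ?B) \<le> ennreal (2 * C') * vnorm q (indicator ?B) / vnorm q (indicator ?B)"
      by (rule divide_right_mono_ennreal)
    also have "\<dots> = ennreal (2 * C')" using fin by (intro mult_divide_eq_ennreal) auto
    finally show ?thesis .
  qed
  have "(SUP (x, \<gamma>)\<in>UNIV. vnorm q (\<lambda>y. (b y - measure haar (qball x \<gamma>) powr (- \<beta>) * enn2real (fmax_loc \<beta> (qball x \<gamma>) b y)) * indicator (qball x \<gamma>) y)
      / vnorm q (indicator (qball x \<gamma>))) \<le> ennreal (2 * C')"
    by (rule SUP_least) (use ratio in auto)
  then have "(SUP (x, \<gamma>)\<in>UNIV. vnorm q (\<lambda>y. (b y - measure haar (qball x \<gamma>) powr (- \<beta>) * enn2real (fmax_loc \<beta> (qball x \<gamma>) b y)) * indicator (qball x \<gamma>) y)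
      / vnorm q (indicator (qball x \<gamma>))) < \<infinity>" by (rule le_less_trans) simp
  then show ?thesis
    unfolding star_cond_def frac_max_loc_eq var_norm_eq measure_powr_eq \<beta>_def .
qed

lemma BMO_of_star_cond:
  fixes b :: "'p qp ^ 'n \<Rightarrow> real"
  assumes adm: "admissible \<alpha> r q" and \<alpha>: "0 < \<alpha>" "\<alpha> < real CARD('n)" and st: "star_cond \<alpha> b q" and li: "loc_int b"
  shows "b \<in> BMO \<and> (\<lambda>x. - min (b x) 0) \<in> Linfty"
proof -
  define \<beta> where "\<beta> = \<alpha> / real CARD('n)"
  have \<beta>: "0 < \<beta>" "\<beta> < 1" using \<alpha> by (auto simp: \<beta>_def)
  obtain lo hi' where lo: "1 < lo" and ql: "log_holder q lo hi'"
    using admissible_log_holder[OF adm \<alpha>(1)] unfolding \<beta>_def by blast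
  have qb: "AE x in haar. lo \<le> q x \<and> q x \<le> hi'" using ql unfolding log_holder_def by auto
  have q1: "AE x in haar. 1 \<le> q x" using qb by eventually_elim (use lo in simp)
  note bm [measurable] = loc_int_measurable[OF li]
  have bint: "set_integrable haar (qball x \<gamma>) b" for x \<gamma> using li by (simp add: loc_int_def)
  let ?G = "\<lambda>x \<gamma> y. (b y - measure haar (qball x \<gamma>) powr (- \<beta>) * enn2real (fmax_loc \<beta> (qball x \<gamma>) b y)) * indicator (qball x \<gamma>) y"
  have "(SUP (x, \<gamma>)\<in>UNIV. vnorm q (?G x \<gamma>) / vnorm q (indicator (qball x \<gamma>))) < \<infinity>"
    using st unfolding star_cond_def frac_max_loc_eq var_norm_eq measure_powr_eq \<beta>_def .
  then obtain K where K: "0 \<le> K" "(SUP (x, \<gamma>)\<in>UNIV. vnorm q (?G x \<gamma>) / vnorm q (indicator (qball x \<gamma>))) = ennreal K"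
    by (cases "SUP (x, \<gamma>)\<in>UNIV. vnorm q (?G x \<gamma>) / vnorm q (indicator (qball x \<gamma>))") auto
  have G_le: "vnorm q (?G x \<gamma>) \<le> ennreal K * vnorm q (indicator (qball x \<gamma>))" for x \<gamma>
  proof -
    let ?v = "vnorm q (indicator (qball x \<gamma>))"
    have fin: "?v < \<infinity>" "0 < ?v" using vnorm_ball_finite[OF q1] by auto
    have "vnorm q (?G x \<gamma>) / ?v \<le> ennreal K" unfolding K(2)[symmetric] by (rule SUP_upper2[of "(x, \<gamma>)"]) auto
    then have "vnorm q (?G x \<gamma>) / ?v * ?v \<le> ennreal K * ?v" by (rule mult_right_mono) simp
    \<comment> \<open>Cancelling in the extended reals requires \<open>?v\<close> to be neither 0
      nor infinite.\<close>
    moreover have "vnorm q (?G x \<gamma>) / ?v * ?v = vnorm q (?G x \<gamma>)"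
    proof -
      have "vnorm q (?G x \<gamma>) / ?v * ?v = (vnorm q (?G x \<gamma>) * ?v) / ?v"
        by (simp add: ennreal_times_divide mult.commute)
      also have "\<dots> = vnorm q (?G x \<gamma>)" using fin by (intro mult_divide_eq_ennreal) auto
      finally show ?thesis .
    qed
    ultimately show ?thesis by simp
  qed
  have Gm: "?G x \<gamma> \<in> borel_measurable haar" for x \<gamma>
  proof -
    \<comment> \<open>Measurability is borrowed from the global maximal function of \<open>b\<close>
      cut to the ball, which agrees on the ball with the local one.\<close>
    have "?G x \<gamma> = (\<lambda>y. (b y - measure haar (qball x \<gamma>) powr (- \<beta>) * enn2real (fmax \<beta> (\<lambda>y. b y * indicator (qball x \<gamma>) y) y)) * indicator (qball x \<gamma>) y)"
    proof
      fix y
      show "?G x \<gamma> y = (b y - measure haar (qball x \<gamma>) powr (- \<beta>) * enn2real (fmax \<beta> (\<lambda>y. b y * indicator (qball x \<gamma>) y) y)) * indicator (qball x \<gamma>) y"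
        using fmax_cut[of y x \<gamma> \<beta> b] \<beta> by (cases "y \<in> qball x \<gamma>") auto
    qed
    moreover have "(\<lambda>y. (b y - measure haar (qball x \<gamma>) powr (- \<beta>) * enn2real (fmax \<beta> (\<lambda>y. b y * indicator (qball x \<gamma>) y) y)) * indicator (qball x \<gamma>) y) \<in> borel_measurable haar"
    proof -
      have [measurable]: "(\<lambda>y. enn2real (fmax \<beta> (\<lambda>y. b y * indicator (qball x \<gamma>) y) y)) \<in> borel_measurable haar"
        using measurable_fmax by (rule borel_measurable_enn2real)
      show ?thesis by measurable
    qed
    ultimately show ?thesis by simp
  qed
  obtain K0 where K0: "1 \<le> K0" "\<And>g x \<gamma> K. g \<in> borel_measurable haar \<Longrightarrow> (\<forall>y. 0 \<le> g y) \<Longrightarrow> 0 \<le> K \<Longrightarrow> (\<forall>y. y \<notin> qball x \<gamma> \<longrightarrow> g y = 0) \<Longrightarrow>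
    vnorm q g \<le> ennreal K * vnorm q (indicator (qball x \<gamma>)) \<Longrightarrow>
    (\<integral>\<^sup>+ y. ennreal (g y) * indicator (qball x \<gamma>) y \<partial>haar) \<le> ennreal ((K + 1) * K0) * emeasure haar (qball x \<gamma>)"
    using avg_le_of_vnorm[OF ql lo] by blast
  define C where "C = (K + 1) * K0"
  have C0: "0 \<le> C" using K K0 by (simp add: C_def)
  have loc: "(\<integral>\<^sup>+ y. ennreal \<bar>b y - measure haar (qball z \<gamma>) powr (- \<beta>) * enn2real (fmax_loc \<beta> (qball z \<gamma>) b y)\<bar> * indicator (qball z \<gamma>) y \<partial>haar)
      \<le> ennreal C * emeasure haar (qball z \<gamma>)" for z \<gamma>
  proof -
    have "(\<integral>\<^sup>+ y. ennreal \<bar>?G z \<gamma> y\<bar> * indicator (qball z \<gamma>) y \<partial>haar) \<le> ennreal C * emeasure haar (qball z \<gamma>)"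
      unfolding C_def
    proof (rule K0(2))
      show "(\<lambda>y. \<bar>?G z \<gamma> y\<bar>) \<in> borel_measurable haar" by (rule borel_measurable_abs[OF Gm])
      show "vnorm q (\<lambda>y. \<bar>?G z \<gamma> y\<bar>) \<le> ennreal K * vnorm q (indicator (qball z \<gamma>))"
        using G_le[of z \<gamma>] by (simp add: vnorm_def)
    qed (use K in auto)
    also have "(\<integral>\<^sup>+ y. ennreal \<bar>?G z \<gamma> y\<bar> * indicator (qball z \<gamma>) y \<partial>haar)
      = (\<integral>\<^sup>+ y. ennreal \<bar>b y - measure haar (qball z \<gamma>) powr (- \<beta>) * enn2real (fmax_loc \<beta> (qball z \<gamma>) b y)\<bar> * indicator (qball z \<gamma>) y \<partial>haar)"
      by (intro nn_integral_cong) (auto simp: indicator_def)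
    finally show ?thesis .
  qed
  note osc = oscillation_of_local_bound[OF bm bint \<beta>(1) C0 loc]
  have "b \<in> BMO" unfolding BMO_def ball_avg_eq using li osc(1) by blast
  moreover have "(\<lambda>x. - min (b x) 0) \<in> Linfty"
  proof -
    have "AE x in haar. \<bar>- min (b x) 0\<bar> \<le> C" using osc(2) by eventually_elim (use C0 in auto)
    then show ?thesis unfolding Linfty_def by auto
  qed
  ultimately show ?thesis by blast
qed

end

theorem theorem1:
  fixes \<alpha> :: real and b :: "('p::finite) qp ^ ('n::finite) \<Rightarrow> real"
  assumes "prime CARD('p)"
    and "0 < \<alpha>" and "\<alpha> < real CARD('n)"
    and "loc_int b"
  defines "T1 \<equiv> b \<in> BMO \<and> (\<lambda>x. - min (b x) 0) \<in> Linfty"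
    and "T2 \<equiv> (\<forall>r q. admissible \<alpha> r q \<longrightarrow> comm_bounded \<alpha> b r q)"
    and "T3 \<equiv> (\<exists>r q. admissible \<alpha> r q \<and> comm_bounded \<alpha> b r q)"
    and "T4 \<equiv> (\<exists>r q. admissible \<alpha> r q \<and> star_cond \<alpha> b q)"
    and "T5 \<equiv> (\<forall>r q. admissible \<alpha> r q \<longrightarrow> star_cond \<alpha> b q)"
  shows "(T1 \<longleftrightarrow> T2) \<and> (T1 \<longleftrightarrow> T3) \<and> (T1 \<longleftrightarrow> T4) \<and> (T1 \<longleftrightarrow> T5)"
proof -
  have "1 < CARD('p)" using assms(1) by (rule prime_gt_1_nat)
  then interpret padic_space "TYPE('p qp ^ 'n)" by unfold_locales
  \<comment> \<open>The cycle through T1, T2, T3 and T4 is closed, and T5 is inserted between T2 and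
    T4. Passing from all to some exponents uses that an admissible pair exists.\<close>
  have "T1 \<Longrightarrow> T2" unfolding T1_def T2_def using comm_bounded_of_BMO assms(2) by blast
  moreover have "T2 \<Longrightarrow> T3" unfolding T2_def T3_def using admissible_exists[OF assms(2,3)] by blast
  moreover have "T3 \<Longrightarrow> T4" unfolding T3_def T4_def using star_cond_of_comm_bounded assms(2,3) by blast
  moreover have "T4 \<Longrightarrow> T1" unfolding T4_def T1_def using BMO_of_star_cond assms(2-4) by blast
  moreover have "T2 \<Longrightarrow> T5" unfolding T2_def T5_def using star_cond_of_comm_bounded assms(2,3) by blast
  moreover have "T5 \<Longrightarrow> T4" unfolding T5_def T4_def using admissible_exists[OF assms(2,3)] by blast
  ultimately show ?thesis by blast
qed

end
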